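(* Let $\Omega\subset\mathbb{R}$ be a bounded open interval. Let $m\ge2$ be an integer, $r\in\mathbb{R}$, $s\in\mathbb{N}$ with $r\le s$ and $s+1>(1+1)/2$. Let $\lambda>0$, $L>0$, $T<\infty$ with $T\ge2d+2\lambda$, let $M>0$ and $\varepsilon_0\in(0,\kappa)$, and let $\psi=v_0|_\Sigma$ be the measurement function. Then there is a constant $C>0$, independent of $\delta$, $a$ and $\mathcal{E}$ below, such that the following holds. Let $a\in C_c^\infty(\Omega\times\mathbb{R})$ be admissible, let $\Lambda$, regarded as a map from (a small ball of) $H^{s+1}(\Sigma)$ to $H^r(\widetilde\Sigma)$, be the Dirichlet-to-Neumann map of the equation $\square u+au^m=0$, and let $\mathcal{E}:H^{s+1}(\Sigma)\to H^r(\Sigma)$ be a (not necessarily linear) map. Let $\delta\in(0,M)$ be such that $$\|\mathcal{E}(f)\|_{H^r(\Sigma)}\le\delta\quad\text{for all } f\in H^{s+1}(\Sigma)\text{ with }\|f\|_{H^{s+1}(\Sigma)}\le\varepsilon_0 .$$ Then there exist $\tau\ge1$, $\varepsilon_1,\dots,\varepsilon_m>0$ and, for each $(x_0,t_0)\in\mathbb{R}^{1+1}$, a finite family of functions $H_j^{\tau,(x_0,t_0)}\in H^{s+1}(\Sigma)$, $j=1,\dots,m$ (such that the combinations appearing below lie in the domain of $\Lambda$), with $$\sup_{(x_0,t_0)\in\Omega\times[0,T]}\Big|-a(x_0,t_0)-\frac1{2\pi}D^m_{\varepsilon_1\cdots\varepsilon_m}\big|_{\varepsilon=0}\int_{\widetilde\Sigma}\psi\,(\Lambda+\mathcal{E})\big(\varepsilon_1H_1^{\tau,(x_0,t_0)}+\cdots+\varepsilon_mH_m^{\tau,(x_0,t_0)}\big)\,dS\Big|\le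 C\,\delta^{\sigma(s)},$$ where $\sigma(s)=\dfrac{m-1}{(2m-1)(m(s+2)+1)}$.
   Context: All functions are real-valued. Here $n=1$, $\square=\partial_t^2-\partial_x^2$, $\Sigma=\Sigma^T=\partial\Omega\times[0,T]$ is the lateral boundary and $\partial_\nu$ is the normal derivative on it. Set $d:=2\inf\{r>0 : \Omega\subset B_r(x)\text{ for some }x\in\mathbb{R}\}$, where $B_r(x)$ is the ball of radius $r$ centered at $x$. Put $t_1=d+\lambda$ and $t_2=T-d-\lambda$. Admissible: a function $a\in C_c^{s+1}(\Omega\times\mathbb{R})$ is admissible (with constants $L$ and $\lambda$) if $\|a\|_{C^{s+1}}\le L$ and $\operatorname{supp}(a)\Subset\Omega\times[t_1,t_2]$. Energy space: $E^{s+1}=\bigcap_{0\le k\le s+1}C^k([0,T];H^{s+1-k}(\Omega))$, with norm $\|u\|_{E^{s+1}}=\sup_{0<t<T}\sum_{0\le k\le s+1}\|\partial_t^ku(\cdot,t)\|_{H^{s+1-k}(\Omega)}$. Dirichlet-to-Neumann map: there are $\kappa,\rho>0$, depending only on $\Omega,T,s,m,L$, such that for every admissible $a$ and every $f\in H^{s+1}(\Sigma)$ with $\|f\|_{H^{s+1}(\Sigma)}<\kappa$ and $\partial_t^kf|_{t=0}=0$ on $\partial\Omega$, $k=0,\dots,s$, the problem $$\square u+au^m=0\text{ in }\Omega\times[0,T],\quad u=f\text{ on }\Sigma,\quad u|_{t=0}=\partial_tu|_{t=0}=0\text{ in }\Omega$$ has a unique solution $u_f\in E^{s+1}$ with $\|u_f\|_{E^{s+1}}<\rho$,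 and $\partial_\nu u_f|_\Sigma\in H^s(\Sigma)$. Such $\kappa,\rho$ are fixed, and the Dirichlet-to-Neumann map is $\Lambda(f)=\partial_\nu u_f|_\Sigma$, defined for such $f$ (its domain). Measurement function: $v_0\in C^\infty(\mathbb{R}^{2})$ is a fixed function (depending only on $\Omega,T,\lambda$) with $\square v_0=0$ in $\mathbb{R}\times[0,T]$, $v_0\equiv1$ in $\Omega\times[t_1,t_2]$, $v_0|_{t=T}=\partial_tv_0|_{t=T}=0$ in $\Omega$, and $v_0|_\Sigma\in C_c^\infty(\Sigma)$; $\psi:=v_0|_\Sigma$, and $\widetilde\Sigma:=\Sigma\cap\operatorname{supp}(v_0)$. (Such a function exists: choose $y_0$ with $\Omega\subset B_{d/2}(y_0)$, $\theta=\pm1$, $s_0=(t_1+t_2)/2$, $\alpha=(t_2-t_1+d)/2$, $0<\varepsilon<\lambda$, and take $v_0(x,t)=\chi_\alpha((x-y_0)\theta-(t-s_0))$ with $\chi_\alpha\in C_0^\infty(\mathbb{R})$ equal to $1$ for $|l|\le\alpha$ and $0$ for $|l|>\alpha+\varepsilon$.) Finite difference: for a function $G$ of $(\varepsilon_1,\dots,\varepsilon_m)$, $$D^m_{\varepsilon_1\cdots\varepsilon_m}\big|_{\varepsilon=0}G=\frac1{\varepsilon_1\cdots\varepsilon_m}\sum_{\sigma\in\{0,1\}^m}(-1)^{|\sigma|+m}G(\sigma_1\varepsilon_1,\dots,\sigma_m\varepsilon_m).$$ When $r<0$, the integral against $\psi$ is understood as the duality pairing. *)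

theory Defs
  imports "HOL-Analysis.Analysis"
begin

text \<open>Points of space-time are pairs \<open>(x, t)\<close>; the space dimension is one.\<close>

definition pd_x :: "(real \<times> real \<Rightarrow> real) \<Rightarrow> real \<times> real \<Rightarrow> real" where
  "pd_x f = (\<lambda>(x, t). deriv (\<lambda>y. f (y, t)) x)"

definition pd_t :: "(real \<times> real \<Rightarrow> real) \<Rightarrow> real \<times> real \<Rightarrow> real" where
  "pd_t f = (\<lambda>(x, t). deriv (\<lambda>\<tau>. f (x, \<tau>)) t)"

definition dalembertian :: "(real \<times> real \<Rightarrow> real) \<Rightarrow> real \<times> real \<Rightarrow> real" where
  "dalembertian f z = pd_t (pd_t f) z - pd_x (pd_x f) z"

primrec C_times :: "nat \<Rightarrow> (real \<times> real \<Rightarrow> real) \<Rightarrow> bool" where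
  "C_times 0 f \<longleftrightarrow> continuous_on UNIV f"
| "C_times (Suc k) f \<longleftrightarrow> continuous_on UNIV f
     \<and> (\<forall>x t. (\<lambda>y. f (y, t)) differentiable (at x) \<and> (\<lambda>\<tau>. f (x, \<tau>)) differentiable (at t))
     \<and> C_times k (pd_x f) \<and> C_times k (pd_t f)"

definition C_infinity :: "(real \<times> real \<Rightarrow> real) \<Rightarrow> bool" where
  "C_infinity f \<longleftrightarrow> (\<forall>k. C_times k f)"

definition supp :: "('a::topological_space \<Rightarrow> real) \<Rightarrow> 'a set" where
  "supp f = closure {z. f z \<noteq> 0}"

definition C_norm :: "nat \<Rightarrow> (real \<times> real \<Rightarrow> real) \<Rightarrow> real" where
  "C_norm k f =
     (\<Sum>(i, j) \<in> {(i, j). i + j \<le> k}. SUP z. \<bar>(pd_x ^^ i) ((pd_t ^^ j) f) z\<bar>)"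

definition test_functions :: "real set \<Rightarrow> (real \<Rightarrow> real) set" where
  "test_functions I = {\<phi>. (\<forall>k x. (deriv ^^ k) \<phi> differentiable (at x))
     \<and> compact (supp \<phi>) \<and> supp \<phi> \<subseteq> I}"

text \<open>
  A distribution on \<open>I\<close> is a functional on \<^term>\<open>test_functions I\<close>. The functionals below are
  set to zero off \<^term>\<open>test_functions I\<close>, so that equality of distributions is equality in HOL.
\<close>

type_synonym distr = "(real \<Rightarrow> real) \<Rightarrow> real"

definition distr_of :: "real set \<Rightarrow> (real \<Rightarrow> real) \<Rightarrow> distr" where
  "distr_of I f = (\<lambda>\<phi>. if \<phi> \<in> test_functions I then (LINT x:I|lborel. f x * \<phi> x) else 0)"

definition fourier :: "(real \<Rightarrow> real) \<Rightarrow> real \<Rightarrow> complex" where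
  "fourier \<phi> \<xi> = (LINT x|lborel. cis (- (\<xi> * x)) * complex_of_real (\<phi> x))"

text \<open>
  \<open>H\<^sup>r(I)\<close>, for every real \<open>r\<close>, is the space of restrictions to \<open>I\<close> of elements of \<open>H\<^sup>r(\<real>)\<close> with
  the quotient norm. An element of \<open>H\<^sup>r(\<real>)\<close> is given by its Fourier transform \<open>g\<close>, a function
  that is square integrable against \<open>(1 + \<xi>\<^sup>2)\<^sup>r\<close>, and acts on \<open>\<phi>\<close> by Parseval's formula; for
  \<open>r = 0\<close> the factor \<open>1 / (2 pi)\<close> makes the norm that of \<open>L\<^sup>2\<close>.
\<close>

definition sobolev_extension :: "real \<Rightarrow> real set \<Rightarrow> distr \<Rightarrow> (real \<Rightarrow> complex) \<Rightarrow> bool" where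
  "sobolev_extension r I u g \<longleftrightarrow>
     g \<in> borel_measurable lborel
     \<and> integrable lborel (\<lambda>\<xi>. (1 + \<xi>\<^sup>2) powr r * (cmod (g \<xi>))\<^sup>2)
     \<and> (\<forall>\<phi> \<in> test_functions I.
          complex_of_real (u \<phi>) = (LINT \<xi>|lborel. g \<xi> * fourier \<phi> (- \<xi>)) / (2 * pi))"

definition sobolev :: "real \<Rightarrow> real set \<Rightarrow> distr set" where
  "sobolev r I = {u. (\<forall>\<phi>. \<phi> \<notin> test_functions I \<longrightarrow> u \<phi> = 0) \<and> (\<exists>g. sobolev_extension r I u g)}"

definition sobolev_norm :: "real \<Rightarrow> real set \<Rightarrow> distr \<Rightarrow> real" where
  "sobolev_norm r I u =
     (INF g \<in> {g. sobolev_extension r I u g}.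
        sqrt ((LINT \<xi>|lborel. (1 + \<xi>\<^sup>2) powr r * (cmod (g \<xi>))\<^sup>2) / (2 * pi)))"

text \<open>
  The derivative of a curve of distributions on \<open>[0,T]\<close>, computed on each test function; it
  coincides with the derivative in a Sobolev norm whenever the latter exists.
\<close>

definition curve_deriv :: "real \<Rightarrow> (real \<Rightarrow> distr) \<Rightarrow> real \<Rightarrow> distr" where
  "curve_deriv T U = (\<lambda>t \<phi>. vector_derivative (\<lambda>\<tau>. U \<tau> \<phi>) (at t within {0..T}))"

definition C_curve :: "real \<Rightarrow> nat \<Rightarrow> real \<Rightarrow> real set \<Rightarrow> (real \<Rightarrow> distr) \<Rightarrow> bool" where
  "C_curve T k r I U \<longleftrightarrow>
     (\<forall>j\<le>k. \<forall>t\<in>{0..T}. (curve_deriv T ^^ j) U t \<in> sobolev r I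
        \<and> ((\<lambda>\<tau>. sobolev_norm r I
              (\<lambda>\<phi>. (curve_deriv T ^^ j) U \<tau> \<phi> - (curve_deriv T ^^ j) U t \<phi>))
            \<longlongrightarrow> 0) (at t within {0..T}))
     \<and> (\<forall>j<k. \<forall>t\<in>{0..T}.
          ((\<lambda>\<tau>. sobolev_norm r I
              (\<lambda>\<phi>. ((curve_deriv T ^^ j) U \<tau> \<phi> - (curve_deriv T ^^ j) U t \<phi>) / (\<tau> - t)
                    - (curve_deriv T ^^ Suc j) U t \<phi>))
            \<longlongrightarrow> 0) (at t within {0..T}))"

definition energy_space :: "real set \<Rightarrow> real \<Rightarrow> nat \<Rightarrow> (real \<Rightarrow> distr) set" where
  "energy_space \<Omega> T n = {U. \<forall>k\<le>n. C_curve T k (real (n - k)) \<Omega> U}"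

definition energy_norm :: "real set \<Rightarrow> real \<Rightarrow> nat \<Rightarrow> (real \<Rightarrow> distr) \<Rightarrow> real" where
  "energy_norm \<Omega> T n U =
     (SUP t\<in>{0<..<T}. \<Sum>k\<le>n. sobolev_norm (real (n - k)) \<Omega> ((curve_deriv T ^^ k) U t))"

text \<open>
  The boundary of the interval \<open>\<Omega>\<close> consists of two points, so a distribution on the lateral
  boundary assigns to each of them a distribution on the time interval \<open>(0,T)\<close>; surface measure
  is counting measure times Lebesgue measure.
\<close>

type_synonym bdistr = "real \<Rightarrow> distr"

definition lateral :: "real set \<Rightarrow> real \<Rightarrow> (real \<times> real) set" where
  "lateral \<Omega> T = frontier \<Omega> \<times> {0..T}"

definition bdistr_of :: "real set \<Rightarrow> real \<Rightarrow> (real \<times> real \<Rightarrow> real) \<Rightarrow> bdistr" where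
  "bdistr_of \<Omega> T f =
     (\<lambda>x. if x \<in> frontier \<Omega> then distr_of {0<..<T} (\<lambda>t. f (x, t)) else (\<lambda>_. 0))"

definition bsobolev :: "real set \<Rightarrow> real \<Rightarrow> real \<Rightarrow> bdistr set" where
  "bsobolev \<Omega> T r = {F. (\<forall>x\<in>frontier \<Omega>. F x \<in> sobolev r {0<..<T})
     \<and> (\<forall>x. x \<notin> frontier \<Omega> \<longrightarrow> F x = (\<lambda>_. 0))}"

definition bsobolev_norm :: "real set \<Rightarrow> real \<Rightarrow> real \<Rightarrow> bdistr \<Rightarrow> real" where
  "bsobolev_norm \<Omega> T r F = sqrt (\<Sum>x\<in>frontier \<Omega>. (sobolev_norm r {0<..<T} (F x))\<^sup>2)"

text \<open>
  \<open>\<integral>\<^sub>A w F dS\<close> for a part \<open>A\<close> of the lateral boundary and a function \<open>w\<close> such that \<open>w\<close> on \<open>A\<close>,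
  extended by zero, is a test function. It is the duality pairing, hence the usual integral when
  \<open>F\<close> is a function.
\<close>

definition bintegral :: "real set \<Rightarrow> (real \<times> real) set \<Rightarrow> (real \<times> real \<Rightarrow> real) \<Rightarrow> bdistr \<Rightarrow> real"
  where "bintegral \<Omega> A w F =
     (\<Sum>x\<in>frontier \<Omega>. F x (\<lambda>t. if (x, t) \<in> A then w (x, t) else 0))"

text \<open>For \<open>x\<close> one of the two endpoints of the interval \<open>\<Omega>\<close>.\<close>

definition outward_normal :: "real set \<Rightarrow> real \<Rightarrow> real" where
  "outward_normal \<Omega> x = (if x = Sup \<Omega> then 1 else - 1)"

definition normal_deriv :: "real set \<Rightarrow> (real \<times> real \<Rightarrow> real) \<Rightarrow> real \<times> real \<Rightarrow> real" where
  "normal_deriv \<Omega> u = (\<lambda>(x, t).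
     outward_normal \<Omega> x * vector_derivative (\<lambda>y. u (y, t)) (at x within closure \<Omega>))"

definition diam_enclosing :: "real set \<Rightarrow> real" where
  "diam_enclosing \<Omega> = 2 * Inf {r. r > 0 \<and> (\<exists>x. \<Omega> \<subseteq> ball x r)}"

definition t_lower :: "real set \<Rightarrow> real \<Rightarrow> real" where
  "t_lower \<Omega> lam = diam_enclosing \<Omega> + lam"

definition t_upper :: "real set \<Rightarrow> real \<Rightarrow> real \<Rightarrow> real" where
  "t_upper \<Omega> T lam = T - diam_enclosing \<Omega> - lam"

definition admissible ::
  "real set \<Rightarrow> real \<Rightarrow> nat \<Rightarrow> real \<Rightarrow> real \<Rightarrow> (real \<times> real \<Rightarrow> real) \<Rightarrow> bool" where
  "admissible \<Omega> T s L lam a \<longleftrightarrow>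
     C_times (s + 1) a \<and> C_norm (s + 1) a \<le> L
     \<and> compact (supp a) \<and> supp a \<subseteq> \<Omega> \<times> {t_lower \<Omega> lam..t_upper \<Omega> T lam}"

text \<open>
  Elements of the energy space are continuous up to the boundary in \<open>x\<close>, so a solution is
  represented by its continuous version, set to zero off \<open>closure \<Omega> \<times> [0,T]\<close> to make it unique
  as a HOL function. For every \<open>t\<close> in \<open>[0,T]\<close> the equation is an identity between distributions
  on \<open>\<Omega>\<close>.
\<close>

definition is_solution ::
  "real set \<Rightarrow> real \<Rightarrow> nat \<Rightarrow> nat \<Rightarrow> (real \<times> real \<Rightarrow> real) \<Rightarrow> bdistr \<Rightarrow> (real \<times> real \<Rightarrow> real) \<Rightarrow> bool"
  where "is_solution \<Omega> T s m a f u \<longleftrightarrow>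
     (let U = (\<lambda>t. distr_of \<Omega> (\<lambda>x. u (x, t))) in
       (\<forall>z. z \<notin> closure \<Omega> \<times> {0..T} \<longrightarrow> u z = 0)
       \<and> (\<forall>t\<in>{0..T}. continuous_on (closure \<Omega>) (\<lambda>x. u (x, t)))
       \<and> U \<in> energy_space \<Omega> T (s + 1)
       \<and> (\<forall>t\<in>{0..T}. \<forall>\<phi>\<in>test_functions \<Omega>.
            curve_deriv T (curve_deriv T U) t \<phi> - U t (deriv (deriv \<phi>))
              + distr_of \<Omega> (\<lambda>x. a (x, t) * u (x, t) ^ m) \<phi> = 0)
       \<and> bdistr_of \<Omega> T u = f
       \<and> (\<forall>\<phi>. U 0 \<phi> = 0) \<and> (\<forall>\<phi>. curve_deriv T U 0 \<phi> = 0))"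

definition is_small_solution ::
  "real set \<Rightarrow> real \<Rightarrow> nat \<Rightarrow> nat \<Rightarrow> real \<Rightarrow> (real \<times> real \<Rightarrow> real) \<Rightarrow> bdistr \<Rightarrow> (real \<times> real \<Rightarrow> real) \<Rightarrow> bool"
  where "is_small_solution \<Omega> T s m \<rho> a f u \<longleftrightarrow>
     is_solution \<Omega> T s m a f u
     \<and> energy_norm \<Omega> T (s + 1) (\<lambda>t. distr_of \<Omega> (\<lambda>x. u (x, t))) < \<rho>"

text \<open>
  \<open>\<partial>\<^sub>t\<^sup>k f = 0\<close> at \<open>t = 0\<close> for \<open>k \<le> s\<close>. An element of \<open>H\<^sup>s\<^sup>+\<^sup>1(0,T)\<close> has a unique representative \<open>G 0\<close>
  in \<open>C\<^sup>s([0,T])\<close>, and \<open>G k\<close> is its \<open>k\<close>-th derivative.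
\<close>

definition vanishing_at_0 :: "real \<Rightarrow> nat \<Rightarrow> distr \<Rightarrow> bool" where
  "vanishing_at_0 T s h \<longleftrightarrow> (\<exists>G :: nat \<Rightarrow> real \<Rightarrow> real.
     h = distr_of {0<..<T} (G 0)
     \<and> (\<forall>k\<le>s. continuous_on {0..T} (G k) \<and> G k 0 = 0)
     \<and> (\<forall>k<s. \<forall>t\<in>{0..T}. (G k has_real_derivative G (Suc k) t) (at t within {0..T})))"

definition DN_domain :: "real set \<Rightarrow> real \<Rightarrow> nat \<Rightarrow> real \<Rightarrow> bdistr set" where
  "DN_domain \<Omega> T s \<kappa> = {f \<in> bsobolev \<Omega> T (real (s + 1)).
     bsobolev_norm \<Omega> T (real (s + 1)) f < \<kappa> \<and> (\<forall>x\<in>frontier \<Omega>. vanishing_at_0 T s (f x))}"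

definition DN_map ::
  "real set \<Rightarrow> real \<Rightarrow> nat \<Rightarrow> nat \<Rightarrow> real \<Rightarrow> (real \<times> real \<Rightarrow> real) \<Rightarrow> bdistr \<Rightarrow> bdistr" where
  "DN_map \<Omega> T s m \<rho> a f =
     bdistr_of \<Omega> T (normal_deriv \<Omega> (THE u. is_small_solution \<Omega> T s m \<rho> a f u))"

text \<open>The property of the constants \<open>\<kappa>\<close>, \<open>\<rho>\<close> that makes \<^const>\<open>DN_map\<close> well defined.\<close>

definition DN_constants ::
  "real set \<Rightarrow> real \<Rightarrow> nat \<Rightarrow> nat \<Rightarrow> real \<Rightarrow> real \<Rightarrow> real \<Rightarrow> real \<Rightarrow> bool" where
  "DN_constants \<Omega> T s m L lam \<kappa> \<rho> \<longleftrightarrow> \<kappa> > 0 \<and> \<rho> > 0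
     \<and> (\<forall>a f. admissible \<Omega> T s L lam a \<and> f \<in> DN_domain \<Omega> T s \<kappa> \<longrightarrow>
          (\<exists>!u. is_small_solution \<Omega> T s m \<rho> a f u)
          \<and> DN_map \<Omega> T s m \<rho> a f \<in> bsobolev \<Omega> T (real s))"

text \<open>
  The condition on \<open>v0\<close> on the lateral boundary is smoothness with compact support in
  \<open>frontier \<Omega> \<times> (0,T)\<close>.
\<close>

definition measurement_wave ::
  "real set \<Rightarrow> real \<Rightarrow> real \<Rightarrow> (real \<times> real \<Rightarrow> real) \<Rightarrow> bool" where
  "measurement_wave \<Omega> T lam v0 \<longleftrightarrow>
     C_infinity v0
     \<and> (\<forall>z \<in> UNIV \<times> {0..T}. dalembertian v0 z = 0)
     \<and> (\<forall>z \<in> \<Omega> \<times> {t_lower \<Omega> lam..t_upper \<Omega> T lam}. v0 z = 1)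
     \<and> (\<forall>x\<in>\<Omega>. v0 (x, T) = 0 \<and> pd_t v0 (x, T) = 0)
     \<and> (\<forall>x\<in>frontier \<Omega>.
          (\<lambda>t. if (x, t) \<in> lateral \<Omega> T then v0 (x, t) else 0) \<in> test_functions {0<..<T})"

definition lateral_supp :: "real set \<Rightarrow> real \<Rightarrow> (real \<times> real \<Rightarrow> real) \<Rightarrow> (real \<times> real) set" where
  "lateral_supp \<Omega> T v0 = lateral \<Omega> T \<inter> supp v0"

definition lin_comb :: "nat \<Rightarrow> (nat \<Rightarrow> real) \<Rightarrow> (nat \<Rightarrow> bdistr) \<Rightarrow> bdistr" where
  "lin_comb m c H = (\<lambda>x \<phi>. \<Sum>j\<in>{1..m}. c j * H j x \<phi>)"

definition finite_diff :: "nat \<Rightarrow> (nat \<Rightarrow> real) \<Rightarrow> ((nat \<Rightarrow> real) \<Rightarrow> real) \<Rightarrow> real" where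
  "finite_diff m \<epsilon> G = 1 / (\<Prod>j\<in>{1..m}. \<epsilon> j) *
     (\<Sum>\<sigma> \<in> {1..m} \<rightarrow>\<^sub>E {0, 1 :: nat}. (- 1) ^ ((\<Sum>j\<in>{1..m}. \<sigma> j) + m) * G (\<lambda>j. real (\<sigma> j) * \<epsilon> j))"

definition sigma_exponent :: "nat \<Rightarrow> nat \<Rightarrow> real" where
  "sigma_exponent m s =
     (real m - 1) / ((2 * real m - 1) * (real m * (real s + 2) + 1))"

end

theory Submission
  imports Defs "HOL-Probability.Probability"
begin

text \<open>
  Why the theorem holds. Let \<open>w_1, ..., w_m\<close> be solutions of the free wave equation that vanish at
  early times, and let \<open>f\<close> be the trace of \<open>W = \<Sum>j. \<sigma>_j w_j\<close> on the lateral boundary. Because \<open>W\<close> is a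
  free wave on the whole line, it already has the boundary values \<open>f\<close> and is not reflected, so the
  solution is \<open>u = W + p\<close> with \<open>p\<close> vanishing on the boundary and at time zero, and
  \<open>p = O(|W|^m)\<close>. Testing the equation with the measurement wave \<open>v\<close>, which solves the free
  equation backwards from time \<open>T\<close> and equals one on the support of \<open>a\<close>, shows that the boundary
  integral of \<open>v \<partial>_\<nu> u\<close> is a term linear in \<open>\<sigma>\<close> plus \<open>\<integral> a u^m\<close>.
  The \<open>m\<close>-fold finite difference kills the linear part, and by polarization it turns \<open>\<integral> a W^m\<close> into
  \<open>m! \<integral> a w_1 ... w_m\<close>. If \<open>w_1\<close> is a right-moving pulse and \<open>w_2, ..., w_m\<close> are left-moving
  pulses of width \<open>1 / \<tau>\<close> that meet at \<open>(x_0, t_0)\<close>, the product is concentrated at that point and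
  the integral is \<open>a(x_0, t_0)\<close> times the mass of the product, up to a relative error \<open>O(1 / \<tau>)\<close>.

  Quantitatively, let the pulses have amplitude \<open>A\<close>. The product has mass of order \<open>A^m / \<tau>^2\<close>, the
  replacement of \<open>u\<close> by \<open>W\<close> costs \<open>O(A^(2m-1))\<close>, and the noise costs \<open>O(\<delta>)\<close> since the finite
  difference is a sum of \<open>2^m\<close> terms. The boundary data have to stay in a fixed ball of
  \<open>H^(s+1)\<close>, in which a pulse has norm at most of order \<open>A \<tau>^(s+1)\<close>; the choice \<open>A \<sim> \<tau>^(-s-2)\<close> respects this
  and makes the total error \<open>O(1 / \<tau> + \<delta> \<tau>^(m(s+2)+2))\<close>. With \<open>\<tau> \<sim> \<delta>^(-\<sigma>)\<close> both terms are
  \<open>O(\<delta>^\<sigma>)\<close> because \<open>\<sigma> (m(s+2)+3) \<le> 1\<close>. The divisor of the finite difference is free: only the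
  product of the \<open>\<epsilon>_j\<close> matters, and it is taken proportional to the exact mass of the product of the
  pulses.

  The analytic work is to justify this for a solution that is only known to lie in the energy space
  and to satisfy the equation in the distributional sense, with norms defined by Fourier extension.
  Sobolev embedding makes \<open>u\<close> continuously differentiable up to the boundary
  (\<open>is_solution_C1\<close>), and the equation, integrated once in time, becomes a classical first-order
  system for \<open>u\<close> and \<open>\<integral>\<^sub>0\<^sup>t u_x\<close> (\<open>weak_wave\<close>, \<open>is_solution_weak_wave\<close>). This form carries a
  sup-norm bound by characteristics (\<open>wave_sup_bound\<close>), which makes \<open>p\<close> small by a continuity argument
  in time (\<open>nonlinear_bootstrap\<close>), and Green's identity against \<open>v\<close> (\<open>Green_identity\<close>). The expansion
  of the Dirichlet-to-Neumann map is \<open>DN_asymptotics\<close>; \<open>pulse_data_in_domain\<close> puts the data in its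
  domain, and \<open>reconstruction_error\<close> and \<open>error_budget\<close> add up the errors. Existence of solutions is
  never constructed: it is what the constants \<open>\<kappa>\<close> and \<open>\<rho>\<close> provide.
\<close>

section \<open>Smooth functions and a bump\<close>

definition smooth :: "(real \<Rightarrow> real) \<Rightarrow> bool" where
  "smooth f \<longleftrightarrow> (\<forall>k x. (deriv ^^ k) f differentiable (at x))"

lemma smooth_differentiable: "smooth f \<Longrightarrow> f differentiable (at x)"
  unfolding smooth_def by (metis funpow_0)

lemma smooth_has_deriv: "smooth f \<Longrightarrow> (f has_real_derivative deriv f x) (at x)"
  using smooth_differentiable[of f x] DERIV_deriv_iff_real_differentiable by blast

lemma smooth_deriv: "smooth f \<Longrightarrow> smooth (deriv f)"
  unfolding smooth_def by (metis funpow_swap1 funpow.simps(2) comp_apply)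

lemma smooth_funpow_deriv: "smooth f \<Longrightarrow> smooth ((deriv ^^ k) f)"
  by (induction k) (auto intro: smooth_deriv)

lemma smooth_continuous: "smooth f \<Longrightarrow> continuous_on S f"
  by (meson smooth_differentiable continuous_at_imp_continuous_on differentiable_imp_continuous_within)

text \<open>
  Closure properties of smoothness follow from a class of functions that differentiation does not
  leave; this avoids an induction over the order of the derivative for each operation.
\<close>
lemma smooth_coinduct:
  assumes "P f" and "\<And>f. P f \<Longrightarrow> (\<forall>x. f differentiable (at x)) \<and> P (deriv f)"
  shows "smooth f"
proof -
  have "P ((deriv ^^ k) f)" for k
    by (induction k) (use assms in auto)
  then show ?thesis using assms(2) unfolding smooth_def by blast
qed

lemma smooth_const: "smooth (\<lambda>x. c)"
  by (rule smooth_coinduct[where P = "\<lambda>f. \<exists>c. f = (\<lambda>x. c)"]) auto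

lemma smooth_add:
  assumes "smooth f" "smooth g" shows "smooth (\<lambda>x. f x + g x)"
proof (rule smooth_coinduct[where P = "\<lambda>h. \<exists>f g. smooth f \<and> smooth g \<and> h = (\<lambda>x. f x + g x)"])
  fix h :: "real \<Rightarrow> real"
  assume "\<exists>f g. smooth f \<and> smooth g \<and> h = (\<lambda>x. f x + g x)"
  then obtain f g where fg: "smooth f" "smooth g" and h: "h = (\<lambda>x. f x + g x)" by blast
  have "(h has_real_derivative (deriv f x + deriv g x)) (at x)" for x
    unfolding h using fg by (auto intro!: derivative_eq_intros smooth_has_deriv)
  then show "(\<forall>x. h differentiable (at x)) \<and> (\<exists>f g. smooth f \<and> smooth g \<and> deriv h = (\<lambda>x. f x + g x))"
    using fg smooth_deriv by (metis (mono_tags, lifting) DERIV_imp_deriv ext real_differentiable_def)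
qed (use assms in blast)

lemma smooth_affine:
  assumes "smooth f" shows "smooth (\<lambda>x. c * f (a * x + b))"
proof (rule smooth_coinduct[where P = "\<lambda>h. \<exists>f c. smooth f \<and> h = (\<lambda>x. c * f (a * x + b))"])
  fix h :: "real \<Rightarrow> real"
  assume "\<exists>f c. smooth f \<and> h = (\<lambda>x. c * f (a * x + b))"
  then obtain f c where f: "smooth f" and h: "h = (\<lambda>x. c * f (a * x + b))" by blast
  have d: "(h has_real_derivative (c * a) * deriv f (a * x + b)) (at x)" for x
  proof -
    have "((\<lambda>x. f (a * x + b)) has_real_derivative deriv f (a * x + b) * a) (at x)"
      by (rule DERIV_chain2[OF smooth_has_deriv[OF f]]) (auto intro!: derivative_eq_intros)
    from DERIV_cmult[OF this, of c] show ?thesis unfolding h by (simp add: algebra_simps)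
  qed
  then have "deriv h = (\<lambda>x. (c * a) * deriv f (a * x + b))" by (auto intro: DERIV_imp_deriv)
  then show "(\<forall>x. h differentiable (at x)) \<and> (\<exists>f c. smooth f \<and> deriv h = (\<lambda>x. c * f (a * x + b)))"
    using d smooth_deriv[OF f] real_differentiable_def by blast
qed (use assms in blast)

text \<open>
  The invariant class consists of the finite sums of products of two smooth functions, which the
  product rule maps to itself.
\<close>
lemma smooth_mult:
  assumes "smooth f" "smooth g" shows "smooth (\<lambda>x. f x * g x)"
proof -
  define P where "P = (\<lambda>h :: real \<Rightarrow> real. \<exists>F. (\<forall>(f, g) \<in> set F. smooth f \<and> smooth g)
                         \<and> h = (\<lambda>x. \<Sum>(f, g)\<leftarrow>F. f x * g x))"
  have step: "(\<forall>x. h differentiable (at x)) \<and> P (deriv h)" if "P h" for h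
  proof -
    obtain F where F: "\<forall>(f, g) \<in> set F. smooth f \<and> smooth g"
      and h: "h = (\<lambda>x. \<Sum>(f, g)\<leftarrow>F. f x * g x)" using \<open>P h\<close> unfolding P_def by blast
    have "\<exists>F'. (\<forall>(f, g) \<in> set F'. smooth f \<and> smooth g) \<and>
            (\<forall>x. ((\<lambda>x. \<Sum>(f, g)\<leftarrow>F. f x * g x) has_real_derivative (\<Sum>(f, g)\<leftarrow>F'. f x * g x)) (at x))"
      using F
    proof (induction F)
      case Nil
      show ?case by (rule exI[of _ "[]"]) simp
    next
      case (Cons p F)
      obtain f g where p: "p = (f, g)" by (cases p)
      have fg: "smooth f" "smooth g" using Cons.prems p by auto
      obtain F' where F': "\<forall>(f, g) \<in> set F'. smooth f \<and> smooth g"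
        "\<And>x. ((\<lambda>x. \<Sum>(f, g)\<leftarrow>F. f x * g x) has_real_derivative (\<Sum>(f, g)\<leftarrow>F'. f x * g x)) (at x)"
        using Cons by auto
      have "((\<lambda>x. f x * g x + (\<Sum>(f, g)\<leftarrow>F. f x * g x)) has_real_derivative
              (deriv f x * g x + f x * deriv g x) + (\<Sum>(f, g)\<leftarrow>F'. f x * g x)) (at x)" for x
        using smooth_has_deriv[OF fg(1), of x] smooth_has_deriv[OF fg(2), of x]
        by (intro DERIV_add F'(2)) (auto intro!: derivative_eq_intros)
      then show ?case
        by (intro exI[of _ "(deriv f, g) # (f, deriv g) # F'"])
           (use F'(1) fg p in \<open>auto simp: smooth_deriv add.assoc\<close>)
    qed
    then show ?thesis unfolding P_def h real_differentiable_def
      by (metis (no_types, lifting) DERIV_imp_deriv ext)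
  qed
  have "P (\<lambda>x. f x * g x)" unfolding P_def
    by (rule exI[of _ "[(f, g)]"]) (use assms in auto)
  from smooth_coinduct[of P, OF this step] show ?thesis .
qed

lemma poly_exp_tendsto_0:
  fixes p :: "real poly" shows "((\<lambda>y. poly p y * exp (- y)) \<longlongrightarrow> 0) at_top"
proof -
  have "((\<lambda>y. \<Sum>i\<le>degree p. coeff p i * (y ^ i / exp y)) \<longlongrightarrow> (\<Sum>i\<le>degree p. coeff p i * 0)) at_top"
    by (intro tendsto_sum tendsto_mult tendsto_const tendsto_power_div_exp_0)
  then show ?thesis
    by (simp add: poly_altdef sum_distrib_right exp_minus divide_inverse mult.assoc)
qed

definition flat_exp :: "real \<Rightarrow> real" where
  "flat_exp x = (if x > 0 then exp (- (1 / x)) else 0)"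

text \<open>
  The derivatives are polynomials in \<open>1 / x\<close> times \<open>exp (- 1 / x)\<close>, a class closed under
  differentiation; at the origin the exponential beats every polynomial.
\<close>
lemma smooth_flat_exp: "smooth flat_exp"
proof -
  define e where "e = (\<lambda>(p :: real poly) x :: real. if x > 0 then poly p (1 / x) * exp (- (1 / x)) else 0)"
  have d: "(e p has_real_derivative e ([:0, 0, 1:] * (p - pderiv p)) x) (at x)" for p x
  proof (cases x "0 :: real" rule: linorder_cases)
    case less
    have "(e p has_real_derivative 0) (at x)"
      by (rule DERIV_cong_ev[THEN iffD1, OF refl _ refl, of "\<lambda>_. 0"])
         (use less in \<open>auto simp: e_def eventually_nhds intro!: exI[of _ "{..<0}"]\<close>)
    then show ?thesis using less by (simp add: e_def)
  next
    case greater
    have "((\<lambda>x. poly p (1 / x) * exp (- (1 / x))) has_real_derivative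
        (poly (pderiv p) (1 / x) * (- (1 / x\<^sup>2))) * exp (- (1 / x)) + poly p (1 / x) * (exp (- (1 / x)) * (1 / x\<^sup>2))) (at x)"
      using greater
      by (auto intro!: derivative_eq_intros DERIV_chain2[OF poly_DERIV] simp: power2_eq_square field_simps)
    then have "((\<lambda>x. poly p (1 / x) * exp (- (1 / x))) has_real_derivative
        e ([:0, 0, 1:] * (p - pderiv p)) x) (at x)"
      by (rule DERIV_cong) (use greater in \<open>simp add: e_def power2_eq_square field_simps\<close>)
    then show ?thesis
      by (rule DERIV_cong_ev[THEN iffD1, OF refl _ refl, rotated])
         (use greater in \<open>auto simp: e_def eventually_nhds intro!: exI[of _ "{0<..}"]\<close>)
  next
    case equal
    have r: "((\<lambda>h. e p h / h) \<longlongrightarrow> 0) (at_right 0)"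
    proof -
      have "((\<lambda>h. poly ([:0, 1:] * p) (inverse h) * exp (- inverse h)) \<longlongrightarrow> 0) (at_right (0::real))"
        by (rule filterlim_compose[OF poly_exp_tendsto_0 filterlim_inverse_at_top_right])
      then show ?thesis
        by (rule filterlim_cong[OF refl refl, THEN iffD1, rotated])
           (auto simp: e_def eventually_at_filter divide_inverse mult_ac)
    qed
    have l: "((\<lambda>h. e p h / h) \<longlongrightarrow> 0) (at_left 0)"
      by (rule tendsto_eventually) (auto simp: e_def eventually_at_filter)
    have "((\<lambda>h. e p h / h) \<longlongrightarrow> 0) (at 0)" using l r by (simp add: filterlim_split_at)
    moreover have "e q 0 = 0" for q by (simp add: e_def)
    ultimately show ?thesis using equal unfolding DERIV_def by simp
  qed
  have "flat_exp = e 1" by (auto simp: e_def flat_exp_def fun_eq_iff)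
  moreover have "smooth (e 1)"
  proof (rule smooth_coinduct[where P = "\<lambda>f. f \<in> range e"])
    fix f assume "f \<in> range e"
    then obtain p where f: "f = e p" by blast
    have "deriv f = e ([:0, 0, 1:] * (p - pderiv p))"
      unfolding f using DERIV_imp_deriv[OF d] by blast
    then show "(\<forall>x. f differentiable (at x)) \<and> deriv f \<in> range e"
      using d[of p] unfolding f real_differentiable_def by blast
  qed simp
  ultimately show ?thesis by simp
qed

definition bump0 :: "real \<Rightarrow> real" where
  "bump0 x = flat_exp (1 + x) * flat_exp (1 - x)"

lemma smooth_bump0: "smooth bump0"
proof -
  have "smooth (\<lambda>x. flat_exp (1 + x) * flat_exp (1 - x))"
    using smooth_mult[OF smooth_affine[OF smooth_flat_exp, of 1 1 1] smooth_affine[OF smooth_flat_exp, of 1 "-1" 1]]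
    by (simp add: add.commute)
  then show ?thesis by (simp add: bump0_def[abs_def])
qed

lemma bump0_pos: "bump0 x > 0 \<longleftrightarrow> \<bar>x\<bar> < 1"
  by (auto simp: bump0_def flat_exp_def zero_less_mult_iff)

lemma bump0_nonneg: "bump0 x \<ge> 0"
  by (auto simp: bump0_def flat_exp_def)

lemma bump0_eq_0: "\<bar>x\<bar> \<ge> 1 \<Longrightarrow> bump0 x = 0"
  by (auto simp: bump0_def flat_exp_def)

lemma integral_bump0_pos: "integral {-1..1} bump0 > 0"
proof -
  have c: "continuous_on {-1..1} bump0" by (rule smooth_continuous[OF smooth_bump0])
  have "integral {-1..1} bump0 \<noteq> 0"
  proof
    assume "integral {-1..1} bump0 = 0"
    then have "(bump0 has_integral 0) (cbox (-1) 1)"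
      using integrable_integral[OF integrable_continuous_interval[OF c]] by simp
    then have "bump0 0 = 0"
      using has_integral_0_cbox_imp_0[of "-1" 1 bump0 0] c bump0_nonneg by auto
    then show False using bump0_pos[of 0] by simp
  qed
  moreover have "integral {-1..1} bump0 \<ge> 0"
    by (intro integral_nonneg integrable_continuous_interval c bump0_nonneg)
  ultimately show ?thesis by linarith
qed

text \<open>
  The integral is normalized to one, so that the bump is also a probability density.
\<close>
definition bump :: "real \<Rightarrow> real" where
  "bump x = bump0 x / integral {-1..1} bump0"

lemma smooth_bump: "smooth bump"
  using smooth_affine[OF smooth_bump0, of "1 / integral {-1..1} bump0" 1 0]
  by (simp add: bump_def[abs_def])

lemma bump_nonneg: "bump x \<ge> 0"
  using bump0_nonneg integral_bump0_pos by (simp add: bump_def)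

lemma bump_pos: "\<bar>x\<bar> < 1 \<Longrightarrow> bump x > 0"
  using bump0_pos integral_bump0_pos by (simp add: bump_def)

lemma bump_eq_0: "\<bar>x\<bar> \<ge> 1 \<Longrightarrow> bump x = 0"
  using bump0_eq_0 by (simp add: bump_def)

text \<open>
  Evenness lets the trace of a left-moving and of a right-moving pulse be written in the same form.
\<close>
lemma bump_even: "bump (- x) = bump x"
  by (simp add: bump_def bump0_def mult.commute)

lemma integral_bump: "(bump has_integral 1) {-1..1}"
proof -
  have "(bump0 has_integral integral {-1..1} bump0) {-1..1}"
    by (intro integrable_integral integrable_continuous_interval smooth_continuous smooth_bump0)
  from has_integral_divide[OF this, of "integral {-1..1} bump0"]
  show ?thesis using integral_bump0_pos by (simp add: bump_def[abs_def])
qed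

section \<open>Test functions\<close>

lemma test_functions_iff:
  "\<phi> \<in> test_functions I \<longleftrightarrow> smooth \<phi> \<and> compact (supp \<phi>) \<and> supp \<phi> \<subseteq> I"
  by (simp add: test_functions_def smooth_def)

lemma supp_subset:
  assumes "closed K" "\<And>x. x \<notin> K \<Longrightarrow> f x = 0" shows "supp f \<subseteq> K"
  unfolding supp_def by (rule closure_minimal[OF _ assms(1)]) (use assms(2) in blast)

lemma not_in_supp: "x \<notin> supp f \<Longrightarrow> f x = 0"
  unfolding supp_def using closure_subset[of "{z. f z \<noteq> 0}"] by blast

lemma test_functions_interval:
  assumes "smooth \<phi>" "\<And>x. x \<notin> {a..b} \<Longrightarrow> \<phi> x = 0" "{a..b} \<subseteq> I"
  shows "\<phi> \<in> test_functions I"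
proof -
  have "supp \<phi> \<subseteq> {a..b}" by (rule supp_subset) (use assms in auto)
  moreover from this have "compact (supp \<phi>)"
    unfolding compact_eq_bounded_closed
    by (auto simp: supp_def intro: bounded_subset[OF bounded_closed_interval])
  ultimately show ?thesis using assms unfolding test_functions_iff by auto
qed

lemma test_functions_bounds:
  assumes "\<phi> \<in> test_functions I"
  obtains R where "R > 0" "\<And>x. \<bar>x\<bar> \<ge> R \<Longrightarrow> \<phi> x = 0"
proof -
  have "bounded (supp \<phi>)" using assms compact_imp_bounded unfolding test_functions_iff by blast
  then obtain R where R: "R > 0" "\<forall>x \<in> supp \<phi>. norm x < R"
    unfolding bounded_pos_less by blast
  show ?thesis
  proof (rule that[OF R(1)])
    fix x assume "\<bar>x\<bar> \<ge> R"
    then have "x \<notin> supp \<phi>" using R(2) by fastforce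
    then show "\<phi> x = 0" by (rule not_in_supp)
  qed
qed

lemma test_functions_deriv:
  assumes "\<phi> \<in> test_functions I" shows "deriv \<phi> \<in> test_functions I"
proof -
  have "deriv \<phi> x = 0" if "x \<notin> supp \<phi>" for x
  proof -
    have "open (- supp \<phi>)" by (simp add: supp_def open_Compl)
    then have "(\<phi> has_real_derivative 0) (at x)"
      using has_field_derivative_transform_within_open[OF DERIV_const, of "- supp \<phi>" x 0 \<phi>] that not_in_supp[of _ \<phi>]
      by (metis Compl_iff)
    then show ?thesis by (rule DERIV_imp_deriv)
  qed
  then have "supp (deriv \<phi>) \<subseteq> supp \<phi>"
    by (intro supp_subset) (auto simp: supp_def)
  moreover from this have "compact (supp (deriv \<phi>))"
    using assms unfolding test_functions_iff
    unfolding compact_eq_bounded_closed by (auto simp: supp_def intro: bounded_subset)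
  ultimately show ?thesis using assms smooth_deriv unfolding test_functions_iff by auto
qed

lemma integrable_test:
  fixes f :: "real \<Rightarrow> 'a :: {banach, second_countable_topology}"
  assumes "continuous_on UNIV f" "\<And>x. \<bar>x\<bar> \<ge> R \<Longrightarrow> f x = 0"
  shows "integrable lborel f"
proof -
  have "set_integrable lborel {-R..R} f"
    by (rule borel_integrable_atLeastAtMost') (use assms continuous_on_subset in blast)
  moreover have "indicator {-R..R} x *\<^sub>R f x = f x" for x
    using assms(2)[of x] by (cases "\<bar>x\<bar> \<ge> R") (auto simp: indicator_def)
  ultimately show ?thesis by (simp add: set_integrable_def)
qed

section \<open>Mollification and the calculus of variations\<close>

definition mollifier :: "real \<Rightarrow> real \<Rightarrow> real \<Rightarrow> real" where
  "mollifier e c x = bump ((x - c) / e) / e"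

lemma smooth_mollifier: "smooth (mollifier e c)"
  using smooth_affine[OF smooth_bump, of "1 / e" "1 / e" "- c / e"]
  by (simp add: mollifier_def[abs_def] diff_divide_distrib)

lemma mollifier_eq_0: "e > 0 \<Longrightarrow> x \<notin> {c - e..c + e} \<Longrightarrow> mollifier e c x = 0"
  unfolding mollifier_def by (subst bump_eq_0) (auto simp: field_simps abs_if)

lemma mollifier_nonneg: "e > 0 \<Longrightarrow> mollifier e c x \<ge> 0"
  by (simp add: mollifier_def bump_nonneg)

lemma mollifier_test: "e > 0 \<Longrightarrow> {c - e..c + e} \<subseteq> I \<Longrightarrow> mollifier e c \<in> test_functions I"
  by (rule test_functions_interval[OF smooth_mollifier mollifier_eq_0])

lemma mollifier_integral:
  assumes "e > 0" shows "(mollifier e c has_integral 1) {c - e..c + e}"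
proof -
  have "((\<lambda>x. bump ((1 / e) *\<^sub>R x + - c / e)) has_integral (1 / \<bar>1 / e\<bar> ^ DIM(real)) *\<^sub>R 1)
          ((\<lambda>x. (1 / (1 / e)) *\<^sub>R x + - ((1 / (1 / e)) *\<^sub>R (- c / e))) ` cbox (-1) 1)"
    by (rule has_integral_affinity) (use integral_bump assms in auto)
  moreover have "(\<lambda>x. (1 / (1 / e)) *\<^sub>R x + - ((1 / (1 / e)) *\<^sub>R (- c / e))) ` cbox (-1) 1 = {c - e..c + e}"
    using assms image_affinity_atLeastAtMost[of e c "-1" 1] by (simp add: algebra_simps)
  ultimately have "((\<lambda>x. bump ((x - c) / e)) has_integral e) {c - e..c + e}"
    using assms by (simp add: diff_divide_distrib)
  from has_integral_divide[OF this, of e] show ?thesis using assms by (simp add: mollifier_def[abs_def])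
qed

lemma mollifier_approx:
  fixes q :: "real \<Rightarrow> real"
  assumes "e > 0" "continuous_on {c - e..c + e} q" "\<And>y. y \<in> {c - e..c + e} \<Longrightarrow> \<bar>q y - q c\<bar> \<le> B"
  shows "\<bar>integral {c - e..c + e} (\<lambda>y. q y * mollifier e c y) - q c\<bar> \<le> B"
proof -
  let ?I = "{c - e..c + e}"
  have m: "continuous_on ?I (mollifier e c)" by (rule smooth_continuous[OF smooth_mollifier])
  have "q c = integral ?I (\<lambda>y. q c * mollifier e c y)"
    using integral_unique[OF mollifier_integral[OF assms(1), of c]] by simp
  then have "integral ?I (\<lambda>y. q y * mollifier e c y) - q c
      = integral ?I (\<lambda>y. (q y - q c) * mollifier e c y)"
    by (simp add: left_diff_distrib)
       (subst integral_diff, auto intro!: integrable_continuous_interval continuous_intros m assms)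
  also have "\<bar>\<dots>\<bar> \<le> integral ?I (\<lambda>y. B * mollifier e c y)"
    unfolding real_norm_def[symmetric]
  proof (rule integral_norm_bound_integral)
    show "norm ((q y - q c) * mollifier e c y) \<le> B * mollifier e c y" if "y \<in> ?I" for y
      using mult_right_mono[OF assms(3)[OF that] mollifier_nonneg[OF assms(1), of c y]]
      by (simp add: abs_mult mollifier_nonneg[OF assms(1)])
  qed (intro integrable_continuous_interval continuous_intros m assms(2))+
  also have "\<dots> = B"
    using integral_unique[OF mollifier_integral[OF assms(1), of c]] by simp
  finally show ?thesis .
qed

lemma integral_mollifier_widen:
  fixes q :: "real \<Rightarrow> real"
  assumes "e > 0" "{c - e..c + e} \<subseteq> {a..b}"
  shows "integral {a..b} (\<lambda>y. q y * mollifier e c y) = integral {c - e..c + e} (\<lambda>y. q y * mollifier e c y)"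
proof -
  have z: "\<And>x. x \<notin> {c - e..c + e} \<Longrightarrow> q x * mollifier e c x = 0"
    using mollifier_eq_0[OF assms(1)] by simp
  have "integral {c - e..c + e} (\<lambda>y. q y * mollifier e c y)
      = integral {a..b} (\<lambda>y. if y \<in> {c - e..c + e} then q y * mollifier e c y else 0)"
    unfolding Henstock_Kurzweil_Integration.integral_restrict_Int using assms(2) by (simp only: Int_absorb2)
  also have "\<dots> = integral {a..b} (\<lambda>y. q y * mollifier e c y)"
    by (rule integral_cong) (use z in auto)
  finally show ?thesis by simp
qed

text \<open>
  Pairing with narrow mollifiers recovers the values of a continuous function. Both lemmas of the
  calculus of variations below rest on this.
\<close>
lemma mollifier_pairing:
  fixes q :: "real \<Rightarrow> real"
  assumes q: "continuous_on {a..b} q" and c: "a < c" "c < b" and B: "B > 0"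
  shows "\<exists>e0>0. \<forall>e. 0 < e \<and> e \<le> e0 \<longrightarrow> {c - e..c + e} \<subseteq> {a<..<b}
    \<and> \<bar>integral {a..b} (\<lambda>y. q y * mollifier e c y) - q c\<bar> \<le> B"
proof -
  obtain d where d: "d > 0" "\<And>y. y \<in> {a..b} \<Longrightarrow> \<bar>y - c\<bar> < d \<Longrightarrow> \<bar>q y - q c\<bar> < B"
    using q[unfolded continuous_on_iff, rule_format, of c B] c B by (auto simp: dist_real_def)
  \<comment> \<open>Small for the modulus of continuity, and small enough to stay inside the interval.\<close>
  define e0 where "e0 = min (d / 2) (min ((c - a) / 2) ((b - c) / 2))"
  have "e0 > 0" using c d(1) by (simp add: e0_def)
  have "e0 \<le> d / 2" by (simp add: e0_def)
  have "e0 \<le> (c - a) / 2" unfolding e0_def by (rule min.coboundedI2, rule min.coboundedI1, simp)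
  have "e0 \<le> (b - c) / 2" unfolding e0_def by (rule min.coboundedI2, rule min.coboundedI2, simp)
  note e0 = \<open>e0 > 0\<close> \<open>e0 \<le> d / 2\<close> \<open>e0 \<le> (c - a) / 2\<close> \<open>e0 \<le> (b - c) / 2\<close>
  have "{c - e..c + e} \<subseteq> {a<..<b} \<and> \<bar>integral {a..b} (\<lambda>y. q y * mollifier e c y) - q c\<bar> \<le> B"
    if e: "0 < e" "e \<le> e0" for e
  proof
    have "a < c - e" using e e0 c by argo
    have "c + e < b" using e e0 c by argo
    have "e < d" using e e0 d(1) by argo
    show s: "{c - e..c + e} \<subseteq> {a<..<b}" using \<open>a < c - e\<close> \<open>c + e < b\<close> by auto
    have s': "{c - e..c + e} \<subseteq> {a..b}" using \<open>a < c - e\<close> \<open>c + e < b\<close> by auto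
    have "\<bar>q y - q c\<bar> \<le> B" if "y \<in> {c - e..c + e}" for y
    proof (rule less_imp_le, rule d(2))
      show "y \<in> {a..b}" using that s' by blast
      show "\<bar>y - c\<bar> < d" using that \<open>e < d\<close> by auto
    qed
    then show "\<bar>integral {a..b} (\<lambda>y. q y * mollifier e c y) - q c\<bar> \<le> B"
      unfolding integral_mollifier_widen[OF e(1) s']
      by (intro mollifier_approx e continuous_on_subset[OF q s'])
  qed
  then show ?thesis using e0(1) by blast
qed

text \<open>
  Identities are tested in the open interval and used at its endpoints, where boundary values are
  taken.
\<close>
lemma continuous_const_on_closed_interval:
  fixes q :: "real \<Rightarrow> real"
  assumes "a < b" "continuous_on {a..b} q" "\<And>x. x \<in> {a<..<b} \<Longrightarrow> q x = k" "x \<in> {a..b}"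
  shows "q x = k"
proof -
  have "x \<in> closure {a<..<b}" using assms(1,4) by simp
  then show ?thesis
    using continuous_constant_on_closure[of "{a<..<b}" q k x] assms by simp
qed

lemma eq_0_if_arbitrarily_small:
  fixes x :: real
  assumes "\<And>B. B > 0 \<Longrightarrow> \<bar>x\<bar> \<le> B" shows "x = 0"
proof (rule ccontr)
  assume "x \<noteq> 0"
  then show False using assms[of "\<bar>x\<bar> / 2"] by simp
qed

lemma fundamental_lemma:
  fixes q :: "real \<Rightarrow> real"
  assumes "a < b" "continuous_on {a..b} q"
    "\<And>\<phi>. \<phi> \<in> test_functions {a<..<b} \<Longrightarrow> integral {a..b} (\<lambda>y. q y * \<phi> y) = 0" "x \<in> {a..b}"
  shows "q x = 0"
proof (rule continuous_const_on_closed_interval[OF assms(1,2) _ assms(4)])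
  fix c assume c: "c \<in> {a<..<b}"
  have "\<bar>q c\<bar> \<le> B" if "B > 0" for B
  proof -
    have "a < c" "c < b" using c by auto
    from mollifier_pairing[OF assms(2) this that] obtain e where e: "e > 0"
      "{c - e..c + e} \<subseteq> {a<..<b}" "\<bar>integral {a..b} (\<lambda>y. q y * mollifier e c y) - q c\<bar> \<le> B"
      by blast
    then show ?thesis using assms(3)[OF mollifier_test[OF e(1,2)]] by simp
  qed
  then show "q c = 0" by (rule eq_0_if_arbitrarily_small)
qed

definition bump_primitive :: "real \<Rightarrow> real" where
  "bump_primitive z = integral {-2..z} bump"

lemma continuous_bump: "continuous_on S bump" by (rule smooth_continuous[OF smooth_bump])

lemma bump_primitive_left: "z \<le> -1 \<Longrightarrow> bump_primitive z = 0"
proof -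
  assume "z \<le> -1"
  then have "integral {-2..z} bump = integral {-2..z} (\<lambda>_. 0 :: real)"
    by (intro integral_cong bump_eq_0) auto
  then show ?thesis by (simp add: bump_primitive_def)
qed

lemma bump_primitive_right: assumes "z \<ge> 1" shows "bump_primitive z = 1"
proof -
  have "bump_primitive z = integral {-2..z} (\<lambda>y. if y \<in> {-1..1} then bump y else 0)"
    unfolding bump_primitive_def by (rule integral_cong) (auto intro!: bump_eq_0)
  also have "\<dots> = integral {-1..1} bump"
    unfolding Henstock_Kurzweil_Integration.integral_restrict_Int using assms by (simp add: Int_absorb2)
  finally show ?thesis using integral_bump by (simp add: integral_unique)
qed

lemma DERIV_bump_primitive: "(bump_primitive has_real_derivative bump z) (at z)"
proof (cases "z < -1")
  case True
  have "(bump_primitive has_real_derivative 0) (at z)"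
    by (rule has_field_derivative_transform_within_open[OF DERIV_const[of 0], of "{..<-1}"])
       (use True bump_primitive_left in auto)
  then show ?thesis using True bump_eq_0[of z] by simp
next
  case False
  have "((\<lambda>u. integral {-2..u} bump) has_real_derivative bump z) (at z within {-2..z+1})"
    by (rule integral_has_real_derivative[OF continuous_bump]) (use False in auto)
  then have "(bump_primitive has_real_derivative bump z) (at z within {-2..z+1})"
    by (simp add: bump_primitive_def[abs_def])
  then show ?thesis using at_within_interior[of z "{-2..z+1}"] False by simp
qed

lemma smooth_if_deriv_smooth:
  assumes "\<And>x. (f has_real_derivative g x) (at x)" "smooth g" shows "smooth f"
proof (rule smooth_coinduct[where P = "\<lambda>h. h = f \<or> smooth h"])
  fix h assume "h = f \<or> smooth h"
  moreover have "deriv f = g" using assms(1) DERIV_imp_deriv by blast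
  ultimately show "(\<forall>x. h differentiable (at x)) \<and> (deriv h = f \<or> smooth (deriv h))"
    using assms smooth_deriv smooth_differentiable real_differentiable_def by metis
qed simp

text \<open>
  The difference of two mollifiers has integral zero, hence a primitive of compact support. It is
  the test function that compares the values of a function at two points.
\<close>
lemma mollifier_difference_primitive:
  assumes e: "e > 0" "{x - e..x + e} \<subseteq> {a<..<b}" "{y - e..y + e} \<subseteq> {a<..<b}"
  obtains \<phi> where "\<phi> \<in> test_functions {a<..<b}" "\<And>z. deriv \<phi> z = mollifier e x z - mollifier e y z"
proof -
  define \<phi> where "\<phi> z = bump_primitive ((z - x) / e) - bump_primitive ((z - y) / e)" for z
  have d: "(\<phi> has_real_derivative mollifier e x z - mollifier e y z) (at z)" for z
    unfolding \<phi>_def mollifier_def using e(1)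
    by (auto intro!: derivative_eq_intros DERIV_chain2[OF DERIV_bump_primitive] simp: field_simps)
  have "smooth (\<lambda>z. mollifier e x z - mollifier e y z)"
    using smooth_add[OF smooth_mollifier smooth_affine[OF smooth_mollifier, of "-1" e y 1 0], of e x] by simp
  then have "smooth \<phi>" by (rule smooth_if_deriv_smooth[OF d])
  moreover have "\<phi> z = 0" if "z \<notin> {min x y - e..max x y + e}" for z
  proof (cases "z < min x y - e")
    case True
    then have "(z - x) / e \<le> -1" "(z - y) / e \<le> -1" using e(1) by (auto simp: field_simps)
    then show ?thesis by (simp add: \<phi>_def bump_primitive_left)
  next
    case False
    then have "(z - x) / e \<ge> 1" "(z - y) / e \<ge> 1" using e(1) that by (auto simp: field_simps)
    then show ?thesis by (simp add: \<phi>_def bump_primitive_right)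
  qed
  moreover have "{min x y - e..max x y + e} \<subseteq> {a<..<b}"
  proof -
    have "x - e \<in> {a<..<b}" "y - e \<in> {a<..<b}" "x + e \<in> {a<..<b}" "y + e \<in> {a<..<b}"
      by (rule subsetD[OF e(2)] subsetD[OF e(3)]; use e(1) in simp)+
    then show ?thesis by (auto simp: min_def max_def split: if_splits)
  qed
  ultimately have "\<phi> \<in> test_functions {a<..<b}" by (rule test_functions_interval)
  then show ?thesis using that DERIV_imp_deriv[OF d] by blast
qed

lemma du_Bois_Reymond:
  fixes q :: "real \<Rightarrow> real"
  assumes ab: "a < b" and q: "continuous_on {a..b} q"
    and 0: "\<And>\<phi>. \<phi> \<in> test_functions {a<..<b} \<Longrightarrow> integral {a..b} (\<lambda>y. q y * deriv \<phi> y) = 0"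
    and x: "x \<in> {a..b}"
  shows "q x = q ((a + b) / 2)"
proof (rule continuous_const_on_closed_interval[OF ab q _ x])
  fix c assume c: "c \<in> {a<..<b}"
  let ?m = "(a + b) / 2"
  have m: "?m \<in> {a<..<b}" using ab by auto
  have "\<bar>q c - q ?m\<bar> \<le> B" if "B > 0" for B
  proof -
    have B2: "B / 2 > 0" using that by simp
    from c have "a < c" "c < b" by auto
    from mollifier_pairing[OF q this B2]
    obtain e1 where e1: "e1 > 0" "\<forall>e. 0 < e \<and> e \<le> e1 \<longrightarrow> {c - e..c + e} \<subseteq> {a<..<b}
      \<and> \<bar>integral {a..b} (\<lambda>y. q y * mollifier e c y) - q c\<bar> \<le> B / 2" by blast
    from m have "a < ?m" "?m < b" by auto
    from mollifier_pairing[OF q this B2]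
    obtain e2 where e2: "e2 > 0" "\<forall>e. 0 < e \<and> e \<le> e2 \<longrightarrow> {?m - e..?m + e} \<subseteq> {a<..<b}
      \<and> \<bar>integral {a..b} (\<lambda>y. q y * mollifier e ?m y) - q ?m\<bar> \<le> B / 2" by blast
    define e where "e = min e1 e2"
    have e: "e > 0" "e \<le> e1" "e \<le> e2" using e1(1) e2(1) by (auto simp: e_def)
    have n1: "{c - e..c + e} \<subseteq> {a<..<b}" "\<bar>integral {a..b} (\<lambda>y. q y * mollifier e c y) - q c\<bar> \<le> B / 2"
      using e1(2) e(1,2) by blast+
    have n2: "{?m - e..?m + e} \<subseteq> {a<..<b}" "\<bar>integral {a..b} (\<lambda>y. q y * mollifier e ?m y) - q ?m\<bar> \<le> B / 2"
      using e2(2) e(1,3) by blast+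
    obtain \<phi> where \<phi>: "\<phi> \<in> test_functions {a<..<b}" "\<And>z. deriv \<phi> z = mollifier e c z - mollifier e ?m z"
      using mollifier_difference_primitive[OF e(1) n1(1) n2(1)] by blast
    have i: "(\<lambda>y. q y * mollifier e w y) integrable_on {a..b}" for w
      by (intro integrable_continuous_interval continuous_intros q smooth_continuous[OF smooth_mollifier])
    have "integral {a..b} (\<lambda>y. q y * mollifier e c y) = integral {a..b} (\<lambda>y. q y * mollifier e ?m y)"
      using 0[OF \<phi>(1)] integral_diff[OF i i, of c ?m] by (simp add: \<phi>(2) right_diff_distrib)
    then show ?thesis using n1(2) n2(2) by argo
  qed
  then have "q c - q ?m = 0" by (rule eq_0_if_arbitrarily_small)
  then show "q c = q ?m" by simp
qed

section \<open>Fourier transforms of test functions\<close>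

lemma integrable_test_function:
  assumes "\<phi> \<in> test_functions I" shows "integrable lborel \<phi>"
proof -
  obtain R where "R > 0" "\<And>x. \<bar>x\<bar> \<ge> R \<Longrightarrow> \<phi> x = 0" using test_functions_bounds[OF assms] by blast
  then show ?thesis
    using assms unfolding test_functions_iff by (intro integrable_test smooth_continuous) auto
qed

lemma borel_measurable_cis_scaled [measurable]: "(\<lambda>x. cis (c * x)) \<in> borel_measurable borel"
  by (intro borel_measurable_continuous_onI continuous_intros)

lemma measurable_test_function:
  assumes "\<phi> \<in> test_functions I" shows "\<phi> \<in> borel_measurable borel"
  using assms unfolding test_functions_iff by (intro borel_measurable_continuous_onI smooth_continuous) auto

lemma integrable_fourier:
  assumes "integrable lborel \<phi>"
  shows "integrable lborel (\<lambda>x. cis (- (\<xi> * x)) * complex_of_real (\<phi> x))"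
proof (rule Bochner_Integration.integrable_bound[OF assms])
  have [measurable]: "\<phi> \<in> borel_measurable lborel" using assms by simp
  have [measurable]: "(\<lambda>x. cis (- (\<xi> * x))) \<in> borel_measurable borel"
    using borel_measurable_cis_scaled[of "- \<xi>"] by (simp only: mult_minus_left)
  show "(\<lambda>x. cis (- (\<xi> * x)) * complex_of_real (\<phi> x)) \<in> borel_measurable lborel"
    by measurable
qed (simp add: norm_mult)

lemma norm_fourier_le:
  assumes "integrable lborel \<phi>" shows "cmod (fourier \<phi> \<xi>) \<le> (LINT x|lborel. \<bar>\<phi> x\<bar>)"
proof -
  have "cmod (fourier \<phi> \<xi>) \<le> (LINT x|lborel. cmod (cis (- (\<xi> * x)) * complex_of_real (\<phi> x)))"
    unfolding fourier_def by (rule integral_norm_bound)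
  then show ?thesis by (simp add: norm_mult)
qed

lemma fourier_deriv:
  assumes "\<phi> \<in> test_functions I"
  shows "fourier (deriv \<phi>) \<xi> = \<i> * \<xi> * fourier \<phi> \<xi>"
proof -
  have sm: "smooth \<phi>" using assms unfolding test_functions_iff by simp
  obtain R where R: "R > 0" "\<And>x. \<bar>x\<bar> \<ge> R \<Longrightarrow> \<phi> x = 0" using test_functions_bounds[OF assms] by blast
  obtain R' where R': "R' > 0" "\<And>x. \<bar>x\<bar> \<ge> R' \<Longrightarrow> deriv \<phi> x = 0"
    using test_functions_bounds[OF test_functions_deriv[OF assms]] by blast
  define S where "S = max R R'"
  have S: "S > 0" "\<And>x. \<bar>x\<bar> \<ge> S \<Longrightarrow> \<phi> x = 0" "\<And>x. \<bar>x\<bar> \<ge> S \<Longrightarrow> deriv \<phi> x = 0"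
    using R R' by (auto simp: S_def)
  define F where "F = (\<lambda>x. cis (- (\<xi> * x)) * complex_of_real (\<phi> x))"
  define f where "f = (\<lambda>x. cis (- (\<xi> * x)) * complex_of_real (deriv \<phi> x) - \<i> * \<xi> * (cis (- (\<xi> * x)) * complex_of_real (\<phi> x)))"
  have d: "(F has_vector_derivative f x) (at x within A)" for x A
  proof -
    have 1: "((\<lambda>x. cis (- (\<xi> * x))) has_vector_derivative (- \<xi>) *\<^sub>R (\<i> * cis (- (\<xi> * x)))) (at x within A)"
    proof -
      have "((\<lambda>z. exp (- (\<i> * \<xi> * z))) has_field_derivative - (\<i> * \<xi>) * exp (- (\<i> * \<xi> * of_real x))) (at (of_real x))"
        by (auto intro!: derivative_eq_intros)
      from has_vector_derivative_real_field[OF this, of A]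
      show ?thesis by (simp add: cis_conv_exp scaleR_conv_of_real mult_ac)
    qed
    have 2: "((\<lambda>x. complex_of_real (\<phi> x)) has_vector_derivative complex_of_real (deriv \<phi> x)) (at x within A)"
      using smooth_has_deriv[OF sm, of x] by (intro has_vector_derivative_of_real has_vector_derivative_at_within)
        (simp add: has_real_derivative_iff_has_vector_derivative)
    show ?thesis unfolding F_def
      by (rule has_vector_derivative_eq_rhs[OF has_vector_derivative_mult[OF 1 2]])
         (simp add: f_def scaleR_conv_of_real algebra_simps)
  qed
  have c: "continuous_on A f" for A
    unfolding f_def by (intro continuous_intros smooth_continuous sm smooth_deriv)
  have "(LINT x|lborel. indicator {-S..S} x *\<^sub>R f x) = F S - F (- S)"
    by (rule integral_FTC_Icc) (use d c S in auto)
  moreover have "indicator {-S..S} x *\<^sub>R f x = f x" for x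
    using S(2,3)[of x] by (cases "\<bar>x\<bar> \<ge> S") (auto simp: f_def indicator_def)
  ultimately have "(LINT x|lborel. f x) = 0" using S by (simp add: F_def)
  then show ?thesis unfolding f_def fourier_def
    by (subst (asm) Bochner_Integration.integral_diff)
       (auto intro!: integrable_fourier integrable_test_function[OF assms]
         integrable_test_function[OF test_functions_deriv[OF assms]] simp: mult.assoc)
qed

lemma test_functions_add_scaled:
  assumes "\<phi> \<in> test_functions I" "\<psi> \<in> test_functions I"
  shows "(\<lambda>x. \<phi> x + c * \<psi> x) \<in> test_functions I"
proof -
  have a: "smooth \<phi>" "compact (supp \<phi>)" "supp \<phi> \<subseteq> I" and b: "smooth \<psi>" "compact (supp \<psi>)" "supp \<psi> \<subseteq> I"
    using assms unfolding test_functions_iff by auto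
  have "supp (\<lambda>x. \<phi> x + c * \<psi> x) \<subseteq> supp \<phi> \<union> supp \<psi>"
  proof (rule supp_subset)
    fix x assume "x \<notin> supp \<phi> \<union> supp \<psi>"
    then show "\<phi> x + c * \<psi> x = 0" using not_in_supp[of x \<phi>] not_in_supp[of x \<psi>] by simp
  qed (auto simp: supp_def)
  moreover from this have "compact (supp (\<lambda>x. \<phi> x + c * \<psi> x))"
    using bounded_subset[OF compact_imp_bounded[OF compact_Un[OF a(2) b(2)]]]
    unfolding compact_eq_bounded_closed by (simp add: supp_def)
  moreover have "smooth (\<lambda>x. \<phi> x + c * \<psi> x)"
    using smooth_add[OF a(1) smooth_affine[OF b(1), of c 1 0]] by simp
  ultimately show ?thesis using a(3) b(3) unfolding test_functions_iff by blast
qed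

text \<open>
  The operator \<open>1 - d\<^sup>2/dx\<^sup>2\<close> multiplies the transform by \<open>1 + \<xi>\<^sup>2\<close>; iterating it gives every power.
\<close>
lemma fourier_decay:
  assumes "\<phi> \<in> test_functions I"
  shows "\<exists>C\<ge>0. \<forall>\<xi>. (1 + \<xi>\<^sup>2) ^ N * cmod (fourier \<phi> \<xi>) \<le> C"
  using assms
proof (induction N arbitrary: \<phi>)
  case 0
  then show ?case
    by (intro exI[of _ "LINT x|lborel. \<bar>\<phi> x\<bar>"]) (auto intro!: norm_fourier_le integrable_test_function integral_nonneg_AE)
next
  case (Suc N)
  note t = Suc.prems test_functions_deriv[OF Suc.prems] test_functions_deriv[OF test_functions_deriv[OF Suc.prems]]
  \<comment> \<open>The test function whose transform is \<open>(1 + \<xi>\<^sup>2)\<close> times that of \<open>\<phi>\<close>.\<close>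
  define \<psi> where "\<psi> = (\<lambda>x. \<phi> x + (-1) * deriv (deriv \<phi>) x)"
  have \<psi>: "\<psi> \<in> test_functions I" unfolding \<psi>_def by (rule test_functions_add_scaled[OF t(1,3)])
  have "fourier \<psi> \<xi> = fourier \<phi> \<xi> - fourier (deriv (deriv \<phi>)) \<xi>" for \<xi>
    unfolding fourier_def \<psi>_def
    using Bochner_Integration.integral_diff[OF integrable_fourier[OF integrable_test_function[OF t(1)]]
        integrable_fourier[OF integrable_test_function[OF t(3)]], of \<xi> \<xi>]
    by (simp add: algebra_simps)
  then have "fourier \<psi> \<xi> = complex_of_real (1 + \<xi>\<^sup>2) * fourier \<phi> \<xi>" for \<xi>
    unfolding fourier_deriv[OF t(2)] fourier_deriv[OF t(1)]
    by (simp add: algebra_simps power2_eq_square)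
  then have "cmod (fourier \<psi> \<xi>) = (1 + \<xi>\<^sup>2) * cmod (fourier \<phi> \<xi>)" for \<xi>
    by (simp add: norm_mult del: of_real_add)
  then show ?case using Suc.IH[OF \<psi>] by (simp add: mult_ac)
qed

text \<open>
  The inverse Fourier transform. It is applied to transforms of extensions, whose synthesis is the
  continuous representative of a distribution of positive Sobolev order.
\<close>
definition fourier_synthesis :: "(real \<Rightarrow> complex) \<Rightarrow> real \<Rightarrow> complex" where
  "fourier_synthesis g x = (LINT \<xi>|lborel. g \<xi> * cis (\<xi> * x)) / (2 * pi)"

lemma integrable_mult_cis:
  fixes g :: "real \<Rightarrow> complex"
  assumes "integrable lborel g" shows "integrable lborel (\<lambda>\<xi>. g \<xi> * cis (\<xi> * x))"
proof (rule Bochner_Integration.integrable_bound[OF assms])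
  have [measurable]: "g \<in> borel_measurable lborel" using assms by simp
  show "(\<lambda>\<xi>. g \<xi> * cis (\<xi> * x)) \<in> borel_measurable lborel"
    using borel_measurable_cis_scaled[of x] by (simp add: mult.commute)
qed (simp add: norm_mult)

lemma norm_fourier_synthesis_le:
  assumes "integrable lborel g"
  shows "cmod (fourier_synthesis g x) \<le> (LINT \<xi>|lborel. cmod (g \<xi>)) / (2 * pi)"
  unfolding fourier_synthesis_def norm_divide
  using integral_norm_bound[of lborel "\<lambda>\<xi>. g \<xi> * cis (\<xi> * x)"]
  by (simp add: norm_mult divide_right_mono)

lemma continuous_fourier_synthesis:
  assumes "integrable lborel g" shows "continuous_on S (fourier_synthesis g)"
proof -
  have m: "g \<in> borel_measurable borel" using assms by simp
  have "isCont (fourier_synthesis g) x" for x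
    unfolding fourier_synthesis_def continuous_at_sequentially comp_def
  proof (intro allI impI tendsto_divide tendsto_const)
    fix X assume X: "X \<longlonglongrightarrow> x"
    show "(\<lambda>n. LINT \<xi>|lborel. g \<xi> * cis (\<xi> * X n)) \<longlonglongrightarrow> (LINT \<xi>|lborel. g \<xi> * cis (\<xi> * x))"
    proof (rule integral_dominated_convergence[where w = "\<lambda>\<xi>. cmod (g \<xi>)"])
      show "AE \<xi> in lborel. (\<lambda>i. g \<xi> * cis (\<xi> * X i)) \<longlonglongrightarrow> g \<xi> * cis (\<xi> * x)"
        by (intro AE_I2 isCont_tendsto_compose[OF _ X]) (auto simp: cis_conv_exp intro!: continuous_intros)
    qed (use assms borel_measurable_integrable[OF integrable_mult_cis[OF assms]] in \<open>auto simp: norm_mult\<close>)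
  qed simp
  then show ?thesis by (simp add: continuous_at_imp_continuous_on)
qed

lemma borel_measurable_mult_cis:
  fixes g :: "real \<Rightarrow> complex"
  assumes "g \<in> borel_measurable borel"
  shows "(\<lambda>\<xi>. g \<xi> * cis (\<xi> * x)) \<in> borel_measurable borel"
  using assms borel_measurable_cis_scaled[of x] by (simp add: mult.commute)

lemma cmod_cis_diff_le: "cmod (cis b - cis a) \<le> \<bar>b - a\<bar>"
proof -
  have "cis b - cis a = cis a * (iexp (b - a) - 1)"
    by (simp add: cis_conv_exp exp_diff right_diff_distrib exp_minus field_simps)
  then have "cmod (cis b - cis a) = cmod (iexp (b - a) - 1)"
    by (simp add: norm_mult)
  also have "\<dots> \<le> \<bar>b - a\<bar>" using iexp_approx1[of "b - a" 0] by simp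
  finally show ?thesis .
qed

text \<open>
  Dominated convergence for the difference quotients, with majorant \<open>|\<xi>| |g|\<close>.
\<close>
lemma fourier_synthesis_has_derivative:
  assumes g: "integrable lborel g" and g': "integrable lborel (\<lambda>\<xi>. \<xi> * cmod (g \<xi>))"
  shows "((\<lambda>x. Re (fourier_synthesis g x)) has_real_derivative
           Re (fourier_synthesis (\<lambda>\<xi>. \<i> * \<xi> * g \<xi>) x)) (at x)"
proof -
  have m: "g \<in> borel_measurable borel" using g by simp
  have gd: "integrable lborel (\<lambda>\<xi>. \<i> * complex_of_real \<xi> * g \<xi>)"
    by (rule Bochner_Integration.integrable_bound[OF g']) (use m in \<open>auto simp: norm_mult abs_mult\<close>)
  have "((\<lambda>h. (fourier_synthesis g (x + h) - fourier_synthesis g x) / h) \<longlongrightarrow>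
      fourier_synthesis (\<lambda>\<xi>. \<i> * \<xi> * g \<xi>) x) (at 0)"
    unfolding tendsto_at_iff_sequentially comp_def
  proof (intro allI impI)
    fix X :: "nat \<Rightarrow> real" assume X: "\<forall>i. X i \<in> UNIV - {0}" "X \<longlonglongrightarrow> 0"
    have e: "(fourier_synthesis g (x + h) - fourier_synthesis g x) / h
        = (LINT \<xi>|lborel. g \<xi> * (cis (\<xi> * (x + h)) - cis (\<xi> * x)) / h) / (2 * pi)" for h :: real
      unfolding fourier_synthesis_def right_diff_distrib
      by (subst integral_divide_zero) (simp add: Bochner_Integration.integral_diff[OF integrable_mult_cis[OF g] integrable_mult_cis[OF g]] diff_divide_distrib mult.commute)
    show "(\<lambda>n. (fourier_synthesis g (x + X n) - fourier_synthesis g x) / complex_of_real (X n))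
        \<longlonglongrightarrow> fourier_synthesis (\<lambda>\<xi>. \<i> * \<xi> * g \<xi>) x"
      unfolding e unfolding fourier_synthesis_def
    proof (intro tendsto_divide tendsto_const)
      show "(\<lambda>n. LINT \<xi>|lborel. g \<xi> * (cis (\<xi> * (x + X n)) - cis (\<xi> * x)) / X n)
          \<longlonglongrightarrow> (LINT \<xi>|lborel. \<i> * \<xi> * g \<xi> * cis (\<xi> * x))"
      proof (rule integral_dominated_convergence[where w = "\<lambda>\<xi>. \<bar>\<xi> * cmod (g \<xi>)\<bar>"])
        show "AE \<xi> in lborel. (\<lambda>n. g \<xi> * (cis (\<xi> * (x + X n)) - cis (\<xi> * x)) / X n)
            \<longlonglongrightarrow> \<i> * \<xi> * g \<xi> * cis (\<xi> * x)"
        proof (rule AE_I2)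
          fix \<xi> :: real
          have "((\<lambda>z. exp (\<i> * \<xi> * z)) has_field_derivative \<i> * \<xi> * exp (\<i> * \<xi> * of_real x)) (at (of_real x))"
            by (auto intro!: derivative_eq_intros)
          then have "((\<lambda>h. (exp (\<i> * \<xi> * (of_real x + h)) - exp (\<i> * \<xi> * of_real x)) / h) \<longlongrightarrow> \<i> * \<xi> * exp (\<i> * \<xi> * of_real x)) (at 0)"
            unfolding DERIV_def .
          moreover have "filterlim (\<lambda>n. complex_of_real (X n)) (at 0) sequentially"
            using X by (auto simp: filterlim_at intro!: tendsto_of_real_iff[THEN iffD2, of X 0, simplified])
          ultimately have "(\<lambda>n. (exp (\<i> * \<xi> * (of_real x + of_real (X n))) - exp (\<i> * \<xi> * of_real x)) / of_real (X n))
              \<longlonglongrightarrow> \<i> * \<xi> * exp (\<i> * \<xi> * of_real x)"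
            by (rule filterlim_compose)
          from tendsto_mult_left[OF this, of "g \<xi>"]
          show "(\<lambda>n. g \<xi> * (cis (\<xi> * (x + X n)) - cis (\<xi> * x)) / X n) \<longlonglongrightarrow> \<i> * \<xi> * g \<xi> * cis (\<xi> * x)"
            by (simp add: cis_conv_exp algebra_simps)
        qed
        show "AE \<xi> in lborel. cmod (g \<xi> * (cis (\<xi> * (x + X n)) - cis (\<xi> * x)) / X n) \<le> \<bar>\<xi> * cmod (g \<xi>)\<bar>" for n
        proof (rule AE_I2)
          fix \<xi> :: real
          define d where "d = cis (\<xi> * (x + X n)) - cis (\<xi> * x)"
          have "cmod d \<le> \<bar>\<xi>\<bar> * \<bar>X n\<bar>"
            using cmod_cis_diff_le[of "\<xi> * (x + X n)" "\<xi> * x"] by (simp add: d_def algebra_simps abs_mult)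
          then have "cmod (g \<xi>) * cmod d \<le> cmod (g \<xi>) * (\<bar>\<xi>\<bar> * \<bar>X n\<bar>)"
            by (rule mult_left_mono) simp
          then have "cmod (g \<xi> * d / X n) \<le> \<bar>\<xi> * cmod (g \<xi>)\<bar>"
            using X(1) by (simp add: norm_mult norm_divide abs_mult field_simps)
          then show "cmod (g \<xi> * (cis (\<xi> * (x + X n)) - cis (\<xi> * x)) / X n) \<le> \<bar>\<xi> * cmod (g \<xi>)\<bar>"
            by (simp add: d_def)
        qed
        show "(\<lambda>\<xi>. g \<xi> * (cis (\<xi> * (x + X n)) - cis (\<xi> * x)) / X n) \<in> borel_measurable lborel" for n
          using borel_measurable_mult_cis[OF m, of "x + X n"] borel_measurable_mult_cis[OF m, of x]
          by (simp add: right_diff_distrib)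
        show "(\<lambda>\<xi>. \<i> * \<xi> * g \<xi> * cis (\<xi> * x)) \<in> borel_measurable lborel"
          using borel_measurable_mult_cis[of "\<lambda>\<xi>. \<i> * \<xi> * g \<xi>" x] gd by simp
        show "integrable lborel (\<lambda>\<xi>. \<bar>\<xi> * cmod (g \<xi>)\<bar>)" using g' by simp
      qed
    qed simp
  qed
  from tendsto_Re[OF this] show ?thesis unfolding DERIV_def by simp
qed

text \<open>
  Fubini's theorem: the pairing by Parseval's formula, in which Sobolev distributions are given, is
  integration against the synthesis.
\<close>
lemma fourier_pairing:
  assumes g: "integrable lborel g" and \<phi>i: "integrable lborel \<phi>"
  shows "(LINT \<xi>|lborel. g \<xi> * fourier \<phi> (- \<xi>)) / (2 * pi)
       = (LINT x|lborel. complex_of_real (\<phi> x) * fourier_synthesis g x)"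
proof -
  have m: "g \<in> borel_measurable borel" using g by simp
  have m\<phi>: "\<phi> \<in> borel_measurable borel" using \<phi>i by simp
  let ?f = "\<lambda>\<xi> x. g \<xi> * (cis (\<xi> * x) * complex_of_real (\<phi> x))"
  have c: "(\<lambda>(\<xi>, x). cis (\<xi> * x)) \<in> borel_measurable (borel :: (real \<times> real) measure)"
    by (intro borel_measurable_continuous_onI) (auto simp: case_prod_beta intro!: continuous_intros)
  have int: "integrable (lborel \<Otimes>\<^sub>M lborel) (case_prod ?f)"
  proof (rule lborel_pair.Fubini_integrable)
    have "(\<lambda>p. g (fst p) * ((\<lambda>(\<xi>, x). cis (\<xi> * x)) p * complex_of_real (\<phi> (snd p))))
       \<in> borel_measurable (borel \<Otimes>\<^sub>M borel)"
      using c m m\<phi> unfolding borel_prod[symmetric] by measurable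
    then show "case_prod ?f \<in> borel_measurable (lborel \<Otimes>\<^sub>M lborel)"
      by (simp add: case_prod_beta cong: measurable_cong_sets)
    show "integrable lborel (\<lambda>\<xi>. LINT y|lborel. norm (case (\<xi>, y) of (\<xi>, x) \<Rightarrow> ?f \<xi> x))"
      using g by (simp add: norm_mult)
    show "AE \<xi> in lborel. integrable lborel (\<lambda>y. case (\<xi>, y) of (\<xi>, x) \<Rightarrow> ?f \<xi> x)"
      using integrable_fourier[OF \<phi>i, of "- _"] by (intro AE_I2) simp
  qed
  have "(LINT \<xi>|lborel. g \<xi> * fourier \<phi> (- \<xi>)) = (LINT \<xi>|lborel. LINT x|lborel. ?f \<xi> x)"
    by (simp add: fourier_def)
  also have "\<dots> = (LINT x|lborel. LINT \<xi>|lborel. ?f \<xi> x)"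
    by (rule lborel_pair.Fubini_integral[OF int, symmetric])
  also have "\<dots> = (LINT x|lborel. complex_of_real (2 * pi) * (complex_of_real (\<phi> x) * fourier_synthesis g x))"
    by (intro Bochner_Integration.integral_cong refl)
       (simp add: fourier_synthesis_def mult.assoc[symmetric])
  also have "\<dots> = 2 * pi * (LINT x|lborel. complex_of_real (\<phi> x) * fourier_synthesis g x)"
    by simp
  finally show ?thesis by simp
qed

section \<open>Weighted norms and duality\<close>

lemma integrable_inverse_one_plus_square: "integrable lborel (\<lambda>\<xi>::real. 1 / (1 + \<xi>\<^sup>2))"
proof -
  have "set_integrable lborel (einterval (-\<infinity>) \<infinity>) (\<lambda>x. inverse (1 + x\<^sup>2))"
    by (rule Sinc_Integral.integrable_inverse_1_plus_square)
  then show ?thesis by (simp add: set_integrable_def divide_inverse)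
qed

lemma measurable_fourier [measurable]:
  assumes "\<phi> \<in> test_functions I" shows "fourier \<phi> \<in> borel_measurable borel"
proof -
  have "integrable lborel \<phi>" by (rule integrable_test_function[OF assms])
  then have c: "integrable lborel (\<lambda>x. complex_of_real (\<phi> x))" by simp
  have "fourier \<phi> = (\<lambda>\<xi>. 2 * pi * fourier_synthesis (\<lambda>x. complex_of_real (\<phi> x)) (- \<xi>))"
    by (simp add: fourier_def fourier_synthesis_def mult.commute fun_eq_iff)
  moreover have "continuous_on UNIV (\<lambda>\<xi>. 2 * pi * fourier_synthesis (\<lambda>x. complex_of_real (\<phi> x)) (- \<xi>))"
    by (intro continuous_intros continuous_on_compose2[OF continuous_fourier_synthesis[OF c, of UNIV]]) auto
  ultimately show ?thesis
    by (simp add: borel_measurable_continuous_onI)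
qed

lemma one_plus_square_ge_1: "1 + \<xi>\<^sup>2 \<ge> (1::real)" by simp

lemma integrable_fourier_weighted:
  assumes "\<phi> \<in> test_functions I"
  shows "integrable lborel (\<lambda>\<xi>. (1 + \<xi>\<^sup>2) powr r * (cmod (fourier \<phi> \<xi>))\<^sup>2)"
proof -
  \<comment> \<open>One power more than the weight leaves the integrable factor \<open>1 / (1 + \<xi>\<^sup>2)\<close>.\<close>
  obtain N :: nat where N: "real N \<ge> r + 1" using real_arch_simple by blast
  obtain C where C: "C \<ge> 0" "\<And>\<xi>. (1 + \<xi>\<^sup>2) ^ N * cmod (fourier \<phi> \<xi>) \<le> C"
    using fourier_decay[OF assms] by blast
  show ?thesis
  proof (rule Bochner_Integration.integrable_bound)
    show "integrable lborel (\<lambda>\<xi>. C\<^sup>2 * (1 / (1 + \<xi>\<^sup>2)))"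
      by (intro integrable_mult_right integrable_inverse_one_plus_square)
    show "(\<lambda>\<xi>. (1 + \<xi>\<^sup>2) powr r * (cmod (fourier \<phi> \<xi>))\<^sup>2) \<in> borel_measurable lborel"
      using measurable_fourier[OF assms] by simp
    show "AE \<xi> in lborel. norm ((1 + \<xi>\<^sup>2) powr r * (cmod (fourier \<phi> \<xi>))\<^sup>2) \<le> norm (C\<^sup>2 * (1 / (1 + \<xi>\<^sup>2)))"
    proof (rule AE_I2)
      fix \<xi> :: real
      define q where "q = 1 + \<xi>\<^sup>2"
      have q: "q \<ge> 1" by (simp add: q_def)
      define F where "F = cmod (fourier \<phi> \<xi>)"
      have F: "0 \<le> F" "q ^ N * F \<le> C" using C(2) by (auto simp: F_def q_def)
      have "q powr r * F\<^sup>2 * q \<le> q powr real N * q powr real N * F\<^sup>2"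
      proof -
        have "q powr r * q = q powr (r + 1)" using q by (simp add: powr_add)
        also have "\<dots> \<le> q powr real N" using q N by (intro powr_mono) auto
        also have "\<dots> \<le> q powr real N * q powr real N" using q by (simp add: ge_one_powr_ge_zero)
        finally show ?thesis using mult_right_mono[of "q powr r * q" "q powr real N * q powr real N" "F\<^sup>2"]
          by (simp add: mult_ac)
      qed
      also have "\<dots> = (q ^ N * F)\<^sup>2" using q by (simp add: powr_realpow power2_eq_square mult_ac)
      also have "\<dots> \<le> C\<^sup>2" using F q by (intro power_mono) auto
      finally show "norm ((1 + \<xi>\<^sup>2) powr r * (cmod (fourier \<phi> \<xi>))\<^sup>2) \<le> norm (C\<^sup>2 * (1 / (1 + \<xi>\<^sup>2)))"
        using q unfolding q_def[symmetric] F_def[symmetric] by (simp add: field_simps)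
    qed
  qed
qed

lemma integrable_fourier_test:
  assumes "\<phi> \<in> test_functions I"
  shows "integrable lborel (\<lambda>\<xi>. (1 + \<xi>\<^sup>2) ^ N * cmod (fourier \<phi> \<xi>))"
proof -
  obtain C where C: "C \<ge> 0" "\<And>\<xi>. (1 + \<xi>\<^sup>2) ^ Suc N * cmod (fourier \<phi> \<xi>) \<le> C"
    using fourier_decay[OF assms] by blast
  show ?thesis
  proof (rule Bochner_Integration.integrable_bound)
    show "integrable lborel (\<lambda>\<xi>. C * (1 / (1 + \<xi>\<^sup>2)))"
      by (intro integrable_mult_right integrable_inverse_one_plus_square)
    show "(\<lambda>\<xi>. (1 + \<xi>\<^sup>2) ^ N * cmod (fourier \<phi> \<xi>)) \<in> borel_measurable lborel"
      using measurable_fourier[OF assms] by simp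
    show "AE \<xi> in lborel. norm ((1 + \<xi>\<^sup>2) ^ N * cmod (fourier \<phi> \<xi>)) \<le> norm (C * (1 / (1 + \<xi>\<^sup>2)))"
    proof (rule AE_I2)
      fix \<xi> :: real
      have "1 + \<xi>\<^sup>2 > 0" using one_plus_square_ge_1[of \<xi>] by linarith
      then show "norm ((1 + \<xi>\<^sup>2) ^ N * cmod (fourier \<phi> \<xi>)) \<le> norm (C * (1 / (1 + \<xi>\<^sup>2)))"
        using C(2)[of \<xi>] C(1) by (simp add: field_simps)
    qed
  qed
qed

text \<open>
  The quadratic form \<open>(s, t) \<mapsto> \<integral> (s f + t g)\<^sup>2\<close> is nonnegative.
\<close>
lemma Cauchy_Schwarz_integral:
  fixes f g :: "real \<Rightarrow> real"
  assumes f: "f \<in> borel_measurable lborel" and g: "g \<in> borel_measurable lborel"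
    and f2: "integrable lborel (\<lambda>x. (f x)\<^sup>2)" and g2: "integrable lborel (\<lambda>x. (g x)\<^sup>2)"
  shows "integrable lborel (\<lambda>x. f x * g x)"
    and "\<bar>LINT x|lborel. f x * g x\<bar> \<le> sqrt (LINT x|lborel. (f x)\<^sup>2) * sqrt (LINT x|lborel. (g x)\<^sup>2)"
proof -
  show i: "integrable lborel (\<lambda>x. f x * g x)"
  proof (rule Bochner_Integration.integrable_bound[of _ "\<lambda>x. (f x)\<^sup>2 + (g x)\<^sup>2"])
    show "AE x in lborel. norm (f x * g x) \<le> norm ((f x)\<^sup>2 + (g x)\<^sup>2)"
    proof (rule AE_I2)
      fix x
      have "0 \<le> (\<bar>f x\<bar> - \<bar>g x\<bar>)\<^sup>2" by simp
      then have "2 * (\<bar>f x\<bar> * \<bar>g x\<bar>) \<le> (f x)\<^sup>2 + (g x)\<^sup>2" by (simp add: power2_diff)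
      moreover have "0 \<le> \<bar>f x\<bar> * \<bar>g x\<bar>" by simp
      ultimately have "\<bar>f x\<bar> * \<bar>g x\<bar> \<le> (f x)\<^sup>2 + (g x)\<^sup>2" by linarith
      then show "norm (f x * g x) \<le> norm ((f x)\<^sup>2 + (g x)\<^sup>2)" by (simp add: abs_mult)
    qed
  qed (use f g f2 g2 in auto)
  define A B D where "A = (LINT x|lborel. (f x)\<^sup>2)" and "B = (LINT x|lborel. (g x)\<^sup>2)"
    and "D = (LINT x|lborel. f x * g x)"
  have AB: "A \<ge> 0" "B \<ge> 0" by (auto simp: A_def B_def)
  have q: "0 \<le> A * s\<^sup>2 + 2 * s * t * D + B * t\<^sup>2" for s t
  proof -
    have "0 \<le> (LINT x|lborel. (s * f x + t * g x)\<^sup>2)" by simp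
    also have "\<dots> = (LINT x|lborel. s\<^sup>2 * (f x)\<^sup>2 + 2 * s * t * (f x * g x) + t\<^sup>2 * (g x)\<^sup>2)"
      by (intro Bochner_Integration.integral_cong) (auto simp: power2_eq_square algebra_simps)
    also have "\<dots> = s\<^sup>2 * A + 2 * s * t * D + t\<^sup>2 * B"
      using i f2 g2 by (simp add: A_def B_def D_def)
    finally show ?thesis by (simp add: mult_ac)
  qed
  have "D\<^sup>2 \<le> A * B"
  proof (cases "B = 0")
    case False
    then have "0 \<le> B * (A * B - D\<^sup>2)" using q[of B "- D"] by (simp add: power2_eq_square algebra_simps)
    then show ?thesis using False AB by (simp add: zero_le_mult_iff)
  next
    case True
    have "D = 0"
    proof (rule ccontr)
      assume "D \<noteq> 0"
      then show False using q[of 1 "- (A + 1) / (2 * D)"] True AB by (simp add: field_simps)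
    qed
    then show ?thesis using True by simp
  qed
  then have "sqrt (D\<^sup>2) \<le> sqrt (A * B)" by (rule real_sqrt_le_mono)
  then show "\<bar>LINT x|lborel. f x * g x\<bar> \<le> sqrt (LINT x|lborel. (f x)\<^sup>2) * sqrt (LINT x|lborel. (g x)\<^sup>2)"
    by (simp add: A_def B_def D_def real_sqrt_mult)
qed

text \<open>
  The Sobolev norm is the infimum of this quantity over all extensions.
\<close>
definition weighted_norm :: "real \<Rightarrow> (real \<Rightarrow> complex) \<Rightarrow> real" where
  "weighted_norm r g = sqrt ((LINT \<xi>|lborel. (1 + \<xi>\<^sup>2) powr r * (cmod (g \<xi>))\<^sup>2) / (2 * pi))"

lemma weighted_norm_nonneg: "weighted_norm r g \<ge> 0"
  unfolding weighted_norm_def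
  by (intro real_sqrt_ge_zero divide_nonneg_nonneg integral_nonneg_AE) auto

text \<open>
  Cauchy-Schwarz after splitting the weight evenly. With \<open>h\<close> the modulus of the transform of a test
  function it bounds the pairing of distributions; with \<open>h = |\<xi>|^k\<close> it is the Sobolev embedding.
\<close>
lemma weighted_duality:
  assumes g: "g \<in> borel_measurable borel" "integrable lborel (\<lambda>\<xi>. (1 + \<xi>\<^sup>2) powr r * (cmod (g \<xi>))\<^sup>2)"
    and h: "h \<in> borel_measurable borel" "integrable lborel (\<lambda>\<xi>. (1 + \<xi>\<^sup>2) powr (- r) * (h \<xi>)\<^sup>2)"
    and h0: "\<And>\<xi>. h \<xi> \<ge> 0"
  shows "integrable lborel (\<lambda>\<xi>. cmod (g \<xi>) * h \<xi>)"
    and "(LINT \<xi>|lborel. cmod (g \<xi>) * h \<xi>) / (2 * pi)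
       \<le> sqrt ((LINT \<xi>|lborel. (1 + \<xi>\<^sup>2) powr (- r) * (h \<xi>)\<^sup>2) / (2 * pi)) * weighted_norm r g"
proof -
  define p q where "p \<xi> = (1 + \<xi>\<^sup>2) powr (r / 2) * cmod (g \<xi>)"
    and "q \<xi> = (1 + \<xi>\<^sup>2) powr (- r / 2) * h \<xi>" for \<xi> :: real
  have m: "p \<in> borel_measurable lborel" "q \<in> borel_measurable lborel"
    using g(1) h(1) unfolding p_def[abs_def] q_def[abs_def] by simp_all
  have ne: "1 + \<xi>\<^sup>2 \<noteq> 0" "1 + \<xi>\<^sup>2 > 0" for \<xi> :: real using one_plus_square_ge_1[of \<xi>] by linarith+
  have p2: "(p \<xi>)\<^sup>2 = (1 + \<xi>\<^sup>2) powr r * (cmod (g \<xi>))\<^sup>2" for \<xi>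
    by (simp add: p_def power_mult_distrib power2_eq_square powr_add[symmetric])
  have q2: "(q \<xi>)\<^sup>2 = (1 + \<xi>\<^sup>2) powr (- r) * (h \<xi>)\<^sup>2" for \<xi>
    by (simp add: q_def power_mult_distrib power2_eq_square powr_add[symmetric])
  have pq: "p \<xi> * q \<xi> = cmod (g \<xi>) * h \<xi>" for \<xi>
  proof -
    have "(1 + \<xi>\<^sup>2) powr (r / 2) * (1 + \<xi>\<^sup>2) powr (- r / 2) = 1"
      using ne[of \<xi>] by (simp add: powr_add[symmetric])
    then show ?thesis unfolding p_def q_def by (metis (no_types, lifting) mult.assoc mult.commute mult.left_neutral)
  qed
  note CS = Cauchy_Schwarz_integral[OF m, unfolded p2 q2 pq, OF g(2) h(2)]
  show "integrable lborel (\<lambda>\<xi>. cmod (g \<xi>) * h \<xi>)" by (rule CS(1))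
  have "(LINT \<xi>|lborel. cmod (g \<xi>) * h \<xi>) / (2 * pi) \<le>
     sqrt (LINT \<xi>|lborel. (1 + \<xi>\<^sup>2) powr r * (cmod (g \<xi>))\<^sup>2) * sqrt (LINT \<xi>|lborel. (1 + \<xi>\<^sup>2) powr (- r) * (h \<xi>)\<^sup>2) / (2 * pi)"
    using CS(2) by (intro divide_right_mono) auto
  also have "\<dots> = sqrt ((LINT \<xi>|lborel. (1 + \<xi>\<^sup>2) powr (- r) * (h \<xi>)\<^sup>2) / (2 * pi)) * weighted_norm r g"
    by (simp add: weighted_norm_def real_sqrt_divide)
  finally show "(LINT \<xi>|lborel. cmod (g \<xi>) * h \<xi>) / (2 * pi)
       \<le> sqrt ((LINT \<xi>|lborel. (1 + \<xi>\<^sup>2) powr (- r) * (h \<xi>)\<^sup>2) / (2 * pi)) * weighted_norm r g" .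
qed

section \<open>Sobolev spaces and embedding\<close>

lemma fourier_minus: "fourier \<phi> (- \<xi>) = cnj (fourier \<phi> \<xi>)"
proof -
  have "fourier \<phi> (- \<xi>) = (LINT x|lborel. cnj (cis (- (\<xi> * x)) * complex_of_real (\<phi> x)))"
    by (simp add: fourier_def cis_cnj)
  then show ?thesis unfolding fourier_def by (simp only: Bochner_Integration.integral_cnj)
qed

lemma borel_measurable_cnj [measurable]: "cnj \<in> borel_measurable borel"
  by (intro borel_measurable_continuous_onI continuous_intros)

lemma cmod_fourier_minus: "cmod (fourier \<phi> (- \<xi>)) = cmod (fourier \<phi> \<xi>)"
  by (simp add: fourier_minus)

lemma sobolev_norm_alt: "sobolev_norm r I u = (INF g \<in> {g. sobolev_extension r I u g}. weighted_norm r g)"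
  by (simp add: sobolev_norm_def weighted_norm_def)

lemma sobolev_norm_le:
  assumes "sobolev_extension r I u g" shows "sobolev_norm r I u \<le> weighted_norm r g"
  unfolding sobolev_norm_alt
  by (rule cINF_lower) (use assms weighted_norm_nonneg in \<open>auto intro!: bdd_belowI[of _ 0]\<close>)

text \<open>
  Estimates by the quotient norm are proved for one extension at a time.
\<close>
lemma le_sobolev_norm:
  assumes "u \<in> sobolev r I" "K \<ge> 0" "\<And>g. sobolev_extension r I u g \<Longrightarrow> c \<le> K * weighted_norm r g"
  shows "c \<le> K * sobolev_norm r I u"
proof -
  obtain g0 where g0: "sobolev_extension r I u g0" using assms(1) unfolding sobolev_def by blast
  show ?thesis
  proof (cases "K = 0")
    case True
    then show ?thesis using assms(3)[OF g0] by simp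
  next
    case False
    then have K: "K > 0" using assms(2) by simp
    have "c / K \<le> sobolev_norm r I u"
      unfolding sobolev_norm_alt
      by (rule cINF_greatest) (use g0 assms(3) K in \<open>auto simp: field_simps\<close>)
    then show ?thesis using K by (simp add: field_simps)
  qed
qed

lemma sobolev_norm_nonneg: "u \<in> sobolev r I \<Longrightarrow> sobolev_norm r I u \<ge> 0"
  using le_sobolev_norm[of u r I 1 0] weighted_norm_nonneg by simp

lemma weighted_duality_test:
  assumes g: "g \<in> borel_measurable borel" "integrable lborel (\<lambda>\<xi>. (1 + \<xi>\<^sup>2) powr r * (cmod (g \<xi>))\<^sup>2)"
    and \<phi>: "\<phi> \<in> test_functions I"
  shows "integrable lborel (\<lambda>\<xi>. g \<xi> * fourier \<phi> (- \<xi>))"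
    and "cmod ((LINT \<xi>|lborel. g \<xi> * fourier \<phi> (- \<xi>)) / (2 * pi)) \<le> weighted_norm (- r) (fourier \<phi>) * weighted_norm r g"
proof -
  have m: "(\<lambda>\<xi>. cmod (fourier \<phi> \<xi>)) \<in> borel_measurable borel" using measurable_fourier[OF \<phi>] by simp
  note D = weighted_duality[OF g m integrable_fourier_weighted[OF \<phi>, of "- r"] norm_ge_zero]
  have "(\<lambda>\<xi>. cnj (fourier \<phi> \<xi>)) \<in> borel_measurable borel"
    by (rule measurable_compose[OF measurable_fourier[OF \<phi>] borel_measurable_cnj])
  then have "(\<lambda>\<xi>. g \<xi> * cnj (fourier \<phi> \<xi>)) \<in> borel_measurable lborel"
    using g(1) by simp
  then show "integrable lborel (\<lambda>\<xi>. g \<xi> * fourier \<phi> (- \<xi>))"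
    by (intro Bochner_Integration.integrable_bound[OF D(1)]) (auto simp: fourier_minus norm_mult)
  have "cmod ((LINT \<xi>|lborel. g \<xi> * fourier \<phi> (- \<xi>)) / (2 * pi)) \<le> (LINT \<xi>|lborel. cmod (g \<xi>) * cmod (fourier \<phi> \<xi>)) / (2 * pi)"
    unfolding norm_divide using integral_norm_bound[of lborel "\<lambda>\<xi>. g \<xi> * fourier \<phi> (- \<xi>)"]
    by (simp add: norm_mult cmod_fourier_minus divide_right_mono)
  also have "\<dots> \<le> weighted_norm (- r) (fourier \<phi>) * weighted_norm r g"
    using D(2) by (simp add: weighted_norm_def)
  finally show "cmod ((LINT \<xi>|lborel. g \<xi> * fourier \<phi> (- \<xi>)) / (2 * pi)) \<le> weighted_norm (- r) (fourier \<phi>) * weighted_norm r g" .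
qed

text \<open>
  This holds for every real order, since test functions have finite weighted norms of all orders. It
  is how the noise is measured, and also how convergence in norm yields convergence on each test
  function.
\<close>
lemma sobolev_pairing_bound:
  assumes u: "u \<in> sobolev r I" and \<phi>: "\<phi> \<in> test_functions I"
  shows "\<bar>u \<phi>\<bar> \<le> weighted_norm (- r) (fourier \<phi>) * sobolev_norm r I u"
proof (rule le_sobolev_norm[OF u weighted_norm_nonneg])
  fix g assume "sobolev_extension r I u g"
  then have g: "g \<in> borel_measurable borel" "integrable lborel (\<lambda>\<xi>. (1 + \<xi>\<^sup>2) powr r * (cmod (g \<xi>))\<^sup>2)"
    "complex_of_real (u \<phi>) = (LINT \<xi>|lborel. g \<xi> * fourier \<phi> (- \<xi>)) / (2 * pi)"
    using \<phi> unfolding sobolev_extension_def by auto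
  have "\<bar>u \<phi>\<bar> = cmod (complex_of_real (u \<phi>))" by simp
  then show "\<bar>u \<phi>\<bar> \<le> weighted_norm (- r) (fourier \<phi>) * weighted_norm r g"
    unfolding g(3) using weighted_duality_test(2)[OF g(1,2) \<phi>] by simp
qed

text \<open>
  Difference quotients of curves have to be recognized as elements of the Sobolev space before their
  norms can be used.
\<close>
lemma sobolev_extension_linear:
  fixes a b :: real
  assumes u: "sobolev_extension r I u g" and v: "sobolev_extension r I v h"
  shows "sobolev_extension r I (\<lambda>\<phi>. a * u \<phi> + b * v \<phi>) (\<lambda>\<xi>. complex_of_real a * g \<xi> + complex_of_real b * h \<xi>)"
proof -
  have g: "g \<in> borel_measurable borel" "integrable lborel (\<lambda>\<xi>. (1 + \<xi>\<^sup>2) powr r * (cmod (g \<xi>))\<^sup>2)"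
    "\<And>\<phi>. \<phi> \<in> test_functions I \<Longrightarrow> complex_of_real (u \<phi>) = (LINT \<xi>|lborel. g \<xi> * fourier \<phi> (- \<xi>)) / (2 * pi)"
    using u unfolding sobolev_extension_def by auto
  have h: "h \<in> borel_measurable borel" "integrable lborel (\<lambda>\<xi>. (1 + \<xi>\<^sup>2) powr r * (cmod (h \<xi>))\<^sup>2)"
    "\<And>\<phi>. \<phi> \<in> test_functions I \<Longrightarrow> complex_of_real (v \<phi>) = (LINT \<xi>|lborel. h \<xi> * fourier \<phi> (- \<xi>)) / (2 * pi)"
    using v unfolding sobolev_extension_def by auto
  let ?k = "\<lambda>\<xi>. complex_of_real a * g \<xi> + complex_of_real b * h \<xi>"
  have m: "?k \<in> borel_measurable borel" using g(1) h(1) by simp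
  have i: "integrable lborel (\<lambda>\<xi>. (1 + \<xi>\<^sup>2) powr r * (cmod (?k \<xi>))\<^sup>2)"
  proof (rule Bochner_Integration.integrable_bound)
    show "integrable lborel (\<lambda>\<xi>. 2 * a\<^sup>2 * ((1 + \<xi>\<^sup>2) powr r * (cmod (g \<xi>))\<^sup>2) + 2 * b\<^sup>2 * ((1 + \<xi>\<^sup>2) powr r * (cmod (h \<xi>))\<^sup>2))"
      by (intro Bochner_Integration.integrable_add integrable_mult_right g(2) h(2))
    show "AE \<xi> in lborel. norm ((1 + \<xi>\<^sup>2) powr r * (cmod (?k \<xi>))\<^sup>2) \<le>
      norm (2 * a\<^sup>2 * ((1 + \<xi>\<^sup>2) powr r * (cmod (g \<xi>))\<^sup>2) + 2 * b\<^sup>2 * ((1 + \<xi>\<^sup>2) powr r * (cmod (h \<xi>))\<^sup>2))"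
    proof (rule AE_I2)
      fix \<xi> :: real
      have "cmod (?k \<xi>) \<le> \<bar>a\<bar> * cmod (g \<xi>) + \<bar>b\<bar> * cmod (h \<xi>)"
        by (rule order_trans[OF norm_triangle_ineq]) (simp add: norm_mult)
      then have "(cmod (?k \<xi>))\<^sup>2 \<le> (\<bar>a\<bar> * cmod (g \<xi>) + \<bar>b\<bar> * cmod (h \<xi>))\<^sup>2" by (rule power_mono) simp
      also have "\<dots> \<le> 2 * a\<^sup>2 * (cmod (g \<xi>))\<^sup>2 + 2 * b\<^sup>2 * (cmod (h \<xi>))\<^sup>2"
      proof -
        have "0 \<le> (\<bar>a\<bar> * cmod (g \<xi>) - \<bar>b\<bar> * cmod (h \<xi>))\<^sup>2" by simp
        then show ?thesis by (simp add: power2_diff power2_sum power_mult_distrib)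
      qed
      finally have "(1 + \<xi>\<^sup>2) powr r * (cmod (?k \<xi>))\<^sup>2 \<le> (1 + \<xi>\<^sup>2) powr r * (2 * a\<^sup>2 * (cmod (g \<xi>))\<^sup>2 + 2 * b\<^sup>2 * (cmod (h \<xi>))\<^sup>2)"
        by (rule mult_left_mono) simp
      also have "\<dots> = 2 * a\<^sup>2 * ((1 + \<xi>\<^sup>2) powr r * (cmod (g \<xi>))\<^sup>2) + 2 * b\<^sup>2 * ((1 + \<xi>\<^sup>2) powr r * (cmod (h \<xi>))\<^sup>2)"
        by (simp add: algebra_simps)
      finally show "norm ((1 + \<xi>\<^sup>2) powr r * (cmod (?k \<xi>))\<^sup>2) \<le>
        norm (2 * a\<^sup>2 * ((1 + \<xi>\<^sup>2) powr r * (cmod (g \<xi>))\<^sup>2) + 2 * b\<^sup>2 * ((1 + \<xi>\<^sup>2) powr r * (cmod (h \<xi>))\<^sup>2))"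
        by (simp del: of_real_add)
    qed
  qed (use m in simp)
  have "complex_of_real (a * u \<phi> + b * v \<phi>) = (LINT \<xi>|lborel. ?k \<xi> * fourier \<phi> (- \<xi>)) / (2 * pi)"
    if \<phi>: "\<phi> \<in> test_functions I" for \<phi>
  proof -
    note ig = weighted_duality_test(1)[OF g(1,2) \<phi>] and ih = weighted_duality_test(1)[OF h(1,2) \<phi>]
    have "(LINT \<xi>|lborel. ?k \<xi> * fourier \<phi> (- \<xi>))
       = (LINT \<xi>|lborel. complex_of_real a * (g \<xi> * fourier \<phi> (- \<xi>)) + complex_of_real b * (h \<xi> * fourier \<phi> (- \<xi>)))"
      by (intro Bochner_Integration.integral_cong) (auto simp: algebra_simps)
    also have "\<dots> = a * (LINT \<xi>|lborel. g \<xi> * fourier \<phi> (- \<xi>)) + b * (LINT \<xi>|lborel. h \<xi> * fourier \<phi> (- \<xi>))"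
      by (subst Bochner_Integration.integral_add) (use ig ih in auto)
    finally show ?thesis using g(3)[OF \<phi>] h(3)[OF \<phi>] by (simp add: add_divide_distrib)
  qed
  then show ?thesis using m i unfolding sobolev_extension_def by simp
qed

lemma sobolev_linear:
  assumes "u \<in> sobolev r I" "v \<in> sobolev r I"
  shows "(\<lambda>\<phi>. a * u \<phi> + b * v \<phi>) \<in> sobolev r I"
  using assms sobolev_extension_linear[of r I u _ v _ a b] unfolding sobolev_def by fastforce

lemma powr_minus_le_inverse:
  fixes q :: real assumes "q \<ge> 1" "r \<ge> 1" shows "q powr (- r) \<le> 1 / q"
proof -
  have "q powr (- r) \<le> q powr (- 1)" using assms by (intro powr_mono) auto
  then show ?thesis using assms by (simp add: powr_minus divide_inverse)
qed

lemma integrable_weights: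
  shows "r \<ge> 1 \<Longrightarrow> integrable lborel (\<lambda>\<xi>::real. (1 + \<xi>\<^sup>2) powr (- r) * 1\<^sup>2)"
    and "r \<ge> 2 \<Longrightarrow> integrable lborel (\<lambda>\<xi>::real. (1 + \<xi>\<^sup>2) powr (- r) * \<bar>\<xi>\<bar>\<^sup>2)"
proof -
  have q: "1 + \<xi>\<^sup>2 \<ge> 1" for \<xi> :: real by simp
  show "integrable lborel (\<lambda>\<xi>::real. (1 + \<xi>\<^sup>2) powr (- r) * 1\<^sup>2)" if "r \<ge> 1"
  proof (rule Bochner_Integration.integrable_bound[OF integrable_inverse_one_plus_square])
    show "AE \<xi> in lborel. norm ((1 + \<xi>\<^sup>2) powr (- r) * 1\<^sup>2) \<le> norm (1 / (1 + \<xi>\<^sup>2))"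
      using powr_minus_le_inverse[OF q that] by (intro AE_I2) (simp add: abs_of_nonneg)
  qed simp
  show "integrable lborel (\<lambda>\<xi>::real. (1 + \<xi>\<^sup>2) powr (- r) * \<bar>\<xi>\<bar>\<^sup>2)" if "r \<ge> 2"
  proof (rule Bochner_Integration.integrable_bound[OF integrable_inverse_one_plus_square])
    show "AE \<xi> in lborel. norm ((1 + \<xi>\<^sup>2) powr (- r) * \<bar>\<xi>\<bar>\<^sup>2) \<le> norm (1 / (1 + \<xi>\<^sup>2))"
    proof (rule AE_I2)
      fix \<xi> :: real
      define p where "p = 1 + \<xi>\<^sup>2"
      have p: "p \<ge> 1" "\<xi>\<^sup>2 \<le> p" by (auto simp: p_def)
      have "- r = - (r - 1) + - 1" by simp
      then have "p powr (- r) = p powr (- (r - 1)) * p powr (- 1)" by (metis powr_add)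
      also have "\<dots> \<le> (1 / p) * (1 / p)"
        using powr_minus_le_inverse[OF p(1), of "r - 1"] powr_minus_le_inverse[OF p(1), of 1] that p
        by (intro mult_mono) auto
      finally have "p powr (- r) * \<xi>\<^sup>2 \<le> (1 / p) * (1 / p) * p" using p by (intro mult_mono) auto
      then show "norm ((1 + \<xi>\<^sup>2) powr (- r) * \<bar>\<xi>\<bar>\<^sup>2) \<le> norm (1 / (1 + \<xi>\<^sup>2))"
        using p unfolding p_def[symmetric] by simp
    qed
  qed simp
qed

text \<open>
  The dual norm of \<open>|\<xi>|^k\<close>. It is used for \<open>r \<ge> k + 1\<close>, where the integral is dominated by that of
  \<open>1 / (1 + \<xi>\<^sup>2)\<close>.
\<close>
definition embedding_const :: "real \<Rightarrow> nat \<Rightarrow> real" where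
  "embedding_const r k = sqrt ((LINT \<xi>|lborel. (1 + \<xi>\<^sup>2) powr (- r) * (\<bar>\<xi>\<bar> ^ k)\<^sup>2) / (2 * pi))"

lemma embedding_const_nonneg: "embedding_const r k \<ge> 0"
  unfolding embedding_const_def
  by (intro real_sqrt_ge_zero divide_nonneg_nonneg integral_nonneg_AE) auto

lemma weighted_embedding:
  assumes g: "g \<in> borel_measurable borel" "integrable lborel (\<lambda>\<xi>. (1 + \<xi>\<^sup>2) powr r * (cmod (g \<xi>))\<^sup>2)"
    and k: "k \<le> 1" "r \<ge> real k + 1"
  shows "integrable lborel (\<lambda>\<xi>. cmod (g \<xi>) * \<bar>\<xi>\<bar> ^ k)"
    and "(LINT \<xi>|lborel. cmod (g \<xi>) * \<bar>\<xi>\<bar> ^ k) / (2 * pi) \<le> embedding_const r k * weighted_norm r g"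
proof -
  have "integrable lborel (\<lambda>\<xi>::real. (1 + \<xi>\<^sup>2) powr (- r) * (\<bar>\<xi>\<bar> ^ k)\<^sup>2)"
    using integrable_weights[of r] k by (cases "k = 0") (auto simp: le_Suc_eq)
  from weighted_duality[OF g _ this]
  show "integrable lborel (\<lambda>\<xi>. cmod (g \<xi>) * \<bar>\<xi>\<bar> ^ k)"
    and "(LINT \<xi>|lborel. cmod (g \<xi>) * \<bar>\<xi>\<bar> ^ k) / (2 * pi) \<le> embedding_const r k * weighted_norm r g"
    by (simp_all add: embedding_const_def)
qed

lemma distr_of_integral:
  fixes q :: "real \<Rightarrow> real"
  assumes q: "continuous_on {a..b} q" and \<phi>: "\<phi> \<in> test_functions {a<..<b}"
  shows "distr_of {a<..<b} q \<phi> = integral {a..b} (\<lambda>x. q x * \<phi> x)"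
proof -
  have c: "continuous_on {a..b} (\<lambda>x. q x * \<phi> x)"
    using \<phi> unfolding test_functions_iff by (intro continuous_intros q smooth_continuous) auto
  have "set_integrable lborel {a<..<b} (\<lambda>x. q x * \<phi> x)"
    by (rule set_integrable_subset[OF borel_integrable_atLeastAtMost'[OF c]]) auto
  then show ?thesis
    using \<phi> by (simp add: distr_of_def set_borel_integral_eq_integral(2) integral_open_interval_real)
qed

lemma distr_of_test_LINT:
  assumes "\<phi> \<in> test_functions I"
  shows "distr_of I f \<phi> = (LINT x|lborel. f x * \<phi> x)"
proof -
  have "indicator I x *\<^sub>R (f x * \<phi> x) = f x * \<phi> x" for x
  proof (cases "x \<in> I")
    case False
    then have "x \<notin> supp \<phi>" using assms unfolding test_functions_iff by blast
    then show ?thesis by (simp add: not_in_supp)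
  qed simp
  then show ?thesis using assms unfolding distr_of_def set_lebesgue_integral_def by (simp only: if_True)
qed

lemma synthesis_pairing:
  assumes g: "integrable lborel g" and \<phi>: "\<phi> \<in> test_functions I"
  shows "Re ((LINT \<xi>|lborel. g \<xi> * fourier \<phi> (- \<xi>)) / (2 * pi)) = distr_of I (\<lambda>x. Re (fourier_synthesis g x)) \<phi>"
proof -
  obtain R where R: "R > 0" "\<And>x. \<bar>x\<bar> \<ge> R \<Longrightarrow> \<phi> x = 0" using test_functions_bounds[OF \<phi>] by blast
  have i: "integrable lborel (\<lambda>x. complex_of_real (\<phi> x) * fourier_synthesis g x)"
    by (rule integrable_test[of _ R])
       (use \<phi> R continuous_fourier_synthesis[OF g] in \<open>auto intro!: continuous_intros smooth_continuous simp: test_functions_iff\<close>)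
  have "Re ((LINT \<xi>|lborel. g \<xi> * fourier \<phi> (- \<xi>)) / (2 * pi))
      = (LINT x|lborel. Re (complex_of_real (\<phi> x) * fourier_synthesis g x))"
    unfolding fourier_pairing[OF g integrable_test_function[OF \<phi>]] using integral_Re[OF i] by simp
  then show ?thesis unfolding distr_of_test_LINT[OF \<phi>] by (simp add: mult.commute)
qed

lemma extension_props:
  assumes "sobolev_extension r I u g"
  shows "g \<in> borel_measurable borel" "integrable lborel (\<lambda>\<xi>. (1 + \<xi>\<^sup>2) powr r * (cmod (g \<xi>))\<^sup>2)"
    "\<And>\<phi>. \<phi> \<in> test_functions I \<Longrightarrow> complex_of_real (u \<phi>) = (LINT \<xi>|lborel. g \<xi> * fourier \<phi> (- \<xi>)) / (2 * pi)"
  using assms unfolding sobolev_extension_def by auto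

lemma extension_integrable:
  assumes "sobolev_extension r I u g"
  shows "r \<ge> 1 \<Longrightarrow> integrable lborel g" "r \<ge> 2 \<Longrightarrow> integrable lborel (\<lambda>\<xi>. \<xi> * cmod (g \<xi>))"
proof -
  note g = extension_props(1,2)[OF assms]
  show "integrable lborel g" if "r \<ge> 1"
    by (rule Bochner_Integration.integrable_bound[OF weighted_embedding(1)[OF g, of 0]]) (use that g in auto)
  show "integrable lborel (\<lambda>\<xi>. \<xi> * cmod (g \<xi>))" if "r \<ge> 2"
    by (rule Bochner_Integration.integrable_bound[OF weighted_embedding(1)[OF g, of 1]])
       (use that g in \<open>auto simp: abs_mult\<close>)
qed

text \<open>
  A distribution with an integrable extension is the function synthesized from it.
\<close>
lemma extension_representation:
  assumes e: "sobolev_extension r I u g" and r: "r \<ge> 1" and z: "\<forall>\<phi>. \<phi> \<notin> test_functions I \<longrightarrow> u \<phi> = 0"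
  shows "u = distr_of I (\<lambda>x. Re (fourier_synthesis g x))"
proof
  fix \<phi>
  show "u \<phi> = distr_of I (\<lambda>x. Re (fourier_synthesis g x)) \<phi>"
  proof (cases "\<phi> \<in> test_functions I")
    case True
    have "u \<phi> = Re (complex_of_real (u \<phi>))" by simp
    also have "\<dots> = distr_of I (\<lambda>x. Re (fourier_synthesis g x)) \<phi>"
      unfolding extension_props(3)[OF e True] by (rule synthesis_pairing[OF extension_integrable(1)[OF e r] True])
    finally show ?thesis .
  qed (use z in \<open>simp add: distr_of_def\<close>)
qed

lemma sobolev_continuous_representative:
  assumes "u \<in> sobolev r I" "r \<ge> 1"
  obtains q where "continuous_on UNIV q" "u = distr_of I q"
proof -
  obtain g where g: "sobolev_extension r I u g" and z: "\<forall>\<phi>. \<phi> \<notin> test_functions I \<longrightarrow> u \<phi> = 0"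
    using assms unfolding sobolev_def by auto
  have "continuous_on UNIV (\<lambda>x. Re (fourier_synthesis g x))"
    by (intro continuous_intros continuous_fourier_synthesis extension_integrable(1)[OF g assms(2)])
  then show ?thesis using that extension_representation[OF g assms(2) z] by blast
qed

text \<open>
  Continuous functions are determined by their distributions, up to the endpoints. This turns the
  boundary and initial conditions, stated for distributions, into pointwise ones.
\<close>
lemma distr_of_inject:
  assumes ab: "a < b" and c: "continuous_on {a..b} q1" "continuous_on {a..b} q2"
    and e: "distr_of {a<..<b} q1 = distr_of {a<..<b} q2" and x: "x \<in> {a..b}"
  shows "q1 x = q2 x"
proof -
  have "q1 x - q2 x = 0"
  proof (rule fundamental_lemma[OF ab _ _ x])
    fix \<phi> assume \<phi>: "\<phi> \<in> test_functions {a<..<b}"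
    have cp: "continuous_on {a..b} \<phi>" using \<phi> unfolding test_functions_iff by (simp add: smooth_continuous)
    have "integral {a..b} (\<lambda>y. (q1 y - q2 y) * \<phi> y)
        = integral {a..b} (\<lambda>y. q1 y * \<phi> y) - integral {a..b} (\<lambda>y. q2 y * \<phi> y)"
      unfolding left_diff_distrib
      by (rule Henstock_Kurzweil_Integration.integral_diff) (auto intro!: integrable_continuous_interval continuous_intros c cp)
    also have "\<dots> = 0" using distr_of_integral[OF c(1) \<phi>] distr_of_integral[OF c(2) \<phi>] e by simp
    finally show "integral {a..b} (\<lambda>y. (q1 y - q2 y) * \<phi> y) = 0" .
  qed (intro continuous_intros c)
  then show ?thesis by simp
qed

lemma extension_pointwise:
  assumes ab: "a < b" and q: "continuous_on {a..b} q" and r: "r \<ge> 1"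
    and e: "sobolev_extension r {a<..<b} (distr_of {a<..<b} q) g" and x: "x \<in> {a..b}"
  shows "q x = Re (fourier_synthesis g x)"
proof (rule distr_of_inject[OF ab q _ _ x])
  show "continuous_on {a..b} (\<lambda>x. Re (fourier_synthesis g x))"
    by (intro continuous_intros continuous_fourier_synthesis extension_integrable(1)[OF e r])
  show "distr_of {a<..<b} q = distr_of {a<..<b} (\<lambda>x. Re (fourier_synthesis g x))"
    by (rule extension_representation[OF e r]) (simp add: distr_of_def)
qed

lemma sobolev_sup_bound:
  assumes ab: "a < b" and q: "continuous_on {a..b} q" and r: "r \<ge> 1"
    and s: "distr_of {a<..<b} q \<in> sobolev r {a<..<b}" and x: "x \<in> {a..b}"
  shows "\<bar>q x\<bar> \<le> embedding_const r 0 * sobolev_norm r {a<..<b} (distr_of {a<..<b} q)"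
proof (rule le_sobolev_norm[OF s embedding_const_nonneg])
  fix g assume e: "sobolev_extension r {a<..<b} (distr_of {a<..<b} q) g"
  have "\<bar>q x\<bar> \<le> cmod (fourier_synthesis g x)"
    unfolding extension_pointwise[OF ab q r e x] by (rule abs_Re_le_cmod)
  also have "\<dots> \<le> (LINT \<xi>|lborel. cmod (g \<xi>)) / (2 * pi)"
    by (rule norm_fourier_synthesis_le[OF extension_integrable(1)[OF e r]])
  also have "\<dots> \<le> embedding_const r 0 * weighted_norm r g"
    using weighted_embedding(2)[OF extension_props(1,2)[OF e], of 0] r by simp
  finally show "\<bar>q x\<bar> \<le> embedding_const r 0 * weighted_norm r g" .
qed

text \<open>
  The derivative is that of the synthesis of any extension. Being the derivative of \<open>q\<close>, it does not
  depend on the extension, and so it is bounded by the infimum over all of them.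
\<close>
lemma sobolev_C1:
  assumes ab: "a < b" and q: "continuous_on {a..b} q" and r: "r \<ge> 2"
    and s: "distr_of {a<..<b} q \<in> sobolev r {a<..<b}"
  shows "\<exists>q'. continuous_on {a..b} q' \<and> (\<forall>x\<in>{a..b}. (q has_real_derivative q' x) (at x within {a..b})
     \<and> \<bar>q' x\<bar> \<le> embedding_const r 1 * sobolev_norm r {a<..<b} (distr_of {a<..<b} q))"
proof -
  have r1: "r \<ge> 1" using r by simp
  have D: "(q has_real_derivative Re (fourier_synthesis (\<lambda>\<xi>. \<i> * \<xi> * g \<xi>) x)) (at x within {a..b})"
    and c: "continuous_on {a..b} (\<lambda>x. Re (fourier_synthesis (\<lambda>\<xi>. \<i> * \<xi> * g \<xi>) x))"
    and B: "\<bar>Re (fourier_synthesis (\<lambda>\<xi>. \<i> * \<xi> * g \<xi>) x)\<bar> \<le> embedding_const r 1 * weighted_norm r g"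
    if e: "sobolev_extension r {a<..<b} (distr_of {a<..<b} q) g" and x: "x \<in> {a..b}" for g x
  proof -
    note g = extension_props(1,2)[OF e]
    note i = extension_integrable[OF e] 
    have i': "integrable lborel (\<lambda>\<xi>. \<i> * complex_of_real \<xi> * g \<xi>)"
      by (rule Bochner_Integration.integrable_bound[OF i(2)[OF r]]) (use g in \<open>auto simp: norm_mult abs_mult\<close>)
    have "((\<lambda>x. Re (fourier_synthesis g x)) has_real_derivative Re (fourier_synthesis (\<lambda>\<xi>. \<i> * \<xi> * g \<xi>) x)) (at x within {a..b})"
      by (rule has_field_derivative_at_within[OF fourier_synthesis_has_derivative[OF i(1)[OF r1] i(2)[OF r]]])
    then show "(q has_real_derivative Re (fourier_synthesis (\<lambda>\<xi>. \<i> * \<xi> * g \<xi>) x)) (at x within {a..b})"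
      by (rule has_field_derivative_transform_within[OF _ zero_less_one x]) (rule extension_pointwise[OF ab q r1 e, symmetric])
    show "continuous_on {a..b} (\<lambda>x. Re (fourier_synthesis (\<lambda>\<xi>. \<i> * \<xi> * g \<xi>) x))"
      by (intro continuous_intros continuous_fourier_synthesis i')
    have "\<bar>Re (fourier_synthesis (\<lambda>\<xi>. \<i> * \<xi> * g \<xi>) x)\<bar> \<le> (LINT \<xi>|lborel. cmod (\<i> * \<xi> * g \<xi>)) / (2 * pi)"
      by (rule order_trans[OF abs_Re_le_cmod norm_fourier_synthesis_le[OF i']])
    also have "\<dots> \<le> embedding_const r 1 * weighted_norm r g"
      using weighted_embedding(2)[OF g, of 1] r by (simp add: norm_mult mult.commute)
    finally show "\<bar>Re (fourier_synthesis (\<lambda>\<xi>. \<i> * \<xi> * g \<xi>) x)\<bar> \<le> embedding_const r 1 * weighted_norm r g" .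
  qed
  obtain g where e: "sobolev_extension r {a<..<b} (distr_of {a<..<b} q) g" using s unfolding sobolev_def by auto
  define q' where "q' x = Re (fourier_synthesis (\<lambda>\<xi>. \<i> * \<xi> * g \<xi>) x)" for x
  have "\<bar>q' x\<bar> \<le> embedding_const r 1 * sobolev_norm r {a<..<b} (distr_of {a<..<b} q)" if x: "x \<in> {a..b}" for x
  proof (rule le_sobolev_norm[OF s embedding_const_nonneg])
    fix h assume h: "sobolev_extension r {a<..<b} (distr_of {a<..<b} q) h"
    have "at x within {a..b} \<noteq> bot" using ab x by (simp add: trivial_limit_within islimpt_Icc)
    then have "q' x = Re (fourier_synthesis (\<lambda>\<xi>. \<i> * \<xi> * h \<xi>) x)"
      unfolding q'_def using has_field_derivative_unique[OF D[OF e x] D[OF h x]] by simp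
    then show "\<bar>q' x\<bar> \<le> embedding_const r 1 * weighted_norm r h" using B[OF h x] by simp
  qed
  then show ?thesis using D[OF e] c[OF e, of a] ab unfolding q'_def by (intro exI[of _ q'] conjI ballI) (auto simp: q'_def[abs_def])
qed

section \<open>Fourier inversion for the bump and Sobolev norms of its dilations\<close>

lemma bump_test: "bump \<in> test_functions UNIV"
  by (rule test_functions_interval[OF smooth_bump, of "-1" 1]) (auto intro: bump_eq_0)

lemma integrable_bump: "integrable lborel bump"
  by (rule integrable_test_function[OF bump_test])

lemma LINT_bump: "(LINT x|lborel. bump x) = 1"
proof -
  have "(bump has_integral (LINT x|lborel. bump x)) UNIV" by (rule has_integral_integral_lborel[OF integrable_bump])
  moreover have "(bump has_integral 1) UNIV"
    by (rule has_integral_on_superset[OF integral_bump]) (auto intro: bump_eq_0)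
  ultimately show ?thesis by (rule has_integral_unique)
qed

text \<open>
  Applied to the difference of the bump and its Fourier synthesis, which is known through integrals
  over intervals only.
\<close>
lemma integral_zero_imp_zero:
  fixes h :: "real \<Rightarrow> real"
  assumes c: "continuous_on UNIV h" and z: "\<And>a b. a \<le> b \<Longrightarrow> integral {a..b} h = 0"
  shows "h x = 0"
proof -
  have "((\<lambda>u. integral {x - 1..u} h) has_real_derivative h x) (at x within {x - 1..x + 1})"
    by (rule integral_has_real_derivative) (auto intro: continuous_on_subset[OF c])
  then have "((\<lambda>u. integral {x - 1..u} h) has_real_derivative h x) (at x)"
    using at_within_interior[of x "{x - 1..x + 1}"] by simp
  moreover have "integral {x - 1..u} h = 0" for u using z[of "x - 1" u] by (cases "x - 1 \<le> u") auto
  ultimately have "((\<lambda>u. 0) has_real_derivative h x) (at x)" by simp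
  then show ?thesis using DERIV_unique[OF _ DERIV_const] by blast
qed

lemma fourier_indicator:
  assumes "a \<le> b" "t \<noteq> 0"
  shows "fourier (indicator {a..b}) t = (iexp (- (t * a)) - iexp (- (t * b))) / (\<i> * t)"
proof -
  define F where "F = (\<lambda>x. \<i> / t * iexp (- (t * x)))"
  have "(LINT x|lborel. indicator {a..b} x *\<^sub>R cis (- (t * x))) = F b - F a"
  proof (rule integral_FTC_Icc[OF assms(1)])
    fix x
    have "((\<lambda>z. \<i> / t * exp (- (\<i> * t * z))) has_field_derivative \<i> / t * (- (\<i> * t) * exp (- (\<i> * t * of_real x)))) (at (of_real x))"
      by (auto intro!: derivative_eq_intros)
    from has_vector_derivative_real_field[OF this, of "{a..b}"]
    show "(F has_vector_derivative cis (- (t * x))) (at x within {a..b})"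
      using assms(2) by (simp add: F_def cis_conv_exp mult_ac)
  qed (intro continuous_intros)
  moreover have "F b - F a = (iexp (- (t * a)) - iexp (- (t * b))) / (\<i> * t)"
    using assms(2) by (simp add: F_def field_simps)
  ultimately show ?thesis
    by (simp add: fourier_def scaleR_conv_of_real mult.commute)
qed

lemma LINT_reflect: "(LINT x|lborel. f (- x)) = (LINT x|lborel. f (x::real) :: complex)"
  using lborel_integral_real_affine[of "-1" f 0] by simp

lemma integrable_fourier_bump: "integrable lborel (fourier bump)"
proof -
  have "integrable lborel (\<lambda>\<xi>. cmod (fourier bump \<xi>))" using integrable_fourier_test[OF bump_test, of 0] by simp
  then show ?thesis using measurable_fourier[OF bump_test] by (simp add: integrable_norm_iff)
qed

text \<open>
  The bump is a probability density, so Levy's inversion formula recovers its integral over an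
  interval from the transform. Since the transform is integrable, the truncated integrals of the
  formula converge to a full integral, which Fubini's theorem rewrites as the integral of the synthesis.
\<close>
lemma bump_integral_inversion:
  assumes ab: "a \<le> b"
  shows "(LINT x|lborel. complex_of_real (indicator {a..b} x) * fourier_synthesis (fourier bump) x)
       = complex_of_real (integral {a..b} bump)"
proof -
  define M where "M = density lborel bump"
  have mb [measurable]: "bump \<in> borel_measurable borel" by (rule measurable_test_function[OF bump_test])
  have nn: "(\<integral>\<^sup>+ x. ennreal (bump x) \<partial>lborel) = 1"
    using nn_integral_eq_integral[OF integrable_bump] by (simp add: bump_nonneg LINT_bump)
  have "prob_space M" by (rule prob_spaceI) (simp add: M_def emeasure_density nn)
  then interpret M: prob_space M .
  interpret M: real_distribution M by unfold_locales (simp_all add: M_def)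
  have meas: "measure M A = (LINT x|lborel. indicator A x * bump x)" if [measurable]: "A \<in> sets borel" for A
  proof -
    have "measure M A = (LINT x|M. indicator A x)" using that by (simp add: M_def)
    also have "\<dots> = (LINT x|lborel. bump x *\<^sub>R indicator A x)"
      unfolding M_def by (rule integral_density) (auto simp: bump_nonneg)
    finally show ?thesis by (simp add: mult.commute)
  qed
  have pt: "measure M {c} = 0" for c
  proof -
    have "AE x in lborel. indicator {c} x * bump x = 0"
      using AE_lborel_singleton[of c] by eventually_elim (simp add: indicator_def)
    then show ?thesis by (simp add: meas integral_eq_zero_AE)
  qed
  have ch: "char M t = fourier bump (- t)" for t
  proof -
    have "char M t = (CLINT x|lborel. bump x *\<^sub>R iexp (t * x))"
      unfolding char_def M_def by (rule integral_density) (auto simp: bump_nonneg)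
    then show ?thesis by (simp add: fourier_def cis_conv_exp scaleR_conv_of_real mult.commute)
  qed
  define F where "F = (\<lambda>t. (iexp (- (t * a)) - iexp (- (t * b))) / (\<i> * t) * fourier bump (- t))"
  define G where "G = (\<lambda>t. fourier (indicator {a..b}) t * fourier bump (- t))"
  have iind: "integrable lborel (indicator {a..b} :: real \<Rightarrow> real)"
    using ab by (intro integrable_real_indicator) (simp_all add: emeasure_lborel_Icc)
  have mind: "fourier (indicator {a..b}) \<in> borel_measurable borel"
  proof -
    have c: "integrable lborel (\<lambda>x. complex_of_real (indicator {a..b} x))" using iind by simp
    have "fourier (indicator {a..b}) = (\<lambda>\<xi>. 2 * pi * fourier_synthesis (\<lambda>x. complex_of_real (indicator {a..b} x)) (- \<xi>))"
      by (simp add: fourier_def fourier_synthesis_def mult.commute fun_eq_iff)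
    moreover have "continuous_on UNIV (\<lambda>\<xi>. 2 * pi * fourier_synthesis (\<lambda>x. complex_of_real (indicator {a..b} x)) (- \<xi>))"
      by (intro continuous_intros continuous_on_compose2[OF continuous_fourier_synthesis[OF c, of UNIV]]) auto
    ultimately show ?thesis by (simp add: borel_measurable_continuous_onI)
  qed
  have mfm: "(\<lambda>t. fourier bump (- t)) \<in> borel_measurable borel"
    using measurable_compose[OF _ measurable_fourier[OF bump_test], of uminus borel] by simp
  have mG: "G \<in> borel_measurable borel" unfolding G_def using mind mfm by simp
  have iG: "integrable lborel G"
  proof (rule Bochner_Integration.integrable_bound)
    show "integrable lborel (\<lambda>t. (LINT x|lborel. \<bar>indicator {a..b} x :: real\<bar>) * cmod (fourier bump (- t)))"
      unfolding cmod_fourier_minus using integrable_fourier_bump by (intro integrable_mult_right integrable_norm)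
    show "AE t in lborel. norm (G t) \<le> norm ((LINT x|lborel. \<bar>indicator {a..b} x :: real\<bar>) * cmod (fourier bump (- t)))"
      using norm_fourier_le[OF iind] by (intro AE_I2) (auto simp: G_def norm_mult abs_mult intro!: mult_right_mono intro: order_trans)
  qed (use mG in simp)
  have AEeq: "AE t in lborel. F t = G t"
    using AE_lborel_singleton[of 0] by eventually_elim (simp add: F_def G_def fourier_indicator[OF ab])
  have lim1: "(\<lambda>n. 1 / (2 * pi) * (CLBINT t=- real n..real n. F t)) \<longlonglongrightarrow> complex_of_real (measure M {a<..b})"
  proof -
    have "(\<lambda>T :: nat. 1 / (2 * pi) * (CLBINT t=- real T..real T. F t)) \<longlonglongrightarrow> complex_of_real (measure M {a<..b})"
      using M.Levy_Inversion[OF ab pt pt] unfolding F_def ch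
      by (simp only: of_int_minus of_int_of_nat_eq)
    then show ?thesis .
  qed
  have int: "(CLBINT t=- real n..real n. F t) = (CLINT t|lborel. indicator {- real n<..<real n} t *\<^sub>R G t)" for n
  proof -
    have "(CLBINT t=- real n..real n. F t) = (CLINT t|lborel. indicator {- real n<..<real n} t *\<^sub>R F t)"
      by (simp add: interval_lebesgue_integral_le_eq set_lebesgue_integral_def einterval_eq)
    also have "\<dots> = (CLINT t|lborel. indicator {- real n<..<real n} t *\<^sub>R G t)"
    proof (rule Bochner_Integration.integral_cong_AE)
      show "(\<lambda>t. indicator {- real n<..<real n} t *\<^sub>R F t) \<in> borel_measurable lborel"
        unfolding F_def using mfm by simp
      show "AE t in lborel. indicator {- real n<..<real n} t *\<^sub>R F t = indicator {- real n<..<real n} t *\<^sub>R G t"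
        using AEeq by eventually_elim simp
    qed (use mG in simp)
    finally show ?thesis .
  qed
  have lim2: "(\<lambda>n. CLINT t|lborel. indicator {- real n<..<real n} t *\<^sub>R G t) \<longlonglongrightarrow> (CLINT t|lborel. G t)"
  proof (rule integral_dominated_convergence[where w = "\<lambda>t. cmod (G t)"])
    show "AE t in lborel. (\<lambda>n. indicator {- real n<..<real n} t *\<^sub>R G t) \<longlonglongrightarrow> G t"
    proof (rule AE_I2)
      fix t :: real
      obtain N :: nat where N: "real N > \<bar>t\<bar>" using reals_Archimedean2 by blast
      have "\<forall>\<^sub>F n in sequentially. indicator {- real n<..<real n} t *\<^sub>R G t = G t"
        using eventually_ge_at_top[of N] by eventually_elim (use N in \<open>auto simp: indicator_def\<close>)
      then show "(\<lambda>n. indicator {- real n<..<real n} t *\<^sub>R G t) \<longlonglongrightarrow> G t" by (rule tendsto_eventually)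
    qed
  qed (use iG mG in \<open>auto simp: indicator_def\<close>)
  have "complex_of_real (measure M {a<..b}) = 1 / (2 * pi) * (CLINT t|lborel. G t)"
    using LIMSEQ_unique[OF lim1] tendsto_mult_left[OF lim2, of "1 / (2 * pi)"] unfolding int by blast
  also have "(CLINT t|lborel. G t) = (CLINT t|lborel. fourier bump t * fourier (indicator {a..b}) (- t))"
    using LINT_reflect[of G] by (simp add: G_def mult.commute)
  also have "1 / (2 * pi) * \<dots> = (LINT x|lborel. complex_of_real (indicator {a..b} x) * fourier_synthesis (fourier bump) x)"
    using fourier_pairing[OF integrable_fourier_bump iind] by simp
  finally have 1: "(LINT x|lborel. complex_of_real (indicator {a..b} x) * fourier_synthesis (fourier bump) x) = complex_of_real (measure M {a<..b})" ..
  have "measure M {a<..b} = (LINT x|lborel. indicator {a..b} x * bump x)"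
    unfolding meas[OF greaterThanAtMost_borel]
  proof (rule Bochner_Integration.integral_cong_AE)
    show "AE x in lborel. indicator {a<..b} x * bump x = indicator {a..b} x * bump x"
      using AE_lborel_singleton[of a] by eventually_elim (auto simp: indicator_def)
  qed simp_all
  also have "\<dots> = (LINT x:{a..b}|lborel. bump x)" by (simp add: set_lebesgue_integral_def)
  also have "\<dots> = integral {a..b} bump"
    by (rule set_borel_integral_eq_integral(2)[OF borel_integrable_atLeastAtMost'[OF continuous_bump]])
  finally show ?thesis using 1 by simp
qed

lemma bump_inversion: "fourier_synthesis (fourier bump) x = complex_of_real (bump x)"
proof -
  let ?G = "fourier_synthesis (fourier bump)"
  have c: "continuous_on S ?G" for S by (rule continuous_fourier_synthesis[OF integrable_fourier_bump])
  have "integral {a..b} (\<lambda>x. ?G x - complex_of_real (bump x)) = 0" if "a \<le> b" for a b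
  proof -
    have "(LINT x|lborel. complex_of_real (indicator {a..b} x) * ?G x) = (LINT x:{a..b}|lborel. ?G x)"
      by (simp add: set_lebesgue_integral_def scaleR_conv_of_real)
    also have "\<dots> = integral {a..b} ?G"
      by (rule set_borel_integral_eq_integral(2)[OF borel_integrable_atLeastAtMost'[OF c]])
    finally have "integral {a..b} ?G = complex_of_real (integral {a..b} bump)"
      using bump_integral_inversion[OF that] by simp
    also have "\<dots> = integral {a..b} (\<lambda>x. complex_of_real (bump x))"
      by (rule integral_unique[symmetric], rule has_integral_of_real, rule integrable_integral)
         (intro integrable_continuous_interval continuous_bump)
    finally show ?thesis
      by (subst Henstock_Kurzweil_Integration.integral_diff)
         (auto intro!: integrable_continuous_interval continuous_intros c continuous_bump)
  qed note z = this
  have i: "(\<lambda>x. ?G x - complex_of_real (bump x)) integrable_on {a..b}" for a b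
    by (intro integrable_continuous_interval continuous_intros c continuous_bump)
  have "Re (?G x - complex_of_real (bump x)) = 0"
  proof (rule integral_zero_imp_zero[of "\<lambda>x. Re (?G x - complex_of_real (bump x))"])
    show "integral {a..b} (\<lambda>x. Re (?G x - complex_of_real (bump x))) = 0" if "a \<le> b" for a b
      using integral_linear[OF i[of a b] bounded_linear_Re] z[OF that] by (simp add: o_def)
  qed (intro continuous_intros c continuous_bump)
  moreover have "Im (?G x - complex_of_real (bump x)) = 0"
  proof (rule integral_zero_imp_zero[of "\<lambda>x. Im (?G x - complex_of_real (bump x))"])
    show "integral {a..b} (\<lambda>x. Im (?G x - complex_of_real (bump x))) = 0" if "a \<le> b" for a b
      using integral_linear[OF i[of a b] bounded_linear_Im] z[OF that] by (simp add: o_def)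
  qed (intro continuous_intros c continuous_bump)
  ultimately show ?thesis by (simp add: complex_eq_iff)
qed

text \<open>
  The transform of \<open>bump (\<tau> (t - c))\<close> is that of the bump, dilated by \<open>\<tau>\<close>, divided by \<open>\<tau>\<close> and multiplied
  by a phase. Its modulus does not depend on \<open>c\<close>, and the dilation costs at most a factor \<open>\<tau>^p\<close> in
  the weighted norm (the bound gives away \<open>\<tau>^(1/2)\<close>).
\<close>
lemma bump_train_extension:
  fixes e c :: "nat \<Rightarrow> real"
  assumes J: "finite J" and \<tau>: "\<tau> \<ge> 1" and p: "p \<ge> 0"
  defines "h \<equiv> \<lambda>t. \<Sum>j\<in>J. e j * bump (\<tau> * (t - c j))"
  obtains g where "sobolev_extension p I (distr_of I h) g"
    "weighted_norm p g \<le> (\<Sum>j\<in>J. \<bar>e j\<bar>) * \<tau> powr p * weighted_norm p (fourier bump)"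
proof -
  define b where "b \<eta> = fourier bump (\<eta> / \<tau>) / \<tau>" for \<eta> :: real
  define g where "g \<eta> = (\<Sum>j\<in>J. complex_of_real (e j) * (b \<eta> * cis (\<eta> * (- c j))))" for \<eta>
  define E where "E = (\<Sum>j\<in>J. \<bar>e j\<bar>)"
  have E: "E \<ge> 0" by (simp add: E_def sum_nonneg)
  have \<tau>0: "\<tau> > 0" "\<tau> \<noteq> 0" using \<tau> by auto
  have mb: "b \<in> borel_measurable borel"
    using measurable_compose[OF _ measurable_fourier[OF bump_test], of "\<lambda>\<eta>. \<eta> / \<tau>" borel]
    unfolding b_def[abs_def] by simp
  have "integrable lborel (\<lambda>x. fourier bump (0 + (1 / \<tau>) * x))"
    by (rule lborel_integrable_real_affine[OF integrable_fourier_bump]) (use \<tau>0 in simp)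
  then have ib: "integrable lborel b" unfolding b_def[abs_def] using \<tau>0(2) by simp
  have ib': "integrable lborel (\<lambda>\<eta>. b \<eta> * cis (\<eta> * y))" for y by (rule integrable_mult_cis[OF ib])
  have ig: "integrable lborel g"
    unfolding g_def[abs_def] by (intro Bochner_Integration.integrable_sum integrable_mult_right ib')
  then have mg: "g \<in> borel_measurable borel" by simp
  have cg: "cmod (g \<eta>) \<le> E * cmod (b \<eta>)" for \<eta>
    unfolding g_def E_def sum_distrib_right by (rule sum_norm_le) (simp add: norm_mult)
  have syn_b: "fourier_synthesis b y = bump (\<tau> * y)" for y
  proof -
    have "(LINT \<eta>|lborel. b \<eta> * cis (\<eta> * y)) = (LINT \<zeta>|lborel. fourier bump \<zeta> * cis (\<zeta> * (\<tau> * y)))"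
      unfolding lborel_integral_real_affine[of \<tau> "\<lambda>\<eta>. b \<eta> * cis (\<eta> * y)" 0, OF \<tau>0(2)]
      using \<tau>0 by (subst integral_scaleR_right[symmetric]) (auto intro!: Bochner_Integration.integral_cong simp: b_def scaleR_conv_of_real mult_ac)
    then show ?thesis using bump_inversion[of "\<tau> * y"] by (simp add: fourier_synthesis_def)
  qed
  have cis_shift: "cis (\<eta> * (x - c j)) = cis (\<eta> * (- c j)) * cis (\<eta> * x)" for \<eta> x j
    by (simp add: cis_mult algebra_simps)
  have syn: "fourier_synthesis g x = complex_of_real (h x)" for x
  proof -
    have "(LINT \<eta>|lborel. g \<eta> * cis (\<eta> * x)) = (LINT \<eta>|lborel. (\<Sum>j\<in>J. complex_of_real (e j) * (b \<eta> * cis (\<eta> * (x - c j)))))"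
      by (intro Bochner_Integration.integral_cong refl)
         (simp only: g_def sum_distrib_right mult.assoc cis_shift)
    also have "\<dots> = (\<Sum>j\<in>J. complex_of_real (e j) * (LINT \<eta>|lborel. b \<eta> * cis (\<eta> * (x - c j))))"
      by (subst Bochner_Integration.integral_sum) (auto intro!: integrable_mult_right ib' simp: integral_mult_right_zero)
    finally have "fourier_synthesis g x = (\<Sum>j\<in>J. complex_of_real (e j) * fourier_synthesis b (x - c j))"
      by (simp add: fourier_synthesis_def sum_divide_distrib)
    then show ?thesis by (simp add: syn_b h_def)
  qed
  have bnd: "(1 + \<xi>\<^sup>2) powr p * (cmod (g \<xi>))\<^sup>2 \<le> E\<^sup>2 * ((1 + \<xi>\<^sup>2) powr p * (cmod (b \<xi>))\<^sup>2)" for \<xi>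
  proof -
    have "(cmod (g \<xi>))\<^sup>2 \<le> (E * cmod (b \<xi>))\<^sup>2" using cg by (intro power_mono) auto
    from mult_left_mono[OF this, of "(1 + \<xi>\<^sup>2) powr p"]
    show ?thesis by (simp add: power_mult_distrib mult_ac)
  qed
  define W where "W \<zeta> = (1 + \<zeta>\<^sup>2) powr p * (cmod (fourier bump \<zeta>))\<^sup>2" for \<zeta> :: real
  have iW: "integrable lborel W" unfolding W_def[abs_def] by (rule integrable_fourier_weighted[OF bump_test])
  have sc: "(1 + (\<tau> * \<zeta>)\<^sup>2) powr p * (cmod (b (\<tau> * \<zeta>)))\<^sup>2 \<le> (\<tau> powr p)\<^sup>2 / \<tau>\<^sup>2 * W \<zeta>" for \<zeta>
  proof -
    \<comment> \<open>This is where \<open>\<tau> \<ge> 1\<close> is used.\<close>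
    have "1 + (\<tau> * \<zeta>)\<^sup>2 \<le> \<tau>\<^sup>2 * (1 + \<zeta>\<^sup>2)"
      using \<tau> by (simp add: power_mult_distrib algebra_simps)
    then have "(1 + (\<tau> * \<zeta>)\<^sup>2) powr p \<le> (\<tau>\<^sup>2 * (1 + \<zeta>\<^sup>2)) powr p"
      using p by (intro powr_mono2) auto
    also have "\<dots> = (\<tau> powr p)\<^sup>2 * (1 + \<zeta>\<^sup>2) powr p"
      using \<tau>0 by (simp add: powr_mult power2_eq_square)
    finally have "(1 + (\<tau> * \<zeta>)\<^sup>2) powr p * (cmod (fourier bump \<zeta>) / \<tau>)\<^sup>2
        \<le> (\<tau> powr p)\<^sup>2 * (1 + \<zeta>\<^sup>2) powr p * (cmod (fourier bump \<zeta>) / \<tau>)\<^sup>2"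
      by (rule mult_right_mono) simp
    then show ?thesis using \<tau>0 by (simp add: b_def W_def norm_divide power_divide)
  qed
  define V where "V \<xi> = (1 + \<xi>\<^sup>2) powr p * (cmod (b \<xi>))\<^sup>2" for \<xi> :: real
  have mV: "V \<in> borel_measurable borel" unfolding V_def[abs_def] using mb by simp
  have iV': "integrable lborel (\<lambda>\<zeta>. V (0 + \<tau> * \<zeta>))"
  proof (rule Bochner_Integration.integrable_bound)
    show "integrable lborel (\<lambda>\<zeta>. (\<tau> powr p)\<^sup>2 / \<tau>\<^sup>2 * W \<zeta>)" by (intro integrable_mult_right iW)
    show "(\<lambda>\<zeta>. V (0 + \<tau> * \<zeta>)) \<in> borel_measurable lborel"
      using measurable_compose[OF _ mV, of "\<lambda>\<zeta>. 0 + \<tau> * \<zeta>" borel] by simp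
    show "AE \<zeta> in lborel. norm (V (0 + \<tau> * \<zeta>)) \<le> norm ((\<tau> powr p)\<^sup>2 / \<tau>\<^sup>2 * W \<zeta>)"
      using sc by (intro AE_I2) (auto simp: V_def W_def abs_mult intro: order_trans)
  qed
  have iV: "integrable lborel V"
    using lborel_integrable_real_affine_iff[OF \<tau>0(2), of V 0] iV' by simp
  have LV: "(LINT \<xi>|lborel. V \<xi>) \<le> (\<tau> powr p)\<^sup>2 * (LINT \<zeta>|lborel. W \<zeta>)"
  proof -
    have "(LINT \<xi>|lborel. V \<xi>) = \<tau> * (LINT \<zeta>|lborel. V (0 + \<tau> * \<zeta>))"
      using lborel_integral_real_affine[of \<tau> V 0] \<tau>0 by simp
    also have "\<dots> \<le> \<tau> * (LINT \<zeta>|lborel. (\<tau> powr p)\<^sup>2 / \<tau>\<^sup>2 * W \<zeta>)"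
      using sc \<tau>0 by (intro mult_left_mono integral_mono iV' integrable_mult_right iW) (auto simp: V_def)
    also have "\<dots> = (1 / \<tau>) * ((\<tau> powr p)\<^sup>2 * (LINT \<zeta>|lborel. W \<zeta>))"
      using \<tau>0 by (simp add: power2_eq_square)
    also have "\<dots> \<le> 1 * ((\<tau> powr p)\<^sup>2 * (LINT \<zeta>|lborel. W \<zeta>))"
      using \<tau> by (intro mult_right_mono mult_nonneg_nonneg integral_nonneg_AE) (auto simp: W_def)
    finally show ?thesis by simp
  qed
  have iG: "integrable lborel (\<lambda>\<xi>. (1 + \<xi>\<^sup>2) powr p * (cmod (g \<xi>))\<^sup>2)"
  proof (rule Bochner_Integration.integrable_bound)
    show "integrable lborel (\<lambda>\<xi>. E\<^sup>2 * V \<xi>)" by (intro integrable_mult_right iV)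
    show "AE \<xi> in lborel. norm ((1 + \<xi>\<^sup>2) powr p * (cmod (g \<xi>))\<^sup>2) \<le> norm (E\<^sup>2 * V \<xi>)"
      using bnd by (intro AE_I2) (auto simp: V_def abs_mult)
  qed (use mg in simp)
  have ext: "sobolev_extension p I (distr_of I h) g"
    unfolding sobolev_extension_def
  proof (intro conjI ballI iG)
    fix \<phi> assume \<phi>: "\<phi> \<in> test_functions I"
    have "(LINT \<xi>|lborel. g \<xi> * fourier \<phi> (- \<xi>)) / (2 * pi) = (LINT x|lborel. complex_of_real (h x * \<phi> x))"
      unfolding fourier_pairing[OF ig integrable_test_function[OF \<phi>]] syn by (simp add: mult.commute)
    also have "\<dots> = complex_of_real (distr_of I h \<phi>)" unfolding distr_of_test_LINT[OF \<phi>] by (rule integral_complex_of_real)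
    finally show "complex_of_real (distr_of I h \<phi>) = (LINT \<xi>|lborel. g \<xi> * fourier \<phi> (- \<xi>)) / (2 * pi)" ..
  qed (use mg in simp)
  have "weighted_norm p g \<le> sqrt (E\<^sup>2 * (\<tau> powr p)\<^sup>2 * ((LINT \<zeta>|lborel. W \<zeta>) / (2 * pi)))"
  proof -
    have "(LINT \<xi>|lborel. (1 + \<xi>\<^sup>2) powr p * (cmod (g \<xi>))\<^sup>2) \<le> (LINT \<xi>|lborel. E\<^sup>2 * V \<xi>)"
      by (intro integral_mono iG integrable_mult_right iV) (use bnd in \<open>simp add: V_def\<close>)
    also have "\<dots> \<le> E\<^sup>2 * ((\<tau> powr p)\<^sup>2 * (LINT \<zeta>|lborel. W \<zeta>))"
      using LV by (simp add: mult_left_mono)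
    finally show ?thesis unfolding weighted_norm_def
      by (intro real_sqrt_le_mono) (simp add: divide_right_mono mult.assoc)
  qed
  also have "\<dots> = E * \<tau> powr p * weighted_norm p (fourier bump)"
    using E by (simp add: weighted_norm_def W_def real_sqrt_mult real_sqrt_divide)
  finally show ?thesis using that ext unfolding E_def by blast
qed

section \<open>Regularity of solutions in the energy space\<close>

lemma distr_of_linear:
  assumes "continuous_on {a..b} p" "continuous_on {a..b} q"
  shows "(\<lambda>\<phi>. c * distr_of {a<..<b} p \<phi> + d * distr_of {a<..<b} q \<phi>) = distr_of {a<..<b} (\<lambda>x. c * p x + d * q x)"
proof
  fix \<phi>
  show "c * distr_of {a<..<b} p \<phi> + d * distr_of {a<..<b} q \<phi> = distr_of {a<..<b} (\<lambda>x. c * p x + d * q x) \<phi>"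
  proof (cases "\<phi> \<in> test_functions {a<..<b}")
    case True
    then have cp: "continuous_on {a..b} \<phi>" unfolding test_functions_iff by (simp add: smooth_continuous)
    have "integral {a..b} (\<lambda>x. (c * p x + d * q x) * \<phi> x)
        = integral {a..b} (\<lambda>x. c * (p x * \<phi> x) + d * (q x * \<phi> x))"
      by (simp add: algebra_simps)
    also have "\<dots> = integral {a..b} (\<lambda>x. c * (p x * \<phi> x)) + integral {a..b} (\<lambda>x. d * (q x * \<phi> x))"
      by (rule Henstock_Kurzweil_Integration.integral_add)
         (intro integrable_continuous_interval continuous_intros assms cp)+
    finally show ?thesis
      using True assms by (simp add: distr_of_integral continuous_intros)
  qed (simp add: distr_of_def)
qed

lemma sobolev_difference_quotient:
  assumes "u \<in> sobolev r I" "v \<in> sobolev r I" "w \<in> sobolev r I"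
  shows "(\<lambda>\<phi>. (u \<phi> - v \<phi>) / h - w \<phi>) \<in> sobolev r I"
proof -
  have "(\<lambda>\<phi>. 1 * u \<phi> + (-1) * v \<phi>) \<in> sobolev r I" by (rule sobolev_linear[OF assms(1,2)])
  from sobolev_linear[OF this assms(3), of "1 / h" "-1"] show ?thesis by simp
qed

lemma sobolev_difference:
  assumes "u \<in> sobolev r I" "v \<in> sobolev r I" shows "(\<lambda>\<phi>. u \<phi> - v \<phi>) \<in> sobolev r I"
  using sobolev_linear[OF assms, of 1 "-1"] by simp

lemma has_derivative_if_bounded_by_null:
  fixes f :: "real \<Rightarrow> real"
  assumes "\<And>\<tau>. \<tau> \<in> S \<Longrightarrow> \<tau> \<noteq> t \<Longrightarrow> \<bar>(f \<tau> - f t) / (\<tau> - t) - D\<bar> \<le> K * N \<tau>"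
    and "(N \<longlongrightarrow> 0) (at t within S)"
  shows "(f has_real_derivative D) (at t within S)"
proof -
  have "((\<lambda>\<tau>. (f \<tau> - f t) / (\<tau> - t) - D) \<longlongrightarrow> 0) (at t within S)"
  proof (rule Lim_null_comparison)
    show "((\<lambda>\<tau>. K * N \<tau>) \<longlongrightarrow> 0) (at t within S)" using tendsto_mult_left[OF assms(2), of K] by simp
    show "\<forall>\<^sub>F \<tau> in at t within S. norm ((f \<tau> - f t) / (\<tau> - t) - D) \<le> K * N \<tau>"
      using assms(1) by (simp add: eventually_at_filter)
  qed
  from tendsto_add[OF this tendsto_const[of D]]
  show ?thesis by (simp add: has_field_derivative_iff)
qed

text \<open>
  Continuity in time with values in a norm that controls the supremum, together with continuity in
  space at each time.
\<close>
lemma jointly_continuous: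
  fixes q :: "real \<times> real \<Rightarrow> real"
  assumes c: "\<And>t. t \<in> B \<Longrightarrow> continuous_on A (\<lambda>x. q (x, t))"
    and l: "\<And>t. t \<in> B \<Longrightarrow> (N t \<longlongrightarrow> 0) (at t within B)"
    and b: "\<And>x t \<tau>. x \<in> A \<Longrightarrow> t \<in> B \<Longrightarrow> \<tau> \<in> B \<Longrightarrow> \<bar>q (x, \<tau>) - q (x, t)\<bar> \<le> K * N t \<tau>"
  shows "continuous_on (A \<times> B) q"
  unfolding continuous_on_iff
proof (intro ballI allI impI)
  fix z e assume z: "z \<in> A \<times> B" and e: "(0::real) < e"
  obtain x t where zt: "z = (x, t)" and x: "x \<in> A" and t: "t \<in> B" using z by auto
  obtain d1 where d1: "d1 > 0" "\<And>y. y \<in> A \<Longrightarrow> dist y x < d1 \<Longrightarrow> dist (q (y, t)) (q (x, t)) < e / 2"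
    using c[OF t, unfolded continuous_on_iff, rule_format, OF x, of "e / 2"] e by auto
  have "((\<lambda>\<tau>. K * N t \<tau>) \<longlongrightarrow> 0) (at t within B)" using tendsto_mult_left[OF l[OF t], of K] by simp
  then have "\<forall>\<^sub>F \<tau> in at t within B. dist (K * N t \<tau>) 0 < e / 2" using e by (intro tendstoD) auto
  then obtain d2 where d2: "d2 > 0" "\<And>\<tau>. \<tau> \<in> B \<Longrightarrow> \<tau> \<noteq> t \<Longrightarrow> dist \<tau> t < d2 \<Longrightarrow> \<bar>K * N t \<tau>\<bar> < e / 2"
    unfolding eventually_at by auto
  show "\<exists>d>0. \<forall>z'\<in>A \<times> B. dist z' z < d \<longrightarrow> dist (q z') (q z) < e"
  proof (intro exI conjI ballI impI)
    fix z' assume z': "z' \<in> A \<times> B" "dist z' z < min d1 d2"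
    obtain y \<tau> where yz: "z' = (y, \<tau>)" and y: "y \<in> A" and \<tau>: "\<tau> \<in> B" using z'(1) by auto
    have "dist y x < d1" "dist \<tau> t < d2"
      using z'(2) dist_fst_le[of z' z] dist_snd_le[of z' z] by (auto simp: yz zt)
    moreover have "\<bar>q (y, \<tau>) - q (y, t)\<bar> < e / 2"
    proof (cases "\<tau> = t")
      case False
      then show ?thesis using b[OF y t \<tau>] d2(2)[OF \<tau> False \<open>dist \<tau> t < d2\<close>] by linarith
    qed (use e in simp)
    moreover have "\<bar>q (y, t) - q (x, t)\<bar> < e / 2" using d1(2)[OF y \<open>dist y x < d1\<close>] by (simp add: dist_real_def)
    ultimately have "\<bar>q (y, \<tau>) - q (x, t)\<bar> < e" by argo
    then show "dist (q z') (q z) < e" unfolding yz zt dist_real_def .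
  qed (use d1 d2 in auto)
qed

lemma integral_by_parts_test:
  fixes q q' :: "real \<Rightarrow> real"
  assumes ab: "a < b" and d: "\<And>x. x \<in> {a..b} \<Longrightarrow> (q has_real_derivative q' x) (at x within {a..b})"
    and c: "continuous_on {a..b} q'" and \<phi>: "\<phi> \<in> test_functions {a<..<b}"
  shows "integral {a..b} (\<lambda>x. q x * deriv \<phi> x) = - integral {a..b} (\<lambda>x. q' x * \<phi> x)"
proof -
  have sm: "smooth \<phi>" and s: "supp \<phi> \<subseteq> {a<..<b}" using \<phi> unfolding test_functions_iff by auto
  have "a \<notin> supp \<phi>" "b \<notin> supp \<phi>" using subsetD[OF s, of a] subsetD[OF s, of b] by auto
  then have z: "\<phi> a = 0" "\<phi> b = 0" by (simp_all add: not_in_supp)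
  have cq: "continuous_on {a..b} q" using d by (meson DERIV_continuous_on)
  have "((\<lambda>x. q' x * \<phi> x + q x * deriv \<phi> x) has_integral q b * \<phi> b - q a * \<phi> a) {a..b}"
  proof (rule fundamental_theorem_of_calculus)
    fix x assume x: "x \<in> {a..b}"
    have "((\<lambda>x. q x * \<phi> x) has_real_derivative q' x * \<phi> x + q x * deriv \<phi> x) (at x within {a..b})"
      using DERIV_mult[OF d[OF x] has_field_derivative_at_within[OF smooth_has_deriv[OF sm, of x]]]
      by (simp add: mult.commute add.commute)
    then show "((\<lambda>x. q x * \<phi> x) has_vector_derivative q' x * \<phi> x + q x * deriv \<phi> x) (at x within {a..b})"
      by (simp add: has_real_derivative_iff_has_vector_derivative)
  qed (use ab in simp)
  then have "integral {a..b} (\<lambda>x. q' x * \<phi> x + q x * deriv \<phi> x) = 0" using z by (simp add: integral_unique)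
  moreover have "integral {a..b} (\<lambda>x. q' x * \<phi> x + q x * deriv \<phi> x)
      = integral {a..b} (\<lambda>x. q' x * \<phi> x) + integral {a..b} (\<lambda>x. q x * deriv \<phi> x)"
    by (rule Henstock_Kurzweil_Integration.integral_add)
       (intro integrable_continuous_interval continuous_intros c cq smooth_continuous sm smooth_deriv)+
  ultimately show ?thesis by simp
qed

lemma energy_space_C_curve:
  assumes "U \<in> energy_space I T (s + 1)" "s \<ge> 1"
  shows "C_curve T 0 (real (s + 1)) I U" "C_curve T 1 (real s) I U" "C_curve T 2 (real (s - 1)) I U"
proof -
  have "\<forall>k\<le>s + 1. C_curve T k (real (s + 1 - k)) I U" using assms(1) by (simp add: energy_space_def)
  from this[rule_format, of 0] this[rule_format, of 1] this[rule_format, of 2]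
  show "C_curve T 0 (real (s + 1)) I U" "C_curve T 1 (real s) I U" "C_curve T 2 (real (s - 1)) I U"
    using assms(2) by (auto simp: numeral_2_eq_2)
qed

lemma C_curve_mem: "C_curve T k r I U \<Longrightarrow> j \<le> k \<Longrightarrow> t \<in> {0..T} \<Longrightarrow> (curve_deriv T ^^ j) U t \<in> sobolev r I"
  by (simp add: C_curve_def)

lemma C_curve_cont: "C_curve T k r I U \<Longrightarrow> j \<le> k \<Longrightarrow> t \<in> {0..T} \<Longrightarrow>
  ((\<lambda>\<tau>. sobolev_norm r I (\<lambda>\<phi>. (curve_deriv T ^^ j) U \<tau> \<phi> - (curve_deriv T ^^ j) U t \<phi>)) \<longlongrightarrow> 0) (at t within {0..T})"
  by (simp add: C_curve_def)

lemma C_curve_deriv: "C_curve T k r I U \<Longrightarrow> j < k \<Longrightarrow> t \<in> {0..T} \<Longrightarrow>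
  ((\<lambda>\<tau>. sobolev_norm r I (\<lambda>\<phi>. ((curve_deriv T ^^ j) U \<tau> \<phi> - (curve_deriv T ^^ j) U t \<phi>) / (\<tau> - t)
     - (curve_deriv T ^^ Suc j) U t \<phi>)) \<longlongrightarrow> 0) (at t within {0..T})"
  unfolding C_curve_def by blast

text \<open>
  The derivative of a curve is defined through test functions; convergence of its difference
  quotients in norm shows that these derivatives exist.
\<close>
lemma C_curve_pairing_derivative:
  assumes C: "C_curve T k r I U" and j: "j < k" and t: "t \<in> {0..T}" and \<phi>: "\<phi> \<in> test_functions I"
  shows "((\<lambda>\<tau>. (curve_deriv T ^^ j) U \<tau> \<phi>) has_real_derivative (curve_deriv T ^^ Suc j) U t \<phi>) (at t within {0..T})"
proof (rule has_derivative_if_bounded_by_null[OF _ C_curve_deriv[OF C j t]])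
  fix \<tau> assume \<tau>: "\<tau> \<in> {0..T}"
  have "(\<lambda>\<phi>. ((curve_deriv T ^^ j) U \<tau> \<phi> - (curve_deriv T ^^ j) U t \<phi>) / (\<tau> - t) - (curve_deriv T ^^ Suc j) U t \<phi>) \<in> sobolev r I"
    using j by (intro sobolev_difference_quotient C_curve_mem[OF C] \<tau> t) auto
  from sobolev_pairing_bound[OF this \<phi>]
  show "\<bar>((curve_deriv T ^^ j) U \<tau> \<phi> - (curve_deriv T ^^ j) U t \<phi>) / (\<tau> - t) - (curve_deriv T ^^ Suc j) U t \<phi>\<bar>
     \<le> weighted_norm (- r) (fourier \<phi>) * sobolev_norm r I (\<lambda>\<phi>. ((curve_deriv T ^^ j) U \<tau> \<phi> - (curve_deriv T ^^ j) U t \<phi>) / (\<tau> - t)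
     - (curve_deriv T ^^ Suc j) U t \<phi>)" .
qed

text \<open>
  A solution is continuous in time with values in \<open>H^(s+1)\<close>, and \<open>s + 1 \<ge> 2\<close>, so \<open>u\<close> and \<open>u_x\<close> are
  continuous up to the boundary. It is differentiable in time with values in \<open>H^s\<close>, and \<open>s \<ge> 1\<close>, so
  the difference quotients in time converge uniformly in space.
\<close>
lemma is_solution_C1:
  fixes u a :: "real \<times> real \<Rightarrow> real"
  assumes ab: "\<alpha> < \<beta>" and T: "T > 0" and s: "s \<ge> 1"
    and sol: "is_solution {\<alpha><..<\<beta>} T s m a f u"
  obtains ux ut where
    "continuous_on ({\<alpha>..\<beta>} \<times> {0..T}) u" "continuous_on ({\<alpha>..\<beta>} \<times> {0..T}) ux" "continuous_on ({\<alpha>..\<beta>} \<times> {0..T}) ut"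
    "\<And>x t. x \<in> {\<alpha>..\<beta>} \<Longrightarrow> t \<in> {0..T} \<Longrightarrow> ((\<lambda>y. u (y, t)) has_real_derivative ux (x, t)) (at x within {\<alpha>..\<beta>})"
    "\<And>x t. x \<in> {\<alpha>..\<beta>} \<Longrightarrow> t \<in> {0..T} \<Longrightarrow> ((\<lambda>\<tau>. u (x, \<tau>)) has_real_derivative ut (x, t)) (at t within {0..T})"
    "\<And>t. t \<in> {0..T} \<Longrightarrow> curve_deriv T (\<lambda>t. distr_of {\<alpha><..<\<beta>} (\<lambda>x. u (x, t))) t = distr_of {\<alpha><..<\<beta>} (\<lambda>x. ut (x, t))"
proof -
  let ?I = "{\<alpha><..<\<beta>}"
  define U where "U = (\<lambda>t. distr_of ?I (\<lambda>x. u (x, t)))"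
  define V where "V = curve_deriv T U"
  have cu: "continuous_on {\<alpha>..\<beta>} (\<lambda>x. u (x, t))" if "t \<in> {0..T}" for t
    using sol that ab unfolding is_solution_def by (simp add: Let_def)
  have en: "U \<in> energy_space ?I T (s + 1)"
    using sol unfolding is_solution_def U_def by (simp add: Let_def)
  note C0 = energy_space_C_curve(1)[OF en s] and C1 = energy_space_C_curve(2)[OF en s]
  have memU: "U t \<in> sobolev (real (s + 1)) ?I" if "t \<in> {0..T}" for t
    using C_curve_mem[OF C0, of 0 t] that by simp
  have memU': "U t \<in> sobolev (real s) ?I" if "t \<in> {0..T}" for t
    using C_curve_mem[OF C1, of 0 t] that by simp
  have memV: "V t \<in> sobolev (real s) ?I" if "t \<in> {0..T}" for t
    using C_curve_mem[OF C1, of 1 t] that by (simp add: V_def)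
  have r2: "real (s + 1) \<ge> 2" and r1: "real s \<ge> 1" using s by auto
  define N where "N t \<tau> = sobolev_norm (real (s + 1)) ?I (\<lambda>\<phi>. U \<tau> \<phi> - U t \<phi>)" for t \<tau>
  have N0: "(N t \<longlongrightarrow> 0) (at t within {0..T})" if "t \<in> {0..T}" for t
    using C_curve_cont[OF C0, of 0 t] that by (simp add: N_def[abs_def])
  have diffU: "(\<lambda>\<phi>. U \<tau> \<phi> - U t \<phi>) = distr_of ?I (\<lambda>x. u (x, \<tau>) - u (x, t))" if "t \<in> {0..T}" "\<tau> \<in> {0..T}" for t \<tau>
    using distr_of_linear[OF cu[OF that(2)] cu[OF that(1)], of 1 "-1"] by (simp add: U_def)
  have cdiff: "continuous_on {\<alpha>..\<beta>} (\<lambda>x. u (x, \<tau>) - u (x, t))" if "t \<in> {0..T}" "\<tau> \<in> {0..T}" for t \<tau>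
    by (intro continuous_intros cu that)
  have memdiff: "distr_of ?I (\<lambda>x. u (x, \<tau>) - u (x, t)) \<in> sobolev (real (s + 1)) ?I" if "t \<in> {0..T}" "\<tau> \<in> {0..T}" for t \<tau>
    unfolding diffU[OF that, symmetric] by (intro sobolev_difference memU that)
  have ujc: "continuous_on ({\<alpha>..\<beta>} \<times> {0..T}) u"
  proof (rule jointly_continuous[OF cu N0])
    fix x t \<tau> assume x: "x \<in> {\<alpha>..\<beta>}" and t: "t \<in> {0..T}" "\<tau> \<in> {0..T}"
    show "\<bar>u (x, \<tau>) - u (x, t)\<bar> \<le> embedding_const (real (s + 1)) 0 * N t \<tau>"
      using sobolev_sup_bound[OF ab cdiff[OF t] _ memdiff[OF t] x] r2 by (simp add: N_def diffU[OF t])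
  qed
  have "\<forall>t\<in>{0..T}. \<exists>q'. continuous_on {\<alpha>..\<beta>} q' \<and> (\<forall>x\<in>{\<alpha>..\<beta>}. ((\<lambda>x. u (x, t)) has_real_derivative q' x) (at x within {\<alpha>..\<beta>}))"
    using sobolev_C1[OF ab cu r2] memU unfolding U_def by blast
  then obtain q' where q'0: "\<forall>t\<in>{0..T}. continuous_on {\<alpha>..\<beta>} (q' t) \<and>
      (\<forall>x\<in>{\<alpha>..\<beta>}. ((\<lambda>x. u (x, t)) has_real_derivative q' t x) (at x within {\<alpha>..\<beta>}))"
    by (rule bchoice[THEN exE])
  have q': "continuous_on {\<alpha>..\<beta>} (q' t)" if "t \<in> {0..T}" for t using q'0 that by blast
  have dq': "((\<lambda>x. u (x, t)) has_real_derivative q' t x) (at x within {\<alpha>..\<beta>})" if "t \<in> {0..T}" "x \<in> {\<alpha>..\<beta>}" for x t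
    using q'0 that by blast
  define ux where "ux = (\<lambda>(x, t). q' t x)"
  have uxjc: "continuous_on ({\<alpha>..\<beta>} \<times> {0..T}) ux"
  proof (rule jointly_continuous[OF _ N0])
    fix t assume "t \<in> {0..T}"
    then show "continuous_on {\<alpha>..\<beta>} (\<lambda>x. ux (x, t))" using q'[of t] by (simp add: ux_def)
  next
    fix x t \<tau> assume x: "x \<in> {\<alpha>..\<beta>}" and t: "t \<in> {0..T}" "\<tau> \<in> {0..T}"
    obtain p where p: "((\<lambda>x. u (x, \<tau>) - u (x, t)) has_real_derivative p x) (at x within {\<alpha>..\<beta>})"
      "\<bar>p x\<bar> \<le> embedding_const (real (s + 1)) 1 * sobolev_norm (real (s + 1)) ?I (distr_of ?I (\<lambda>x. u (x, \<tau>) - u (x, t)))"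
      using sobolev_C1[OF ab cdiff[OF t] r2 memdiff[OF t]] x by blast
    have "((\<lambda>x. u (x, \<tau>) - u (x, t)) has_real_derivative q' \<tau> x - q' t x) (at x within {\<alpha>..\<beta>})"
      by (intro DERIV_diff dq' t x)
    moreover have "at x within {\<alpha>..\<beta>} \<noteq> bot" using ab x by (simp add: trivial_limit_within islimpt_Icc)
    ultimately have "p x = q' \<tau> x - q' t x" using has_field_derivative_unique[OF p(1)] by blast
    then show "\<bar>ux (x, \<tau>) - ux (x, t)\<bar> \<le> embedding_const (real (s + 1)) 1 * N t \<tau>"
      using p(2) by (simp add: ux_def N_def diffU[OF t])
  qed
  have "\<forall>t\<in>{0..T}. \<exists>q. continuous_on UNIV q \<and> V t = distr_of ?I q"
    using sobolev_continuous_representative[OF memV r1] by metis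
  then obtain w where w0: "\<forall>t\<in>{0..T}. continuous_on UNIV (w t) \<and> V t = distr_of ?I (w t)" by (rule bchoice[THEN exE])
  have w: "continuous_on {\<alpha>..\<beta>} (w t)" "V t = distr_of ?I (w t)" if "t \<in> {0..T}" for t
    using w0 that continuous_on_subset by blast+
  define ut where "ut = (\<lambda>(x, t). w t x)"
  define N1 where "N1 t \<tau> = sobolev_norm (real s) ?I (\<lambda>\<phi>. V \<tau> \<phi> - V t \<phi>)" for t \<tau>
  have N1: "(N1 t \<longlongrightarrow> 0) (at t within {0..T})" if "t \<in> {0..T}" for t
    using C_curve_cont[OF C1, of 1 t] that by (simp add: N1_def[abs_def] V_def)
  have utjc: "continuous_on ({\<alpha>..\<beta>} \<times> {0..T}) ut"
  proof (rule jointly_continuous[OF _ N1])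
    fix t assume "t \<in> {0..T}"
    then show "continuous_on {\<alpha>..\<beta>} (\<lambda>x. ut (x, t))" using w(1)[of t] by (simp add: ut_def)
  next
    fix x t \<tau> assume x: "x \<in> {\<alpha>..\<beta>}" and t: "t \<in> {0..T}" "\<tau> \<in> {0..T}"
    have e: "(\<lambda>\<phi>. V \<tau> \<phi> - V t \<phi>) = distr_of ?I (\<lambda>x. w \<tau> x - w t x)"
      using distr_of_linear[OF w(1)[OF t(2)] w(1)[OF t(1)], of 1 "-1"] w(2)[OF t(1)] w(2)[OF t(2)] by simp
    have m: "distr_of ?I (\<lambda>x. w \<tau> x - w t x) \<in> sobolev (real s) ?I"
      unfolding e[symmetric] by (intro sobolev_difference memV t)
    have c: "continuous_on {\<alpha>..\<beta>} (\<lambda>x. w \<tau> x - w t x)" by (intro continuous_intros w t)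
    show "\<bar>ut (x, \<tau>) - ut (x, t)\<bar> \<le> embedding_const (real s) 0 * N1 t \<tau>"
      using sobolev_sup_bound[OF ab c r1 m x] by (simp add: N1_def e ut_def)
  qed
  define N2 where "N2 t \<tau> = sobolev_norm (real s) ?I (\<lambda>\<phi>. (U \<tau> \<phi> - U t \<phi>) / (\<tau> - t) - V t \<phi>)" for t \<tau>
  have N2: "(N2 t \<longlongrightarrow> 0) (at t within {0..T})" if "t \<in> {0..T}" for t
    using C_curve_deriv[OF C1, of 0 t] that by (simp add: N2_def[abs_def] V_def)
  have dut: "((\<lambda>\<tau>. u (x, \<tau>)) has_real_derivative ut (x, t)) (at t within {0..T})"
    if x: "x \<in> {\<alpha>..\<beta>}" and t: "t \<in> {0..T}" for x t
  proof (rule has_derivative_if_bounded_by_null[OF _ N2[OF t]])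
    fix \<tau> assume \<tau>: "\<tau> \<in> {0..T}"
    have e: "(\<lambda>\<phi>. (U \<tau> \<phi> - U t \<phi>) / (\<tau> - t) - V t \<phi>) = distr_of ?I (\<lambda>x. (u (x, \<tau>) - u (x, t)) / (\<tau> - t) - w t x)"
    proof
      fix \<phi>
      have "U \<tau> \<phi> - U t \<phi> = distr_of ?I (\<lambda>x. u (x, \<tau>) - u (x, t)) \<phi>" using fun_cong[OF diffU[OF t \<tau>], of \<phi>] by simp
      then show "(U \<tau> \<phi> - U t \<phi>) / (\<tau> - t) - V t \<phi> = distr_of ?I (\<lambda>x. (u (x, \<tau>) - u (x, t)) / (\<tau> - t) - w t x) \<phi>"
        using fun_cong[OF distr_of_linear[OF cdiff[OF t \<tau>] w(1)[OF t], of "1 / (\<tau> - t)" "-1"], of \<phi>] w(2)[OF t] by simp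
    qed
    have m: "distr_of ?I (\<lambda>x. (u (x, \<tau>) - u (x, t)) / (\<tau> - t) - w t x) \<in> sobolev (real s) ?I"
      unfolding e[symmetric] by (intro sobolev_difference_quotient memU' memV t \<tau>)
    have c: "continuous_on {\<alpha>..\<beta>} (\<lambda>x. (u (x, \<tau>) - u (x, t)) / (\<tau> - t) - w t x)"
    proof (cases "\<tau> = t")
      case False
      then show ?thesis by (intro continuous_intros cu w t \<tau>) auto
    qed (simp add: w(1)[OF t] continuous_intros)
    show "\<bar>(u (x, \<tau>) - u (x, t)) / (\<tau> - t) - ut (x, t)\<bar> \<le> embedding_const (real s) 0 * N2 t \<tau>"
      using sobolev_sup_bound[OF ab c r1 m x] by (simp add: N2_def e ut_def)
  qed
  show ?thesis
  proof (rule that[OF ujc uxjc utjc _ dut])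
    show "((\<lambda>y. u (y, t)) has_real_derivative ux (x, t)) (at x within {\<alpha>..\<beta>})" if "x \<in> {\<alpha>..\<beta>}" "t \<in> {0..T}" for x t
      using dq'[OF that(2,1)] by (simp add: ux_def)
    show "curve_deriv T (\<lambda>t. distr_of ?I (\<lambda>x. u (x, t))) t = distr_of ?I (\<lambda>x. ut (x, t))" if "t \<in> {0..T}" for t
      using w(2)[OF that] by (simp add: V_def U_def ut_def)
  qed
qed

text \<open>
  The equation \<open>u_tt - u_xx + g = 0\<close>, integrated once in time. Second derivatives of \<open>u\<close> need not
  exist, but \<open>A = \<integral>\<^sub>0\<^sup>t u_x\<close> is continuously differentiable: \<open>A_t = u_x\<close> and
  \<open>A_x = u_t - u_t(0) + \<integral>\<^sub>0\<^sup>t g\<close>. The functions \<open>u\<close>, \<open>A\<close> thus solve a classical first-order system.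
\<close>
definition weak_wave ::
  "real \<Rightarrow> real \<Rightarrow> real \<Rightarrow> (real \<times> real \<Rightarrow> real) \<Rightarrow> (real \<times> real \<Rightarrow> real) \<Rightarrow> (real \<times> real \<Rightarrow> real)
    \<Rightarrow> (real \<times> real \<Rightarrow> real) \<Rightarrow> bool" where
  "weak_wave \<alpha> \<beta> T g u ux ut \<longleftrightarrow>
     continuous_on ({\<alpha>..\<beta>} \<times> {0..T}) g \<and> continuous_on ({\<alpha>..\<beta>} \<times> {0..T}) u
     \<and> continuous_on ({\<alpha>..\<beta>} \<times> {0..T}) ux \<and> continuous_on ({\<alpha>..\<beta>} \<times> {0..T}) ut
     \<and> (\<forall>x\<in>{\<alpha>..\<beta>}. \<forall>t\<in>{0..T}.
          ((\<lambda>y. u (y, t)) has_real_derivative ux (x, t)) (at x within {\<alpha>..\<beta>})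
        \<and> ((\<lambda>\<tau>. u (x, \<tau>)) has_real_derivative ut (x, t)) (at t within {0..T})
        \<and> ((\<lambda>y. integral {0..t} (\<lambda>\<tau>. ux (y, \<tau>))) has_real_derivative
              ut (x, t) - ut (x, 0) + integral {0..t} (\<lambda>\<tau>. g (x, \<tau>))) (at x within {\<alpha>..\<beta>}))"

lemma continuous_slice_x:
  assumes "continuous_on ({\<alpha>..\<beta>} \<times> {0..T}) f" "t \<in> {0..T}" shows "continuous_on {\<alpha>..\<beta>} (\<lambda>x. f (x, t))"
  by (rule continuous_on_compose2[OF assms(1)]) (use assms(2) in \<open>auto intro!: continuous_intros\<close>)

lemma continuous_slice_t:
  assumes "continuous_on ({\<alpha>..\<beta>} \<times> {0..T}) f" "x \<in> {\<alpha>..\<beta>}" "S \<subseteq> {0..T}" shows "continuous_on S (\<lambda>t. f (x, t))"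
  by (rule continuous_on_compose2[OF assms(1)]) (use assms(2,3) in \<open>auto intro!: continuous_intros\<close>)

lemma continuous_time_integral:
  fixes f :: "real \<times> real \<Rightarrow> real"
  assumes f: "continuous_on ({\<alpha>..\<beta>} \<times> {0..T}) f" and t: "t \<in> {0..T}"
  shows "continuous_on {\<alpha>..\<beta>} (\<lambda>x. integral {0..t} (\<lambda>\<tau>. f (x, \<tau>)))"
proof -
  have "continuous_on ({\<alpha>..\<beta>} \<times> cbox 0 t) (\<lambda>(x, \<tau>). f (x, \<tau>))"
    using continuous_on_subset[OF f, of "{\<alpha>..\<beta>} \<times> {0..t}"] t by (simp add: case_prod_beta Sigma_mono)
  from integral_continuous_on_param[OF this] show ?thesis by simp
qed

lemma integral_swap:
  fixes f :: "real \<times> real \<Rightarrow> real"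
  assumes f: "continuous_on ({\<alpha>..\<beta>} \<times> {0..T}) f" and t: "t \<in> {0..T}"
  shows "integral {0..t} (\<lambda>\<tau>. integral {\<alpha>..\<beta>} (\<lambda>x. f (x, \<tau>))) = integral {\<alpha>..\<beta>} (\<lambda>x. integral {0..t} (\<lambda>\<tau>. f (x, \<tau>)))"
proof -
  have "continuous_on (cbox (\<alpha>, 0) (\<beta>, t)) (\<lambda>(x, y). f (x, y))"
    using continuous_on_subset[OF f, of "cbox (\<alpha>, 0) (\<beta>, t)"] t by (simp add: case_prod_beta cbox_Pair_eq Sigma_mono)
  from integral_swap_continuous[OF this] show ?thesis by simp
qed

lemma FTC_within:
  fixes F :: "real \<Rightarrow> real"
  assumes "a \<le> b" "{a..b} \<subseteq> S" "\<And>x. x \<in> {a..b} \<Longrightarrow> (F has_real_derivative f x) (at x within S)"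
  shows "(f has_integral F b - F a) {a..b}"
  by (rule fundamental_theorem_of_calculus[OF assms(1)])
     (use assms(2,3) has_field_derivative_subset in \<open>force simp: has_real_derivative_iff_has_vector_derivative[symmetric]\<close>)

text \<open>
  Paired with a test function \<open>\<phi>\<close> and integrated in time, the equation says that \<open>\<integral>\<^sub>0\<^sup>t u_x\<close> has the weak
  derivative \<open>u_t + \<integral>\<^sub>0\<^sup>t a u^m\<close> in space. By the lemma of du Bois-Reymond the derivative is classical,
  because this function is continuous.
\<close>
lemma is_solution_weak_wave:
  fixes u a :: "real \<times> real \<Rightarrow> real"
  assumes ab: "\<alpha> < \<beta>" and T: "T > 0" and s: "s \<ge> 1" and ca: "continuous_on UNIV a"
    and sol: "is_solution {\<alpha><..<\<beta>} T s m a f u"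
  obtains ux ut where "weak_wave \<alpha> \<beta> T (\<lambda>z. a z * u z ^ m) u ux ut"
    "\<And>x. x \<in> {\<alpha>..\<beta>} \<Longrightarrow> u (x, 0) = 0" "\<And>x. x \<in> {\<alpha>..\<beta>} \<Longrightarrow> ut (x, 0) = 0"
proof -
  let ?I = "{\<alpha><..<\<beta>}" and ?R = "{\<alpha>..\<beta>} \<times> {0..T}"
  obtain ux ut where c: "continuous_on ?R u" "continuous_on ?R ux" "continuous_on ?R ut"
    and dx: "\<And>x t. x \<in> {\<alpha>..\<beta>} \<Longrightarrow> t \<in> {0..T} \<Longrightarrow> ((\<lambda>y. u (y, t)) has_real_derivative ux (x, t)) (at x within {\<alpha>..\<beta>})"
    and dt: "\<And>x t. x \<in> {\<alpha>..\<beta>} \<Longrightarrow> t \<in> {0..T} \<Longrightarrow> ((\<lambda>\<tau>. u (x, \<tau>)) has_real_derivative ut (x, t)) (at t within {0..T})"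
    and cd: "\<And>t. t \<in> {0..T} \<Longrightarrow> curve_deriv T (\<lambda>t. distr_of ?I (\<lambda>x. u (x, t))) t = distr_of ?I (\<lambda>x. ut (x, t))"
    using is_solution_C1[OF ab T s sol] by metis
  define g where "g = (\<lambda>z. a z * u z ^ m)"
  have cg: "continuous_on ?R g" unfolding g_def
    by (intro continuous_intros c continuous_on_subset[OF ca]) auto
  define U where "U = (\<lambda>t. distr_of ?I (\<lambda>x. u (x, t)))"
  have en: "U \<in> energy_space ?I T (s + 1)"
    using sol unfolding is_solution_def U_def by (simp add: Let_def)
  have eq: "curve_deriv T (curve_deriv T U) t \<phi> = U t (deriv (deriv \<phi>)) - distr_of ?I (\<lambda>x. g (x, t)) \<phi>"
    if "t \<in> {0..T}" "\<phi> \<in> test_functions ?I" for t \<phi>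
  proof -
    have "curve_deriv T (curve_deriv T U) t \<phi> - U t (deriv (deriv \<phi>)) + distr_of ?I (\<lambda>x. a (x, t) * u (x, t) ^ m) \<phi> = 0"
      using sol that unfolding is_solution_def U_def Let_def by blast
    then show ?thesis by (simp add: g_def)
  qed
  have U0: "U 0 \<phi> = 0" "curve_deriv T U 0 \<phi> = 0" for \<phi>
    using sol unfolding is_solution_def U_def Let_def by blast+
  have T0: "0 \<in> {0..T}" using T by simp
  have u0: "u (x, 0) = 0" if "x \<in> {\<alpha>..\<beta>}" for x
  proof (rule distr_of_inject[OF ab continuous_slice_x[OF c(1) T0] continuous_on_const _ that])
    show "distr_of ?I (\<lambda>x. u (x, 0)) = distr_of ?I (\<lambda>_. 0)"
      using U0(1) by (auto simp: U_def distr_of_def fun_eq_iff)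
  qed
  have ut0: "ut (x, 0) = 0" if "x \<in> {\<alpha>..\<beta>}" for x
  proof (rule distr_of_inject[OF ab continuous_slice_x[OF c(3) T0] continuous_on_const _ that])
    show "distr_of ?I (\<lambda>x. ut (x, 0)) = distr_of ?I (\<lambda>_. 0)"
      using U0(2) cd[OF T0] by (auto simp: U_def distr_of_def fun_eq_iff)
  qed
  have cons: "((\<lambda>y. integral {0..t} (\<lambda>\<tau>. ux (y, \<tau>))) has_real_derivative
              ut (x, t) - ut (x, 0) + integral {0..t} (\<lambda>\<tau>. g (x, \<tau>))) (at x within {\<alpha>..\<beta>})"
    if x: "x \<in> {\<alpha>..\<beta>}" and t: "t \<in> {0..T}" for x t
  proof -
    define A where "A y = integral {0..t} (\<lambda>\<tau>. ux (y, \<tau>))" for y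
    define k where "k y = ut (y, t) + integral {0..t} (\<lambda>\<tau>. g (y, \<tau>))" for y
    define K where "K y = integral {\<alpha>..y} k" for y
    have cA: "continuous_on {\<alpha>..\<beta>} A" unfolding A_def by (rule continuous_time_integral[OF c(2) t])
    have cG: "continuous_on {\<alpha>..\<beta>} (\<lambda>y. integral {0..t} (\<lambda>\<tau>. g (y, \<tau>)))" by (rule continuous_time_integral[OF cg t])
    have cut: "continuous_on {\<alpha>..\<beta>} (\<lambda>y. ut (y, t))" by (rule continuous_slice_x[OF c(3) t])
    have ck: "continuous_on {\<alpha>..\<beta>} k" unfolding k_def by (intro continuous_intros cut cG)
    have dK: "(K has_real_derivative k y) (at y within {\<alpha>..\<beta>})" if "y \<in> {\<alpha>..\<beta>}" for y
      unfolding K_def by (rule integral_has_real_derivative[OF ck that])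
    have cK: "continuous_on {\<alpha>..\<beta>} K" using dK by (meson DERIV_continuous_on)
    have z: "integral {\<alpha>..\<beta>} (\<lambda>y. (A y - K y) * deriv \<phi> y) = 0" if \<phi>: "\<phi> \<in> test_functions ?I" for \<phi>
    proof -
      note \<phi>1 = test_functions_deriv[OF \<phi>] and \<phi>2 = test_functions_deriv[OF test_functions_deriv[OF \<phi>]]
      have c\<phi>: "continuous_on S \<phi>" "continuous_on S (deriv \<phi>)" "continuous_on S (deriv (deriv \<phi>))" for S
        using \<phi> \<phi>1 \<phi>2 unfolding test_functions_iff by (auto intro: smooth_continuous)
      have c\<phi>R: "continuous_on S (\<lambda>z. \<phi> (fst z))" "continuous_on S (\<lambda>z. deriv \<phi> (fst z))" for S :: "(real \<times> real) set"
        by (rule continuous_on_compose2[OF c\<phi>(1)[of UNIV]], auto intro!: continuous_intros)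
           (rule continuous_on_compose2[OF c\<phi>(2)[of UNIV]], auto intro!: continuous_intros)
      define y where "y \<tau> = curve_deriv T U \<tau> \<phi>" for \<tau>
      have "(y has_real_derivative curve_deriv T (curve_deriv T U) \<tau> \<phi>) (at \<tau> within {0..T})" if "\<tau> \<in> {0..T}" for \<tau>
        using C_curve_pairing_derivative[OF energy_space_C_curve(3)[OF en s] _ that \<phi>, of 1]
        by (simp add: y_def[abs_def])
      then have "((\<lambda>\<tau>. curve_deriv T (curve_deriv T U) \<tau> \<phi>) has_integral y t - y 0) {0..t}"
        by (intro FTC_within[of 0 t "{0..T}"]) (use t in auto)
      moreover have "y 0 = 0" by (simp add: y_def U0)
      ultimately have "y t = integral {0..t} (\<lambda>\<tau>. curve_deriv T (curve_deriv T U) \<tau> \<phi>)" by (simp add: integral_unique)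
      also have "\<dots> = integral {0..t} (\<lambda>\<tau>. integral {\<alpha>..\<beta>} (\<lambda>x. - (ux (x, \<tau>) * deriv \<phi> x) - g (x, \<tau>) * \<phi> x))"
      proof (rule Henstock_Kurzweil_Integration.integral_cong)
        fix \<tau> assume "\<tau> \<in> {0..t}"
        then have \<tau>: "\<tau> \<in> {0..T}" using t by auto
        have "U \<tau> (deriv (deriv \<phi>)) = integral {\<alpha>..\<beta>} (\<lambda>x. u (x, \<tau>) * deriv (deriv \<phi>) x)"
          unfolding U_def by (rule distr_of_integral[OF continuous_slice_x[OF c(1) \<tau>] \<phi>2])
        also have "\<dots> = - integral {\<alpha>..\<beta>} (\<lambda>x. ux (x, \<tau>) * deriv \<phi> x)"
          by (rule integral_by_parts_test[OF ab dx[OF _ \<tau>] continuous_slice_x[OF c(2) \<tau>] \<phi>1])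
        finally have "curve_deriv T (curve_deriv T U) \<tau> \<phi> = - integral {\<alpha>..\<beta>} (\<lambda>x. ux (x, \<tau>) * deriv \<phi> x)
            - integral {\<alpha>..\<beta>} (\<lambda>x. g (x, \<tau>) * \<phi> x)"
          unfolding eq[OF \<tau> \<phi>] distr_of_integral[OF continuous_slice_x[OF cg \<tau>] \<phi>] by simp
        also have "\<dots> = integral {\<alpha>..\<beta>} (\<lambda>x. - (ux (x, \<tau>) * deriv \<phi> x) - g (x, \<tau>) * \<phi> x)"
          by (subst Henstock_Kurzweil_Integration.integral_diff)
             (auto intro!: integrable_continuous_interval continuous_intros c\<phi> continuous_slice_x[OF c(2) \<tau>] continuous_slice_x[OF cg \<tau>])
        finally show "curve_deriv T (curve_deriv T U) \<tau> \<phi> = integral {\<alpha>..\<beta>} (\<lambda>x. - (ux (x, \<tau>) * deriv \<phi> x) - g (x, \<tau>) * \<phi> x)" .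
      qed
      also have "\<dots> = integral {\<alpha>..\<beta>} (\<lambda>x. integral {0..t} (\<lambda>\<tau>. - (ux (x, \<tau>) * deriv \<phi> x) - g (x, \<tau>) * \<phi> x))"
        using integral_swap[of \<alpha> \<beta> T "\<lambda>z. - (ux z * deriv \<phi> (fst z)) - g z * \<phi> (fst z)" t] t
        by (simp add: continuous_intros c(2) cg c\<phi>R)
      also have "\<dots> = integral {\<alpha>..\<beta>} (\<lambda>x. - (A x * deriv \<phi> x) - integral {0..t} (\<lambda>\<tau>. g (x, \<tau>)) * \<phi> x)"
      proof (rule Henstock_Kurzweil_Integration.integral_cong)
        fix x assume x: "x \<in> {\<alpha>..\<beta>}"
        have st: "{0..t} \<subseteq> {0..T}" using t by auto
        show "integral {0..t} (\<lambda>\<tau>. - (ux (x, \<tau>) * deriv \<phi> x) - g (x, \<tau>) * \<phi> x) = - (A x * deriv \<phi> x) - integral {0..t} (\<lambda>\<tau>. g (x, \<tau>)) * \<phi> x"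
          by (subst Henstock_Kurzweil_Integration.integral_diff)
             (auto intro!: integrable_continuous_interval continuous_intros continuous_slice_t[OF c(2) x st] continuous_slice_t[OF cg x st] simp: A_def)
      qed
      finally have 1: "y t = integral {\<alpha>..\<beta>} (\<lambda>x. - (A x * deriv \<phi> x) - integral {0..t} (\<lambda>\<tau>. g (x, \<tau>)) * \<phi> x)" .
      have 2: "y t = integral {\<alpha>..\<beta>} (\<lambda>x. ut (x, t) * \<phi> x)"
        using distr_of_integral[OF cut \<phi>] cd[OF t] by (simp add: y_def U_def)
      have 3: "integral {\<alpha>..\<beta>} (\<lambda>x. K x * deriv \<phi> x) = - integral {\<alpha>..\<beta>} (\<lambda>x. k x * \<phi> x)"
        by (rule integral_by_parts_test[OF ab dK ck \<phi>])
      have 4: "integral {\<alpha>..\<beta>} (\<lambda>x. k x * \<phi> x) = integral {\<alpha>..\<beta>} (\<lambda>x. ut (x, t) * \<phi> x)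
          + integral {\<alpha>..\<beta>} (\<lambda>x. integral {0..t} (\<lambda>\<tau>. g (x, \<tau>)) * \<phi> x)"
        unfolding k_def distrib_right
        by (rule Henstock_Kurzweil_Integration.integral_add) (intro integrable_continuous_interval continuous_intros cut cG c\<phi>)+
      have 5: "integral {\<alpha>..\<beta>} (\<lambda>x. - (A x * deriv \<phi> x) - integral {0..t} (\<lambda>\<tau>. g (x, \<tau>)) * \<phi> x)
          = - integral {\<alpha>..\<beta>} (\<lambda>x. A x * deriv \<phi> x) - integral {\<alpha>..\<beta>} (\<lambda>x. integral {0..t} (\<lambda>\<tau>. g (x, \<tau>)) * \<phi> x)"
        by (subst Henstock_Kurzweil_Integration.integral_diff)
           (auto intro!: integrable_continuous_interval continuous_intros cA cG c\<phi>)
      have "integral {\<alpha>..\<beta>} (\<lambda>y. (A y - K y) * deriv \<phi> y)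
          = integral {\<alpha>..\<beta>} (\<lambda>x. A x * deriv \<phi> x) - integral {\<alpha>..\<beta>} (\<lambda>x. K x * deriv \<phi> x)"
        unfolding left_diff_distrib
        by (rule Henstock_Kurzweil_Integration.integral_diff) (intro integrable_continuous_interval continuous_intros cA cK c\<phi>)+
      then show ?thesis using 1 2 3 4 5 by simp
    qed
    define d where "d = A ((\<alpha> + \<beta>) / 2) - K ((\<alpha> + \<beta>) / 2)"
    have e: "K y + d = A y" if "y \<in> {\<alpha>..\<beta>}" for y
    proof -
      have "A y - K y = d"
        unfolding d_def by (rule du_Bois_Reymond[OF ab _ z that]) (intro continuous_intros cA cK)
      then show ?thesis by simp
    qed
    have "((\<lambda>y. K y + d) has_real_derivative k x + 0) (at x within {\<alpha>..\<beta>})"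
      by (intro DERIV_add dK[OF x] DERIV_const)
    then have "((\<lambda>y. K y + d) has_real_derivative k x) (at x within {\<alpha>..\<beta>})" by simp
    then have "(A has_real_derivative k x) (at x within {\<alpha>..\<beta>})"
      by (rule has_field_derivative_transform_within[OF _ zero_less_one x]) (rule e)
    then show ?thesis using ut0[OF x] by (simp add: A_def[abs_def] k_def)
  qed
  have "weak_wave \<alpha> \<beta> T g u ux ut"
    unfolding weak_wave_def using cg c dx dt cons by blast
  then show ?thesis using that u0 ut0 unfolding g_def by blast
qed

section \<open>A sup-norm bound by characteristics\<close>

text \<open>
  Continuity of one of the two partial derivatives is enough for total differentiability.
\<close>
lemma directional_derivative:
  fixes f fx ft :: "real \<times> real \<Rightarrow> real"
  assumes fx: "\<And>x t. x \<in> X \<Longrightarrow> t \<in> Y \<Longrightarrow> ((\<lambda>y. f (y, t)) has_real_derivative fx (x, t)) (at x within X)"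
    and ft: "\<And>x t. x \<in> X \<Longrightarrow> t \<in> Y \<Longrightarrow> ((\<lambda>\<tau>. f (x, \<tau>)) has_real_derivative ft (x, t)) (at t within Y)"
    and c: "continuous_on (X \<times> Y) ft" and Y: "convex Y" and z: "x \<in> X" "t \<in> Y"
  shows "(f has_derivative (\<lambda>(h, k). fx (x, t) * h + ft (x, t) * k)) (at (x, t) within X \<times> Y)"
proof -
  have "((\<lambda>(x, t). f (x, t)) has_derivative (\<lambda>(h, k). fx (x, t) * h + blinfun_apply (blinfun_mult_right (ft (x, t))) k)) (at (x, t) within X \<times> Y)"
  proof (rule has_derivative_partialsI[where fy = "\<lambda>x t. blinfun_mult_right (ft (x, t))"])
    show "((\<lambda>y. f (y, t)) has_derivative (*) (fx (x, t))) (at x within X)"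
      using fx[OF z] by (simp add: has_field_derivative_def)
    show "((\<lambda>\<tau>. f (y, \<tau>)) has_derivative blinfun_apply (blinfun_mult_right (ft (y, s)))) (at s within Y)"
      if "y \<in> X" "s \<in> Y" for y s
      using ft[OF that] by (simp add: has_field_derivative_def)
    have "continuous_on (X \<times> Y) (\<lambda>z. blinfun_mult_right (ft z))"
      by (intro bounded_linear.continuous_on[OF bounded_linear_blinfun_mult_right] c)
    then show "continuous (at (x, t) within X \<times> Y) (\<lambda>(x, t). blinfun_mult_right (ft (x, t)))"
      using z by (simp add: continuous_on_eq_continuous_within split_def)
  qed (use z Y in auto)
  then show ?thesis by simp
qed

lemma characteristic_step:
  fixes f fx ft :: "real \<times> real \<Rightarrow> real"
  assumes D: "\<And>x t. x \<in> X \<Longrightarrow> t \<in> Y \<Longrightarrow> (f has_derivative (\<lambda>(h, k). fx (x, t) * h + ft (x, t) * k)) (at (x, t) within X \<times> Y)"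
    and b: "\<And>x t. x \<in> X \<Longrightarrow> t \<in> Y \<Longrightarrow> \<bar>c * fx (x, t) - ft (x, t)\<bar> \<le> \<gamma>"
    and h: "h \<ge> 0" and line: "\<And>k. k \<in> {0..h} \<Longrightarrow> x + c * k \<in> X \<and> t - k \<in> Y"
  shows "\<bar>f (x + c * h, t - h) - f (x, t)\<bar> \<le> \<gamma> * h"
proof -
  define F where "F k = f (x + c * k, t - k)" for k
  have d: "(F has_real_derivative c * fx (x + c * k, t - k) - ft (x + c * k, t - k)) (at k within {0..h})" if k: "k \<in> {0..h}" for k
  proof -
    have i: "((\<lambda>k. (x + c * k, t - k)) has_derivative (\<lambda>k. (c * k, - k))) (at k within {0..h})"
      by (auto intro!: derivative_eq_intros)
    have im: "(\<lambda>k. (x + c * k, t - k)) ` {0..h} \<subseteq> X \<times> Y" using line by auto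
    have "(f has_derivative (\<lambda>(a, b). fx (x + c * k, t - k) * a + ft (x + c * k, t - k) * b))
        (at (x + c * k, t - k) within (\<lambda>k. (x + c * k, t - k)) ` {0..h})"
      using has_derivative_subset[OF D im] line[OF k] by blast
    from diff_chain_within[OF i this]
    have "(F has_derivative (\<lambda>l. fx (x + c * k, t - k) * (c * l) + ft (x + c * k, t - k) * (- l))) (at k within {0..h})"
      unfolding F_def by (simp add: o_def)
    then show ?thesis unfolding has_field_derivative_def
      by (rule has_derivative_eq_rhs) (simp add: fun_eq_iff algebra_simps)
  qed
  have "norm (F h - F 0) \<le> \<gamma> * norm (h - 0)"
  proof (rule field_differentiable_bound[of "{0..h}" F])
    fix k assume k: "k \<in> {0..h}"
    show "(F has_real_derivative c * fx (x + c * k, t - k) - ft (x + c * k, t - k)) (at k within {0..h})" by (rule d[OF k])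
    show "norm (c * fx (x + c * k, t - k) - ft (x + c * k, t - k)) \<le> \<gamma>" using b line[OF k] by simp
  qed (use h in auto)
  then show ?thesis using h by (simp add: F_def)
qed

text \<open>
  Let \<open>A = \<integral>\<^sub>0\<^sup>t p_x\<close> and let \<open>G = \<integral>\<^sub>0\<^sup>t g\<close>. Then \<open>p + A\<close> and \<open>p - A\<close> change at rate \<open>G\<close> along the
  two families of characteristics, and where \<open>p = 0\<close> they have the same modulus, so that reflection at
  the boundary passes from one to the other without loss. If \<open>|G| \<le> \<gamma>\<close>, the function
  \<open>max |p + A| |p - A| - 2 \<gamma> t\<close> therefore increases when one moves back along a suitable
  characteristic, and its maximum is attained at time zero, where it vanishes. This argument does not
  count reflections.
\<close>
lemma wave_sup_bound:
  assumes ab: "\<alpha> < \<beta>" and T: "T > 0" and w: "weak_wave \<alpha> \<beta> T g p px pt"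
    and bc: "\<And>t. t \<in> {0..T} \<Longrightarrow> p (\<alpha>, t) = 0" "\<And>t. t \<in> {0..T} \<Longrightarrow> p (\<beta>, t) = 0"
    and ic: "\<And>x. x \<in> {\<alpha>..\<beta>} \<Longrightarrow> p (x, 0) = 0" "\<And>x. x \<in> {\<alpha>..\<beta>} \<Longrightarrow> pt (x, 0) = 0"
    and t1: "t1 \<in> {0..T}" and B: "B > 0" "\<And>x t. x \<in> {\<alpha>..\<beta>} \<Longrightarrow> t \<in> {0..t1} \<Longrightarrow> \<bar>g (x, t)\<bar> \<le> B"
    and x1: "x1 \<in> {\<alpha>..\<beta>}"
  shows "\<bar>p (x1, t1)\<bar> \<le> 2 * T\<^sup>2 * B"
proof -
  let ?X = "{\<alpha>..\<beta>}" and ?Y = "{0..t1}"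
  have sub: "?Y \<subseteq> {0..T}" using t1 by auto
  have cg: "continuous_on (?X \<times> {0..T}) g" and cp: "continuous_on (?X \<times> {0..T}) p"
    and cpx: "continuous_on (?X \<times> {0..T}) px" and cpt: "continuous_on (?X \<times> {0..T}) pt"
    using w by (simp_all add: weak_wave_def)
  define A where "A z = integral {0..snd z} (\<lambda>\<tau>. px (fst z, \<tau>))" for z :: "real \<times> real"
  define Gi where "Gi z = integral {0..snd z} (\<lambda>\<tau>. g (fst z, \<tau>))" for z :: "real \<times> real"
  have dp: "((\<lambda>y. p (y, t)) has_real_derivative px (x, t)) (at x within ?X)"
      "((\<lambda>\<tau>. p (x, \<tau>)) has_real_derivative pt (x, t)) (at t within ?Y)"
    and dA: "((\<lambda>y. A (y, t)) has_real_derivative pt (x, t) + Gi (x, t)) (at x within ?X)"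
      "((\<lambda>\<tau>. A (x, \<tau>)) has_real_derivative px (x, t)) (at t within ?Y)"
    if x: "x \<in> ?X" and t: "t \<in> ?Y" for x t
  proof -
    have tT: "t \<in> {0..T}" using t sub by blast
    have "((\<lambda>y. p (y, t)) has_real_derivative px (x, t)) (at x within ?X)
        \<and> ((\<lambda>\<tau>. p (x, \<tau>)) has_real_derivative pt (x, t)) (at t within {0..T})
        \<and> ((\<lambda>y. integral {0..t} (\<lambda>\<tau>. px (y, \<tau>))) has_real_derivative
              pt (x, t) - pt (x, 0) + integral {0..t} (\<lambda>\<tau>. g (x, \<tau>))) (at x within ?X)"
      using w x tT unfolding weak_wave_def by blast
    then show "((\<lambda>y. p (y, t)) has_real_derivative px (x, t)) (at x within ?X)"
      "((\<lambda>\<tau>. p (x, \<tau>)) has_real_derivative pt (x, t)) (at t within ?Y)"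
      "((\<lambda>y. A (y, t)) has_real_derivative pt (x, t) + Gi (x, t)) (at x within ?X)"
      using ic(2)[OF x] has_field_derivative_subset[OF _ sub] by (auto simp: A_def Gi_def)
    show "((\<lambda>\<tau>. A (x, \<tau>)) has_real_derivative px (x, t)) (at t within ?Y)"
      unfolding A_def fst_conv snd_conv
      by (rule integral_has_real_derivative[OF continuous_slice_t[OF cpx x sub] t])
  qed
  define \<gamma> where "\<gamma> = T * B"
  have Gb: "\<bar>Gi (x, t)\<bar> \<le> \<gamma>" if x: "x \<in> ?X" and t: "t \<in> ?Y" for x t
  proof -
    have s: "{0..t} \<subseteq> {0..T}" using t sub by auto
    have "norm (integral {0..t} (\<lambda>\<tau>. g (x, \<tau>))) \<le> B * (t - 0)"
      by (rule integral_bound) (use t B(2)[OF x] continuous_slice_t[OF cg x s] in auto)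
    also have "\<dots> \<le> \<gamma>" using t t1 B(1) by (simp add: \<gamma>_def mult.commute mult_left_mono)
    finally show ?thesis by (simp add: Gi_def)
  qed
  define R where "R z = p z + A z" for z
  define L where "L z = p z - A z" for z
  define D where "D c z = (\<lambda>(h, k). (px z + c * (pt z + Gi z)) * h + (pt z + c * px z) * k)" for c z
  have cs: "continuous_on (?X \<times> ?Y) px" "continuous_on (?X \<times> ?Y) pt"
    by (rule continuous_on_subset[OF cpx] continuous_on_subset[OF cpt]; use sub in blast)+
  have DR: "(R has_derivative (\<lambda>(h, k). (px (x, t) + (pt (x, t) + Gi (x, t))) * h + (pt (x, t) + px (x, t)) * k)) (at (x, t) within ?X \<times> ?Y)"
    if "x \<in> ?X" "t \<in> ?Y" for x t unfolding R_def
    by (rule directional_derivative[where fx = "\<lambda>z. px z + (pt z + Gi z)" and ft = "\<lambda>z. pt z + px z"])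
       (use that in \<open>auto intro!: DERIV_add dp dA continuous_intros cs\<close>)
  have DL: "(L has_derivative (\<lambda>(h, k). (px (x, t) - (pt (x, t) + Gi (x, t))) * h + (pt (x, t) - px (x, t)) * k)) (at (x, t) within ?X \<times> ?Y)"
    if "x \<in> ?X" "t \<in> ?Y" for x t unfolding L_def
    by (rule directional_derivative[where fx = "\<lambda>z. px z - (pt z + Gi z)" and ft = "\<lambda>z. pt z - px z"])
       (use that in \<open>auto intro!: DERIV_diff dp dA continuous_intros cs\<close>)
  have cR: "continuous_on (?X \<times> ?Y) R" and cL: "continuous_on (?X \<times> ?Y) L"
    unfolding continuous_on_eq_continuous_within
    using has_derivative_continuous[OF DR] has_derivative_continuous[OF DL] by blast+
  have stepR: "\<bar>R (x + h, t - h) - R (x, t)\<bar> \<le> \<gamma> * h"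
    if "x \<in> ?X" "t \<in> ?Y" "h \<ge> 0" "x + h \<le> \<beta>" "h \<le> t" for x t h
    using characteristic_step[of ?X ?Y R "\<lambda>z. px z + (pt z + Gi z)" "\<lambda>z. pt z + px z" 1 \<gamma> h x t] DR Gb that by force
  have stepL: "\<bar>L (x - h, t - h) - L (x, t)\<bar> \<le> \<gamma> * h"
    if "x \<in> ?X" "t \<in> ?Y" "h \<ge> 0" "\<alpha> \<le> x - h" "h \<le> t" for x t h
    using characteristic_step[of ?X ?Y L "\<lambda>z. px z - (pt z + Gi z)" "\<lambda>z. pt z - px z" "-1" \<gamma> h x t] DL Gb that by force
  have \<gamma>: "\<gamma> > 0" using T B(1) by (simp add: \<gamma>_def)
  \<comment> \<open>The rate \<open>2 \<gamma>\<close> exceeds the rate of change \<open>\<gamma>\<close> along characteristics strictly, so that a step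
    back in time increases this function.\<close>
  define \<Phi> where "\<Phi> z = max \<bar>R z\<bar> \<bar>L z\<bar> - 2 * \<gamma> * snd z" for z
  have cPhi: "continuous_on (?X \<times> ?Y) \<Phi>" unfolding \<Phi>_def by (intro continuous_intros cR cL)
  have "?X \<times> ?Y \<noteq> {}" using ab t1 by auto
  then obtain z where z: "z \<in> ?X \<times> ?Y" "\<forall>y\<in>?X \<times> ?Y. \<Phi> y \<le> \<Phi> z"
    using continuous_attains_sup[OF compact_Times[OF compact_Icc compact_Icc] _ cPhi] by blast
  obtain x t where zt: "z = (x, t)" and x: "x \<in> ?X" and t: "t \<in> ?Y" using z(1) by auto
  have noR: "\<not> (t > 0 \<and> x < \<beta> \<and> \<bar>R (x, t)\<bar> \<ge> \<bar>L (x, t)\<bar>)"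
  proof
    assume a: "t > 0 \<and> x < \<beta> \<and> \<bar>R (x, t)\<bar> \<ge> \<bar>L (x, t)\<bar>"
    define h where "h = min t (\<beta> - x)"
    have h: "h > 0" "h \<le> t" "x + h \<le> \<beta>" using a by (auto simp: h_def)
    have "\<bar>R (x + h, t - h) - R (x, t)\<bar> \<le> \<gamma> * h" using stepR[OF x t] h by simp
    moreover have "\<Phi> (x + h, t - h) \<le> \<Phi> (x, t)" using z(2) h x t unfolding zt by auto
    moreover have "\<bar>R (x + h, t - h)\<bar> - 2 * \<gamma> * (t - h) \<le> \<Phi> (x + h, t - h)" by (simp add: \<Phi>_def)
    moreover have "\<Phi> (x, t) = \<bar>R (x, t)\<bar> - 2 * \<gamma> * t" using a by (simp add: \<Phi>_def)
    moreover have "2 * \<gamma> * (t - h) = 2 * \<gamma> * t - 2 * (\<gamma> * h)" by (simp add: algebra_simps)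
    moreover have "\<gamma> * h > 0" using \<gamma> h by simp
    ultimately show False by linarith
  qed
  have noL: "\<not> (t > 0 \<and> x > \<alpha> \<and> \<bar>L (x, t)\<bar> \<ge> \<bar>R (x, t)\<bar>)"
  proof
    assume a: "t > 0 \<and> x > \<alpha> \<and> \<bar>L (x, t)\<bar> \<ge> \<bar>R (x, t)\<bar>"
    define h where "h = min t (x - \<alpha>)"
    have h: "h > 0" "h \<le> t" "\<alpha> \<le> x - h" using a by (auto simp: h_def)
    have "\<bar>L (x - h, t - h) - L (x, t)\<bar> \<le> \<gamma> * h" using stepL[OF x t] h by simp
    moreover have "\<Phi> (x - h, t - h) \<le> \<Phi> (x, t)" using z(2) h x t unfolding zt by auto
    moreover have "\<bar>L (x - h, t - h)\<bar> - 2 * \<gamma> * (t - h) \<le> \<Phi> (x - h, t - h)" by (simp add: \<Phi>_def)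
    moreover have "\<Phi> (x, t) = \<bar>L (x, t)\<bar> - 2 * \<gamma> * t" using a by (simp add: \<Phi>_def)
    moreover have "2 * \<gamma> * (t - h) = 2 * \<gamma> * t - 2 * (\<gamma> * h)" by (simp add: algebra_simps)
    moreover have "\<gamma> * h > 0" using \<gamma> h by simp
    ultimately show False by linarith
  qed
  \<comment> \<open>On the boundary a step along the outgoing family would leave the interval; the equal moduli
    allow the step to be made along the other family.\<close>
  have refl: "\<bar>R (x, t)\<bar> = \<bar>L (x, t)\<bar>" if "x = \<alpha> \<or> x = \<beta>"
  proof -
    have "t \<in> {0..T}" using t sub by blast
    then have "p (x, t) = 0" using that bc by auto
    then show ?thesis by (simp add: R_def L_def)
  qed
  have "t = 0"
  proof (rule ccontr)
    assume "t \<noteq> 0"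
    then have "t > 0" using t by simp
    then show False using noR noL refl x ab by (cases "\<bar>R (x, t)\<bar> \<ge> \<bar>L (x, t)\<bar>"; cases "x = \<alpha>"; cases "x = \<beta>") auto
  qed
  then have "\<Phi> z = 0" using ic(1)[OF x] by (simp add: \<Phi>_def zt R_def L_def A_def)
  moreover have "(x1, t1) \<in> ?X \<times> ?Y" using x1 t1 by simp
  ultimately have "\<Phi> (x1, t1) \<le> 0" using z(2) by metis
  then have RL: "\<bar>R (x1, t1)\<bar> \<le> 2 * \<gamma> * t1" "\<bar>L (x1, t1)\<bar> \<le> 2 * \<gamma> * t1" by (auto simp: \<Phi>_def)
  have "\<bar>p (x1, t1)\<bar> \<le> (\<bar>R (x1, t1)\<bar> + \<bar>L (x1, t1)\<bar>) / 2"
    using abs_triangle_ineq[of "R (x1, t1)" "L (x1, t1)"] by (simp add: R_def L_def)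
  also have "\<dots> \<le> (2 * \<gamma> * t1 + 2 * \<gamma> * t1) / 2" by (intro divide_right_mono add_mono RL) simp
  also have "\<dots> = 2 * \<gamma> * t1" by simp
  also have "\<dots> \<le> 2 * \<gamma> * T" using t1 \<gamma> by simp
  finally show ?thesis by (simp add: \<gamma>_def power2_eq_square mult_ac)
qed

section \<open>Green's identity\<close>

lemma C_infinity_partials:
  assumes "C_infinity f" shows "C_infinity (pd_x f)" "C_infinity (pd_t f)"
  using assms C_times.simps(2) unfolding C_infinity_def by blast+

lemma C_infinity_continuous: "C_infinity f \<Longrightarrow> continuous_on S f"
  using C_times.simps(1) continuous_on_subset[of UNIV f S] unfolding C_infinity_def by blast

lemma C_infinity_has_partials:
  assumes "C_infinity f"
  shows "((\<lambda>y. f (y, t)) has_real_derivative pd_x f (x, t)) (at x within S)"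
    and "((\<lambda>\<tau>. f (x, \<tau>)) has_real_derivative pd_t f (x, t)) (at t within S)"
proof -
  have "C_times (Suc 0) f" using assms unfolding C_infinity_def by blast
  then have d: "(\<lambda>y. f (y, t)) differentiable (at x)" "(\<lambda>\<tau>. f (x, \<tau>)) differentiable (at t)" by simp_all
  show "((\<lambda>y. f (y, t)) has_real_derivative pd_x f (x, t)) (at x within S)"
    using d(1) by (simp add: pd_x_def DERIV_deriv_iff_real_differentiable has_field_derivative_at_within)
  show "((\<lambda>\<tau>. f (x, \<tau>)) has_real_derivative pd_t f (x, t)) (at t within S)"
    using d(2) by (simp add: pd_t_def DERIV_deriv_iff_real_differentiable has_field_derivative_at_within)
qed

text \<open>
  Differentiate \<open>f (y, \<tau>) - f (a, \<tau>) = \<integral> f_x\<close> under the integral sign in time, and then in space.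
\<close>
lemma mixed_partials:
  assumes f: "C_infinity f" shows "pd_x (pd_t f) (x, t) = pd_t (pd_x f) (x, t)"
proof -
  note fx = C_infinity_partials(1)[OF f] and ft = C_infinity_partials(2)[OF f]
  note ftx = C_infinity_partials(2)[OF fx]
  define a where "a = x - 1"
  have e: "pd_t f (y, t) = pd_t f (a, t) + integral {a..y} (\<lambda>z. pd_t (pd_x f) (z, t))" if y: "y \<in> {a..x + 1}" for y
  proof -
    have i: "f (y, \<tau>) - f (a, \<tau>) = integral {a..y} (\<lambda>z. pd_x f (z, \<tau>))" for \<tau>
      using FTC_within[of a y UNIV "\<lambda>z. f (z, \<tau>)" "\<lambda>z. pd_x f (z, \<tau>)"] C_infinity_has_partials(1)[OF f] y
      by (simp add: integral_unique)
    have "((\<lambda>\<tau>. integral (cbox a y) (\<lambda>z. pd_x f (z, \<tau>))) has_real_derivative integral (cbox a y) (\<lambda>z. pd_t (pd_x f) (z, t))) (at t within UNIV)"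
    proof (rule leibniz_rule_field_derivative)
      show "((\<lambda>\<tau>. pd_x f (z, \<tau>)) has_real_derivative pd_t (pd_x f) (z, \<tau>)) (at \<tau> within UNIV)" for \<tau> z
        by (rule C_infinity_has_partials(2)[OF fx])
      show "(\<lambda>z. pd_x f (z, \<tau>)) integrable_on cbox a y" for \<tau>
        by (intro integrable_continuous continuous_on_compose2[OF C_infinity_continuous[OF fx, of UNIV]] continuous_intros) auto
      show "continuous_on (UNIV \<times> cbox a y) (\<lambda>(\<tau>, z). pd_t (pd_x f) (z, \<tau>))"
        unfolding split_def
        by (intro continuous_on_compose2[OF C_infinity_continuous[OF ftx, of UNIV]] continuous_intros) auto
    qed auto
    then have "((\<lambda>\<tau>. f (y, \<tau>) - f (a, \<tau>)) has_real_derivative integral {a..y} (\<lambda>z. pd_t (pd_x f) (z, t))) (at t)"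
      by (simp add: i)
    moreover have "((\<lambda>\<tau>. f (y, \<tau>) - f (a, \<tau>)) has_real_derivative pd_t f (y, t) - pd_t f (a, t)) (at t)"
      by (intro DERIV_diff C_infinity_has_partials(2)[OF f])
    ultimately show ?thesis using DERIV_unique by fastforce
  qed
  have c: "continuous_on {a..x + 1} (\<lambda>z. pd_t (pd_x f) (z, t))"
    by (intro continuous_on_compose2[OF C_infinity_continuous[OF ftx, of UNIV]] continuous_intros) auto
  have x: "x \<in> {a..x + 1}" by (simp add: a_def)
  have "((\<lambda>y. pd_t f (a, t) + integral {a..y} (\<lambda>z. pd_t (pd_x f) (z, t))) has_real_derivative 0 + pd_t (pd_x f) (x, t)) (at x within {a..x + 1})"
    by (intro DERIV_add DERIV_const integral_has_real_derivative c x)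
  then have "((\<lambda>y. pd_t f (y, t)) has_real_derivative 0 + pd_t (pd_x f) (x, t)) (at x within {a..x + 1})"
    by (rule has_field_derivative_transform_within[OF _ zero_less_one x]) (rule e[symmetric])
  then have "((\<lambda>y. pd_t f (y, t)) has_real_derivative pd_t (pd_x f) (x, t)) (at x)"
    using at_within_interior[of x "{a..x + 1}"] by (simp add: a_def)
  then show ?thesis using DERIV_unique[OF _ C_infinity_has_partials(1)[OF ft]] by metis
qed

lemma integral_by_parts:
  fixes F G f g :: "real \<Rightarrow> real"
  assumes ab: "a \<le> b" and F: "\<And>x. x \<in> {a..b} \<Longrightarrow> (F has_real_derivative f x) (at x within {a..b})"
    and G: "\<And>x. x \<in> {a..b} \<Longrightarrow> (G has_real_derivative g x) (at x within {a..b})"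
    and c: "continuous_on {a..b} f" "continuous_on {a..b} g"
  shows "integral {a..b} (\<lambda>x. F x * g x) = F b * G b - F a * G a - integral {a..b} (\<lambda>x. f x * G x)"
proof -
  have cF: "continuous_on {a..b} F" and cG: "continuous_on {a..b} G"
    using F G by (meson DERIV_continuous_on)+
  have "((\<lambda>x. f x * G x + F x * g x) has_integral F b * G b - F a * G a) {a..b}"
  proof (rule FTC_within[OF ab order_refl])
    fix x assume x: "x \<in> {a..b}"
    show "((\<lambda>x. F x * G x) has_real_derivative f x * G x + F x * g x) (at x within {a..b})"
      using DERIV_mult[OF F[OF x] G[OF x]] by (simp add: mult.commute)
  qed
  then have "integral {a..b} (\<lambda>x. f x * G x + F x * g x) = F b * G b - F a * G a" by (simp add: integral_unique)
  moreover have "integral {a..b} (\<lambda>x. f x * G x + F x * g x) = integral {a..b} (\<lambda>x. f x * G x) + integral {a..b} (\<lambda>x. F x * g x)"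
    by (rule Henstock_Kurzweil_Integration.integral_add) (intro integrable_continuous_interval continuous_intros c cF cG)+
  ultimately show ?thesis by linarith
qed

text \<open>
  The function \<open>D x = \<integral> v p_x dt\<close> is differentiable although \<open>p_x\<close> is not known to be: by parts in
  time, \<open>D = - \<integral> v_t A\<close> with \<open>A = \<integral>\<^sub>0\<^sup>t p_x\<close>, and \<open>A_x = p_t + \<integral>\<^sub>0\<^sup>t g\<close>. After differentiation, the
  integrations by parts in time are undone; the terms at \<open>T\<close> vanish with \<open>v\<close>, \<open>v_t\<close> and \<open>v_x\<close>, those at
  \<open>0\<close> with \<open>p\<close>, \<open>A\<close> and \<open>\<integral>\<^sub>0\<^sup>t g\<close>. As \<open>v_tt = v_xx\<close>, the result is \<open>D' = \<integral> ((v_x p)_x + v g) dt\<close>, and \<open>v_x p\<close> is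
  zero on the boundary.
\<close>
lemma Green_identity:
  assumes ab: "\<alpha> < \<beta>" and T: "T > 0" and w: "weak_wave \<alpha> \<beta> T g p px pt"
    and bc: "\<And>t. t \<in> {0..T} \<Longrightarrow> p (\<alpha>, t) = 0" "\<And>t. t \<in> {0..T} \<Longrightarrow> p (\<beta>, t) = 0"
    and ic: "\<And>x. x \<in> {\<alpha>..\<beta>} \<Longrightarrow> p (x, 0) = 0" "\<And>x. x \<in> {\<alpha>..\<beta>} \<Longrightarrow> pt (x, 0) = 0"
    and v: "C_infinity v" and box: "\<And>x t. t \<in> {0..T} \<Longrightarrow> dalembertian v (x, t) = 0"
    and vT: "\<And>x. x \<in> {\<alpha><..<\<beta>} \<Longrightarrow> v (x, T) = 0" "\<And>x. x \<in> {\<alpha><..<\<beta>} \<Longrightarrow> pd_t v (x, T) = 0"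
  shows "integral {0..T} (\<lambda>t. v (\<beta>, t) * px (\<beta>, t)) - integral {0..T} (\<lambda>t. v (\<alpha>, t) * px (\<alpha>, t))
       = integral {\<alpha>..\<beta>} (\<lambda>x. integral {0..T} (\<lambda>t. v (x, t) * g (x, t)))"
proof -
  let ?X = "{\<alpha>..\<beta>}" and ?Y = "{0..T}"
  have TT: "T \<in> ?Y" and T0: "0 \<in> ?Y" and T': "0 \<le> T" using T by auto
  have cg: "continuous_on (?X \<times> ?Y) g" and cp: "continuous_on (?X \<times> ?Y) p"
    and cpx: "continuous_on (?X \<times> ?Y) px" and cpt: "continuous_on (?X \<times> ?Y) pt"
    using w by (simp_all add: weak_wave_def)
  note vx = C_infinity_partials(1)[OF v] and vt = C_infinity_partials(2)[OF v]
  note vxx = C_infinity_partials(1)[OF vx] and vxt = C_infinity_partials(2)[OF vx]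
    and vtx = C_infinity_partials(1)[OF vt] and vtt = C_infinity_partials(2)[OF vt]
  note cv = C_infinity_continuous[OF v] and cvx = C_infinity_continuous[OF vx] and cvt = C_infinity_continuous[OF vt]
    and cvxx = C_infinity_continuous[OF vxx] and cvtx = C_infinity_continuous[OF vtx] and cvtt = C_infinity_continuous[OF vtt]
  have slice: "continuous_on S (\<lambda>t. f (x, t))" if "C_infinity f" for f :: "real \<times> real \<Rightarrow> real" and x S
    by (rule continuous_on_compose2[OF C_infinity_continuous[OF that, of UNIV]]) (auto intro!: continuous_intros)
  have slicex: "continuous_on S (\<lambda>x. f (x, t))" if "C_infinity f" for f :: "real \<times> real \<Rightarrow> real" and t S
    by (rule continuous_on_compose2[OF C_infinity_continuous[OF that, of UNIV]]) (auto intro!: continuous_intros)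
  have vT': "v (x, T) = 0" "pd_t v (x, T) = 0" "pd_x v (x, T) = 0" if x: "x \<in> ?X" for x
  proof -
    show "v (x, T) = 0" by (rule continuous_const_on_closed_interval[OF ab slicex[OF v] vT(1) x])
    show "pd_t v (x, T) = 0" by (rule continuous_const_on_closed_interval[OF ab slicex[OF vt] vT(2) x])
    show "pd_x v (x, T) = 0"
    proof (rule continuous_const_on_closed_interval[OF ab slicex[OF vx] _ x])
      fix y assume y: "y \<in> {\<alpha><..<\<beta>}"
      have "((\<lambda>y. v (y, T)) has_real_derivative 0) (at y)"
        by (rule has_field_derivative_transform_within_open[OF DERIV_const[of 0], of "{\<alpha><..<\<beta>}"]) (use y vT(1) in auto)
      then show "pd_x v (y, T) = 0" using DERIV_unique[OF C_infinity_has_partials(1)[OF v, of T y UNIV]] by blast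
    qed
  qed
  define A where "A z = integral {0..snd z} (\<lambda>\<tau>. px (fst z, \<tau>))" for z :: "real \<times> real"
  define Gi where "Gi z = integral {0..snd z} (\<lambda>\<tau>. g (fst z, \<tau>))" for z :: "real \<times> real"
  have ww: "((\<lambda>y. p (y, t)) has_real_derivative px (x, t)) (at x within ?X)
        \<and> ((\<lambda>\<tau>. p (x, \<tau>)) has_real_derivative pt (x, t)) (at t within ?Y)
        \<and> ((\<lambda>y. integral {0..t} (\<lambda>\<tau>. px (y, \<tau>))) has_real_derivative
              pt (x, t) - pt (x, 0) + integral {0..t} (\<lambda>\<tau>. g (x, \<tau>))) (at x within ?X)"
    if "x \<in> ?X" "t \<in> ?Y" for x t
    using w that unfolding weak_wave_def by blast
  have dpx: "((\<lambda>y. p (y, t)) has_real_derivative px (x, t)) (at x within ?X)"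
    and dpt: "((\<lambda>\<tau>. p (x, \<tau>)) has_real_derivative pt (x, t)) (at t within ?Y)"
    and dAx: "((\<lambda>y. A (y, t)) has_real_derivative pt (x, t) + Gi (x, t)) (at x within ?X)"
    if "x \<in> ?X" "t \<in> ?Y" for x t
    using ww[OF that] ic(2)[OF that(1)] by (simp_all add: A_def Gi_def)
  have dAt: "((\<lambda>\<tau>. A (x, \<tau>)) has_real_derivative px (x, t)) (at t within ?Y)" if "x \<in> ?X" "t \<in> ?Y" for x t
    unfolding A_def fst_conv snd_conv
    by (rule integral_has_real_derivative[OF continuous_slice_t[OF cpx that(1) order_refl] that(2)])
  have dGt: "((\<lambda>\<tau>. Gi (x, \<tau>)) has_real_derivative g (x, t)) (at t within ?Y)" if "x \<in> ?X" "t \<in> ?Y" for x t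
    unfolding Gi_def fst_conv snd_conv
    by (rule integral_has_real_derivative[OF continuous_slice_t[OF cg that(1) order_refl] that(2)])
  have A0: "A (x, 0) = 0" "Gi (x, 0) = 0" for x by (simp_all add: A_def Gi_def)
  have jc: "continuous_on (?X \<times> ?Y) (\<lambda>z. integral {0..snd z} (\<lambda>\<tau>. f (fst z, \<tau>)))"
    if f: "continuous_on (?X \<times> ?Y) f" for f :: "real \<times> real \<Rightarrow> real"
  proof -
    obtain B where B: "\<And>z. z \<in> ?X \<times> ?Y \<Longrightarrow> norm (f z) \<le> B" 
      using compact_imp_bounded[OF compact_continuous_image[OF f compact_Times[OF compact_Icc compact_Icc]]]
      unfolding bounded_iff by auto
    show ?thesis
    proof (rule jointly_continuous[where N = "\<lambda>t \<tau>. \<bar>\<tau> - t\<bar>" and K = B])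
      show "continuous_on ?X (\<lambda>x. integral {0..snd (x, t)} (\<lambda>\<tau>. f (fst (x, t), \<tau>)))" if "t \<in> ?Y" for t
        using continuous_time_integral[OF f that] by simp
      show "((\<lambda>\<tau>. \<bar>\<tau> - t\<bar>) \<longlongrightarrow> 0) (at t within ?Y)" for t
        by (rule tendsto_eq_intros refl | simp)+
      fix x t \<tau> assume x: "x \<in> ?X" and t: "t \<in> ?Y" "\<tau> \<in> ?Y"
      define F where "F t = integral {0..t} (\<lambda>\<tau>. f (x, \<tau>))" for t
      have "norm (F \<tau> - F t) \<le> B * norm (\<tau> - t)"
      proof (rule field_differentiable_bound[of ?Y F "\<lambda>t. f (x, t)"])
        show "(F has_real_derivative f (x, r)) (at r within ?Y)" if "r \<in> ?Y" for r
          unfolding F_def by (rule integral_has_real_derivative[OF continuous_slice_t[OF f x order_refl] that])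
      qed (use B x t in auto)
      then show "\<bar>integral {0..snd (x, \<tau>)} (\<lambda>r. f (fst (x, \<tau>), r)) - integral {0..snd (x, t)} (\<lambda>r. f (fst (x, t), r))\<bar> \<le> B * \<bar>\<tau> - t\<bar>"
        by (simp add: F_def)
    qed
  qed
  have cA: "continuous_on (?X \<times> ?Y) A" and cG: "continuous_on (?X \<times> ?Y) Gi"
    using jc[OF cpx] jc[OF cg] by (simp_all add: A_def[abs_def] Gi_def[abs_def])
  define D where "D x = integral ?Y (\<lambda>t. v (x, t) * px (x, t))" for x
  have st: "continuous_on ?Y (\<lambda>t. f (x, t))" if "continuous_on (?X \<times> ?Y) f" "x \<in> ?X" for f :: "real \<times> real \<Rightarrow> real" and x
    by (rule continuous_slice_t[OF that order_refl])
  have D_eq: "D x = - integral ?Y (\<lambda>t. pd_t v (x, t) * A (x, t))" if x: "x \<in> ?X" for x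
    unfolding D_def
    using integral_by_parts[OF T' C_infinity_has_partials(2)[OF v] dAt[OF x] slice[OF vt] st[OF cpx x], of x]
    by (simp add: vT'[OF x] A0)
  define D' where "D' x = - integral ?Y (\<lambda>t. pd_x (pd_t v) (x, t) * A (x, t) + pd_t v (x, t) * (pt (x, t) + Gi (x, t)))" for x
  have dD: "(D has_real_derivative D' x) (at x within ?X)" if x: "x \<in> ?X" for x
  proof -
    have "((\<lambda>x. integral (cbox 0 T) (\<lambda>t. pd_t v (x, t) * A (x, t))) has_real_derivative
        integral (cbox 0 T) (\<lambda>t. pd_x (pd_t v) (x, t) * A (x, t) + pd_t v (x, t) * (pt (x, t) + Gi (x, t)))) (at x within ?X)"
    proof (rule leibniz_rule_field_derivative)
      show "((\<lambda>x. pd_t v (x, t) * A (x, t)) has_real_derivative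
          pd_x (pd_t v) (x, t) * A (x, t) + pd_t v (x, t) * (pt (x, t) + Gi (x, t))) (at x within ?X)"
        if "x \<in> ?X" "t \<in> cbox 0 T" for x t
        using DERIV_mult[OF C_infinity_has_partials(1)[OF vt, of t x ?X] dAx[of x t]] that by (simp add: mult.commute)
      show "(\<lambda>t. pd_t v (x, t) * A (x, t)) integrable_on cbox 0 T" if "x \<in> ?X" for x
        using integrable_continuous_interval[of 0 T "\<lambda>t. pd_t v (x, t) * A (x, t)"]
        by (simp add: continuous_intros slice[OF vt] st[OF cA that])
      show "continuous_on (?X \<times> cbox 0 T) (\<lambda>(x, t). pd_x (pd_t v) (x, t) * A (x, t) + pd_t v (x, t) * (pt (x, t) + Gi (x, t)))"
        unfolding split_def prod.collapse cbox_interval by (intro continuous_intros cvtx cA cvt cpt cG)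
    qed (use x in auto)
    from DERIV_minus[OF this] have "((\<lambda>x. - integral ?Y (\<lambda>t. pd_t v (x, t) * A (x, t))) has_real_derivative D' x) (at x within ?X)"
      by (simp add: D'_def)
    then show ?thesis by (rule has_field_derivative_transform_within[OF _ zero_less_one x]) (rule D_eq[symmetric])
  qed
  have D'_eq: "D' x = integral ?Y (\<lambda>t. (pd_x v (x, t) * px (x, t) + pd_x (pd_x v) (x, t) * p (x, t)) + v (x, t) * g (x, t))" if x: "x \<in> ?X" for x
  proof -
    have 1: "integral ?Y (\<lambda>t. pd_x v (x, t) * px (x, t)) = - integral ?Y (\<lambda>t. pd_t (pd_x v) (x, t) * A (x, t))"
      using integral_by_parts[OF T' C_infinity_has_partials(2)[OF vx] dAt[OF x] slice[OF vxt] st[OF cpx x], of x]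
      by (simp add: vT'[OF x] A0)
    have 2: "integral ?Y (\<lambda>t. pd_t v (x, t) * pt (x, t)) = - integral ?Y (\<lambda>t. pd_t (pd_t v) (x, t) * p (x, t))"
      using integral_by_parts[OF T' C_infinity_has_partials(2)[OF vt] dpt[OF x] slice[OF vtt] st[OF cpt x], of x]
      by (simp add: vT'[OF x] ic[OF x])
    have 3: "integral ?Y (\<lambda>t. v (x, t) * g (x, t)) = - integral ?Y (\<lambda>t. pd_t v (x, t) * Gi (x, t))"
      using integral_by_parts[OF T' C_infinity_has_partials(2)[OF v] dGt[OF x] slice[OF vt] st[OF cg x], of x]
      by (simp add: vT'[OF x] A0)
    have 4: "integral ?Y (\<lambda>t. pd_t (pd_t v) (x, t) * p (x, t)) = integral ?Y (\<lambda>t. pd_x (pd_x v) (x, t) * p (x, t))"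
      using box by (intro Henstock_Kurzweil_Integration.integral_cong) (simp add: dalembertian_def)
    have s1: "integral ?Y (\<lambda>t. pd_x (pd_t v) (x, t) * A (x, t) + pd_t v (x, t) * (pt (x, t) + Gi (x, t)))
       = integral ?Y (\<lambda>t. pd_t (pd_x v) (x, t) * A (x, t)) + (integral ?Y (\<lambda>t. pd_t v (x, t) * pt (x, t)) + integral ?Y (\<lambda>t. pd_t v (x, t) * Gi (x, t)))"
      unfolding mixed_partials[OF v] distrib_left
      by (subst Henstock_Kurzweil_Integration.integral_add
          | (intro integrable_continuous_interval continuous_intros slice[OF vt] slice[OF vxt] st[OF cA x] st[OF cpt x] st[OF cG x])
          | rule refl)+
    have s2: "integral ?Y (\<lambda>t. (pd_x v (x, t) * px (x, t) + pd_x (pd_x v) (x, t) * p (x, t)) + v (x, t) * g (x, t))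
       = (integral ?Y (\<lambda>t. pd_x v (x, t) * px (x, t)) + integral ?Y (\<lambda>t. pd_x (pd_x v) (x, t) * p (x, t))) + integral ?Y (\<lambda>t. v (x, t) * g (x, t))"
      by (subst Henstock_Kurzweil_Integration.integral_add
          | (intro integrable_continuous_interval continuous_intros slice[OF v] slice[OF vx] slice[OF vxx] st[OF cp x] st[OF cpx x] st[OF cg x])
          | rule refl)+
    show ?thesis unfolding D'_def s1 s2 using 1 2 3 4 by linarith
  qed
  have "(D' has_integral D \<beta> - D \<alpha>) ?X"
    by (rule FTC_within[OF less_imp_le[OF ab] order_refl dD])
  then have "D \<beta> - D \<alpha> = integral ?X D'" by (simp add: integral_unique)
  also have "\<dots> = integral ?X (\<lambda>x. integral ?Y (\<lambda>t. pd_x v (x, t) * px (x, t) + pd_x (pd_x v) (x, t) * p (x, t)) + integral ?Y (\<lambda>t. v (x, t) * g (x, t)))"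
  proof (rule Henstock_Kurzweil_Integration.integral_cong)
    fix x assume x: "x \<in> ?X"
    show "D' x = integral ?Y (\<lambda>t. pd_x v (x, t) * px (x, t) + pd_x (pd_x v) (x, t) * p (x, t)) + integral ?Y (\<lambda>t. v (x, t) * g (x, t))"
      unfolding D'_eq[OF x]
      by (rule Henstock_Kurzweil_Integration.integral_add)
         (intro integrable_continuous_interval continuous_intros slice[OF v] slice[OF vx] slice[OF vxx] st[OF cp x] st[OF cpx x] st[OF cg x])+
  qed
  also have "\<dots> = integral ?X (\<lambda>x. integral ?Y (\<lambda>t. pd_x v (x, t) * px (x, t) + pd_x (pd_x v) (x, t) * p (x, t))) + integral ?X (\<lambda>x. integral ?Y (\<lambda>t. v (x, t) * g (x, t)))"
  proof (rule Henstock_Kurzweil_Integration.integral_add)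
    have "continuous_on (?X \<times> ?Y) (\<lambda>z. pd_x v z * px z + pd_x (pd_x v) z * p z)"
      by (intro continuous_intros cvx cpx cvxx cp)
    from continuous_time_integral[OF this TT]
    show "(\<lambda>x. integral ?Y (\<lambda>t. pd_x v (x, t) * px (x, t) + pd_x (pd_x v) (x, t) * p (x, t))) integrable_on ?X"
      by (rule integrable_continuous_interval)
    have "continuous_on (?X \<times> ?Y) (\<lambda>z. v z * g z)" by (intro continuous_intros cv cg)
    from continuous_time_integral[OF this TT]
    show "(\<lambda>x. integral ?Y (\<lambda>t. v (x, t) * g (x, t))) integrable_on ?X"
      by (rule integrable_continuous_interval)
  qed
  also have "integral ?X (\<lambda>x. integral ?Y (\<lambda>t. pd_x v (x, t) * px (x, t) + pd_x (pd_x v) (x, t) * p (x, t)))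
      = integral ?Y (\<lambda>t. integral ?X (\<lambda>x. pd_x v (x, t) * px (x, t) + pd_x (pd_x v) (x, t) * p (x, t)))"
    using integral_swap[of \<alpha> \<beta> T "\<lambda>z. pd_x v z * px z + pd_x (pd_x v) z * p z" T] TT
    by (simp add: continuous_intros cvx cpx cvxx cp)
  also have "\<dots> = integral ?Y (\<lambda>t. 0)"
  proof (rule Henstock_Kurzweil_Integration.integral_cong)
    fix t assume t: "t \<in> ?Y"
    have "((\<lambda>x. pd_x v (x, t) * px (x, t) + pd_x (pd_x v) (x, t) * p (x, t)) has_integral
        pd_x v (\<beta>, t) * p (\<beta>, t) - pd_x v (\<alpha>, t) * p (\<alpha>, t)) ?X"
    proof (rule FTC_within[OF less_imp_le[OF ab] order_refl])
      fix x assume "x \<in> ?X"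
      then show "((\<lambda>x. pd_x v (x, t) * p (x, t)) has_real_derivative pd_x v (x, t) * px (x, t) + pd_x (pd_x v) (x, t) * p (x, t)) (at x within ?X)"
        using DERIV_mult[OF C_infinity_has_partials(1)[OF vx, of t x ?X] dpx[OF _ t, of x]] by (simp add: algebra_simps)
    qed
    then show "integral ?X (\<lambda>x. pd_x v (x, t) * px (x, t) + pd_x (pd_x v) (x, t) * p (x, t)) = 0"
      using bc[OF t] by (simp add: integral_unique)
  qed
  finally show ?thesis by (simp add: D_def)
qed

section \<open>Polarization\<close>

text \<open>
  Adding an index \<open>i\<close> to \<open>J\<close> replaces \<open>x^n\<close> by \<open>(x + w_i)^n - x^n\<close>, a combination of powers below
  \<open>n\<close>. By induction only the power \<open>card J\<close> survives. The cases \<open>n = 0\<close> and \<open>n = 1\<close> say that constants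
  and linear terms are annihilated.
\<close>
lemma polarization:
  fixes w :: "nat \<Rightarrow> real"
  assumes "finite J" "n \<le> card J"
  shows "(\<Sum>\<sigma> \<in> J \<rightarrow>\<^sub>E {0, 1 :: nat}. (- 1) ^ ((\<Sum>j\<in>J. \<sigma> j) + card J) * (x + (\<Sum>j\<in>J. real (\<sigma> j) * w j)) ^ n)
       = (if n = card J then fact n * (\<Prod>j\<in>J. w j) else 0)"
  using assms
proof (induction J arbitrary: n x rule: finite_induct)
  case empty
  then show ?case by simp
next
  case (insert i J)
  define S where "S n x = (\<Sum>\<sigma> \<in> J \<rightarrow>\<^sub>E {0, 1 :: nat}. (- 1) ^ ((\<Sum>j\<in>J. \<sigma> j) + card J) * (x + (\<Sum>j\<in>J. real (\<sigma> j) * w j)) ^ n)" for n x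
  let ?F = "\<lambda>\<sigma>. (- 1) ^ ((\<Sum>j\<in>insert i J. \<sigma> j) + card (insert i J)) * (x + (\<Sum>j\<in>insert i J. real (\<sigma> j) * w j)) ^ n :: real"
  let ?h = "\<lambda>(y, \<sigma>). \<sigma>(i := y)"
  have inj: "inj_on ?h ({0, 1 :: nat} \<times> (J \<rightarrow>\<^sub>E {0, 1}))"
    using inj_combinator[OF insert.hyps(2), of "\<lambda>_. {0, 1 :: nat}"] by simp
  have fin: "finite (J \<rightarrow>\<^sub>E {0, 1 :: nat})" by (rule finite_PiE) (use insert in auto)
  have upd: "(\<Sum>j\<in>insert i J. (\<sigma>(i := y)) j) = y + (\<Sum>j\<in>J. \<sigma> j)"
    "(\<Sum>j\<in>insert i J. real ((\<sigma>(i := y)) j) * w j) = real y * w i + (\<Sum>j\<in>J. real (\<sigma> j) * w j)" for \<sigma> y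
    using insert.hyps by (simp_all cong: sum.cong_simp) (auto intro!: sum.cong)
  have "(\<Sum>\<sigma> \<in> insert i J \<rightarrow>\<^sub>E {0, 1 :: nat}. ?F \<sigma>) = (\<Sum>z \<in> {0, 1 :: nat} \<times> (J \<rightarrow>\<^sub>E {0, 1}). ?F (?h z))"
    unfolding PiE_insert_eq by (subst sum.reindex[OF inj]) (simp add: o_def)
  also have "\<dots> = (\<Sum>y\<in>{0, 1 :: nat}. \<Sum>\<sigma> \<in> J \<rightarrow>\<^sub>E {0, 1}. ?F (\<sigma>(i := y)))"
    unfolding sum.cartesian_product by (rule sum.cong) auto
  also have "\<dots> = S n (x + w i) - S n x"
    unfolding S_def upd using insert.hyps by (simp add: sum_negf[symmetric] add.assoc mult_ac)
  finally have 1: "(\<Sum>\<sigma> \<in> insert i J \<rightarrow>\<^sub>E {0, 1 :: nat}. ?F \<sigma>) = S n (x + w i) - S n x" .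
  have bin: "(a + b) ^ n - a ^ n = (\<Sum>k<n. real (n choose k) * b ^ (n - k) * a ^ k)" for a b :: real
    unfolding binomial_ring by (simp add: lessThan_Suc_atMost[symmetric] mult_ac)
  have "S n (x + w i) - S n x = (\<Sum>k<n. real (n choose k) * w i ^ (n - k) * S k x)"
  proof -
    have "S n (x + w i) - S n x = (\<Sum>\<sigma> \<in> J \<rightarrow>\<^sub>E {0, 1 :: nat}. (- 1) ^ ((\<Sum>j\<in>J. \<sigma> j) + card J) *
        ((x + (\<Sum>j\<in>J. real (\<sigma> j) * w j) + w i) ^ n - (x + (\<Sum>j\<in>J. real (\<sigma> j) * w j)) ^ n))"
      unfolding S_def sum_subtractf[symmetric] by (intro sum.cong) (simp_all add: algebra_simps)
    also have "\<dots> = (\<Sum>\<sigma> \<in> J \<rightarrow>\<^sub>E {0, 1 :: nat}. \<Sum>k<n. real (n choose k) * w i ^ (n - k) *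
        ((- 1) ^ ((\<Sum>j\<in>J. \<sigma> j) + card J) * (x + (\<Sum>j\<in>J. real (\<sigma> j) * w j)) ^ k))"
      unfolding bin sum_distrib_left by (simp add: mult_ac)
    finally show ?thesis unfolding S_def sum_distrib_left by (subst sum.swap) 
  qed
  also have "\<dots> = (\<Sum>k<n. if k = card J then real (n choose k) * w i ^ (n - k) * (fact k * (\<Prod>j\<in>J. w j)) else 0)"
  proof (rule sum.cong)
    fix k assume "k \<in> {..<n}"
    then have "k \<le> card J" using insert.prems insert.hyps by simp
    from insert.IH[OF this, of x]
    show "real (n choose k) * w i ^ (n - k) * S k x = (if k = card J then real (n choose k) * w i ^ (n - k) * (fact k * (\<Prod>j\<in>J. w j)) else 0)"
      unfolding S_def by simp
  qed simp
  also have "\<dots> = (if n = card (insert i J) then fact n * (\<Prod>j\<in>insert i J. w j) else 0)"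
    using insert.prems insert.hyps by (auto simp: sum.delta)
  finally show ?case unfolding 1 .
qed

section \<open>Pointwise bounds for admissible coefficients\<close>

lemma pd_vanishing:
  assumes "closed K" "\<And>z. z \<notin> K \<Longrightarrow> f z = 0" "z \<notin> K"
  shows "pd_x f z = 0" "pd_t f z = 0"
proof -
  obtain x t where z: "z = (x, t)" by (cases z)
  have o1: "open {y. (y, t) \<notin> K}"
  proof -
    have "continuous_on UNIV (\<lambda>y. (y, t))" by (intro continuous_intros)
    then show ?thesis using open_vimage[of "- K" "\<lambda>y. (y, t)"] assms(1) by (simp add: vimage_def open_Compl)
  qed
  have "((\<lambda>y. f (y, t)) has_real_derivative 0) (at x)"
    by (rule has_field_derivative_transform_within_open[OF DERIV_const[of 0] o1]) (use assms(2,3) z in auto)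
  then show "pd_x f z = 0" by (simp add: pd_x_def z DERIV_imp_deriv)
  have o2: "open {y. (x, y) \<notin> K}"
  proof -
    have "continuous_on UNIV (\<lambda>y. (x, y))" by (intro continuous_intros)
    then show ?thesis using open_vimage[of "- K" "\<lambda>y. (x, y)"] assms(1) by (simp add: vimage_def open_Compl)
  qed
  have "((\<lambda>y. f (x, y)) has_real_derivative 0) (at t)"
    by (rule has_field_derivative_transform_within_open[OF DERIV_const[of 0] o2]) (use assms(2,3) z in auto)
  then show "pd_t f z = 0" by (simp add: pd_t_def z DERIV_imp_deriv)
qed

lemma iterated_partials:
  assumes "C_infinity a" "compact (supp a)"
  shows "C_infinity ((pd_x ^^ i) ((pd_t ^^ j) a))" "z \<notin> supp a \<Longrightarrow> (pd_x ^^ i) ((pd_t ^^ j) a) z = 0"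
proof -
  have K: "closed (supp a)" using assms(2) compact_imp_closed by blast
  have t: "C_infinity ((pd_t ^^ j) a) \<and> (\<forall>z. z \<notin> supp a \<longrightarrow> (pd_t ^^ j) a z = 0)"
  proof (induction j)
    case (Suc j)
    then show ?case using pd_vanishing(2)[OF K, of "(pd_t ^^ j) a"] C_infinity_partials(2) by auto
  qed (use assms not_in_supp in auto)
  have "C_infinity ((pd_x ^^ i) ((pd_t ^^ j) a)) \<and> (\<forall>z. z \<notin> supp a \<longrightarrow> (pd_x ^^ i) ((pd_t ^^ j) a) z = 0)"
  proof (induction i)
    case (Suc i)
    then show ?case using pd_vanishing(1)[OF K, of "(pd_x ^^ i) ((pd_t ^^ j) a)"] C_infinity_partials(1) by auto
  qed (use t in auto)
  then show "C_infinity ((pd_x ^^ i) ((pd_t ^^ j) a))" "z \<notin> supp a \<Longrightarrow> (pd_x ^^ i) ((pd_t ^^ j) a) z = 0" by blast+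
qed

text \<open>
  A supremum of reals is meaningful only for bounded sets; compact support makes all terms of the
  norm such suprema, so that each of them is below the sum.
\<close>
lemma partials_le_C_norm:
  assumes a: "C_infinity a" "compact (supp a)" and ij: "i + j \<le> k"
  shows "\<bar>(pd_x ^^ i) ((pd_t ^^ j) a) z\<bar> \<le> C_norm k a"
proof -
  have bdd: "bdd_above (range (\<lambda>z. \<bar>(pd_x ^^ i) ((pd_t ^^ j) a) z\<bar>))" for i j
  proof -
    have "bounded ((pd_x ^^ i) ((pd_t ^^ j) a) ` supp a)"
      by (intro compact_imp_bounded compact_continuous_image C_infinity_continuous iterated_partials a)
    then obtain B where B: "\<forall>z\<in>supp a. \<bar>(pd_x ^^ i) ((pd_t ^^ j) a) z\<bar> \<le> B" unfolding bounded_iff by auto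
    have "\<bar>(pd_x ^^ i) ((pd_t ^^ j) a) z\<bar> \<le> max B 0" for z
      using B iterated_partials(2)[OF a, of z i j] by (cases "z \<in> supp a") auto
    then show ?thesis by (intro bdd_aboveI) auto
  qed
  have up: "\<bar>(pd_x ^^ i) ((pd_t ^^ j) a) z\<bar> \<le> (SUP z. \<bar>(pd_x ^^ i) ((pd_t ^^ j) a) z\<bar>)" for i j z
    by (rule cSUP_upper[OF _ bdd]) simp
  have "finite ({..k} \<times> {..k})" by simp
  then have fin: "finite {(i, j). i + j \<le> k}" by (rule finite_subset[rotated]) auto
  have "\<bar>(pd_x ^^ i) ((pd_t ^^ j) a) z\<bar> \<le> (case (i, j) of (i, j) \<Rightarrow> SUP z. \<bar>(pd_x ^^ i) ((pd_t ^^ j) a) z\<bar>)" using up by simp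
  also have "\<dots> \<le> C_norm k a" unfolding C_norm_def
  proof (rule member_le_sum[OF _ _ fin])
    show "0 \<le> (case p of (i, j) \<Rightarrow> SUP z. \<bar>(pd_x ^^ i) ((pd_t ^^ j) a) z\<bar>)" for p
      using order_trans[OF abs_ge_zero up] by (auto split: prod.split)
  qed (use ij in auto)
  finally show ?thesis .
qed

lemma admissible_bounds:
  assumes a: "C_infinity a" and adm: "admissible \<Omega> T s L lam a"
  shows "\<bar>a z\<bar> \<le> L" "\<bar>a (x, t) - a (y, r)\<bar> \<le> L * (\<bar>x - y\<bar> + \<bar>t - r\<bar>)"
    "z \<notin> \<Omega> \<times> {t_lower \<Omega> lam..t_upper \<Omega> T lam} \<Longrightarrow> a z = 0"
proof -
  have c: "compact (supp a)" and n: "C_norm (s + 1) a \<le> L" and s: "supp a \<subseteq> \<Omega> \<times> {t_lower \<Omega> lam..t_upper \<Omega> T lam}"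
    using adm by (auto simp: admissible_def)
  note le = order_trans[OF partials_le_C_norm[OF a c] n]
  show "\<bar>a z\<bar> \<le> L" using le[of 0 0 z] by simp
  show "z \<notin> \<Omega> \<times> {t_lower \<Omega> lam..t_upper \<Omega> T lam} \<Longrightarrow> a z = 0" using s not_in_supp[of z a] by blast
  have "norm (a (x, t) - a (y, t)) \<le> L * norm (x - y)"
    by (rule field_differentiable_bound[of UNIV "\<lambda>x. a (x, t)" "\<lambda>x. pd_x a (x, t)"])
       (use C_infinity_has_partials(1)[OF a] le[of 1 0] in auto)
  moreover have "norm (a (y, t) - a (y, r)) \<le> L * norm (t - r)"
    by (rule field_differentiable_bound[of UNIV "\<lambda>t. a (y, t)" "\<lambda>t. pd_t a (y, t)"])
       (use C_infinity_has_partials(2)[OF a] le[of 0 1] in auto)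
  ultimately show "\<bar>a (x, t) - a (y, r)\<bar> \<le> L * (\<bar>x - y\<bar> + \<bar>t - r\<bar>)" by (simp add: algebra_simps)
qed

section \<open>Concentration\<close>

text \<open>
  The product of one right-moving and \<open>m - 1\<close> left-moving pulses of unit width and amplitude that meet
  at the origin.
\<close>
definition pulse_kernel :: "nat \<Rightarrow> real \<times> real \<Rightarrow> real" where
  "pulse_kernel m z = bump (fst z - snd z) * bump (fst z + snd z) ^ (m - 1)"

lemma continuous_pulse_kernel: "continuous_on S (pulse_kernel m)"
  unfolding pulse_kernel_def
  by (intro continuous_intros continuous_on_compose2[OF continuous_bump[of UNIV]]) auto

lemma pulse_kernel_nonneg: "pulse_kernel m z \<ge> 0" by (simp add: pulse_kernel_def bump_nonneg)

lemma pulse_kernel_zero: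
  assumes "m \<ge> 2" "z \<notin> cbox (-1, -1) (1, 1)" shows "pulse_kernel m z = 0"
proof -
  have "\<bar>fst z - snd z\<bar> \<ge> 1 \<or> \<bar>fst z + snd z\<bar> \<ge> 1"
    using assms(2) by (cases z) (auto simp: cbox_Pair_eq)
  then show ?thesis using assms(1) by (auto simp: pulse_kernel_def bump_eq_0 zero_power)
qed

definition kernel_mass :: "nat \<Rightarrow> real" where
  "kernel_mass m = integral (cbox (-1, -1) (1, 1)) (pulse_kernel m)"

lemma kernel_mass_pos: "kernel_mass m > 0"
proof -
  have "kernel_mass m \<noteq> 0"
  proof
    assume "kernel_mass m = 0"
    then have "(pulse_kernel m has_integral 0) (cbox (-1, -1) (1, 1))"
      using integrable_integral[OF integrable_continuous[OF continuous_pulse_kernel]] unfolding kernel_mass_def by metis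
    then have "pulse_kernel m (0, 0) = 0"
      by (rule has_integral_0_cbox_imp_0[rotated 2])
         (auto simp: continuous_pulse_kernel pulse_kernel_nonneg box_def Basis_prod_def cbox_Pair_eq intro!: exI[of _ "0 :: real"])
    then show False using bump_pos[of 0] by (simp add: pulse_kernel_def)
  qed
  moreover have "kernel_mass m \<ge> 0" unfolding kernel_mass_def
    by (intro integral_nonneg integrable_continuous continuous_pulse_kernel pulse_kernel_nonneg)
  ultimately show ?thesis by linarith
qed

text \<open>
  The kernel is nonnegative and lives in a square of side \<open>2 / \<tau>\<close> about the point, where a Lipschitz
  function varies by \<open>2 L / \<tau>\<close> at most; the error is relative to the mass, which scales like
  \<open>1 / \<tau>\<^sup>2\<close>.
\<close>
lemma concentration:
  fixes a :: "real \<times> real \<Rightarrow> real"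
  assumes m: "m \<ge> 2" and \<tau>: "\<tau> \<ge> 1" and ca: "continuous_on UNIV a"
    and lip: "\<And>x t. \<bar>a (x, t) - a (x0, t0)\<bar> \<le> L * (\<bar>x - x0\<bar> + \<bar>t - t0\<bar>)" and L: "L \<ge> 0"
    and out: "\<And>z. z \<notin> R \<Longrightarrow> a z = 0"
  shows "\<bar>integral R (\<lambda>z. a z * pulse_kernel m (\<tau> *\<^sub>R (z - (x0, t0)))) - a (x0, t0) * (kernel_mass m / \<tau>\<^sup>2)\<bar>
      \<le> 2 * L / \<tau> * (kernel_mass m / \<tau>\<^sup>2)"
proof -
  let ?z = "(x0, t0)"
  have \<tau>0: "\<tau> > 0" using \<tau> by simp
  define k where "k z = pulse_kernel m (\<tau> *\<^sub>R (z - ?z))" for z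
  define K where "K = cbox (x0 - 1 / \<tau>, t0 - 1 / \<tau>) (x0 + 1 / \<tau>, t0 + 1 / \<tau>)"
  have ck: "continuous_on S k" for S unfolding k_def
    by (intro continuous_on_compose2[OF continuous_pulse_kernel[of UNIV]] continuous_intros) auto
  have k0: "k z = 0" if "z \<notin> K" for z
  proof -
    obtain x t where z: "z = (x, t)" by (cases z)
    have "\<tau> *\<^sub>R (z - ?z) \<notin> cbox (-1, -1) (1, 1)"
      using that \<tau>0 by (auto simp: K_def z cbox_Pair_eq field_simps)
    then show ?thesis unfolding k_def by (rule pulse_kernel_zero[OF m])
  qed
  have mass: "(k has_integral kernel_mass m / \<tau>\<^sup>2) K"
  proof -
    have i: "(pulse_kernel m has_integral kernel_mass m) (cbox (-1, -1) (1, 1))"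
      unfolding kernel_mass_def by (intro integrable_integral integrable_continuous continuous_pulse_kernel)
    have "((\<lambda>z. pulse_kernel m (\<tau> *\<^sub>R z + - (\<tau> *\<^sub>R ?z))) has_integral (1 / \<bar>\<tau>\<bar> ^ DIM(real \<times> real)) *\<^sub>R kernel_mass m)
       ((\<lambda>z. (1 / \<tau>) *\<^sub>R z + - ((1 / \<tau>) *\<^sub>R - (\<tau> *\<^sub>R ?z))) ` cbox (-1, -1) (1, 1))"
      using has_integral_affinity[OF i, of \<tau> "- (\<tau> *\<^sub>R ?z)"] \<tau>0 by simp
    moreover have "(\<lambda>z. (1 / \<tau>) *\<^sub>R z + - ((1 / \<tau>) *\<^sub>R - (\<tau> *\<^sub>R ?z))) ` cbox (-1, -1) (1, 1) = K"
      using \<tau>0 by (subst image_affinity_cbox) (auto simp: K_def cbox_Pair_eq)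
    moreover have "(1 / \<bar>\<tau>\<bar> ^ DIM(real \<times> real)) *\<^sub>R kernel_mass m = kernel_mass m / \<tau>\<^sup>2"
      by (simp add: power2_eq_square)
    moreover have "(\<lambda>z. pulse_kernel m (\<tau> *\<^sub>R z + - (\<tau> *\<^sub>R ?z))) = k" by (simp add: k_def fun_eq_iff scaleR_diff_right)
    ultimately show ?thesis by (simp only:)
  qed
  have "integral R (\<lambda>z. a z * k z) = integral UNIV (\<lambda>z. if z \<in> R then a z * k z else 0)"
    by (simp add: integral_restrict_UNIV)
  also have "\<dots> = integral UNIV (\<lambda>z. if z \<in> K then a z * k z else 0)"
    by (rule Henstock_Kurzweil_Integration.integral_cong) (use out k0 in auto)
  also have "\<dots> = integral K (\<lambda>z. a z * k z)" by (simp add: integral_restrict_UNIV)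
  finally have "integral R (\<lambda>z. a z * k z) - a ?z * (kernel_mass m / \<tau>\<^sup>2)
      = integral K (\<lambda>z. a z * k z) - integral K (\<lambda>z. a ?z * k z)"
    using integral_unique[OF mass] by simp
  also have "\<dots> = integral K (\<lambda>z. (a z - a ?z) * k z)"
    unfolding left_diff_distrib K_def
    by (rule Henstock_Kurzweil_Integration.integral_diff[symmetric])
       (intro integrable_continuous continuous_intros ck continuous_on_subset[OF ca subset_UNIV])+
  also have "\<bar>\<dots>\<bar> \<le> integral K (\<lambda>z. 2 * L / \<tau> * k z)"
    unfolding real_norm_def[symmetric]
  proof (rule integral_norm_bound_integral)
    show "(\<lambda>z. (a z - a ?z) * k z) integrable_on K" "(\<lambda>z. 2 * L / \<tau> * k z) integrable_on K"
      unfolding K_def by (intro integrable_continuous continuous_intros ck continuous_on_subset[OF ca subset_UNIV])+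
    fix z assume z: "z \<in> K"
    obtain x t where xt: "z = (x, t)" by (cases z)
    have "\<bar>x - x0\<bar> + \<bar>t - t0\<bar> \<le> 2 / \<tau>" using z unfolding K_def xt cbox_Pair_eq by (auto simp: abs_le_iff)
    from mult_left_mono[OF this L] have "\<bar>a z - a ?z\<bar> \<le> 2 * L / \<tau>" using lip[of x t] by (simp add: xt mult.commute)
    then show "norm ((a z - a ?z) * k z) \<le> 2 * L / \<tau> * k z"
      using mult_right_mono[OF _ pulse_kernel_nonneg[of m "\<tau> *\<^sub>R (z - ?z)"]] pulse_kernel_nonneg[of m "\<tau> *\<^sub>R (z - ?z)"]
      unfolding k_def real_norm_def abs_mult by (simp only: abs_of_nonneg)
  qed
  also have "\<dots> = 2 * L / \<tau> * (kernel_mass m / \<tau>\<^sup>2)" using integral_unique[OF mass] by simp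
  finally show ?thesis by (simp add: k_def)
qed

section \<open>Superposition, travelling waves and the nonlinear correction\<close>

lemma weak_wave_combine:
  assumes u: "weak_wave \<alpha> \<beta> T g u ux ut" and v: "weak_wave \<alpha> \<beta> T h v vx vt"
  shows "weak_wave \<alpha> \<beta> T (\<lambda>z. g z + c * h z) (\<lambda>z. u z + c * v z) (\<lambda>z. ux z + c * vx z) (\<lambda>z. ut z + c * vt z)"
proof -
  let ?R = "{\<alpha>..\<beta>} \<times> {0..T}"
  have cu: "continuous_on ?R g" "continuous_on ?R u" "continuous_on ?R ux" "continuous_on ?R ut"
    using u by (simp_all add: weak_wave_def)
  have cv: "continuous_on ?R h" "continuous_on ?R v" "continuous_on ?R vx" "continuous_on ?R vt"
    using v by (simp_all add: weak_wave_def)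
  have int: "integral {0..t} (\<lambda>\<tau>. p (x, \<tau>) + c * q (x, \<tau>)) = integral {0..t} (\<lambda>\<tau>. p (x, \<tau>)) + c * integral {0..t} (\<lambda>\<tau>. q (x, \<tau>))"
    if "continuous_on ?R p" "continuous_on ?R q" "x \<in> {\<alpha>..\<beta>}" "t \<in> {0..T}" for p q :: "real \<times> real \<Rightarrow> real" and x t
  proof -
    have s: "{0..t} \<subseteq> {0..T}" using that(4) by auto
    show ?thesis
      by (subst Henstock_Kurzweil_Integration.integral_add)
         (auto intro!: integrable_continuous_interval continuous_intros continuous_slice_t[OF that(1,3) s] continuous_slice_t[OF that(2,3) s])
  qed
  have "((\<lambda>y. u (y, t) + c * v (y, t)) has_real_derivative ux (x, t) + c * vx (x, t)) (at x within {\<alpha>..\<beta>})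
        \<and> ((\<lambda>\<tau>. u (x, \<tau>) + c * v (x, \<tau>)) has_real_derivative ut (x, t) + c * vt (x, t)) (at t within {0..T})
        \<and> ((\<lambda>y. integral {0..t} (\<lambda>\<tau>. ux (y, \<tau>) + c * vx (y, \<tau>))) has_real_derivative
              ut (x, t) + c * vt (x, t) - (ut (x, 0) + c * vt (x, 0)) + integral {0..t} (\<lambda>\<tau>. g (x, \<tau>) + c * h (x, \<tau>))) (at x within {\<alpha>..\<beta>})"
    if x: "x \<in> {\<alpha>..\<beta>}" and t: "t \<in> {0..T}" for x t
  proof (intro conjI)
    have U: "((\<lambda>y. u (y, t)) has_real_derivative ux (x, t)) (at x within {\<alpha>..\<beta>})"
        "((\<lambda>\<tau>. u (x, \<tau>)) has_real_derivative ut (x, t)) (at t within {0..T})"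
        "((\<lambda>y. integral {0..t} (\<lambda>\<tau>. ux (y, \<tau>))) has_real_derivative
              ut (x, t) - ut (x, 0) + integral {0..t} (\<lambda>\<tau>. g (x, \<tau>))) (at x within {\<alpha>..\<beta>})"
      using u x t unfolding weak_wave_def by blast+
    have V: "((\<lambda>y. v (y, t)) has_real_derivative vx (x, t)) (at x within {\<alpha>..\<beta>})"
        "((\<lambda>\<tau>. v (x, \<tau>)) has_real_derivative vt (x, t)) (at t within {0..T})"
        "((\<lambda>y. integral {0..t} (\<lambda>\<tau>. vx (y, \<tau>))) has_real_derivative
              vt (x, t) - vt (x, 0) + integral {0..t} (\<lambda>\<tau>. h (x, \<tau>))) (at x within {\<alpha>..\<beta>})"
      using v x t unfolding weak_wave_def by blast+
    show "((\<lambda>y. u (y, t) + c * v (y, t)) has_real_derivative ux (x, t) + c * vx (x, t)) (at x within {\<alpha>..\<beta>})"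
      by (intro DERIV_add DERIV_cmult U V)
    show "((\<lambda>\<tau>. u (x, \<tau>) + c * v (x, \<tau>)) has_real_derivative ut (x, t) + c * vt (x, t)) (at t within {0..T})"
      by (intro DERIV_add DERIV_cmult U V)
    have "((\<lambda>y. integral {0..t} (\<lambda>\<tau>. ux (y, \<tau>)) + c * integral {0..t} (\<lambda>\<tau>. vx (y, \<tau>))) has_real_derivative
        (ut (x, t) - ut (x, 0) + integral {0..t} (\<lambda>\<tau>. g (x, \<tau>))) + c * (vt (x, t) - vt (x, 0) + integral {0..t} (\<lambda>\<tau>. h (x, \<tau>)))) (at x within {\<alpha>..\<beta>})"
      by (intro DERIV_add DERIV_cmult U V)
    then have "((\<lambda>y. integral {0..t} (\<lambda>\<tau>. ux (y, \<tau>) + c * vx (y, \<tau>))) has_real_derivative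
        (ut (x, t) - ut (x, 0) + integral {0..t} (\<lambda>\<tau>. g (x, \<tau>))) + c * (vt (x, t) - vt (x, 0) + integral {0..t} (\<lambda>\<tau>. h (x, \<tau>)))) (at x within {\<alpha>..\<beta>})"
      by (rule has_field_derivative_transform_within[OF _ zero_less_one x]) (rule int[OF cu(3) cv(3) _ t, symmetric])
    then show "((\<lambda>y. integral {0..t} (\<lambda>\<tau>. ux (y, \<tau>) + c * vx (y, \<tau>))) has_real_derivative
        ut (x, t) + c * vt (x, t) - (ut (x, 0) + c * vt (x, 0)) + integral {0..t} (\<lambda>\<tau>. g (x, \<tau>) + c * h (x, \<tau>))) (at x within {\<alpha>..\<beta>})"
      unfolding int[OF cu(1) cv(1) x t] by (rule DERIV_cong) (simp add: algebra_simps)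
  qed
  then show ?thesis unfolding weak_wave_def using cu cv by (simp add: continuous_intros)
qed

lemma weak_wave_zero: "weak_wave \<alpha> \<beta> T (\<lambda>_. 0) (\<lambda>_. 0) (\<lambda>_. 0) (\<lambda>_. 0)"
  by (auto simp: weak_wave_def)

lemma weak_wave_sum:
  assumes "finite J" "\<And>j. j \<in> J \<Longrightarrow> weak_wave \<alpha> \<beta> T (\<lambda>_. 0) (w j) (wx j) (wt j)"
  shows "weak_wave \<alpha> \<beta> T (\<lambda>_. 0) (\<lambda>z. \<Sum>j\<in>J. c j * w j z) (\<lambda>z. \<Sum>j\<in>J. c j * wx j z) (\<lambda>z. \<Sum>j\<in>J. c j * wt j z)"
  using assms
proof (induction J rule: finite_induct)
  case (insert i J)
  then have "weak_wave \<alpha> \<beta> T (\<lambda>_. 0) (\<lambda>z. \<Sum>j\<in>J. c j * w j z) (\<lambda>z. \<Sum>j\<in>J. c j * wx j z) (\<lambda>z. \<Sum>j\<in>J. c j * wt j z)"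
    by simp
  from weak_wave_combine[OF this insert.prems[of i], of "c i"] insert.hyps
  show ?case by (simp add: add.commute)
qed (simp add: weak_wave_zero)

text \<open>
  The integral in time of \<open>h''\<close> along a line \<open>x - \<theta> t\<close> is explicit, and \<open>\<theta>\<^sup>2 = 1\<close>.
\<close>
lemma weak_wave_travelling:
  assumes h: "smooth h" and \<theta>: "\<theta> = 1 \<or> \<theta> = - 1"
  shows "weak_wave \<alpha> \<beta> T (\<lambda>_. 0) (\<lambda>z. h (fst z - \<theta> * snd z)) (\<lambda>z. deriv h (fst z - \<theta> * snd z)) (\<lambda>z. - \<theta> * deriv h (fst z - \<theta> * snd z))"
proof -
  note dh = smooth_deriv[OF h]
  have c: "continuous_on S (\<lambda>z. h (fst z - \<theta> * snd z))" "continuous_on S (\<lambda>z. deriv h (fst z - \<theta> * snd z))" for S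
    by (rule continuous_on_compose2[OF smooth_continuous[OF h, of UNIV]], auto intro!: continuous_intros)
       (rule continuous_on_compose2[OF smooth_continuous[OF dh, of UNIV]], auto intro!: continuous_intros)
  have dx: "((\<lambda>y. f (y - \<theta> * t)) has_real_derivative deriv f (x - \<theta> * t)) (at x within S)" if "smooth f" for f x t S
    by (rule has_field_derivative_at_within, rule DERIV_cong[OF DERIV_chain2[OF smooth_has_deriv[OF that]]]) (auto intro!: derivative_eq_intros)
  have dt: "((\<lambda>t. f (x - \<theta> * t)) has_real_derivative - \<theta> * deriv f (x - \<theta> * t)) (at t within S)" if "smooth f" for f x t S
    by (rule has_field_derivative_at_within, rule DERIV_cong[OF DERIV_chain2[OF smooth_has_deriv[OF that]]]) (auto intro!: derivative_eq_intros)
  have "((\<lambda>y. integral {0..t} (\<lambda>\<tau>. deriv h (y - \<theta> * \<tau>))) has_real_derivative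
      - \<theta> * deriv h (x - \<theta> * t) - - \<theta> * deriv h (x - \<theta> * 0)) (at x within {\<alpha>..\<beta>})"
    if x: "x \<in> {\<alpha>..\<beta>}" and t: "t \<in> {0..T}" for x t
  proof -
    have "((\<lambda>y. integral (cbox 0 t) (\<lambda>\<tau>. deriv h (y - \<theta> * \<tau>))) has_real_derivative
        integral (cbox 0 t) (\<lambda>\<tau>. deriv (deriv h) (x - \<theta> * \<tau>))) (at x within {\<alpha>..\<beta>})"
    proof (rule leibniz_rule_field_derivative)
      show "(\<lambda>\<tau>. deriv h (y - \<theta> * \<tau>)) integrable_on cbox 0 t" for y
        by (intro integrable_continuous continuous_on_compose2[OF smooth_continuous[OF dh, of UNIV]] continuous_intros) auto
      show "continuous_on ({\<alpha>..\<beta>} \<times> cbox 0 t) (\<lambda>(y, \<tau>). deriv (deriv h) (y - \<theta> * \<tau>))"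
        unfolding split_def
        by (intro continuous_on_compose2[OF smooth_continuous[OF smooth_deriv[OF dh], of UNIV]] continuous_intros) auto
    qed (use x dx[OF dh] in auto)
    moreover have "((\<lambda>\<tau>. deriv (deriv h) (x - \<theta> * \<tau>)) has_integral - \<theta> * deriv h (x - \<theta> * t) - - \<theta> * deriv h (x - \<theta> * 0)) {0..t}"
    proof (rule FTC_within[of 0 t UNIV])
      show "((\<lambda>\<tau>. - \<theta> * deriv h (x - \<theta> * \<tau>)) has_real_derivative deriv (deriv h) (x - \<theta> * \<tau>)) (at \<tau>)" for \<tau>
        by (rule DERIV_cong[OF DERIV_cmult[OF dt[OF dh]]]) (use \<theta> in auto)
    qed (use t in auto)
    ultimately show ?thesis by (simp add: integral_unique)
  qed
  then show ?thesis unfolding weak_wave_def using c dx[OF h] dt[OF h] by (auto intro!: continuous_intros)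
qed

lemma power_difference_bound:
  fixes x y B :: real
  assumes "\<bar>x\<bar> \<le> B" "\<bar>y\<bar> \<le> B"
  shows "\<bar>x ^ m - y ^ m\<bar> \<le> real m * B ^ (m - 1) * \<bar>x - y\<bar>"
proof -
  have "norm (x ^ m - y ^ m) \<le> real m * B ^ (m - 1) * norm (x - y)"
  proof (rule field_differentiable_bound[of "{-B..B}" "\<lambda>x. x ^ m" "\<lambda>x. real m * x ^ (m - 1)"])
    show "norm (real m * z ^ (m - 1)) \<le> real m * B ^ (m - 1)" if "z \<in> {-B..B}" for z
      using that by (auto simp: abs_mult power_abs intro!: mult_left_mono power_mono)
  qed (use assms in \<open>auto intro!: derivative_eq_intros\<close>)
  then show ?thesis by simp
qed

text \<open>
  As long as \<open>|u - W| \<le> b\<close>, the source is at most \<open>L (2b)^m\<close> and the bound by characteristics gives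
  \<open>|u - W| \<le> 2 T\<^sup>2 L (2b)^m < b\<close>. By continuity in time \<open>|u - W|\<close> never reaches \<open>b\<close>.
\<close>
lemma nonlinear_bootstrap:
  assumes ab: "\<alpha> < \<beta>" and T: "T > 0" and p: "weak_wave \<alpha> \<beta> T (\<lambda>z. a z * u z ^ m) (\<lambda>z. u z - W z) px pt"
    and bc: "\<And>t. t \<in> {0..T} \<Longrightarrow> u (\<alpha>, t) = W (\<alpha>, t)" "\<And>t. t \<in> {0..T} \<Longrightarrow> u (\<beta>, t) = W (\<beta>, t)"
    and ic: "\<And>x. x \<in> {\<alpha>..\<beta>} \<Longrightarrow> u (x, 0) = W (x, 0)" "\<And>x. x \<in> {\<alpha>..\<beta>} \<Longrightarrow> pt (x, 0) = 0"
    and a: "\<And>z. \<bar>a z\<bar> \<le> L" and L: "L > 0" and W: "\<And>z. \<bar>W z\<bar> \<le> b" and b: "b > 0"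
    and small: "2 * T\<^sup>2 * (L * (2 * b) ^ m) < b" and z: "z \<in> {\<alpha>..\<beta>} \<times> {0..T}"
  shows "\<bar>u z - W z\<bar> \<le> 2 * T\<^sup>2 * (L * (2 * b) ^ m)"
proof -
  let ?X = "{\<alpha>..\<beta>}" and ?Y = "{0..T}"
  define q where "q = 2 * T\<^sup>2 * (L * (2 * b) ^ m)"
  define P where "P z = u z - W z" for z
  have cP: "continuous_on (?X \<times> ?Y) P" using p by (simp add: weak_wave_def P_def)
  have gb: "\<bar>a z * u z ^ m\<bar> \<le> L * (2 * b) ^ m" if "\<bar>P z\<bar> \<le> b" for z
  proof -
    have "\<bar>u z\<bar> \<le> 2 * b" using that W[of z] unfolding P_def by linarith
    then have "\<bar>u z\<bar> ^ m \<le> (2 * b) ^ m" by (intro power_mono) auto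
    then show ?thesis unfolding abs_mult power_abs using a[of z] L by (intro mult_mono) auto
  qed
  have B: "L * (2 * b) ^ m > 0" using L b by simp
  have key: "\<bar>P (x, t)\<bar> \<le> q" if t: "t \<in> ?Y" and x: "x \<in> ?X" and h: "\<And>y r. y \<in> ?X \<Longrightarrow> r \<in> {0..t} \<Longrightarrow> \<bar>P (y, r)\<bar> \<le> b" for x t
  proof -
    have "\<bar>u (x, t) - W (x, t)\<bar> \<le> 2 * T\<^sup>2 * (L * (2 * b) ^ m)"
    proof (rule wave_sup_bound[OF ab T p _ _ _ ic(2) t B _ x])
      show "\<bar>a (y, r) * u (y, r) ^ m\<bar> \<le> L * (2 * b) ^ m" if "y \<in> ?X" "r \<in> {0..t}" for y r
        by (rule gb[OF h[OF that]])
    qed (use bc ic(1) in auto)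
    then show ?thesis by (simp add: P_def q_def)
  qed
  have all: "\<bar>P z\<bar> < b" if z: "z \<in> ?X \<times> ?Y" for z
  proof (rule ccontr)
    assume "\<not> \<bar>P z\<bar> < b"
    define S where "S = {z \<in> ?X \<times> ?Y. b \<le> \<bar>P z\<bar>}"
    have "z \<in> S" using z \<open>\<not> \<bar>P z\<bar> < b\<close> unfolding S_def by (simp only: mem_Collect_eq not_less)
    then have ne: "S \<noteq> {}" by blast
    have K: "compact (?X \<times> ?Y)" by (intro compact_Times compact_Icc)
    have "closed ((?X \<times> ?Y) \<inter> (\<lambda>z. \<bar>P z\<bar>) -` {b..})"
      by (rule continuous_closed_preimage) (intro continuous_intros cP compact_imp_closed[OF K] closed_atLeast)+
    from compact_Int_closed[OF K this] have "compact ((?X \<times> ?Y) \<inter> ((?X \<times> ?Y) \<inter> (\<lambda>z. \<bar>P z\<bar>) -` {b..}))" .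
    moreover have "(?X \<times> ?Y) \<inter> ((?X \<times> ?Y) \<inter> (\<lambda>z. \<bar>P z\<bar>) -` {b..}) = S" unfolding S_def by blast
    ultimately have "compact S" by (simp only:)
    moreover have "continuous_on S snd" by (intro continuous_intros)
    ultimately obtain z1 where z1: "z1 \<in> S" "\<forall>y\<in>S. snd z1 \<le> snd y" using continuous_attains_inf[OF _ ne] by blast
    obtain x1 t1 where zz: "z1 = (x1, t1)" by (cases z1)
    have x1: "x1 \<in> ?X" and t1: "t1 \<in> ?Y" and P1: "b \<le> \<bar>P (x1, t1)\<bar>" using z1(1) by (auto simp: S_def zz)
    \<comment> \<open>At \<open>(x1, t1)\<close> the bound fails for the first time.\<close>
    have before: "\<bar>P (y, r)\<bar> \<le> b" if "y \<in> ?X" "r \<in> ?Y" "r < t1" for y r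
    proof (rule ccontr)
      assume "\<not> \<bar>P (y, r)\<bar> \<le> b"
      then have "(y, r) \<in> S" using that by (auto simp: S_def)
      then show False using z1(2) that(3) by (auto simp: zz)
    qed
    have "t1 \<noteq> 0" using P1 ic(1)[OF x1] b by (auto simp: P_def)
    then have t1p: "t1 > 0" using t1 by auto
    have "continuous_on ?Y (\<lambda>t. P (x1, t))" by (rule continuous_slice_t[OF cP x1 order_refl])
    moreover have bq: "b - q > 0" using small by (simp add: q_def)
    ultimately obtain d where d: "d > 0" "\<forall>r\<in>?Y. dist r t1 < d \<longrightarrow> dist (P (x1, r)) (P (x1, t1)) < b - q"
      using t1 unfolding continuous_on_iff by blast
    define r where "r = max 0 (t1 - d / 2)"
    have r: "r \<in> ?Y" "r < t1" "dist r t1 < d" using t1 t1p d(1) by (auto simp: r_def dist_real_def)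
    have "\<bar>P (x1, r)\<bar> \<le> q"
      by (rule key[OF r(1) x1 before]) (use r t1 in auto)
    moreover have "\<bar>P (x1, r) - P (x1, t1)\<bar> < b - q" using d(2) r(1,3) by (auto simp: dist_real_def)
    ultimately show False using P1 by linarith
  qed
  obtain x t where xt: "z = (x, t)" "x \<in> ?X" "t \<in> ?Y" using z by auto
  have "\<bar>P (x, t)\<bar> \<le> q"
  proof (rule key[OF xt(3,2)])
    fix y r assume "y \<in> ?X" "r \<in> {0..t}"
    then have "(y, r) \<in> ?X \<times> ?Y" using xt(3) by auto
    from less_imp_le[OF all[OF this]] show "\<bar>P (y, r)\<bar> \<le> b" .
  qed
  then show ?thesis by (simp add: P_def q_def xt(1))
qed

lemma nonlinear_integral_error:
  assumes ab: "\<alpha> < \<beta>" and T: "T > 0"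
    and c: "continuous_on UNIV a" "continuous_on ({\<alpha>..\<beta>} \<times> {0..T}) u" "continuous_on ({\<alpha>..\<beta>} \<times> {0..T}) W"
    and a: "\<And>z. \<bar>a z\<bar> \<le> L" and W: "\<And>z. \<bar>W z\<bar> \<le> b" and e: "e \<le> b"
    and d: "\<And>z. z \<in> {\<alpha>..\<beta>} \<times> {0..T} \<Longrightarrow> \<bar>u z - W z\<bar> \<le> e"
  shows "\<bar>integral (cbox (\<alpha>, 0) (\<beta>, T)) (\<lambda>z. a z * u z ^ m) - integral (cbox (\<alpha>, 0) (\<beta>, T)) (\<lambda>z. a z * W z ^ m)\<bar>
      \<le> L * (real m * (2 * b) ^ (m - 1) * e) * ((\<beta> - \<alpha>) * T)"
proof -
  let ?C = "cbox (\<alpha>, 0) (\<beta>, T)"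
  have C: "?C = {\<alpha>..\<beta>} \<times> {0..T}" by (simp add: cbox_Pair_eq)
  have i: "(\<lambda>z. a z * u z ^ m) integrable_on ?C" "(\<lambda>z. a z * W z ^ m) integrable_on ?C"
    using c(2,3) unfolding C[symmetric]
    by (auto intro!: integrable_continuous continuous_intros continuous_on_subset[OF c(1)])
  have "integral ?C (\<lambda>z. a z * u z ^ m) - integral ?C (\<lambda>z. a z * W z ^ m) = integral ?C (\<lambda>z. a z * u z ^ m - a z * W z ^ m)"
    by (rule Henstock_Kurzweil_Integration.integral_diff[OF i, symmetric])
  also have "norm \<dots> \<le> integral ?C (\<lambda>z. L * (real m * (2 * b) ^ (m - 1) * e))"
  proof (rule integral_norm_bound_integral)
    show "(\<lambda>z. a z * u z ^ m - a z * W z ^ m) integrable_on ?C" by (rule Henstock_Kurzweil_Integration.integrable_diff[OF i])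
    show "(\<lambda>z. L * (real m * (2 * b) ^ (m - 1) * e)) integrable_on ?C" by (rule integrable_const)
    fix z assume "z \<in> ?C"
    then have d': "\<bar>u z - W z\<bar> \<le> e" using d unfolding C by blast
    have b0: "0 \<le> b" using W[of z] by linarith
    have L0: "0 \<le> L" using a[of z] by linarith
    have "\<bar>u z ^ m - W z ^ m\<bar> \<le> real m * (2 * b) ^ (m - 1) * \<bar>u z - W z\<bar>"
      by (rule power_difference_bound) (use d' e W[of z] b0 in linarith)+
    also have "\<dots> \<le> real m * (2 * b) ^ (m - 1) * e" using b0 d' by (intro mult_left_mono) auto
    finally show "norm (a z * u z ^ m - a z * W z ^ m) \<le> L * (real m * (2 * b) ^ (m - 1) * e)"
      unfolding right_diff_distrib[symmetric] real_norm_def abs_mult using a[of z] L0 by (intro mult_mono) auto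
  qed
  also have "\<dots> = L * (real m * (2 * b) ^ (m - 1) * e) * ((\<beta> - \<alpha>) * T)"
    using ab T by (simp add: content_Pair)
  finally show ?thesis by simp
qed

text \<open>
  Green's identity for \<open>u - W\<close>. The weight \<open>v\<close> disappears from the source term since it is one
  wherever the source is not zero.
\<close>
lemma boundary_flux:
  assumes ab: "\<alpha> < \<beta>" and T: "T > 0" and p: "weak_wave \<alpha> \<beta> T g (\<lambda>z. u z - W z) (\<lambda>z. ux z - Wx z) pt"
    and cux: "continuous_on ({\<alpha>..\<beta>} \<times> {0..T}) ux" and cWx: "continuous_on ({\<alpha>..\<beta>} \<times> {0..T}) Wx"
    and bc: "\<And>t. t \<in> {0..T} \<Longrightarrow> u (\<alpha>, t) = W (\<alpha>, t)" "\<And>t. t \<in> {0..T} \<Longrightarrow> u (\<beta>, t) = W (\<beta>, t)"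
    and ic: "\<And>x. x \<in> {\<alpha>..\<beta>} \<Longrightarrow> u (x, 0) = W (x, 0)" "\<And>x. x \<in> {\<alpha>..\<beta>} \<Longrightarrow> pt (x, 0) = 0"
    and v: "C_infinity v" and box: "\<And>x t. t \<in> {0..T} \<Longrightarrow> dalembertian v (x, t) = 0"
    and vT: "\<And>x. x \<in> {\<alpha><..<\<beta>} \<Longrightarrow> v (x, T) = 0" "\<And>x. x \<in> {\<alpha><..<\<beta>} \<Longrightarrow> pd_t v (x, T) = 0"
    and v1: "\<And>z. g z = 0 \<or> v z = 1"
  shows "integral {0..T} (\<lambda>t. v (\<beta>, t) * ux (\<beta>, t)) - integral {0..T} (\<lambda>t. v (\<alpha>, t) * ux (\<alpha>, t))
     = (integral {0..T} (\<lambda>t. v (\<beta>, t) * Wx (\<beta>, t)) - integral {0..T} (\<lambda>t. v (\<alpha>, t) * Wx (\<alpha>, t)))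
       + integral (cbox (\<alpha>, 0) (\<beta>, T)) g"
proof -
  have cv: "continuous_on {0..T} (\<lambda>t. v (x, t))" for x
    by (rule continuous_on_compose2[OF C_infinity_continuous[OF v, of UNIV]]) (auto intro!: continuous_intros)
  have split: "integral {0..T} (\<lambda>t. v (x, t) * (ux (x, t) - Wx (x, t)))
      = integral {0..T} (\<lambda>t. v (x, t) * ux (x, t)) - integral {0..T} (\<lambda>t. v (x, t) * Wx (x, t))"
    if x: "x \<in> {\<alpha>..\<beta>}" for x
    unfolding right_diff_distrib
    by (rule Henstock_Kurzweil_Integration.integral_diff)
       (intro integrable_continuous_interval continuous_intros cv continuous_slice_t[OF cux x order_refl] continuous_slice_t[OF cWx x order_refl])+
  have vg: "v z * g z = g z" for z using v1[of z] by auto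
  have cg: "continuous_on (cbox (\<alpha>, 0) (\<beta>, T)) g" using p by (simp add: weak_wave_def cbox_Pair_eq)
  have "integral {0..T} (\<lambda>t. v (\<beta>, t) * (ux (\<beta>, t) - Wx (\<beta>, t))) - integral {0..T} (\<lambda>t. v (\<alpha>, t) * (ux (\<alpha>, t) - Wx (\<alpha>, t)))
       = integral {\<alpha>..\<beta>} (\<lambda>x. integral {0..T} (\<lambda>t. v (x, t) * g (x, t)))"
    by (rule Green_identity[OF ab T p _ _ _ ic(2) v box vT]) (use bc ic(1) in auto)
  also have "\<dots> = integral (cbox (\<alpha>, 0) (\<beta>, T)) g"
    using integral_prod_continuous[OF cg] by (simp add: vg)
  finally show ?thesis using split[of \<alpha>] split[of \<beta>] ab by simp
qed

section \<open>The interval and the travel times\<close>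

lemma open_bounded_interval:
  fixes \<Omega> :: "real set"
  assumes "is_interval \<Omega>" "open \<Omega>" "bounded \<Omega>" "\<Omega> \<noteq> {}"
  obtains \<alpha> \<beta> where "\<alpha> < \<beta>" "\<Omega> = {\<alpha><..<\<beta>}"
proof -
  have bd: "bdd_below \<Omega>" "bdd_above \<Omega>"
    using assms(3) bounded_imp_bdd_below bounded_imp_bdd_above by auto
  have "x \<in> \<Omega> \<longleftrightarrow> Inf \<Omega> < x \<and> x < Sup \<Omega>" for x
  proof
    assume x: "x \<in> \<Omega>"
    then obtain e where e: "e > 0" "ball x e \<subseteq> \<Omega>" using assms(2) open_contains_ball by blast
    moreover have "x - e / 2 \<in> ball x e" "x + e / 2 \<in> ball x e" using e(1) by (simp_all add: dist_real_def)
    ultimately have "x - e / 2 \<in> \<Omega>" "x + e / 2 \<in> \<Omega>" by blast+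
    then have "Inf \<Omega> \<le> x - e / 2" "x + e / 2 \<le> Sup \<Omega>"
      using cInf_lower[OF _ bd(1)] cSup_upper[OF _ bd(2)] by blast+
    then show "Inf \<Omega> < x \<and> x < Sup \<Omega>" using e(1) by simp
  next
    assume x: "Inf \<Omega> < x \<and> x < Sup \<Omega>"
    obtain y where "y \<in> \<Omega>" "y < x" using cInf_lessD[OF assms(4)] x by blast
    moreover obtain z where "z \<in> \<Omega>" "x < z" using less_cSupD[OF assms(4)] x by blast
    ultimately show "x \<in> \<Omega>" using assms(1) unfolding is_interval_1 by (meson less_imp_le)
  qed
  then have eq: "\<Omega> = {Inf \<Omega><..<Sup \<Omega>}" by (intro set_eqI) (simp only: greaterThanLessThan_iff)
  obtain w where "w \<in> \<Omega>" using assms(4) by blast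
  then have "Inf \<Omega> < Sup \<Omega>" using eq by (metis greaterThanLessThan_iff less_trans)
  then show ?thesis using that eq by blast
qed

lemma frontier_open_interval: "\<alpha> < \<beta> \<Longrightarrow> frontier {\<alpha><..<\<beta>} = {\<alpha>, \<beta> :: real}"
  by (auto simp: frontier_def interior_open)

lemma diam_enclosing_interval:
  assumes "\<alpha> < \<beta>" shows "\<beta> - \<alpha> \<le> diam_enclosing {\<alpha><..<\<beta>}"
proof -
  have "(\<beta> - \<alpha>) / 2 \<le> Inf {r. r > 0 \<and> (\<exists>x. {\<alpha><..<\<beta>} \<subseteq> ball x r)}"
  proof (rule cInf_greatest)
    have "{\<alpha><..<\<beta>} \<subseteq> ball \<alpha> (\<beta> - \<alpha>)" by (auto simp: dist_real_def)
    then show "{r. r > 0 \<and> (\<exists>x. {\<alpha><..<\<beta>} \<subseteq> ball x r)} \<noteq> {}" using assms by force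
  next
    fix r assume "r \<in> {r. r > 0 \<and> (\<exists>x. {\<alpha><..<\<beta>} \<subseteq> ball x r)}"
    then obtain x where "{\<alpha><..<\<beta>} \<subseteq> ball x r" by blast
    then have "closure {\<alpha><..<\<beta>} \<subseteq> cball x r" by (intro closure_minimal) auto
    moreover have "\<alpha> \<in> closure {\<alpha><..<\<beta>}" "\<beta> \<in> closure {\<alpha><..<\<beta>}" using assms by simp_all
    ultimately have "\<alpha> \<in> cball x r" "\<beta> \<in> cball x r" by blast+
    then show "(\<beta> - \<alpha>) / 2 \<le> r" by (auto simp: dist_real_def)
  qed
  then show ?thesis by (simp add: diam_enclosing_def)
qed

text \<open>
  A wave needs at most time \<open>\<beta> - \<alpha>\<close> to cross the interval, and points in the support of an admissible
  coefficient are later than that by \<open>lam\<close>. A pulse that passes through such a point has not entered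
  the interval, nor its boundary, before time \<open>lam\<close>.
\<close>
lemma pulse_time_margin:
  assumes ab: "\<alpha> < \<beta>" and z0: "z0 \<in> {\<alpha><..<\<beta>} \<times> {t_lower {\<alpha><..<\<beta>} lam..t_upper {\<alpha><..<\<beta>} T lam}"
    and x: "x \<in> {\<alpha>..\<beta>}"
  shows "\<bar>x - fst z0\<bar> + lam \<le> snd z0"
proof -
  have "fst z0 \<in> {\<alpha><..<\<beta>}" "diam_enclosing {\<alpha><..<\<beta>} + lam \<le> snd z0" using z0 by (auto simp: t_lower_def)
  moreover from this(1) have "\<bar>x - fst z0\<bar> \<le> \<beta> - \<alpha>" using x by (auto simp: abs_le_iff)
  ultimately show ?thesis using diam_enclosing_interval[OF ab] by linarith
qed

section \<open>Pulses and their boundary data\<close>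

definition direction :: "nat \<Rightarrow> real" where "direction j = (if j = 1 then 1 else - 1)"

text \<open>
  The first pulse moves to the right and the others to the left, through \<open>z0\<close>. The first one has
  negative amplitude, so that the product recovers \<open>- a\<close>, as in the reconstruction formula.
\<close>
definition pulse :: "real \<Rightarrow> real \<Rightarrow> real \<times> real \<Rightarrow> nat \<Rightarrow> real \<times> real \<Rightarrow> real" where
  "pulse A \<tau> z0 j z = - direction j * A * bump (\<tau> * ((fst z - fst z0) - direction j * (snd z - snd z0)))"

lemma direction_cases: "direction j = 1 \<or> direction j = - 1" by (simp add: direction_def)

lemma abs_direction: "\<bar>direction j\<bar> = 1" by (simp add: direction_def)

definition pulse_profile :: "real \<Rightarrow> real \<Rightarrow> real \<times> real \<Rightarrow> nat \<Rightarrow> real \<Rightarrow> real" where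
  "pulse_profile A \<tau> z0 j y = - direction j * A * bump (\<tau> * y + \<tau> * (direction j * snd z0 - fst z0))"

lemma smooth_pulse_profile: "smooth (pulse_profile A \<tau> z0 j)"
  using smooth_affine[OF smooth_bump, of "- direction j * A" \<tau> "\<tau> * (direction j * snd z0 - fst z0)"]
  by (simp add: pulse_profile_def[abs_def])

lemma pulse_eq: "pulse A \<tau> z0 j z = pulse_profile A \<tau> z0 j (fst z - direction j * snd z)"
  by (simp add: pulse_def pulse_profile_def algebra_simps)

lemma pulse_weak_wave:
  "weak_wave \<alpha> \<beta> T (\<lambda>_. 0) (pulse A \<tau> z0 j) (\<lambda>z. deriv (pulse_profile A \<tau> z0 j) (fst z - direction j * snd z))
     (\<lambda>z. - direction j * deriv (pulse_profile A \<tau> z0 j) (fst z - direction j * snd z))"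
  using weak_wave_travelling[OF smooth_pulse_profile direction_cases, of \<alpha> \<beta> T A \<tau> z0 j]
  by (simp add: pulse_eq[abs_def])

lemma pulse_trace:
  "pulse A \<tau> z0 j (x, t) = - direction j * A * bump (\<tau> * (t - (snd z0 + direction j * (x - fst z0))))"
proof -
  have "\<tau> * ((x - fst z0) - direction j * (t - snd z0)) = - direction j * (\<tau> * (t - (snd z0 + direction j * (x - fst z0))))"
    using direction_cases[of j] by (auto simp: algebra_simps)
  then show ?thesis using direction_cases[of j] bump_even unfolding pulse_def by auto
qed

lemma pulse_initial:
  assumes "\<tau> * lam > 1" "lam > 0" "\<bar>x - fst z0\<bar> + lam \<le> snd z0"
  shows "pulse A \<tau> z0 j (x, 0) = 0" "deriv (pulse_profile A \<tau> z0 j) (x - direction j * 0) = 0"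
proof -
  have "0 < \<tau> * lam" using assms(1) by linarith
  then have \<tau>: "\<tau> > 0" using assms(2) zero_less_mult_pos2 by blast
  define y where "y = \<tau> * x + \<tau> * (direction j * snd z0 - fst z0)"
  have "lam \<le> \<bar>x - fst z0 + direction j * snd z0\<bar>" using assms(3) direction_cases[of j] by auto
  then have "\<tau> * lam \<le> \<tau> * \<bar>x - fst z0 + direction j * snd z0\<bar>" using \<tau> by simp
  also have "\<dots> = \<bar>\<tau> * (x - fst z0 + direction j * snd z0)\<bar>" using \<tau> by (simp only: abs_mult abs_of_pos)
  also have "\<tau> * (x - fst z0 + direction j * snd z0) = y" by (simp add: y_def algebra_simps)
  finally have y: "\<bar>y\<bar> > 1" using assms(1) by linarith
  show "pulse A \<tau> z0 j (x, 0) = 0"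
    using y bump_eq_0[of y] by (simp add: pulse_eq pulse_profile_def y_def)
  define S where "S = {x. \<bar>\<tau> * x + \<tau> * (direction j * snd z0 - fst z0)\<bar> > 1}"
  have "open S" unfolding S_def by (intro open_Collect_less continuous_intros)
  moreover have "x \<in> S" using y by (simp add: S_def y_def)
  moreover have "0 = pulse_profile A \<tau> z0 j x'" if "x' \<in> S" for x'
    using that bump_eq_0[of "\<tau> * x' + \<tau> * (direction j * snd z0 - fst z0)"] by (simp add: S_def pulse_profile_def)
  ultimately have "(pulse_profile A \<tau> z0 j has_real_derivative 0) (at x)"
    using has_field_derivative_transform_within_open[OF DERIV_const[of 0]] by blast
  then show "deriv (pulse_profile A \<tau> z0 j) (x - direction j * 0) = 0" by (simp add: DERIV_imp_deriv)
qed

lemma pulse_product: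
  assumes "m \<ge> 2"
  shows "(\<Prod>j\<in>{1..m}. pulse A \<tau> z0 j z) = - (A ^ m) * pulse_kernel m (\<tau> *\<^sub>R (z - z0))"
proof -
  have "{1..m} = insert 1 {2..m}" using assms by auto
  then have "(\<Prod>j\<in>{1..m}. pulse A \<tau> z0 j z) = pulse A \<tau> z0 1 z * (\<Prod>j\<in>{2..m}. pulse A \<tau> z0 j z)" by simp
  also have "(\<Prod>j\<in>{2..m}. pulse A \<tau> z0 j z) = (\<Prod>j\<in>{2..m}. A * bump (\<tau> * ((fst z - fst z0) + (snd z - snd z0))))"
    by (rule prod.cong) (auto simp: pulse_def direction_def algebra_simps)
  also have "\<dots> = A ^ (m - 1) * bump (\<tau> * ((fst z - fst z0) + (snd z - snd z0))) ^ (m - 1)"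
    using assms by (simp add: power_mult_distrib numeral_2_eq_2)
  finally show ?thesis using assms
    by (cases m) (simp_all add: pulse_def direction_def pulse_kernel_def right_diff_distrib distrib_left)
qed

lemma bump_bounded: obtains B where "B > 0" "\<And>y. bump y \<le> B"
proof -
  have "bounded (bump ` {-1..1})" by (intro compact_imp_bounded compact_continuous_image continuous_bump compact_Icc)
  then obtain B where B: "\<forall>y\<in>{-1..1}. \<bar>bump y\<bar> \<le> B" unfolding bounded_iff by auto
  have "bump y \<le> max B 1" for y
  proof (cases "\<bar>y\<bar> \<ge> 1")
    case False
    then have "y \<in> {-1..1}" by auto
    then have "\<bar>bump y\<bar> \<le> B" using B by blast
    then show ?thesis by linarith
  qed (simp add: bump_eq_0)
  then show ?thesis using that[of "max B 1"] by simp
qed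

lemma pulse_sum_bound:
  assumes B: "\<And>y. bump y \<le> B" and A: "A \<ge> 0" and \<sigma>: "\<And>j. j \<in> {1..m} \<Longrightarrow> \<sigma> j \<in> {0, 1 :: nat}"
  shows "\<bar>\<Sum>j\<in>{1..m}. real (\<sigma> j) * pulse A \<tau> z0 j z\<bar> \<le> real m * A * B"
proof -
  have "\<bar>\<Sum>j\<in>{1..m}. real (\<sigma> j) * pulse A \<tau> z0 j z\<bar> \<le> (\<Sum>j\<in>{1..m}. A * B)"
  proof (rule order_trans[OF sum_abs sum_mono])
    fix j assume j: "j \<in> {1..m}"
    have "\<bar>pulse A \<tau> z0 j z\<bar> \<le> A * B"
      using B bump_nonneg A by (simp add: pulse_def abs_mult abs_direction mult_left_mono)
    moreover have "0 \<le> A * B" using A order_trans[OF bump_nonneg[of 0] B[of 0]] by simp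
    ultimately show "\<bar>real (\<sigma> j) * pulse A \<tau> z0 j z\<bar> \<le> A * B" using \<sigma>[OF j] by auto
  qed
  then show ?thesis by (simp add: mult.assoc)
qed

lemma continuous_pulse_trace: "continuous_on S (\<lambda>t. pulse A \<tau> z0 j (x, t))"
  unfolding pulse_trace by (intro continuous_intros continuous_on_compose2[OF continuous_bump[of UNIV]]) auto

lemma distr_of_sum:
  assumes "finite J" "\<And>j. j \<in> J \<Longrightarrow> continuous_on {a..b} (h j)"
  shows "(\<Sum>j\<in>J. c j * distr_of {a<..<b} (h j) \<phi>) = distr_of {a<..<b} (\<lambda>t. \<Sum>j\<in>J. c j * h j t) \<phi>"
  using assms
proof (induction J rule: finite_induct)
  case empty
  then show ?case by (simp add: distr_of_def)
next
  case (insert i J)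
  have c: "continuous_on {a..b} (\<lambda>t. \<Sum>j\<in>J. c j * h j t)" by (intro continuous_intros insert.prems) auto
  have "c i * distr_of {a<..<b} (h i) \<phi> + 1 * distr_of {a<..<b} (\<lambda>t. \<Sum>j\<in>J. c j * h j t) \<phi>
      = distr_of {a<..<b} (\<lambda>t. c i * h i t + 1 * (\<Sum>j\<in>J. c j * h j t)) \<phi>"
    by (rule fun_cong[OF distr_of_linear[OF insert.prems c]]) simp
  then show ?case using insert by simp
qed

text \<open>
  Traces of sums of pulses have this form.
\<close>
lemma bump_train_sobolev:
  fixes e c :: "nat \<Rightarrow> real"
  assumes "finite J" "\<tau> \<ge> 1" "p \<ge> 0"
  defines "h \<equiv> \<lambda>t. \<Sum>j\<in>J. e j * bump (\<tau> * (t - c j))"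
  shows "distr_of I h \<in> sobolev p I"
    "sobolev_norm p I (distr_of I h) \<le> (\<Sum>j\<in>J. \<bar>e j\<bar>) * \<tau> powr p * weighted_norm p (fourier bump)"
proof -
  obtain g where g: "sobolev_extension p I (distr_of I h) g"
    "weighted_norm p g \<le> (\<Sum>j\<in>J. \<bar>e j\<bar>) * \<tau> powr p * weighted_norm p (fourier bump)"
    using bump_train_extension[OF assms(1-3), of I e c] unfolding h_def by blast
  show "distr_of I h \<in> sobolev p I" using g(1) unfolding sobolev_def by (auto simp: distr_of_def)
  show "sobolev_norm p I (distr_of I h) \<le> (\<Sum>j\<in>J. \<bar>e j\<bar>) * \<tau> powr p * weighted_norm p (fourier bump)"
    using sobolev_norm_le[OF g(1)] g(2) by linarith
qed

lemma smooth_sum: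
  assumes "finite J" "\<And>j. j \<in> J \<Longrightarrow> smooth (f j)" shows "smooth (\<lambda>x. \<Sum>j\<in>J. f j x)"
  using assms by (induction J rule: finite_induct) (auto intro: smooth_add smooth_const)

lemma iterated_deriv_vanishing:
  fixes f :: "real \<Rightarrow> real"
  assumes "open S" "\<And>x. x \<in> S \<Longrightarrow> f x = 0" "x \<in> S" shows "(deriv ^^ k) f x = 0"
proof -
  have "\<forall>x\<in>S. (deriv ^^ k) f x = 0"
  proof (induction k)
    case (Suc k)
    show ?case
    proof
      fix x assume x: "x \<in> S"
      have "((deriv ^^ k) f has_real_derivative 0) (at x)"
        by (rule has_field_derivative_transform_within_open[OF DERIV_const[of 0] assms(1) x]) (use Suc in auto)
      then show "(deriv ^^ Suc k) f x = 0" by (simp add: DERIV_imp_deriv)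
    qed
  qed (use assms in auto)
  then show ?thesis using assms(3) by blast
qed

text \<open>
  The condition at time zero asks for a tower of derivatives; for a smooth function that vanishes near
  zero, the iterated derivatives are one.
\<close>
lemma vanishing_at_0_smooth:
  assumes "smooth h" "e > 0" "\<And>t. t < e \<Longrightarrow> h t = 0" shows "vanishing_at_0 T s (distr_of {0<..<T} h)"
  unfolding vanishing_at_0_def
proof (intro exI[of _ "\<lambda>k. (deriv ^^ k) h"] conjI allI impI ballI)
  show "(deriv ^^ k) h 0 = 0" for k
    by (rule iterated_deriv_vanishing[of "{..<e}"]) (use assms in auto)
  show "continuous_on {0..T} ((deriv ^^ k) h)" for k
    by (rule smooth_continuous[OF smooth_funpow_deriv[OF assms(1)]])
  show "((deriv ^^ k) h has_real_derivative (deriv ^^ Suc k) h t) (at t within {0..T})" for k t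
    using has_field_derivative_at_within[OF smooth_has_deriv[OF smooth_funpow_deriv[OF assms(1)]]] by simp
qed simp

lemma pulse_data_in_domain:
  fixes T :: real
  assumes ab: "\<alpha> < \<beta>" and \<tau>: "\<tau> \<ge> 1" "\<tau> * lam > 1" and lam: "lam > 0"
    and z0: "\<And>x. x \<in> {\<alpha>, \<beta>} \<Longrightarrow> \<bar>x - fst z0\<bar> + lam \<le> snd z0"
    and A: "A \<ge> 0" and \<sigma>: "\<And>j. j \<in> {1..m} \<Longrightarrow> \<sigma> j \<in> {0, 1 :: nat}"
    and small: "2 * (real m * A * \<tau> ^ (s + 1) * weighted_norm (real (s + 1)) (fourier bump)) < \<kappa>"
  defines "F \<equiv> bdistr_of {\<alpha><..<\<beta>} T (\<lambda>z. \<Sum>j\<in>{1..m}. real (\<sigma> j) * pulse A \<tau> z0 j z)"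
  shows "F \<in> DN_domain {\<alpha><..<\<beta>} T s \<kappa>"
    "bsobolev_norm {\<alpha><..<\<beta>} T (real (s + 1)) F \<le> 2 * (real m * A * \<tau> ^ (s + 1) * weighted_norm (real (s + 1)) (fourier bump))"
proof -
  let ?\<Omega> = "{\<alpha><..<\<beta>}" and ?p = "real (s + 1)"
  define N where "N = real m * A * \<tau> ^ (s + 1) * weighted_norm ?p (fourier bump)"
  have N0: "N \<ge> 0" using A \<tau> weighted_norm_nonneg by (simp add: N_def)
  define e where "e j = real (\<sigma> j) * (- direction j * A)" for j
  define c where "c x j = snd z0 + direction j * (x - fst z0)" for x j
  define h where "h x t = (\<Sum>j\<in>{1..m}. e j * bump (\<tau> * (t - c x j)))" for x t
  have hW: "(\<Sum>j\<in>{1..m}. real (\<sigma> j) * pulse A \<tau> z0 j (x, t)) = h x t" for x t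
    by (simp add: h_def e_def c_def pulse_trace mult.assoc)
  have Fx: "F x = (if x \<in> frontier ?\<Omega> then distr_of {0<..<T} (h x) else (\<lambda>_. 0))" for x
    unfolding F_def bdistr_of_def hW ..
  have es: "(\<Sum>j\<in>{1..m}. \<bar>e j\<bar>) \<le> real m * A"
  proof -
    have "(\<Sum>j\<in>{1..m}. \<bar>e j\<bar>) \<le> (\<Sum>j\<in>{1..m}. A)"
    proof (rule sum_mono)
      fix j assume "j \<in> {1..m}"
      from \<sigma>[OF this] show "\<bar>e j\<bar> \<le> A" using A by (auto simp: e_def abs_mult abs_direction)
    qed
    then show ?thesis by simp
  qed
  have mem: "distr_of {0<..<T} (h x) \<in> sobolev ?p {0<..<T}" for x
    unfolding h_def by (rule bump_train_sobolev(1)) (use \<tau> in auto)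
  have nrm: "sobolev_norm ?p {0<..<T} (distr_of {0<..<T} (h x)) \<le> N" for x
  proof -
    have "sobolev_norm ?p {0<..<T} (distr_of {0<..<T} (h x)) \<le> (\<Sum>j\<in>{1..m}. \<bar>e j\<bar>) * \<tau> powr ?p * weighted_norm ?p (fourier bump)"
      unfolding h_def by (rule bump_train_sobolev(2)) (use \<tau> in auto)
    also have "\<dots> \<le> real m * A * \<tau> powr ?p * weighted_norm ?p (fourier bump)"
      by (intro mult_right_mono es weighted_norm_nonneg) simp
    also have "\<tau> powr ?p = \<tau> ^ (s + 1)" using \<tau> powr_realpow[of \<tau> "s + 1"] by simp
    finally show ?thesis by (simp add: N_def)
  qed
  have fin: "frontier ?\<Omega> = {\<alpha>, \<beta>}" by (rule frontier_open_interval[OF ab])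
  have bm: "F \<in> bsobolev ?\<Omega> T ?p" using mem unfolding bsobolev_def by (simp add: Fx)
  have bn: "bsobolev_norm ?\<Omega> T ?p F \<le> 2 * N"
  proof -
    have "(sobolev_norm ?p {0<..<T} (distr_of {0<..<T} (h x)))\<^sup>2 \<le> N\<^sup>2" for x
      by (rule power_mono[OF nrm sobolev_norm_nonneg[OF mem]])
    from this[of \<alpha>] this[of \<beta>]
    have "(sobolev_norm ?p {0<..<T} (F \<alpha>))\<^sup>2 + (sobolev_norm ?p {0<..<T} (F \<beta>))\<^sup>2 \<le> 4 * N\<^sup>2"
      using zero_le_power2[of N] unfolding Fx fin by (simp only: insert_iff simp_thms if_True)
    then have "(\<Sum>x\<in>frontier ?\<Omega>. (sobolev_norm ?p {0<..<T} (F x))\<^sup>2) \<le> (2 * N)\<^sup>2"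
      using ab by (simp add: fin power_mult_distrib)
    then have "bsobolev_norm ?\<Omega> T ?p F \<le> sqrt ((2 * N)\<^sup>2)" unfolding bsobolev_norm_def by (rule real_sqrt_le_mono)
    also have "sqrt ((2 * N)\<^sup>2) = 2 * N" unfolding real_sqrt_abs using N0 by simp
    finally show ?thesis .
  qed
  then show "bsobolev_norm ?\<Omega> T ?p F \<le> 2 * (real m * A * \<tau> ^ (s + 1) * weighted_norm ?p (fourier bump))"
    by (simp add: N_def)
  have van: "vanishing_at_0 T s (F x)" if x: "x \<in> frontier ?\<Omega>" for x
  proof -
    have sm: "smooth (h x)"
      unfolding h_def
    proof (rule smooth_sum)
      fix j show "smooth (\<lambda>t. e j * bump (\<tau> * (t - c x j)))"
        using smooth_affine[OF smooth_bump, of "e j" \<tau> "- (\<tau> * c x j)"] by (simp add: right_diff_distrib)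
    qed simp
    \<comment> \<open>The trace is centered at a time not before \<open>lam\<close> and has width \<open>1 / \<tau>\<close>.\<close>
    define r where "r = lam - 1 / \<tau>"
    have r: "r > 0" using \<tau> by (simp add: r_def field_simps)
    have z: "h x t = 0" if t: "t < r" for t
    proof -
      have "bump (\<tau> * (t - c x j)) = 0" for j
      proof (rule bump_eq_0)
        have "\<bar>x - fst z0\<bar> + lam \<le> snd z0" using z0 x fin by auto
        moreover have "- \<bar>x - fst z0\<bar> \<le> direction j * (x - fst z0)" using direction_cases[of j] by auto
        ultimately have "lam \<le> c x j" unfolding c_def by linarith
        then have "1 / \<tau> \<le> c x j - t" using t by (simp add: r_def)
        then have "1 \<le> \<tau> * (c x j - t)" using \<tau> by (simp add: field_simps)
        then show "1 \<le> \<bar>\<tau> * (t - c x j)\<bar>" by (simp add: algebra_simps abs_if)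
      qed
      then show ?thesis by (simp add: h_def)
    qed
    show ?thesis using vanishing_at_0_smooth[OF sm r z] x by (simp add: Fx)
  qed
  show "F \<in> DN_domain ?\<Omega> T s \<kappa>"
    unfolding DN_domain_def using bm bn van small by (simp add: N_def)
qed

lemma single_pulse_sobolev:
  assumes ab: "\<alpha> < \<beta>" and \<tau>: "\<tau> \<ge> 1"
  shows "bdistr_of {\<alpha><..<\<beta>} T (\<lambda>z. pulse A \<tau> z0 j z / e) \<in> bsobolev {\<alpha><..<\<beta>} T (real (s + 1))"
proof -
  have "distr_of {0<..<T} (\<lambda>t. pulse A \<tau> z0 j (x, t) / e) \<in> sobolev (real (s + 1)) {0<..<T}" for x
    using bump_train_sobolev(1)[of "{j}" \<tau> "real (s + 1)" "{0<..<T}" "\<lambda>j. - direction j * A / e" "\<lambda>j. snd z0 + direction j * (x - fst z0)"] \<tau>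
    by (simp add: pulse_trace)
  then show ?thesis by (simp add: bsobolev_def bdistr_of_def)
qed

lemma zero_bsobolev: "(\<lambda>_ _. 0) \<in> bsobolev \<Omega> T (real (s + 1))"
proof -
  have "distr_of {0<..<T} (\<lambda>t. \<Sum>j\<in>({} :: nat set). (0::real) * bump (1 * (t - 0))) \<in> sobolev (real (s + 1)) {0<..<T}"
    by (rule bump_train_sobolev(1)[where e = "\<lambda>_. 0" and c = "\<lambda>_. 0"]) auto
  moreover have "distr_of {0<..<T} (\<lambda>t. 0) = (\<lambda>_. 0)" by (simp add: distr_of_def fun_eq_iff)
  ultimately show ?thesis by (simp add: bsobolev_def)
qed

section \<open>Expansion of the measurements\<close>

text \<open>
  The values \<open>G\<close> are a linear term, an integral of an \<open>m\<close>-th power and an error. The linear term is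
  annihilated, the powers become a product by polarization under the integral, and the errors are
  summed over the \<open>2^m\<close> vertices of the cube.
\<close>
lemma finite_difference_estimate:
  fixes a :: "real \<times> real \<Rightarrow> real" and w :: "nat \<Rightarrow> real \<times> real \<Rightarrow> real"
  assumes m: "m \<ge> 2" and P: "(\<Prod>j\<in>{1..m}. \<epsilon> j) = P" "P > 0"
    and ca: "continuous_on UNIV a" and cw: "\<And>j. continuous_on UNIV (w j)"
    and G: "\<And>\<sigma>. \<sigma> \<in> {1..m} \<rightarrow>\<^sub>E {0, 1 :: nat} \<Longrightarrow> \<bar>G (\<lambda>j. real (\<sigma> j) * \<epsilon> j) - (\<Sum>j\<in>{1..m}. real (\<sigma> j) * l j)
        - integral (cbox p q) (\<lambda>z. a z * (\<Sum>j\<in>{1..m}. real (\<sigma> j) * w j z) ^ m)\<bar> \<le> e"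
  shows "\<bar>finite_diff m \<epsilon> G - fact m * integral (cbox p q) (\<lambda>z. a z * (\<Prod>j\<in>{1..m}. w j z)) / P\<bar> \<le> 2 ^ m * e / P"
proof -
  let ?S = "{1..m} \<rightarrow>\<^sub>E {0, 1 :: nat}"
  define sg where "sg \<sigma> = (- 1 :: real) ^ ((\<Sum>j\<in>{1..m}. \<sigma> j) + m)" for \<sigma> :: "nat \<Rightarrow> nat"
  define lin where "lin \<sigma> = (\<Sum>j\<in>{1..m}. real (\<sigma> j) * l j)" for \<sigma> :: "nat \<Rightarrow> nat"
  define I0 where "I0 \<sigma> = integral (cbox p q) (\<lambda>z. a z * (\<Sum>j\<in>{1..m}. real (\<sigma> j) * w j z) ^ m)" for \<sigma> :: "nat \<Rightarrow> nat"
  define R where "R \<sigma> = G (\<lambda>j. real (\<sigma> j) * \<epsilon> j) - lin \<sigma> - I0 \<sigma>" for \<sigma>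
  have fin: "finite ?S" by (rule finite_PiE) auto
  have "(\<Sum>\<sigma>\<in>?S. sg \<sigma> * lin \<sigma>) = 0"
    using polarization[of "{1..m}" 1 0 l] m by (simp add: sg_def lin_def)
  moreover have "(\<Sum>\<sigma>\<in>?S. sg \<sigma> * I0 \<sigma>) = fact m * integral (cbox p q) (\<lambda>z. a z * (\<Prod>j\<in>{1..m}. w j z))"
  proof -
    have c: "continuous_on (cbox p q) (\<lambda>z. a z * (\<Sum>j\<in>{1..m}. real (\<sigma> j) * w j z) ^ m)" for \<sigma> :: "nat \<Rightarrow> nat"
      by (intro continuous_intros continuous_on_subset[OF ca] continuous_on_subset[OF cw]) auto
    have "(\<Sum>\<sigma>\<in>?S. sg \<sigma> * I0 \<sigma>) = (\<Sum>\<sigma>\<in>?S. integral (cbox p q) (\<lambda>z. sg \<sigma> * (a z * (\<Sum>j\<in>{1..m}. real (\<sigma> j) * w j z) ^ m)))"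
      by (simp add: I0_def)
    also have "\<dots> = integral (cbox p q) (\<lambda>z. \<Sum>\<sigma>\<in>?S. sg \<sigma> * (a z * (\<Sum>j\<in>{1..m}. real (\<sigma> j) * w j z) ^ m))"
      by (rule Henstock_Kurzweil_Integration.integral_sum[symmetric, OF fin])
         (intro integrable_continuous continuous_intros c)
    also have "\<dots> = integral (cbox p q) (\<lambda>z. fact m * (a z * (\<Prod>j\<in>{1..m}. w j z)))"
    proof (rule Henstock_Kurzweil_Integration.integral_cong)
      fix z
      have "(\<Sum>\<sigma>\<in>?S. sg \<sigma> * (a z * (\<Sum>j\<in>{1..m}. real (\<sigma> j) * w j z) ^ m)) = a z * (\<Sum>\<sigma>\<in>?S. sg \<sigma> * (\<Sum>j\<in>{1..m}. real (\<sigma> j) * w j z) ^ m)"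
        by (simp add: sum_distrib_left mult_ac)
      also have "(\<Sum>\<sigma>\<in>?S. sg \<sigma> * (\<Sum>j\<in>{1..m}. real (\<sigma> j) * w j z) ^ m) = fact m * (\<Prod>j\<in>{1..m}. w j z)"
        using polarization[of "{1..m}" m 0 "\<lambda>j. w j z"] by (simp add: sg_def)
      finally show "(\<Sum>\<sigma>\<in>?S. sg \<sigma> * (a z * (\<Sum>j\<in>{1..m}. real (\<sigma> j) * w j z) ^ m)) = fact m * (a z * (\<Prod>j\<in>{1..m}. w j z))"
        by simp
    qed
    finally show ?thesis by simp
  qed
  moreover have "(\<Sum>\<sigma>\<in>?S. sg \<sigma> * G (\<lambda>j. real (\<sigma> j) * \<epsilon> j))
      = (\<Sum>\<sigma>\<in>?S. sg \<sigma> * lin \<sigma>) + (\<Sum>\<sigma>\<in>?S. sg \<sigma> * I0 \<sigma>) + (\<Sum>\<sigma>\<in>?S. sg \<sigma> * R \<sigma>)"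
    unfolding sum.distrib[symmetric] by (intro sum.cong) (simp_all add: R_def algebra_simps)
  moreover have "finite_diff m \<epsilon> G = (\<Sum>\<sigma>\<in>?S. sg \<sigma> * G (\<lambda>j. real (\<sigma> j) * \<epsilon> j)) / P"
    unfolding finite_diff_def sg_def P(1) by simp
  ultimately have "finite_diff m \<epsilon> G - fact m * integral (cbox p q) (\<lambda>z. a z * (\<Prod>j\<in>{1..m}. w j z)) / P = (\<Sum>\<sigma>\<in>?S. sg \<sigma> * R \<sigma>) / P"
    by (simp add: add_divide_distrib)
  moreover have "\<bar>\<Sum>\<sigma>\<in>?S. sg \<sigma> * R \<sigma>\<bar> \<le> (\<Sum>\<sigma>\<in>?S. e)"
  proof (rule order_trans[OF sum_abs sum_mono])
    fix \<sigma> assume "\<sigma> \<in> ?S"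
    from G[OF this] show "\<bar>sg \<sigma> * R \<sigma>\<bar> \<le> e" by (simp add: R_def lin_def I0_def sg_def abs_mult)
  qed
  ultimately show ?thesis using P(2) by (simp add: card_PiE divide_right_mono numeral_2_eq_2)
qed

text \<open>
  The weight vanishes off its support, so restricting it to the support changes nothing and leaves the
  test function that a measurement wave provides.
\<close>
lemma lateral_supp_test:
  assumes x: "x \<in> frontier \<Omega>"
  shows "(\<lambda>t. if (x, t) \<in> lateral_supp \<Omega> T v then v (x, t) else 0) = (\<lambda>t. if (x, t) \<in> lateral \<Omega> T then v (x, t) else 0)"
  using not_in_supp[of _ v] by (auto simp: lateral_supp_def fun_eq_iff)

text \<open>
  Since \<open>u\<close> is continuously differentiable up to the boundary, the pairing with the normal derivative
  is a classical integral.
\<close>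
lemma DN_pairing:
  assumes ab: "\<alpha> < \<beta>" and T: "T > 0" and w: "weak_wave \<alpha> \<beta> T g u ux ut"
    and v: "C_infinity v"
    and tst: "\<And>x. x \<in> {\<alpha>, \<beta>} \<Longrightarrow> (\<lambda>t. if (x, t) \<in> lateral {\<alpha><..<\<beta>} T then v (x, t) else 0) \<in> test_functions {0<..<T}"
  shows "bintegral {\<alpha><..<\<beta>} (lateral_supp {\<alpha><..<\<beta>} T v) v (bdistr_of {\<alpha><..<\<beta>} T (normal_deriv {\<alpha><..<\<beta>} u))
    = integral {0..T} (\<lambda>t. v (\<beta>, t) * ux (\<beta>, t)) - integral {0..T} (\<lambda>t. v (\<alpha>, t) * ux (\<alpha>, t))"
proof -
  let ?\<Omega> = "{\<alpha><..<\<beta>}"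
  have fr: "frontier ?\<Omega> = {\<alpha>, \<beta>}" by (rule frontier_open_interval[OF ab])
  have cux: "continuous_on ({\<alpha>..\<beta>} \<times> {0..T}) ux" using w by (simp add: weak_wave_def)
  have one: "bdistr_of ?\<Omega> T (normal_deriv ?\<Omega> u) x (\<lambda>t. if (x, t) \<in> lateral_supp ?\<Omega> T v then v (x, t) else 0)
      = outward_normal ?\<Omega> x * integral {0..T} (\<lambda>t. v (x, t) * ux (x, t))" if x: "x \<in> {\<alpha>, \<beta>}" for x
  proof -
    define \<psi> where "\<psi> = (\<lambda>t. if (x, t) \<in> lateral ?\<Omega> T then v (x, t) else 0)"
    have \<psi>: "\<psi> \<in> test_functions {0<..<T}" using tst[OF x] by (simp add: \<psi>_def)
    have xi: "x \<in> {\<alpha>..\<beta>}" and xf: "x \<in> frontier ?\<Omega>" using x ab fr by auto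
    have nd: "normal_deriv ?\<Omega> u (x, t) = outward_normal ?\<Omega> x * ux (x, t)" if t: "t \<in> {0..T}" for t
    proof -
      have "((\<lambda>y. u (y, t)) has_vector_derivative ux (x, t)) (at x within {\<alpha>..\<beta>})"
        using w xi t unfolding weak_wave_def by (simp add: has_real_derivative_iff_has_vector_derivative)
      then have "vector_derivative (\<lambda>y. u (y, t)) (at x within {\<alpha>..\<beta>}) = ux (x, t)"
        by (intro vector_derivative_within_cbox[of \<alpha> \<beta>, unfolded cbox_interval] ab xi)
      then show ?thesis using ab by (simp add: normal_deriv_def)
    qed
    have "bdistr_of ?\<Omega> T (normal_deriv ?\<Omega> u) x \<psi> = distr_of {0<..<T} (\<lambda>t. normal_deriv ?\<Omega> u (x, t)) \<psi>"
      using xf by (simp add: bdistr_of_def)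
    also have "\<dots> = distr_of {0<..<T} (\<lambda>t. outward_normal ?\<Omega> x * ux (x, t)) \<psi>"
      using \<psi> by (simp add: distr_of_def) (rule set_lebesgue_integral_cong; simp add: nd)
    also have "\<dots> = integral {0..T} (\<lambda>t. outward_normal ?\<Omega> x * ux (x, t) * \<psi> t)"
      by (rule distr_of_integral[OF _ \<psi>]) (intro continuous_intros continuous_slice_t[OF cux xi order_refl])
    also have "\<dots> = integral {0..T} (\<lambda>t. outward_normal ?\<Omega> x * (v (x, t) * ux (x, t)))"
      by (rule Henstock_Kurzweil_Integration.integral_cong) (use xf in \<open>simp add: \<psi>_def lateral_def\<close>)
    finally show ?thesis unfolding lateral_supp_test[OF xf] \<psi>_def by simp
  qed
  show ?thesis unfolding bintegral_def fr using ab one[of \<alpha>] one[of \<beta>]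
    by (simp add: outward_normal_def)
qed

lemma bsobolev_pairing_bound:
  assumes F: "F \<in> bsobolev \<Omega> T r" and fin: "finite (frontier \<Omega>)"
    and tst: "\<And>x. x \<in> frontier \<Omega> \<Longrightarrow> (\<lambda>t. if (x, t) \<in> lateral \<Omega> T then v (x, t) else 0) \<in> test_functions {0<..<T}"
  shows "\<bar>bintegral \<Omega> (lateral_supp \<Omega> T v) v F\<bar>
    \<le> (\<Sum>x\<in>frontier \<Omega>. weighted_norm (- r) (fourier (\<lambda>t. if (x, t) \<in> lateral \<Omega> T then v (x, t) else 0))) * bsobolev_norm \<Omega> T r F"
  unfolding bintegral_def sum_distrib_right
proof (rule order_trans[OF sum_abs sum_mono])
  fix x assume x: "x \<in> frontier \<Omega>"
  let ?\<psi> = "\<lambda>t. if (x, t) \<in> lateral \<Omega> T then v (x, t) else 0"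
  have m: "F x \<in> sobolev r {0<..<T}" using F x by (simp add: bsobolev_def)
  have "(sobolev_norm r {0<..<T} (F x))\<^sup>2 \<le> (\<Sum>x\<in>frontier \<Omega>. (sobolev_norm r {0<..<T} (F x))\<^sup>2)"
    by (rule member_le_sum[OF x _ fin]) simp
  then have "sqrt ((sobolev_norm r {0<..<T} (F x))\<^sup>2) \<le> bsobolev_norm \<Omega> T r F"
    unfolding bsobolev_norm_def by (rule real_sqrt_le_mono)
  then have "sobolev_norm r {0<..<T} (F x) \<le> bsobolev_norm \<Omega> T r F" using sobolev_norm_nonneg[OF m] by simp
  then have "weighted_norm (- r) (fourier ?\<psi>) * sobolev_norm r {0<..<T} (F x) \<le> weighted_norm (- r) (fourier ?\<psi>) * bsobolev_norm \<Omega> T r F"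
    by (rule mult_left_mono[OF _ weighted_norm_nonneg])
  then show "\<bar>F x (\<lambda>t. if (x, t) \<in> lateral_supp \<Omega> T v then v (x, t) else 0)\<bar> \<le> weighted_norm (- r) (fourier ?\<psi>) * bsobolev_norm \<Omega> T r F"
    unfolding lateral_supp_test[OF x] using sobolev_pairing_bound[OF m tst[OF x]] by linarith
qed

text \<open>
  The contribution of a single pulse to the measurement; it enters linearly.
\<close>
definition pulse_flux :: "real \<Rightarrow> real \<Rightarrow> real \<Rightarrow> (real \<times> real \<Rightarrow> real) \<Rightarrow> real \<Rightarrow> real \<Rightarrow> real \<times> real \<Rightarrow> nat \<Rightarrow> real" where
  "pulse_flux \<alpha> \<beta> T v A \<tau> z0 j =
     integral {0..T} (\<lambda>t. v (\<beta>, t) * deriv (pulse_profile A \<tau> z0 j) (\<beta> - direction j * t))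
     - integral {0..T} (\<lambda>t. v (\<alpha>, t) * deriv (pulse_profile A \<tau> z0 j) (\<alpha> - direction j * t))"

text \<open>
  The measurement of the Dirichlet-to-Neumann map on pulse data, to first order in the nonlinearity.
  The solution selected by the map is the sum of the pulses and a correction that is zero on the
  boundary, which \<open>nonlinear_bootstrap\<close> bounds and \<open>boundary_flux\<close> converts into the integral of
  \<open>a u^m\<close>; finally \<open>u\<close> is replaced by the sum of the pulses.
\<close>
lemma DN_asymptotics:
  assumes ab: "\<alpha> < \<beta>" and T: "T > 0" and s: "s \<ge> 1" and m: "m \<ge> 2"
    and a: "C_infinity a" "admissible {\<alpha><..<\<beta>} T s L lam a" and L: "L > 0"
    and DN: "DN_constants {\<alpha><..<\<beta>} T s m L lam \<kappa> \<rho>" and v: "measurement_wave {\<alpha><..<\<beta>} T lam v"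
    and lam: "lam > 0" and \<tau>: "\<tau> \<ge> 1" "\<tau> * lam > 1" and A: "A > 0" and B: "B > 0" "\<And>y. bump y \<le> B"
    and z0: "z0 \<in> {\<alpha><..<\<beta>} \<times> {t_lower {\<alpha><..<\<beta>} lam..t_upper {\<alpha><..<\<beta>} T lam}"
    and b: "b = real m * A * B" and small: "2 * T\<^sup>2 * (L * (2 * b) ^ m) < b"
    and small': "2 * (real m * A * \<tau> ^ (s + 1) * weighted_norm (real (s + 1)) (fourier bump)) < \<kappa>"
    and \<sigma>: "\<sigma> \<in> {1..m} \<rightarrow>\<^sub>E {0, 1 :: nat}"
  shows "\<bar>bintegral {\<alpha><..<\<beta>} (lateral_supp {\<alpha><..<\<beta>} T v) v
        (DN_map {\<alpha><..<\<beta>} T s m \<rho> a (bdistr_of {\<alpha><..<\<beta>} T (\<lambda>z. \<Sum>j\<in>{1..m}. real (\<sigma> j) * pulse A \<tau> z0 j z)))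
      - (\<Sum>j\<in>{1..m}. real (\<sigma> j) * pulse_flux \<alpha> \<beta> T v A \<tau> z0 j)
      - integral (cbox (\<alpha>, 0) (\<beta>, T)) (\<lambda>z. a z * (\<Sum>j\<in>{1..m}. real (\<sigma> j) * pulse A \<tau> z0 j z) ^ m)\<bar>
    \<le> L * (real m * (2 * b) ^ (m - 1) * (2 * T\<^sup>2 * (L * (2 * b) ^ m))) * ((\<beta> - \<alpha>) * T)"
proof -
  let ?\<Omega> = "{\<alpha><..<\<beta>}" and ?R = "{\<alpha>..\<beta>} \<times> {0..T}"
  define W where "W z = (\<Sum>j\<in>{1..m}. real (\<sigma> j) * pulse A \<tau> z0 j z)" for z
  define Wx where "Wx z = (\<Sum>j\<in>{1..m}. real (\<sigma> j) * deriv (pulse_profile A \<tau> z0 j) (fst z - direction j * snd z))" for z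
  define Wt where "Wt z = (\<Sum>j\<in>{1..m}. real (\<sigma> j) * (- direction j * deriv (pulse_profile A \<tau> z0 j) (fst z - direction j * snd z)))" for z
  have \<sigma>01: "\<sigma> j \<in> {0, 1}" if "j \<in> {1..m}" for j using \<sigma> that by (rule PiE_mem)
  have early: "\<bar>x - fst z0\<bar> + lam \<le> snd z0" if "x \<in> {\<alpha>..\<beta>}" for x
        by (rule pulse_time_margin[OF ab z0 that])
  have ww: "weak_wave \<alpha> \<beta> T (\<lambda>_. 0) W Wx Wt"
    unfolding W_def Wx_def Wt_def by (rule weak_wave_sum[OF finite_atLeastAtMost pulse_weak_wave])
  have W0: "W (x, 0) = 0" "Wt (x, 0) = 0" if "x \<in> {\<alpha>..\<beta>}" for x
    using pulse_initial[OF \<tau>(2) lam early[OF that]] by (simp_all add: W_def Wt_def)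
  have Wb: "\<bar>W z\<bar> \<le> b" for z
    unfolding W_def b by (rule pulse_sum_bound[OF B(2) less_imp_le[OF A] \<sigma>01])
  have b0: "b > 0" using A B m by (simp add: b)
  define f where "f = bdistr_of ?\<Omega> T W"
  have fdom: "f \<in> DN_domain ?\<Omega> T s \<kappa>"
    unfolding f_def W_def
    by (rule pulse_data_in_domain(1)[OF ab \<tau> lam _ less_imp_le[OF A] \<sigma>01 small']) (use early ab in auto)
  define u where "u = (THE u. is_small_solution ?\<Omega> T s m \<rho> a f u)"
  have "\<exists>!u. is_small_solution ?\<Omega> T s m \<rho> a f u" using DN a(2) fdom unfolding DN_constants_def by blast
  then have "is_small_solution ?\<Omega> T s m \<rho> a f u" unfolding u_def by (rule theI')
  then have sol: "is_solution ?\<Omega> T s m a f u" by (simp add: is_small_solution_def)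
  have ca: "continuous_on UNIV a" by (rule C_infinity_continuous[OF a(1)])
  obtain ux ut where uw: "weak_wave \<alpha> \<beta> T (\<lambda>z. a z * u z ^ m) u ux ut"
    and u0: "\<And>x. x \<in> {\<alpha>..\<beta>} \<Longrightarrow> u (x, 0) = 0" and ut0: "\<And>x. x \<in> {\<alpha>..\<beta>} \<Longrightarrow> ut (x, 0) = 0"
    using is_solution_weak_wave[OF ab T s ca sol] by blast
  have cu: "continuous_on ?R u" "continuous_on ?R ux" using uw by (simp_all add: weak_wave_def)
  have cW: "continuous_on ?R W" "continuous_on ?R Wx" using ww by (simp_all add: weak_wave_def)
  have pw: "weak_wave \<alpha> \<beta> T (\<lambda>z. a z * u z ^ m) (\<lambda>z. u z - W z) (\<lambda>z. ux z - Wx z) (\<lambda>z. ut z - Wt z)"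
    using weak_wave_combine[OF uw ww, of "-1"] by simp
  have bdry: "u (x, t) = W (x, t)" if x: "x \<in> frontier ?\<Omega>" and t: "t \<in> {0..T}" for x t
  proof -
    have xi: "x \<in> {\<alpha>..\<beta>}" using x frontier_open_interval[OF ab] ab by auto
    have "bdistr_of ?\<Omega> T u = bdistr_of ?\<Omega> T W" using sol unfolding is_solution_def f_def by (simp add: Let_def)
    from fun_cong[OF this, of x] have "distr_of {0<..<T} (\<lambda>t. u (x, t)) = distr_of {0<..<T} (\<lambda>t. W (x, t))"
      using x by (simp add: bdistr_of_def)
    then show ?thesis
      by (rule distr_of_inject[OF T continuous_slice_t[OF cu(1) xi order_refl] continuous_slice_t[OF cW(1) xi order_refl] _ t])
  qed
  have bc: "u (\<alpha>, t) = W (\<alpha>, t)" "u (\<beta>, t) = W (\<beta>, t)" if "t \<in> {0..T}" for t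
    using bdry that frontier_open_interval[OF ab] by auto
  have ic: "u (x, 0) = W (x, 0)" "ut (x, 0) - Wt (x, 0) = 0" if "x \<in> {\<alpha>..\<beta>}" for x
    using u0 ut0 W0 that by auto
  have vC: "C_infinity v" and vbox: "\<And>x t. t \<in> {0..T} \<Longrightarrow> dalembertian v (x, t) = 0"
    and vT: "\<And>x. x \<in> ?\<Omega> \<Longrightarrow> v (x, T) = 0" "\<And>x. x \<in> ?\<Omega> \<Longrightarrow> pd_t v (x, T) = 0"
    and v1: "\<And>z. z \<in> ?\<Omega> \<times> {t_lower ?\<Omega> lam..t_upper ?\<Omega> T lam} \<Longrightarrow> v z = 1"
    and vtest: "\<And>x. x \<in> frontier ?\<Omega> \<Longrightarrow> (\<lambda>t. if (x, t) \<in> lateral ?\<Omega> T then v (x, t) else 0) \<in> test_functions {0<..<T}"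
    using v unfolding measurement_wave_def by auto
  note a_bounds = admissible_bounds[OF a]
  define q where "q = 2 * T\<^sup>2 * (L * (2 * b) ^ m)"
  have d: "\<bar>u z - W z\<bar> \<le> q" if "z \<in> ?R" for z
    unfolding q_def by (rule nonlinear_bootstrap[OF ab T pw bc ic a_bounds(1) L Wb b0 small that])
  have "bintegral ?\<Omega> (lateral_supp ?\<Omega> T v) v (DN_map ?\<Omega> T s m \<rho> a f)
      = integral {0..T} (\<lambda>t. v (\<beta>, t) * ux (\<beta>, t)) - integral {0..T} (\<lambda>t. v (\<alpha>, t) * ux (\<alpha>, t))"
    unfolding DN_map_def u_def[symmetric]
    by (rule DN_pairing[OF ab T uw vC]) (use vtest frontier_open_interval[OF ab] in auto)
  also have "\<dots> = (integral {0..T} (\<lambda>t. v (\<beta>, t) * Wx (\<beta>, t)) - integral {0..T} (\<lambda>t. v (\<alpha>, t) * Wx (\<alpha>, t)))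
       + integral (cbox (\<alpha>, 0) (\<beta>, T)) (\<lambda>z. a z * u z ^ m)"
  proof (rule boundary_flux[OF ab T pw cu(2) cW(2) bc ic vC vbox vT])
    show "a z * u z ^ m = 0 \<or> v z = 1" for z using v1[of z] a_bounds(3)[of z] by auto
  qed
  also have "integral {0..T} (\<lambda>t. v (\<beta>, t) * Wx (\<beta>, t)) - integral {0..T} (\<lambda>t. v (\<alpha>, t) * Wx (\<alpha>, t))
      = (\<Sum>j\<in>{1..m}. real (\<sigma> j) * pulse_flux \<alpha> \<beta> T v A \<tau> z0 j)"
  proof -
    have "integral {0..T} (\<lambda>t. v (x, t) * Wx (x, t)) = (\<Sum>j\<in>{1..m}. real (\<sigma> j) * integral {0..T} (\<lambda>t. v (x, t) * deriv (pulse_profile A \<tau> z0 j) (x - direction j * t)))" for x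
    proof -
      have c: "continuous_on {0..T} (\<lambda>t. v (x, t) * deriv (pulse_profile A \<tau> z0 j) (x - direction j * t))" for j
        by (intro continuous_intros continuous_on_compose2[OF C_infinity_continuous[OF vC, of UNIV]]
            continuous_on_compose2[OF smooth_continuous[OF smooth_deriv[OF smooth_pulse_profile], of UNIV]]) auto
      have "integral {0..T} (\<lambda>t. v (x, t) * Wx (x, t)) = integral {0..T} (\<lambda>t. \<Sum>j\<in>{1..m}. real (\<sigma> j) * (v (x, t) * deriv (pulse_profile A \<tau> z0 j) (x - direction j * t)))"
        by (simp add: Wx_def sum_distrib_left mult_ac)
      also have "\<dots> = (\<Sum>j\<in>{1..m}. integral {0..T} (\<lambda>t. real (\<sigma> j) * (v (x, t) * deriv (pulse_profile A \<tau> z0 j) (x - direction j * t))))"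
        by (rule Henstock_Kurzweil_Integration.integral_sum) (auto intro!: integrable_continuous_interval continuous_intros c)
      finally show ?thesis by simp
    qed
    then show ?thesis by (simp add: pulse_flux_def sum_subtractf right_diff_distrib)
  qed
  finally have e: "bintegral ?\<Omega> (lateral_supp ?\<Omega> T v) v (DN_map ?\<Omega> T s m \<rho> a f)
      = (\<Sum>j\<in>{1..m}. real (\<sigma> j) * pulse_flux \<alpha> \<beta> T v A \<tau> z0 j) + integral (cbox (\<alpha>, 0) (\<beta>, T)) (\<lambda>z. a z * u z ^ m)" .
  have "\<bar>integral (cbox (\<alpha>, 0) (\<beta>, T)) (\<lambda>z. a z * u z ^ m) - integral (cbox (\<alpha>, 0) (\<beta>, T)) (\<lambda>z. a z * W z ^ m)\<bar>
      \<le> L * (real m * (2 * b) ^ (m - 1) * q) * ((\<beta> - \<alpha>) * T)"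
    by (rule nonlinear_integral_error[OF ab T ca cu(1) cW(1) a_bounds(1) Wb _ d]) (use small in \<open>simp add: q_def\<close>)
  then show ?thesis using e unfolding f_def W_def q_def by simp
qed

section \<open>Choice of the parameters and reconstruction\<close>

text \<open>
  With \<open>X = m (s + 2)\<close> the second claim is \<open>(m - 1) (X + 3) \<le> (2 m - 1) (X + 1)\<close>. It is the only
  property of the exponent that the balance of errors needs.
\<close>
lemma sigma_exponent_bounds:
  assumes m: "m \<ge> 2"
  shows "0 \<le> sigma_exponent m s" "sigma_exponent m s * (real m * (real s + 2) + 3) \<le> 1"
proof -
  define X where "X = real m * (real s + 2)"
  have X: "X \<ge> 1" using m mult_mono[of 1 "real m" 1 "real s + 2"] by (simp add: X_def)
  have m2: "real m \<ge> 2" using m by simp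
  have D: "(2 * real m - 1) * (X + 1) > 0" using m2 X by simp
  show "0 \<le> sigma_exponent m s" unfolding sigma_exponent_def X_def[symmetric] using m2 D by simp
  have "real m \<le> real m * X" using X m2 by simp
  then have "(real m - 1) * (X + 3) \<le> (2 * real m - 1) * (X + 1)" by (simp add: algebra_simps)
  then show "sigma_exponent m s * (real m * (real s + 2) + 3) \<le> 1"
    unfolding sigma_exponent_def X_def[symmetric] using D by (simp add: field_simps)
qed

text \<open>
  The width of the pulses is balanced against the noise: both \<open>1 / \<tau>\<close> and \<open>\<delta> \<tau>^N\<close> become of order
  \<open>\<delta>^\<sigma>\<close>. The factor \<open>\<tau>0\<close> keeps the pulses narrow for all noise levels below \<open>M\<close>.
\<close>
lemma parameter_choice:
  fixes \<delta> M \<tau>0 :: real and m s :: nat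
  assumes m: "m \<ge> 2" and \<delta>: "0 < \<delta>" "\<delta> < M" and \<tau>0: "\<tau>0 \<ge> 1"
  defines "\<sigma> \<equiv> sigma_exponent m s" and "N \<equiv> m * (s + 2) + 2"
  defines "\<tau> \<equiv> \<tau>0 * (\<delta> / M) powr (- \<sigma>)"
  shows "\<tau> \<ge> \<tau>0" "1 / \<tau> \<le> M powr (- \<sigma>) * \<delta> powr \<sigma>" "\<delta> * \<tau> ^ N \<le> \<tau>0 ^ N * M powr (1 - \<sigma>) * \<delta> powr \<sigma>"
proof -
  define x where "x = \<delta> / M"
  have x: "0 < x" "x \<le> 1" and M: "M > 0" and \<delta>x: "\<delta> = M * x" using \<delta> by (simp_all add: x_def)
  have \<sigma>0: "\<sigma> \<ge> 0" and \<sigma>N: "\<sigma> * (real N + 1) \<le> 1"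
    using sigma_exponent_bounds[OF m, of s] by (simp_all add: \<sigma>_def N_def algebra_simps)
  have x1: "x powr (- \<sigma>) \<ge> 1"
  proof -
    have "x powr \<sigma> \<le> 1 powr \<sigma>" by (rule powr_mono2) (use x \<sigma>0 in auto)
    then show ?thesis using x by (simp add: powr_minus field_simps)
  qed
  show "\<tau> \<ge> \<tau>0" using mult_left_mono[OF x1, of \<tau>0] \<tau>0 by (simp add: \<tau>_def x_def)
  have "1 / \<tau> = x powr \<sigma> / \<tau>0" by (simp add: \<tau>_def x_def[symmetric] powr_minus_divide)
  also have "\<dots> \<le> x powr \<sigma> / 1" using \<tau>0 by (intro divide_left_mono) auto
  also have "\<dots> = M powr (- \<sigma>) * \<delta> powr \<sigma>" using M \<delta> by (simp add: x_def powr_divide powr_minus_divide)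
  finally show "1 / \<tau> \<le> M powr (- \<sigma>) * \<delta> powr \<sigma>" .
  have "\<delta> * \<tau> ^ N = \<tau>0 ^ N * M * (x * (x powr (- \<sigma>)) ^ N)"
    by (simp add: \<tau>_def x_def[symmetric] \<delta>x power_mult_distrib mult_ac)
  also have "x * (x powr (- \<sigma>)) ^ N = x powr (1 - \<sigma> * real N)"
  proof -
    have "(x powr (- \<sigma>)) ^ N = x powr (- (\<sigma> * real N))" using x by (simp add: powr_power mult.commute)
    then have "x * (x powr (- \<sigma>)) ^ N = x powr 1 * x powr (- (\<sigma> * real N))" using x by simp
    then show ?thesis by (simp only: powr_add[symmetric] diff_conv_add_uminus)
  qed
  also have "\<tau>0 ^ N * M * \<dots> \<le> \<tau>0 ^ N * M * x powr \<sigma>"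
  proof (rule mult_left_mono)
    have "ln x \<le> 0" using x by simp
    then have "(1 - \<sigma> * real N) * ln x \<le> \<sigma> * ln x" using \<sigma>N by (intro mult_right_mono_neg) (simp_all add: algebra_simps)
    then show "x powr (1 - \<sigma> * real N) \<le> x powr \<sigma>" using x by (simp add: powr_def)
  qed (use \<tau>0 M in simp)
  also have "\<dots> = \<tau>0 ^ N * M powr (1 - \<sigma>) * \<delta> powr \<sigma>"
    using M \<delta> by (simp add: x_def powr_divide powr_diff)
  finally show "\<delta> * \<tau> ^ N \<le> \<tau>0 ^ N * M powr (1 - \<sigma>) * \<delta> powr \<sigma>" .
qed

text \<open>
  Two smallness conditions: the data stay in the ball where the noise is controlled, and the
  bootstrap closes. The second one holds for small amplitudes because \<open>m \<ge> 2\<close>.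
\<close>
lemma amplitude_choice:
  fixes Wb B L T \<epsilon>0 :: real
  assumes m: "m \<ge> 2" and pos: "Wb \<ge> 0" "B > 0" "L > 0" "\<epsilon>0 > 0"
  obtains A0 where "A0 > 0" "A0 \<le> 1" "2 * (real m * A0 * Wb) \<le> \<epsilon>0"
    "\<And>A. 0 < A \<Longrightarrow> A \<le> A0 \<Longrightarrow> 2 * T\<^sup>2 * (L * (2 * (real m * A * B)) ^ m) < real m * A * B"
proof -
  define k where "k = 2 * T\<^sup>2 * L * 2 ^ m"
  \<comment> \<open>Each summand is responsible for one of the conditions on \<open>A0 = 1 / D\<close>.\<close>
  define D where "D = 1 + 2 * real m * Wb / \<epsilon>0 + real m * B + k * (real m * B)"
  have k: "k \<ge> 0" using pos by (simp add: k_def)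
  have parts: "2 * real m * Wb / \<epsilon>0 \<ge> 0" "real m * B > 0" "k * (real m * B) \<ge> 0" using pos m k by auto
  have D: "D \<ge> 1" "D > 2 * real m * Wb / \<epsilon>0" "D > real m * B" "D > k * (real m * B)"
    using parts unfolding D_def by linarith+
  show ?thesis
  proof (rule that[of "1 / D"])
    show "1 / D > 0" "1 / D \<le> 1" using D(1) by auto
    have "2 * real m * Wb \<le> D * \<epsilon>0" using D(2) pos(4) by (simp add: field_simps)
    then show "2 * (real m * (1 / D) * Wb) \<le> \<epsilon>0" using D(1) by (simp add: field_simps)
    fix A :: real assume A: "0 < A" "A \<le> 1 / D"
    define b where "b = real m * A * B"
    have b: "b > 0" using A pos m by (simp add: b_def)
    have "b \<le> (real m * B) / D" using mult_right_mono[OF A(2), of "real m * B"] parts(2) by (simp add: b_def mult_ac)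
    moreover have "(real m * B) / D \<le> 1" using D(1,3) by simp
    ultimately have b1: "b \<le> 1" by linarith
    have "k * b \<le> k * ((real m * B) / D)" using \<open>b \<le> (real m * B) / D\<close> k by (rule mult_left_mono)
    also have "\<dots> < 1" using D(1,4) by (simp add: field_simps)
    finally have kb: "k * b < 1" .
    have "b ^ m \<le> b ^ 2" using b b1 m by (intro power_decreasing) auto
    then have "k * b ^ m \<le> k * b ^ 2" using k by (rule mult_left_mono)
    also have "\<dots> = (k * b) * b" by (simp add: power2_eq_square)
    also have "\<dots> < 1 * b" using kb b by (rule mult_strict_right_mono)
    finally have "2 * T\<^sup>2 * (L * (2 * b) ^ m) < b" by (simp add: k_def power_mult_distrib mult_ac)
    then show "2 * T\<^sup>2 * (L * (2 * (real m * A * B)) ^ m) < real m * A * B" unfolding b_def .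
  qed
qed

lemma lin_comb_pulses:
  assumes ab: "\<alpha> < \<beta>" and \<epsilon>: "\<And>j. j \<in> {1..m} \<Longrightarrow> \<epsilon> j > 0"
  shows "lin_comb m (\<lambda>j. c j * \<epsilon> j) (\<lambda>j. bdistr_of \<Omega> T (\<lambda>y. pulse A \<tau> z j y / \<epsilon> j))
       = bdistr_of \<Omega> T (\<lambda>y. \<Sum>j\<in>{1..m}. c j * pulse A \<tau> z j y)"
proof (intro ext)
  fix x \<phi>
  show "lin_comb m (\<lambda>j. c j * \<epsilon> j) (\<lambda>j. bdistr_of \<Omega> T (\<lambda>y. pulse A \<tau> z j y / \<epsilon> j)) x \<phi>
       = bdistr_of \<Omega> T (\<lambda>y. \<Sum>j\<in>{1..m}. c j * pulse A \<tau> z j y) x \<phi>"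
  proof (cases "x \<in> frontier \<Omega>")
    case True
    have "(\<Sum>j\<in>{1..m}. c j * \<epsilon> j * distr_of {0<..<T} (\<lambda>t. pulse A \<tau> z j (x, t) / \<epsilon> j) \<phi>)
        = distr_of {0<..<T} (\<lambda>t. \<Sum>j\<in>{1..m}. c j * \<epsilon> j * (pulse A \<tau> z j (x, t) / \<epsilon> j)) \<phi>"
    proof (rule distr_of_sum)
      fix j assume "j \<in> {1..m}"
      then have "\<epsilon> j \<noteq> 0" using \<epsilon> by force
      then show "continuous_on {0..T} (\<lambda>t. pulse A \<tau> z j (x, t) / \<epsilon> j)"
        by (intro continuous_on_divide continuous_pulse_trace continuous_on_const) simp
    qed simp
    also have "(\<lambda>t. \<Sum>j\<in>{1..m}. c j * \<epsilon> j * (pulse A \<tau> z j (x, t) / \<epsilon> j)) = (\<lambda>t. \<Sum>j\<in>{1..m}. c j * pulse A \<tau> z j (x, t))"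
    proof (intro ext sum.cong refl)
      fix t j assume "j \<in> {1..m}"
      from \<epsilon>[OF this] show "c j * \<epsilon> j * (pulse A \<tau> z j (x, t) / \<epsilon> j) = c j * pulse A \<tau> z j (x, t)" by simp
    qed
    finally show ?thesis using True by (simp add: lin_comb_def bdistr_of_def)
  qed (simp add: lin_comb_def bdistr_of_def)
qed

lemma finite_diff_const: "m \<ge> 1 \<Longrightarrow> finite_diff m \<epsilon> (\<lambda>e. k) = 0"
  using polarization[of "{1..m}" 0 0 "\<lambda>_. 0"] by (simp add: finite_diff_def sum_distrib_right[symmetric])

lemma continuous_pulse: "continuous_on S (pulse A \<tau> z0 j)"
  unfolding pulse_def by (intro continuous_intros continuous_on_compose2[OF continuous_bump[of UNIV]]) auto

lemma bintegral_add: "bintegral \<Omega> S w (\<lambda>x \<phi>. F x \<phi> + G x \<phi>) = bintegral \<Omega> S w F + bintegral \<Omega> S w G"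
  by (simp add: bintegral_def sum.distrib)

text \<open>
  The three errors of the reconstruction at one point: concentration of the product, replacement of
  the solution by the pulses, and noise. The last two are divided by the product of the \<open>\<epsilon> j\<close>, which
  is the mass of the product of the pulses up to the factor \<open>2 pi / m!\<close>.
\<close>
lemma reconstruction_error:
  assumes ab: "\<alpha> < \<beta>" and T: "T > 0" and s: "s \<ge> 1" and m: "m \<ge> 2"
    and a: "C_infinity a" "admissible {\<alpha><..<\<beta>} T s L lam a" and L: "L > 0"
    and DN: "DN_constants {\<alpha><..<\<beta>} T s m L lam \<kappa> \<rho>" and v: "measurement_wave {\<alpha><..<\<beta>} T lam v"
    and lam: "lam > 0" and \<tau>: "\<tau> \<ge> 1" "\<tau> * lam > 1" and A: "A > 0" and B: "B > 0" "\<And>y. bump y \<le> B"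
    and z0: "z0 \<in> {\<alpha><..<\<beta>} \<times> {t_lower {\<alpha><..<\<beta>} lam..t_upper {\<alpha><..<\<beta>} T lam}"
    and b: "b = real m * A * B" and small: "2 * T\<^sup>2 * (L * (2 * b) ^ m) < b"
    and small': "2 * (real m * A * \<tau> ^ (s + 1) * weighted_norm (real (s + 1)) (fourier bump)) \<le> \<epsilon>0" "\<epsilon>0 < \<kappa>"
    and E: "\<E> \<in> bsobolev {\<alpha><..<\<beta>} T (real (s + 1)) \<rightarrow> bsobolev {\<alpha><..<\<beta>} T r"
      "\<forall>f \<in> bsobolev {\<alpha><..<\<beta>} T (real (s + 1)). bsobolev_norm {\<alpha><..<\<beta>} T (real (s + 1)) f \<le> \<epsilon>0
          \<longrightarrow> bsobolev_norm {\<alpha><..<\<beta>} T r (\<E> f) \<le> \<delta>"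
    and P: "P = fact m * A ^ m * (kernel_mass m / \<tau>\<^sup>2) / (2 * pi)"
    and \<epsilon>: "\<And>j. j \<in> {1..m} \<Longrightarrow> \<epsilon> j > 0" "(\<Prod>j\<in>{1..m}. \<epsilon> j) = P"
    and Cp: "Cp = (\<Sum>x\<in>frontier {\<alpha><..<\<beta>}. weighted_norm (- r) (fourier (\<lambda>t. if (x, t) \<in> lateral {\<alpha><..<\<beta>} T then v (x, t) else 0)))"
    and H: "H = (\<lambda>j. bdistr_of {\<alpha><..<\<beta>} T (\<lambda>y. pulse A \<tau> z0 j y / \<epsilon> j))"
  shows "\<bar>- a z0 - 1 / (2 * pi) * finite_diff m \<epsilon> (\<lambda>e. bintegral {\<alpha><..<\<beta>} (lateral_supp {\<alpha><..<\<beta>} T v) v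
              (\<lambda>x \<phi>. DN_map {\<alpha><..<\<beta>} T s m \<rho> a (lin_comb m e H) x \<phi> + \<E> (lin_comb m e H) x \<phi>))\<bar>
    \<le> 2 * L / \<tau> + 2 ^ m * (L * (real m * (2 * b) ^ (m - 1) * (2 * T\<^sup>2 * (L * (2 * b) ^ m))) * ((\<beta> - \<alpha>) * T) + Cp * \<delta>) / (2 * pi * P)"
proof -
  let ?\<Omega> = "{\<alpha><..<\<beta>}" and ?S = "{1..m} \<rightarrow>\<^sub>E {0, 1 :: nat}"
  define err where "err = L * (real m * (2 * b) ^ (m - 1) * (2 * T\<^sup>2 * (L * (2 * b) ^ m))) * ((\<beta> - \<alpha>) * T)"
  define G where "G e = bintegral ?\<Omega> (lateral_supp ?\<Omega> T v) v
              (\<lambda>x \<phi>. DN_map ?\<Omega> T s m \<rho> a (lin_comb m e H) x \<phi> + \<E> (lin_comb m e H) x \<phi>)" for e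
  define J where "J = integral (cbox (\<alpha>, 0) (\<beta>, T)) (\<lambda>y. a y * pulse_kernel m (\<tau> *\<^sub>R (y - z0)))"
  have K: "kernel_mass m > 0" by (rule kernel_mass_pos)
  have \<tau>0: "\<tau> > 0" using \<tau> by simp
  have P0: "P > 0" using A K \<tau>0 by (simp add: P)
  have ca: "continuous_on UNIV a" by (rule C_infinity_continuous[OF a(1)])
  have fr: "frontier ?\<Omega> = {\<alpha>, \<beta>}" by (rule frontier_open_interval[OF ab])
  have vtest: "\<And>x. x \<in> frontier ?\<Omega> \<Longrightarrow> (\<lambda>t. if (x, t) \<in> lateral ?\<Omega> T then v (x, t) else 0) \<in> test_functions {0<..<T}"
    using v unfolding measurement_wave_def by auto
  have early: "\<bar>x - fst z0\<bar> + lam \<le> snd z0" if "x \<in> {\<alpha>, \<beta>}" for x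
        by (rule pulse_time_margin[OF ab z0]) (use that ab in auto)
  have dev: "\<bar>G (\<lambda>j. real (\<sigma> j) * \<epsilon> j) - (\<Sum>j\<in>{1..m}. real (\<sigma> j) * pulse_flux \<alpha> \<beta> T v A \<tau> z0 j)
        - integral (cbox (\<alpha>, 0) (\<beta>, T)) (\<lambda>z. a z * (\<Sum>j\<in>{1..m}. real (\<sigma> j) * pulse A \<tau> z0 j z) ^ m)\<bar> \<le> err + Cp * \<delta>"
    if \<sigma>: "\<sigma> \<in> ?S" for \<sigma>
  proof -
    define f where "f = bdistr_of ?\<Omega> T (\<lambda>z. \<Sum>j\<in>{1..m}. real (\<sigma> j) * pulse A \<tau> z0 j z)"
    have lc: "lin_comb m (\<lambda>j. real (\<sigma> j) * \<epsilon> j) H = f"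
      unfolding f_def H by (rule lin_comb_pulses[OF ab \<epsilon>(1)])
    have \<sigma>01: "\<sigma> j \<in> {0, 1}" if "j \<in> {1..m}" for j using \<sigma> that by (rule PiE_mem)
    have s\<kappa>: "2 * (real m * A * \<tau> ^ (s + 1) * weighted_norm (real (s + 1)) (fourier bump)) < \<kappa>" using small' by linarith
    have dom: "f \<in> DN_domain ?\<Omega> T s \<kappa>"
      "bsobolev_norm ?\<Omega> T (real (s + 1)) f \<le> 2 * (real m * A * \<tau> ^ (s + 1) * weighted_norm (real (s + 1)) (fourier bump))"
      unfolding f_def
      by (rule pulse_data_in_domain(1)[OF ab \<tau> lam _ less_imp_le[OF A] _ s\<kappa>], erule early, erule \<sigma>01)
         (rule pulse_data_in_domain(2)[OF ab \<tau> lam _ less_imp_le[OF A] _ s\<kappa>], erule early, erule \<sigma>01)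
    have fb: "f \<in> bsobolev ?\<Omega> T (real (s + 1))" using dom(1) by (simp add: DN_domain_def)
    have "bsobolev_norm ?\<Omega> T (real (s + 1)) f \<le> \<epsilon>0" using dom(2) small'(1) by linarith
    then have Ef: "bsobolev_norm ?\<Omega> T r (\<E> f) \<le> \<delta>" using E(2) fb by blast
    have Em: "\<E> f \<in> bsobolev ?\<Omega> T r" using E(1) fb by blast
    have "\<bar>bintegral ?\<Omega> (lateral_supp ?\<Omega> T v) v (\<E> f)\<bar> \<le> Cp * bsobolev_norm ?\<Omega> T r (\<E> f)"
      unfolding Cp by (rule bsobolev_pairing_bound[OF Em _ vtest]) (simp_all add: fr)
    also have "\<dots> \<le> Cp * \<delta>"
      by (rule mult_left_mono[OF Ef]) (simp add: Cp sum_nonneg weighted_norm_nonneg)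
    finally have 1: "\<bar>bintegral ?\<Omega> (lateral_supp ?\<Omega> T v) v (\<E> f)\<bar> \<le> Cp * \<delta>" .
    have 2: "G (\<lambda>j. real (\<sigma> j) * \<epsilon> j) = bintegral ?\<Omega> (lateral_supp ?\<Omega> T v) v (DN_map ?\<Omega> T s m \<rho> a f)
        + bintegral ?\<Omega> (lateral_supp ?\<Omega> T v) v (\<E> f)"
      unfolding G_def lc bintegral_add ..
    from DN_asymptotics[OF ab T s m a L DN v lam \<tau> A B z0 b small s\<kappa> \<sigma>, folded f_def err_def] 1 2
    show ?thesis by linarith
  qed
  have fd: "\<bar>finite_diff m \<epsilon> G - fact m * integral (cbox (\<alpha>, 0) (\<beta>, T)) (\<lambda>z. a z * (\<Prod>j\<in>{1..m}. pulse A \<tau> z0 j z)) / P\<bar> \<le> 2 ^ m * (err + Cp * \<delta>) / P"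
    by (rule finite_difference_estimate[where w = "pulse A \<tau> z0" and l = "pulse_flux \<alpha> \<beta> T v A \<tau> z0", OF m \<epsilon>(2) P0 ca continuous_pulse dev])
  have "integral (cbox (\<alpha>, 0) (\<beta>, T)) (\<lambda>z. a z * (\<Prod>j\<in>{1..m}. pulse A \<tau> z0 j z)) = integral (cbox (\<alpha>, 0) (\<beta>, T)) (\<lambda>y. - (A ^ m) * (a y * pulse_kernel m (\<tau> *\<^sub>R (y - z0))))"
    unfolding pulse_product[OF m]
    by (rule Henstock_Kurzweil_Integration.integral_cong) (simp only: mult_ac mult_minus_left mult_minus_right)
  also have "\<dots> = - (A ^ m) * J" unfolding J_def by (rule Henstock_Kurzweil_Integration.integral_mult_right)
  finally have J: "integral (cbox (\<alpha>, 0) (\<beta>, T)) (\<lambda>z. a z * (\<Prod>j\<in>{1..m}. pulse A \<tau> z0 j z)) = - (A ^ m) * J" .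
  define Q where "Q = kernel_mass m / \<tau>\<^sup>2"
  have Q: "Q > 0" using K \<tau>0 by (simp add: Q_def)
  have main: "fact m * (- (A ^ m) * J) / P = - (2 * pi) * (J / Q)"
  proof -
    define F where "F = fact m * A ^ m"
    have F: "F \<noteq> 0" using A by (simp add: F_def)
    have "P = F * Q / (2 * pi)" by (simp only: P Q_def F_def)
    moreover have "fact m * (- (A ^ m) * J) = - (F * J)" by (simp add: F_def)
    ultimately have "fact m * (- (A ^ m) * J) / P = - (F * J) / (F * Q / (2 * pi))" by (simp only:)
    then show ?thesis using F Q by simp
  qed
  have "\<bar>J - a z0 * Q\<bar> \<le> 2 * L / \<tau> * Q"
    unfolding J_def Q_def
  proof (rule concentration[OF m \<tau>(1) ca, of "fst z0" "snd z0", simplified prod.collapse])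
    show "\<bar>a (x, t) - a z0\<bar> \<le> L * (\<bar>x - fst z0\<bar> + \<bar>t - snd z0\<bar>)" for x t
      using admissible_bounds(2)[OF a, of x t "fst z0" "snd z0"] by simp
    show "a z = 0" if z: "z \<notin> cbox (\<alpha>, 0) (\<beta>, T)" for z
    proof (rule admissible_bounds(3)[OF a])
      have "0 \<le> diam_enclosing ?\<Omega>" using diam_enclosing_interval[OF ab] ab by linarith
      then have "?\<Omega> \<times> {t_lower ?\<Omega> lam..t_upper ?\<Omega> T lam} \<subseteq> cbox (\<alpha>, 0) (\<beta>, T)"
        using lam by (auto simp: cbox_Pair_eq t_lower_def t_upper_def)
      then show "z \<notin> ?\<Omega> \<times> {t_lower ?\<Omega> lam..t_upper ?\<Omega> T lam}" using z by blast
    qed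
  qed (use L in simp)
  then have "\<bar>J - a z0 * Q\<bar> / Q \<le> 2 * L / \<tau>" using Q by (simp add: pos_divide_le_eq)
  moreover have "\<bar>J - a z0 * Q\<bar> / Q = \<bar>J / Q - a z0\<bar>"
  proof -
    have "J / Q - a z0 = (J - a z0 * Q) / Q" using Q by (simp add: diff_divide_distrib)
    then show ?thesis using Q by (simp only: abs_div_pos)
  qed
  ultimately have conc: "\<bar>J / Q - a z0\<bar> \<le> 2 * L / \<tau>" by simp
  have "\<bar>finite_diff m \<epsilon> G + 2 * pi * (J / Q)\<bar> \<le> 2 ^ m * (err + Cp * \<delta>) / P"
    using fd unfolding J main by simp
  then have "\<bar>finite_diff m \<epsilon> G + 2 * pi * (J / Q)\<bar> / (2 * pi) \<le> 2 ^ m * (err + Cp * \<delta>) / P / (2 * pi)"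
    by (rule divide_right_mono) simp
  also have "2 ^ m * (err + Cp * \<delta>) / P / (2 * pi) = 2 ^ m * (err + Cp * \<delta>) / (2 * pi * P)"
    by (simp add: divide_divide_eq_left mult.commute)
  also have "\<bar>finite_diff m \<epsilon> G + 2 * pi * (J / Q)\<bar> / (2 * pi) = \<bar>(finite_diff m \<epsilon> G + 2 * pi * (J / Q)) / (2 * pi)\<bar>"
    by (rule abs_div_pos) simp
  also have "(finite_diff m \<epsilon> G + 2 * pi * (J / Q)) / (2 * pi) = 1 / (2 * pi) * finite_diff m \<epsilon> G + J / Q"
    by (simp add: add_divide_distrib)
  finally have "\<bar>1 / (2 * pi) * finite_diff m \<epsilon> G + J / Q\<bar> \<le> 2 ^ m * (err + Cp * \<delta>) / (2 * pi * P)" .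
  then show ?thesis using conc unfolding err_def[symmetric] G_def[abs_def] by linarith
qed

lemma zero_data_in_domain:
  assumes "\<alpha> < \<beta>" "\<kappa> > 0"
  shows "(\<lambda>_ _. 0) \<in> DN_domain {\<alpha><..<\<beta>} T s \<kappa>"
proof -
  have "bdistr_of {\<alpha><..<\<beta>} T (\<lambda>z. \<Sum>j\<in>{1..0}. real ((\<lambda>_. 0) j) * pulse 0 2 (\<alpha>, \<beta> - \<alpha> + 1) j z) \<in> DN_domain {\<alpha><..<\<beta>} T s \<kappa>"
    by (rule pulse_data_in_domain(1)[where lam = 1]) (use assms in auto)
  moreover have "bdistr_of {\<alpha><..<\<beta>} T (\<lambda>z. 0) = (\<lambda>_ _. 0)" by (simp add: bdistr_of_def distr_of_def fun_eq_iff)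
  ultimately show ?thesis by simp
qed

text \<open>
  With \<open>A = A0 / \<tau>^(s+2)\<close> and \<open>s \<ge> 1\<close>, the relative size \<open>A^(m-1) \<tau>\<^sup>2\<close> of the nonlinear error is at most
  \<open>1 / \<tau>\<close>, and the noise is amplified by \<open>\<tau>\<^sup>2 / A^m\<close>, a multiple of \<open>\<tau>^(m(s+2)+2)\<close>.
\<close>
lemma error_budget:
  fixes A A0 B L T \<tau> \<tau>0 \<delta> M K Cp area :: real and m s :: nat
  assumes m: "m \<ge> 2" and s: "s \<ge> 1" and pos: "0 < A0" "A0 \<le> 1" "B > 0" "L > 0" "K > 0" "Cp \<ge> 0" "area > 0"
    and \<delta>: "0 < \<delta>" "\<delta> < M" and \<tau>0: "\<tau>0 \<ge> 1"
    and \<tau>: "\<tau> = \<tau>0 * (\<delta> / M) powr (- sigma_exponent m s)" and A: "A = A0 / \<tau> ^ (s + 2)"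
    and b: "b = real m * A * B" and P: "2 * pi * P = fact m * K * A ^ m / \<tau>\<^sup>2"
  defines "K1 \<equiv> L * (real m * (2 * (real m * B)) ^ (m - 1) * (2 * T\<^sup>2 * (L * (2 * (real m * B)) ^ m))) * area"
    and "c1 \<equiv> fact m * K"
  shows "2 * L / \<tau> + 2 ^ m * (L * (real m * (2 * b) ^ (m - 1) * (2 * T\<^sup>2 * (L * (2 * b) ^ m))) * area + Cp * \<delta>) / (2 * pi * P)
    \<le> ((2 * L + 2 ^ m * K1 / c1) * M powr (- sigma_exponent m s)
       + 2 ^ m * Cp / (c1 * A0 ^ m) * (\<tau>0 ^ (m * (s + 2) + 2) * M powr (1 - sigma_exponent m s))) * \<delta> powr sigma_exponent m s"
proof -
  define \<sigma> where "\<sigma> = sigma_exponent m s"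
  define N where "N = m * (s + 2) + 2"
  note pc = parameter_choice[OF m \<delta> \<tau>0, of s, folded \<tau> \<sigma>_def N_def]
  have \<tau>1: "\<tau> \<ge> 1" using pc(1) \<tau>0 by linarith
  have \<tau>p: "\<tau> > 0" using \<tau>1 by linarith
  have Ap: "A > 0" using pos \<tau>p by (simp add: A)
  have c1: "c1 > 0" using pos by (simp add: c1_def)
  have K1: "K1 \<ge> 0" using pos by (simp add: K1_def)
  have e1: "L * (real m * (2 * b) ^ (m - 1) * (2 * T\<^sup>2 * (L * (2 * b) ^ m))) * area = K1 * A ^ (m - 1) * A ^ m"
  proof -
    have "2 * b = (2 * (real m * B)) * A" by (simp add: b)
    then show ?thesis unfolding K1_def by (simp only: power_mult_distrib mult_ac)
  qed
  have A3: "A ^ (m - 1) * \<tau>\<^sup>2 \<le> 1 / \<tau>"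
  proof -
    have "A \<le> 1 / \<tau> ^ (s + 2)" unfolding A using pos \<tau>p by (intro divide_right_mono) auto
    also have "\<dots> \<le> 1 / \<tau> ^ 3" using s \<tau>1 by (intro divide_left_mono power_increasing) auto
    finally have a3: "A \<le> 1 / \<tau> ^ 3" .
    also have "\<dots> \<le> 1" using \<tau>1 by simp
    finally have "A ^ (m - 1) \<le> A ^ 1" using m Ap by (intro power_decreasing) auto
    then have "A ^ (m - 1) * \<tau>\<^sup>2 \<le> (1 / \<tau> ^ 3) * \<tau>\<^sup>2" using a3 by (intro mult_right_mono) auto
    also have "\<dots> = 1 / \<tau>" using \<tau>p by (simp add: power2_eq_square power3_eq_cube)
    finally show ?thesis .
  qed
  have PP: "2 * pi * P = c1 * A ^ m / \<tau>\<^sup>2" using P by (simp add: c1_def)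
  have split: "2 ^ m * (K1 * Y * X + Cp * \<delta>) / (c1 * X / t) = 2 ^ m * K1 / c1 * (Y * t) + 2 ^ m * Cp / c1 * (\<delta> * t / X)"
    if "X > 0" "t > 0" for X Y t :: real
    using that c1 by (simp add: field_simps)
  have 1: "2 ^ m * (K1 * A ^ (m - 1) * A ^ m + Cp * \<delta>) / (2 * pi * P)
      = 2 ^ m * K1 / c1 * (A ^ (m - 1) * \<tau>\<^sup>2) + 2 ^ m * Cp / c1 * (\<delta> * \<tau>\<^sup>2 / A ^ m)"
    unfolding PP by (rule split) (use Ap \<tau>p in simp_all)
  have 2: "2 ^ m * K1 / c1 * (A ^ (m - 1) * \<tau>\<^sup>2) \<le> 2 ^ m * K1 / c1 * (1 / \<tau>)"
    by (rule mult_left_mono[OF A3]) (use K1 c1 in simp)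
  have "A ^ m = A0 ^ m / \<tau> ^ (m * (s + 2))"
    by (simp only: A power_divide power_mult[symmetric] mult.commute[of m])
  moreover have "\<tau> ^ N = \<tau> ^ (m * (s + 2)) * \<tau>\<^sup>2" by (simp only: N_def power_add)
  ultimately have "\<delta> * \<tau>\<^sup>2 / A ^ m = \<delta> * \<tau> ^ N / A0 ^ m" by simp
  then have 3: "2 ^ m * Cp / c1 * (\<delta> * \<tau>\<^sup>2 / A ^ m) = 2 ^ m * Cp / (c1 * A0 ^ m) * (\<delta> * \<tau> ^ N)" by simp
  have 4: "(2 * L + X) * (1 / \<tau>) = 2 * L / \<tau> + X * (1 / \<tau>)" for X by (simp add: add_divide_distrib)
  have "2 * L / \<tau> + 2 ^ m * (K1 * A ^ (m - 1) * A ^ m + Cp * \<delta>) / (2 * pi * P)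
      \<le> (2 * L + 2 ^ m * K1 / c1) * (1 / \<tau>) + 2 ^ m * Cp / (c1 * A0 ^ m) * (\<delta> * \<tau> ^ N)"
    unfolding 1 3 4 using 2 by linarith
  also have "\<dots> \<le> (2 * L + 2 ^ m * K1 / c1) * (M powr (- \<sigma>) * \<delta> powr \<sigma>) + 2 ^ m * Cp / (c1 * A0 ^ m) * (\<tau>0 ^ N * M powr (1 - \<sigma>) * \<delta> powr \<sigma>)"
    by (intro add_mono mult_left_mono pc(2,3)) (use pos K1 c1 in simp_all)
  also have "\<dots> = ((2 * L + 2 ^ m * K1 / c1) * M powr (- \<sigma>) + 2 ^ m * Cp / (c1 * A0 ^ m) * (\<tau>0 ^ N * M powr (1 - \<sigma>))) * \<delta> powr \<sigma>"
    by (simp only: distrib_right mult.assoc)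
  finally show ?thesis unfolding e1 \<sigma>_def N_def .
qed

theorem theorem3:
  fixes \<Omega> :: "real set" and m s :: nat and r lam L T M \<kappa> \<rho> \<epsilon>0 :: real
    and v0 :: "real \<times> real \<Rightarrow> real"
  assumes "is_interval \<Omega>" "open \<Omega>" "bounded \<Omega>" "\<Omega> \<noteq> {}"
    and "m \<ge> 2" and "r \<le> real s" and "real s + 1 > (1 + 1) / 2"
    and "lam > 0" and "L > 0" and "T \<ge> 2 * diam_enclosing \<Omega> + 2 * lam" and "M > 0"
    and "DN_constants \<Omega> T s m L lam \<kappa> \<rho>"
    and "0 < \<epsilon>0" "\<epsilon>0 < \<kappa>"
    and "measurement_wave \<Omega> T lam v0"
  shows "\<exists>C>0. \<forall>a (\<E> :: bdistr \<Rightarrow> bdistr) \<delta>.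
    C_infinity a \<and> admissible \<Omega> T s L lam a
    \<and> \<E> \<in> bsobolev \<Omega> T (real (s + 1)) \<rightarrow> bsobolev \<Omega> T r
    \<and> 0 < \<delta> \<and> \<delta> < M
    \<and> (\<forall>f \<in> bsobolev \<Omega> T (real (s + 1)). bsobolev_norm \<Omega> T (real (s + 1)) f \<le> \<epsilon>0
          \<longrightarrow> bsobolev_norm \<Omega> T r (\<E> f) \<le> \<delta>)
    \<longrightarrow>
    (\<exists>\<tau>\<ge>1. \<exists>\<epsilon> :: nat \<Rightarrow> real. \<exists>H :: real \<Rightarrow> real \<times> real \<Rightarrow> nat \<Rightarrow> bdistr.
       (\<forall>j\<in>{1..m}. \<epsilon> j > 0)
       \<and> (\<forall>z. \<forall>j\<in>{1..m}. H \<tau> z j \<in> bsobolev \<Omega> T (real (s + 1)))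
       \<and> (\<forall>z \<in> \<Omega> \<times> {0..T}. \<forall>\<sigma> \<in> {1..m} \<rightarrow>\<^sub>E {0, 1 :: nat}.
            lin_comb m (\<lambda>j. real (\<sigma> j) * \<epsilon> j) (H \<tau> z) \<in> DN_domain \<Omega> T s \<kappa>)
       \<and> (SUP z \<in> \<Omega> \<times> {0..T}. ereal \<bar>- a z - 1 / (2 * pi) *
            finite_diff m \<epsilon> (\<lambda>e. bintegral \<Omega> (lateral_supp \<Omega> T v0) v0
              (\<lambda>x \<phi>. DN_map \<Omega> T s m \<rho> a (lin_comb m e (H \<tau> z)) x \<phi>
                     + \<E> (lin_comb m e (H \<tau> z)) x \<phi>))\<bar>)
         \<le> ereal (C * \<delta> powr sigma_exponent m s))"
proof -
  note m = \<open>m \<ge> 2\<close> and lam = \<open>lam > 0\<close> and L = \<open>L > 0\<close> and DN = \<open>DN_constants \<Omega> T s m L lam \<kappa> \<rho>\<close>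
    and v = \<open>measurement_wave \<Omega> T lam v0\<close>
  obtain \<alpha> \<beta> where ab: "\<alpha> < \<beta>" and \<Omega>: "\<Omega> = {\<alpha><..<\<beta>}" by (rule open_bounded_interval[OF assms(1-4)])
  have s: "s \<ge> 1" using \<open>real s + 1 > (1 + 1) / 2\<close> by simp
  have diam: "\<beta> - \<alpha> \<le> diam_enclosing \<Omega>" unfolding \<Omega> by (rule diam_enclosing_interval[OF ab])
  then have T: "T > 0" using \<open>T \<ge> 2 * diam_enclosing \<Omega> + 2 * lam\<close> ab lam by linarith
  obtain B where B: "B > 0" "\<And>y. bump y \<le> B" using bump_bounded by blast
  define Wb where "Wb = weighted_norm (real (s + 1)) (fourier bump)"
  have Wb: "Wb \<ge> 0" by (simp add: Wb_def weighted_norm_nonneg)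
  obtain A0 where A0: "A0 > 0" "A0 \<le> 1" "2 * (real m * A0 * Wb) \<le> \<epsilon>0"
    "\<And>A. 0 < A \<Longrightarrow> A \<le> A0 \<Longrightarrow> 2 * T\<^sup>2 * (L * (2 * (real m * A * B)) ^ m) < real m * A * B"
    by (rule amplitude_choice[OF m Wb B(1) L \<open>0 < \<epsilon>0\<close>, of T]) blast
  \<comment> \<open>Pulses of width below \<open>lam\<close> are still outside the interval at time zero.\<close>
  define \<tau>0 where "\<tau>0 = 1 + 1 / lam"
  have \<tau>0: "\<tau>0 \<ge> 1" "\<tau>0 * lam > 1" using lam by (simp_all add: \<tau>0_def distrib_right)
  define K where "K = kernel_mass m"
  have K: "K > 0" by (simp add: K_def kernel_mass_pos)
  define Cp where "Cp = (\<Sum>x\<in>frontier \<Omega>. weighted_norm (- r) (fourier (\<lambda>t. if (x, t) \<in> lateral \<Omega> T then v0 (x, t) else 0)))"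
  have Cp: "Cp \<ge> 0" by (simp add: Cp_def sum_nonneg weighted_norm_nonneg)
  define area where "area = (\<beta> - \<alpha>) * T"
  have area: "area > 0" using ab T by (simp add: area_def)
  define K1 where "K1 = L * (real m * (2 * (real m * B)) ^ (m - 1) * (2 * T\<^sup>2 * (L * (2 * (real m * B)) ^ m))) * area"
  define C where "C = (2 * L + 2 ^ m * K1 / (fact m * K)) * M powr (- sigma_exponent m s)
       + 2 ^ m * Cp / (fact m * K * A0 ^ m) * (\<tau>0 ^ (m * (s + 2) + 2) * M powr (1 - sigma_exponent m s))"
  have "K1 \<ge> 0" using L B area by (simp add: K1_def)
  then have "(2 * L + 2 ^ m * K1 / (fact m * K)) * M powr (- sigma_exponent m s) > 0"
    using L K \<open>M > 0\<close> by (intro mult_pos_pos add_pos_nonneg) auto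
  then have C: "C > 0" unfolding C_def using Cp K A0(1) \<tau>0(1) by (intro add_pos_nonneg) auto
  show ?thesis
  proof (rule exI[of _ C], intro conjI C allI impI)
    fix a \<delta> and \<E> :: "bdistr \<Rightarrow> bdistr"
    assume "C_infinity a \<and> admissible \<Omega> T s L lam a
      \<and> \<E> \<in> bsobolev \<Omega> T (real (s + 1)) \<rightarrow> bsobolev \<Omega> T r \<and> 0 < \<delta> \<and> \<delta> < M
      \<and> (\<forall>f \<in> bsobolev \<Omega> T (real (s + 1)). bsobolev_norm \<Omega> T (real (s + 1)) f \<le> \<epsilon>0
            \<longrightarrow> bsobolev_norm \<Omega> T r (\<E> f) \<le> \<delta>)"
    then have a: "C_infinity a" "admissible \<Omega> T s L lam a"
      and E: "\<E> \<in> bsobolev \<Omega> T (real (s + 1)) \<rightarrow> bsobolev \<Omega> T r"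
        "\<forall>f \<in> bsobolev \<Omega> T (real (s + 1)). bsobolev_norm \<Omega> T (real (s + 1)) f \<le> \<epsilon>0 \<longrightarrow> bsobolev_norm \<Omega> T r (\<E> f) \<le> \<delta>"
      and \<delta>: "0 < \<delta>" "\<delta> < M" by auto
    define \<tau> where "\<tau> = \<tau>0 * (\<delta> / M) powr (- sigma_exponent m s)"
    have "\<tau> \<ge> \<tau>0" unfolding \<tau>_def by (rule parameter_choice(1)[OF m \<delta> \<tau>0(1)])
    moreover from this have "\<tau>0 * lam \<le> \<tau> * lam" using lam by (intro mult_right_mono) auto
    ultimately have \<tau>: "\<tau> \<ge> 1" "\<tau> * lam > 1" using \<tau>0 by linarith+
    have \<tau>p: "\<tau> > 0" using \<tau> by linarith
    define A where "A = A0 / \<tau> ^ (s + 2)"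
    have A: "A > 0" using A0(1) \<tau>p by (simp add: A_def)
    have "A0 / \<tau> ^ (s + 2) \<le> A0 / 1" using \<tau> A0(1) by (intro divide_left_mono one_le_power) auto
    then have AA0: "A \<le> A0" by (simp add: A_def)
    define P where "P = fact m * A ^ m * (kernel_mass m / \<tau>\<^sup>2) / (2 * pi)"
    have P: "P > 0" using A \<tau>p kernel_mass_pos[of m] by (simp add: P_def)
    \<comment> \<open>The data are \<open>\<epsilon> j * H j\<close>, so only the product of the \<open>\<epsilon> j\<close> matters.\<close>
    define \<epsilon> where "\<epsilon> j = (if j = 1 then P else 1)" for j :: nat
    have \<epsilon>: "\<epsilon> j > 0" for j using P by (simp add: \<epsilon>_def)
    have prod\<epsilon>: "(\<Prod>j\<in>{1..m}. \<epsilon> j) = P"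
      unfolding \<epsilon>_def using m by (subst prod.delta) auto
    define Z where "Z = \<Omega> \<times> {t_lower \<Omega> lam..t_upper \<Omega> T lam}"
    \<comment> \<open>Where no admissible coefficient can be nonzero, zero data give the exact value.\<close>
    define H where "H = (\<lambda>(\<tau>' :: real) z j. if z \<in> Z then bdistr_of \<Omega> T (\<lambda>y. pulse A \<tau> z j y / \<epsilon> j) else (\<lambda>_ _. 0))"
    have HZ: "H \<tau> z = (\<lambda>j. bdistr_of \<Omega> T (\<lambda>y. pulse A \<tau> z j y / \<epsilon> j))" if "z \<in> Z" for z
      using that by (simp add: H_def fun_eq_iff)
    have Hn: "lin_comb m c (H \<tau> z) = (\<lambda>_ _. 0)" if "z \<notin> Z" for z c
      using that by (simp add: H_def lin_comb_def)
    have small': "2 * (real m * A * \<tau> ^ (s + 1) * weighted_norm (real (s + 1)) (fourier bump)) \<le> \<epsilon>0"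
    proof -
      have "A * \<tau> ^ (s + 1) = A0 / \<tau>" using \<tau>p by (simp add: A_def)
      also have "\<dots> \<le> A0 / 1" using \<tau> A0(1) by (intro divide_left_mono) auto
      finally have "real m * Wb * (A * \<tau> ^ (s + 1)) \<le> real m * Wb * A0" using Wb by (intro mult_left_mono) auto
      then show ?thesis using A0(3) unfolding Wb_def[symmetric] by (simp add: mult_ac)
    qed
    have dom: "lin_comb m (\<lambda>j. real (\<sigma> j) * \<epsilon> j) (H \<tau> z) \<in> DN_domain \<Omega> T s \<kappa>"
      if \<sigma>: "\<sigma> \<in> {1..m} \<rightarrow>\<^sub>E {0, 1 :: nat}" for z \<sigma>
    proof (cases "z \<in> Z")
      case True
      have early: "\<bar>x - fst z\<bar> + lam \<le> snd z" if "x \<in> {\<alpha>, \<beta>}" for x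
        by (rule pulse_time_margin[OF ab True[unfolded Z_def \<Omega>]]) (use that ab in auto)
      have s\<kappa>: "2 * (real m * A * \<tau> ^ (s + 1) * weighted_norm (real (s + 1)) (fourier bump)) < \<kappa>"
        using small' \<open>\<epsilon>0 < \<kappa>\<close> by linarith
      show ?thesis
        unfolding HZ[OF True] lin_comb_pulses[OF ab \<epsilon>] unfolding \<Omega>
        by (rule pulse_data_in_domain(1)[OF ab \<tau> lam _ less_imp_le[OF A] _ s\<kappa>], erule early, rule PiE_mem[OF \<sigma>])
    next
      case False
      then show ?thesis using zero_data_in_domain[OF ab, of \<kappa> T s] \<open>0 < \<epsilon>0\<close> \<open>\<epsilon>0 < \<kappa>\<close> by (simp add: Hn \<Omega>)
    qed
    have est: "\<bar>- a z - 1 / (2 * pi) * finite_diff m \<epsilon> (\<lambda>e. bintegral \<Omega> (lateral_supp \<Omega> T v0) v0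
              (\<lambda>x \<phi>. DN_map \<Omega> T s m \<rho> a (lin_comb m e (H \<tau> z)) x \<phi> + \<E> (lin_comb m e (H \<tau> z)) x \<phi>))\<bar>
        \<le> C * \<delta> powr sigma_exponent m s" for z
    proof (cases "z \<in> Z")
      case True
      have "2 * pi * P = fact m * K * A ^ m / \<tau>\<^sup>2" by (simp add: P_def K_def)
      from order_trans[OF
          reconstruction_error[OF ab T s m a[unfolded \<Omega>] L DN[unfolded \<Omega>] v[unfolded \<Omega>] lam \<tau> A B True[unfolded Z_def \<Omega>] refl
            A0(4)[OF A AA0] small' \<open>\<epsilon>0 < \<kappa>\<close> E[unfolded \<Omega>] P_def \<epsilon> prod\<epsilon> Cp_def[unfolded \<Omega>] HZ[OF True, unfolded \<Omega>]]
          error_budget[OF m s A0(1,2) B(1) L K Cp area \<delta> \<tau>0(1) \<tau>_def A_def refl this, of T, unfolded area_def]]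
      show ?thesis unfolding \<Omega> C_def K1_def area_def .
    next
      case False
      then have "a z = 0" using admissible_bounds(3)[OF a, of z] by (simp add: Z_def)
      then show ?thesis using m C \<delta> by (simp add: Hn[OF False] finite_diff_const)
    qed
    show "\<exists>\<tau>\<ge>1. \<exists>\<epsilon> :: nat \<Rightarrow> real. \<exists>H :: real \<Rightarrow> real \<times> real \<Rightarrow> nat \<Rightarrow> bdistr.
       (\<forall>j\<in>{1..m}. \<epsilon> j > 0)
       \<and> (\<forall>z. \<forall>j\<in>{1..m}. H \<tau> z j \<in> bsobolev \<Omega> T (real (s + 1)))
       \<and> (\<forall>z \<in> \<Omega> \<times> {0..T}. \<forall>\<sigma> \<in> {1..m} \<rightarrow>\<^sub>E {0, 1 :: nat}.
            lin_comb m (\<lambda>j. real (\<sigma> j) * \<epsilon> j) (H \<tau> z) \<in> DN_domain \<Omega> T s \<kappa>)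
       \<and> (SUP z \<in> \<Omega> \<times> {0..T}. ereal \<bar>- a z - 1 / (2 * pi) *
            finite_diff m \<epsilon> (\<lambda>e. bintegral \<Omega> (lateral_supp \<Omega> T v0) v0
              (\<lambda>x \<phi>. DN_map \<Omega> T s m \<rho> a (lin_comb m e (H \<tau> z)) x \<phi>
                     + \<E> (lin_comb m e (H \<tau> z)) x \<phi>))\<bar>)
         \<le> ereal (C * \<delta> powr sigma_exponent m s)"
    proof (intro exI conjI ballI allI)
      show "\<tau> \<ge> 1" by (rule \<tau>(1))
      show "\<epsilon> j > 0" for j by (rule \<epsilon>)
      show "H \<tau> z j \<in> bsobolev \<Omega> T (real (s + 1))" for z j
        unfolding H_def using single_pulse_sobolev[OF ab \<tau>(1)] zero_bsobolev by (simp add: \<Omega>)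
      show "lin_comb m (\<lambda>j. real (\<sigma> j) * \<epsilon> j) (H \<tau> z) \<in> DN_domain \<Omega> T s \<kappa>"
        if "\<sigma> \<in> {1..m} \<rightarrow>\<^sub>E {0, 1 :: nat}" for z \<sigma> by (rule dom[OF that])
      show "(SUP z \<in> \<Omega> \<times> {0..T}. ereal \<bar>- a z - 1 / (2 * pi) *
            finite_diff m \<epsilon> (\<lambda>e. bintegral \<Omega> (lateral_supp \<Omega> T v0) v0
              (\<lambda>x \<phi>. DN_map \<Omega> T s m \<rho> a (lin_comb m e (H \<tau> z)) x \<phi>
                     + \<E> (lin_comb m e (H \<tau> z)) x \<phi>))\<bar>)
         \<le> ereal (C * \<delta> powr sigma_exponent m s)"
        by (rule SUP_least) (use est in simp)
    qed
  qed
qed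

end
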